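(* Let $\mathcal Y\subset\mathrm{Rat}_+$ be mild, and suppose that $\mathcal Y$ is nice with respect to a holomorphic family $\mathcal W$ of rational maps. Then the set of weakly mean stable elements $\tau\in\mathfrak M_{1,c}(\mathcal Y)$ is open and dense in $(\mathfrak M_{1,c}(\mathcal Y),\mathcal O)$.
   Context: $\hat{\mathbb C}$ is the Riemann sphere, $d$ the spherical distance, $\sharp$ denotes cardinality. $\mathrm{Rat}$ is the set of non-constant rational maps $\hat{\mathbb C}\to\hat{\mathbb C}$ with the metric $\kappa(f,g)=\sup_z d(f(z),g(z))$; $\mathrm{Rat}_+=\{g\in\mathrm{Rat}:\deg g\ge2\}$; subsets carry the relative topology. For a semigroup $G\subset\mathrm{Rat}$ (under composition), a minimal set of $(G,\hat{\mathbb C})$ is a non-empty compact $L\subset\hat{\mathbb C}$ with $L=\overline{\{h(z):h\in G\}}$ for every $z\in L$; $\mathrm{Min}(G,\hat{\mathbb C})$ is the set of them. For a metric space $X$, $\mathfrak M_1(X)$ is the space of Borel probability measures with weak convergence topology, $\mathrm{supp}\,\tau$ the topological support, $\mathfrak M_{1,c}(X)$ those with compact support, $\mathrm{Cpt}(X)$ the non-empty compact subsets with the Hausdorff metric. $G_\tau$ is the semigroup generated by $\mathrm{supp}\,\tau$. $L\in\mathrm{Min}(G_\tau,\hat{\mathbb C})$ is attracting for $\tau$ if there are open $A,B\subset\hat{\mathbb C}$ with $\sharp(\hat{\mathbb C}\setminus A)\ge3$ and $n\in\mathbb N$ such that $L\subset B\subset\overline B\subset A$ and $\gamma_n\circ\cdots\circ\gamma_1(A)\subset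 B$ for all $(\gamma_1,\dots,\gamma_n)\in(\mathrm{supp}\,\tau)^n$. $\mathcal Y\subset\mathrm{Rat}$ is mild if for every $\tau\in\mathfrak M_{1,c}(\mathcal Y)$ there is a minimal set attracting for $\tau$. A holomorphic family of rational maps is $\mathcal W=\{f_\lambda\}_{\lambda\in\Lambda}$, $\Lambda$ a connected complex manifold, $f_\lambda\in\mathrm{Rat}$, with $(z,\lambda)\mapsto f_\lambda(z)$ holomorphic on $\hat{\mathbb C}\times\Lambda$. $\mathcal Y$ is weakly nice with respect to $\mathcal W$ if $\mathcal Y$ is a closed subset of an open subset of $\mathrm{Rat}$, $\lambda\mapsto f_\lambda$ is not constant, and $\mathcal Y=\{f_\lambda:\lambda\in\Lambda\}$. $S_n(\mathcal W)$ is the set of $z$ such that $(\lambda_1,\dots,\lambda_n)\mapsto f_{\lambda_1}\circ\cdots\circ f_{\lambda_n}(z)$ is constant on $\Lambda^n$; $S(\mathcal W)=\bigcap_nS_n(\mathcal W)$. $\mathcal Y$ is nice with respect to $\mathcal W$ if it is weakly nice and for each $\tau\in\mathfrak M_{1,c}(\mathcal Y)$, each $L\in\mathrm{Min}(G_\tau,\hat{\mathbb C})$ with $L\subset S(\mathcal W)$ and each $z\in L$, either $\lambda\mapsto D(f_\lambda)_z$ is non-constant on $\Lambda$, or $D(f_\lambda)_z=0$ for all $\lambda\in\Lambda$. $\tau\in\mathfrak M_{1,c}(\mathrm{Rat})$ is weakly mean stable if there exist $n\in\mathbb N$ and non-empty open $V_1,V_2\subset\hat{\mathbb C}$ with $\overline{V_1}\subset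 V_2$, $\sharp(\hat{\mathbb C}\setminus V_2)\ge3$ such that (a) $\gamma_n\circ\cdots\circ\gamma_1(V_2)\subset V_1$ for all $(\gamma_1,\dots,\gamma_n)\in(\mathrm{supp}\,\tau)^n$; (b) $D_\tau:=\bigcap_{g\in G_\tau}g^{-1}(\hat{\mathbb C}\setminus V_2)$ is finite; (c) for each $L\in\mathrm{Min}(G_\tau,\hat{\mathbb C})$ with $L\subset D_\tau$ there are $z\in L$ and $g_z\in G_\tau$ such that $z$ is a repelling fixed point of $g_z$. $\mathcal O$ is the topology on $\mathfrak M_{1,c}(\mathcal Y)$ in which $\tau_n\to\tau$ iff $\int\varphi\,d\tau_n\to\int\varphi\,d\tau$ for each bounded continuous $\varphi:\mathcal Y\to\mathbb C$ and $\mathrm{supp}\,\tau_n\to\mathrm{supp}\,\tau$ in $\mathrm{Cpt}(\mathcal Y)$ (i.e. the topology induced by $\tau\mapsto(\tau,\mathrm{supp}\,\tau)$). *)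

theory Defs
  imports
    "HOL-Probability.Probability"
    "HOL-Computational_Algebra.Computational_Algebra"
    "HOL-Computational_Algebra.Field_as_Ring"
begin

section \<open>The Riemann sphere with the spherical distance\<close>

datatype riemann_sphere = Fin complex | Infty

fun stereo :: "riemann_sphere \<Rightarrow> complex \<times> real" where
  "stereo (Fin z) =
     ((2 / (1 + (cmod z)\<^sup>2)) *\<^sub>R z, ((cmod z)\<^sup>2 - 1) / ((cmod z)\<^sup>2 + 1))"
| "stereo Infty = (0, 1)"

lemma stereo_unit: "norm (stereo x) = 1"
proof (cases x)
  case (Fin z)
  have p: "1 + (cmod z)\<^sup>2 > 0" by (smt (verit) zero_le_power2)
  have "(norm (stereo x))\<^sup>2
      = (2 / (1 + (cmod z)\<^sup>2))\<^sup>2 * (cmod z)\<^sup>2 + (((cmod z)\<^sup>2 - 1) / (1 + (cmod z)\<^sup>2))\<^sup>2"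
    using p by (simp add: Fin norm_Pair add.commute power_mult_distrib power_divide)
  also have "\<dots> = (4 * (cmod z)\<^sup>2 + ((cmod z)\<^sup>2 - 1)\<^sup>2) / (1 + (cmod z)\<^sup>2)\<^sup>2"
    by (simp add: power_divide add_divide_distrib)
  also have "4 * (cmod z)\<^sup>2 + ((cmod z)\<^sup>2 - 1)\<^sup>2 = (1 + (cmod z)\<^sup>2)\<^sup>2"
    by algebra
  finally have "(norm (stereo x))\<^sup>2 = 1"
    using p by simp
  then show ?thesis
    by (metis norm_ge_zero one_power2 power2_eq_imp_eq zero_le_one)
qed (simp add: norm_Pair)

lemma stereo_inj: "stereo x = stereo y \<Longrightarrow> x = y"
proof -
  have ne: "((cmod z)\<^sup>2 - 1) / ((cmod z)\<^sup>2 + 1) \<noteq> 1" for z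
  proof -
    have "(cmod z)\<^sup>2 + 1 > 0" by (smt (verit) zero_le_power2)
    then show ?thesis by (simp add: divide_eq_eq)
  qed
  assume eq: "stereo x = stereo y"
  show "x = y"
  proof (cases x; cases y)
    fix z w assume xy: "x = Fin z" "y = Fin w"
    have p: "(cmod z)\<^sup>2 + 1 > 0" "(cmod w)\<^sup>2 + 1 > 0" by (smt (verit) zero_le_power2)+
    have "((cmod z)\<^sup>2 - 1) / ((cmod z)\<^sup>2 + 1) = ((cmod w)\<^sup>2 - 1) / ((cmod w)\<^sup>2 + 1)"
      using eq xy by simp
    then have s: "(cmod z)\<^sup>2 = (cmod w)\<^sup>2"
      using p by (simp add: field_simps)
    have "(2 / (1 + (cmod z)\<^sup>2)) *\<^sub>R z = (2 / (1 + (cmod w)\<^sup>2)) *\<^sub>R w"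
      using eq xy by simp
    then show ?thesis using s p xy by (simp add: add.commute)
  qed (use eq ne in \<open>auto dest: sym\<close>)
qed

lemma angle_triangle:
  fixes a b c :: "'a::real_inner"
  assumes "norm a = 1" "norm b = 1" "norm c = 1"
  shows "arccos (a \<bullet> c) \<le> arccos (a \<bullet> b) + arccos (b \<bullet> c)"
proof -
  have abs1: "\<bar>x \<bullet> y\<bar> \<le> 1" if "norm x = 1" "norm y = 1" for x y :: 'a
    using Cauchy_Schwarz_ineq2[of x y] that by simp
  note r = abs1[OF assms(1,2)] abs1[OF assms(2,3)] abs1[OF assms(1,3)]
  let ?s = "arccos (a \<bullet> b)" and ?t = "arccos (b \<bullet> c)"
  have b: "0 \<le> ?s" "?s \<le> pi" "0 \<le> ?t" "?t \<le> pi" "arccos (a \<bullet> c) \<le> pi"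
    using r by (auto intro!: arccos_lbound arccos_ubound simp: abs_le_iff)
  show ?thesis
  proof (cases "?s + ?t \<le> pi")
    case True
    have n: "b \<bullet> b = 1" "a \<bullet> a = 1" "c \<bullet> c = 1"
      using assms by (simp_all add: dot_square_norm)
    let ?u = "a - (a \<bullet> b) *\<^sub>R b" and ?v = "c - (b \<bullet> c) *\<^sub>R b"
    have "norm ?u = sqrt (1 - (a \<bullet> b)\<^sup>2)" "norm ?v = sqrt (1 - (b \<bullet> c)\<^sup>2)"
      unfolding norm_eq_sqrt_inner
      by (simp_all add: inner_diff_left inner_diff_right n inner_commute power2_eq_square)
    moreover have "?u \<bullet> ?v = a \<bullet> c - (a \<bullet> b) * (b \<bullet> c)"
      by (simp add: inner_diff_left inner_diff_right n inner_commute)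
    moreover have "\<bar>?u \<bullet> ?v\<bar> \<le> norm ?u * norm ?v"
      by (rule Cauchy_Schwarz_ineq2)
    ultimately have "(a \<bullet> b) * (b \<bullet> c) - sqrt (1 - (a \<bullet> b)\<^sup>2) * sqrt (1 - (b \<bullet> c)\<^sup>2) \<le> a \<bullet> c"
      by (simp add: abs_le_iff)
    moreover have "cos (?s + ?t)
        = (a \<bullet> b) * (b \<bullet> c) - sqrt (1 - (a \<bullet> b)\<^sup>2) * sqrt (1 - (b \<bullet> c)\<^sup>2)"
      using r by (simp add: cos_add cos_arccos_abs sin_arccos_abs)
    ultimately have "cos (?s + ?t) \<le> cos (arccos (a \<bullet> c))"
      using r by (simp add: cos_arccos_abs)
    then show ?thesis
      using True b r by (subst (asm) cos_mono_le_eq) (auto intro!: arccos_lbound simp: abs_le_iff)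
  qed (use b in linarith)
qed

text \<open>The geodesic distance of the unit sphere, transported by stereographic projection.\<close>

instantiation riemann_sphere :: metric_space
begin

definition dist_riemann_sphere :: "riemann_sphere \<Rightarrow> riemann_sphere \<Rightarrow> real" where
  "dist_riemann_sphere x y = arccos (stereo x \<bullet> stereo y)"

definition uniformity_riemann_sphere :: "(riemann_sphere \<times> riemann_sphere) filter" where
  "uniformity_riemann_sphere = (INF e\<in>{0<..}. principal {(x, y). dist x y < e})"

definition open_riemann_sphere :: "riemann_sphere set \<Rightarrow> bool" where
  "open_riemann_sphere U \<longleftrightarrow>
     (\<forall>x\<in>U. eventually (\<lambda>(x', y). x' = x \<longrightarrow> y \<in> U) uniformity)"

instance
proof
  fix x y z :: riemann_sphere
  have r: "\<bar>stereo x \<bullet> stereo y\<bar> \<le> 1"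
    using Cauchy_Schwarz_ineq2[of "stereo x" "stereo y"] by (simp add: stereo_unit)
  show "dist x y = 0 \<longleftrightarrow> x = y"
  proof
    assume "dist x y = 0"
    then have "stereo x \<bullet> stereo y = 1"
      unfolding dist_riemann_sphere_def using r by (metis cos_arccos_abs cos_zero)
    then have "(norm (stereo x - stereo y))\<^sup>2 = 0"
      by (simp add: dot_norm_neg stereo_unit)
    then show "x = y" by (simp add: stereo_inj)
  qed (simp add: dist_riemann_sphere_def dot_square_norm stereo_unit)
  have "dist x y \<le> dist x z + dist z y"
    unfolding dist_riemann_sphere_def by (intro angle_triangle stereo_unit)
  then show "dist x y \<le> dist x z + dist y z"
    by (simp add: dist_riemann_sphere_def inner_commute)
qed (simp_all add: uniformity_riemann_sphere_def open_riemann_sphere_def)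

end

lemma dist_riemann_sphere_le_pi: "dist x y \<le> pi" for x y :: riemann_sphere
  using Cauchy_Schwarz_ineq2[of "stereo x" "stereo y"]
  by (auto simp: dist_riemann_sphere_def stereo_unit abs_le_iff intro: arccos_ubound)

section \<open>Holomorphic maps between complex manifolds\<close>

class complex_space = real_normed_vector +
  fixes scaleC :: "complex \<Rightarrow> 'a \<Rightarrow> 'a" (infixr "*\<^sub>C" 75)
  assumes scaleC_add_right: "c *\<^sub>C (x + y) = c *\<^sub>C x + c *\<^sub>C y"
    and scaleC_add_left: "(c + d) *\<^sub>C x = c *\<^sub>C x + d *\<^sub>C x"
    and scaleC_scaleC: "c *\<^sub>C d *\<^sub>C x = (c * d) *\<^sub>C x"
    and scaleR_eq_scaleC: "r *\<^sub>R x = complex_of_real r *\<^sub>C x"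

instantiation complex :: complex_space
begin
definition scaleC_complex :: "complex \<Rightarrow> complex \<Rightarrow> complex" where
  "scaleC_complex c x = c * x"
instance
  by standard (simp_all add: scaleC_complex_def algebra_simps scaleR_conv_of_real)
end

instantiation prod :: (complex_space, complex_space) complex_space
begin
definition scaleC_prod :: "complex \<Rightarrow> 'a \<times> 'b \<Rightarrow> 'a \<times> 'b" where
  "scaleC_prod c x = (c *\<^sub>C fst x, c *\<^sub>C snd x)"
instance
  by standard (simp_all add: scaleC_prod_def prod_eq_iff scaleC_add_right scaleC_add_left
      scaleC_scaleC scaleR_eq_scaleC)
end

instantiation vec :: (complex_space, finite) complex_space
begin
definition scaleC_vec :: "complex \<Rightarrow> 'a ^ 'b \<Rightarrow> 'a ^ 'b" where
  "scaleC_vec c x = (\<chi> i. c *\<^sub>C (x $ i))"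
instance
  by standard (simp_all add: scaleC_vec_def vec_eq_iff scaleC_add_right scaleC_add_left
      scaleC_scaleC scaleR_eq_scaleC)
end

text \<open>Complex Frechet differentiability; meant for open \<open>S\<close>.\<close>

definition cholomorphic_on ::
    "('a::complex_space \<Rightarrow> 'b::complex_space) \<Rightarrow> 'a set \<Rightarrow> bool" where
  "cholomorphic_on f S \<longleftrightarrow>
     (\<forall>x\<in>S. \<exists>D. (f has_derivative D) (at x) \<and> (\<forall>c v. D (c *\<^sub>C v) = c *\<^sub>C D v))"

lemma cholomorphic_on_complex_iff:
  fixes f :: "complex \<Rightarrow> complex"
  assumes "open S"
  shows "cholomorphic_on f S \<longleftrightarrow> f holomorphic_on S"
proof -
  have "(\<exists>D. (f has_derivative D) (at x) \<and> (\<forall>c v. D (c * v) = c * D v))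
      \<longleftrightarrow> f field_differentiable (at x)" for x
  proof
    assume "\<exists>D. (f has_derivative D) (at x) \<and> (\<forall>c v. D (c * v) = c * D v)"
    then obtain D where D: "(f has_derivative D) (at x)" "\<And>c v. D (c * v) = c * D v" by blast
    have "D = (*) (D 1)"
    proof
      fix v show "D v = D 1 * v"
        using D(2)[of v 1] by (metis mult.commute mult.right_neutral)
    qed
    with D(1) show "f field_differentiable (at x)"
      by (metis field_differentiable_def has_field_derivative_def)
  next
    assume "f field_differentiable (at x)"
    then obtain d where "(f has_derivative (*) d) (at x)"
      by (auto simp: field_differentiable_def has_field_derivative_def)
    then show "\<exists>D. (f has_derivative D) (at x) \<and> (\<forall>c v. D (c * v) = c * D v)"
      by (intro exI[of _ "(*) d"]) (simp add: mult.left_commute)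
  qed
  with assms show ?thesis
    by (simp add: cholomorphic_on_def scaleC_complex_def holomorphic_on_def
        at_within_open[OF _ assms])
qed

type_synonym ('a, 'e) atlas = "('a set \<times> ('a \<Rightarrow> 'e)) set"

text \<open>Charts \<open>(U, \<phi>)\<close> are total functions of which only the restriction to \<open>U\<close> matters.
  Manifolds are Hausdorff, second countable and modelled on \<open>'e\<close>.\<close>

definition complex_manifold :: "'a topology \<Rightarrow> ('a, 'e::complex_space) atlas \<Rightarrow> bool" where
  "complex_manifold X A \<longleftrightarrow>
     Hausdorff_space X \<and> second_countable X \<and>
     (\<Union>(U, \<phi>)\<in>A. U) = topspace X \<and>
     (\<forall>(U, \<phi>)\<in>A. openin X U \<and> open (\<phi> ` U) \<and>
        homeomorphic_map (subtopology X U) (top_of_set (\<phi> ` U)) \<phi>) \<and>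
     (\<forall>(U, \<phi>)\<in>A. \<forall>(V, \<psi>)\<in>A. cholomorphic_on (\<psi> \<circ> inv_into U \<phi>) (\<phi> ` (U \<inter> V)))"

definition prod_atlas :: "('a, 'd) atlas \<Rightarrow> ('b, 'e) atlas \<Rightarrow> ('a \<times> 'b, 'd \<times> 'e) atlas" where
  "prod_atlas A B = {(U \<times> V, map_prod \<phi> \<psi>) | U \<phi> V \<psi>. (U, \<phi>) \<in> A \<and> (V, \<psi>) \<in> B}"

definition holomorphic_map ::
    "'a topology \<Rightarrow> ('a, 'd::complex_space) atlas \<Rightarrow>
     'b topology \<Rightarrow> ('b, 'e::complex_space) atlas \<Rightarrow> ('a \<Rightarrow> 'b) \<Rightarrow> bool" where
  "holomorphic_map X A Y B h \<longleftrightarrow>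
     continuous_map X Y h \<and>
     (\<forall>(U, \<phi>)\<in>A. \<forall>(V, \<psi>)\<in>B.
        cholomorphic_on (\<psi> \<circ> h \<circ> inv_into U \<phi>) (\<phi> ` (U \<inter> h -` V)))"

fun fin_coord :: "riemann_sphere \<Rightarrow> complex" where
  "fin_coord (Fin z) = z"
| "fin_coord Infty = 0"

fun inf_coord :: "riemann_sphere \<Rightarrow> complex" where
  "inf_coord (Fin z) = inverse z"
| "inf_coord Infty = 0"

definition fin_chart :: "riemann_sphere set \<times> (riemann_sphere \<Rightarrow> complex)" where
  "fin_chart = (- {Infty}, fin_coord)"

definition inf_chart :: "riemann_sphere set \<times> (riemann_sphere \<Rightarrow> complex)" where
  "inf_chart = (- {Fin 0}, inf_coord)"

definition sphere_atlas :: "(riemann_sphere, complex) atlas" where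
  "sphere_atlas = {fin_chart, inf_chart}"

text \<open>The differential of \<open>h\<close> at \<open>z\<close>, read in a fixed coordinate around \<open>z\<close> and a fixed
  coordinate around \<open>h z\<close> (the latter depends only on the point \<open>h z\<close>, so that the
  differentials at \<open>z\<close> of maps with the same value at \<open>z\<close> can be compared). At a fixed point
  this is the multiplier.\<close>

definition chart_at :: "riemann_sphere \<Rightarrow> riemann_sphere set \<times> (riemann_sphere \<Rightarrow> complex)" where
  "chart_at z = (if z = Infty then inf_chart else fin_chart)"

definition sphere_deriv :: "(riemann_sphere \<Rightarrow> riemann_sphere) \<Rightarrow> riemann_sphere \<Rightarrow> complex" where
  "sphere_deriv h z =
     (let (U, \<phi>) = chart_at z; (V, \<psi>) = chart_at (h z)
      in deriv (\<psi> \<circ> h \<circ> inv_into U \<phi>) (\<phi> z))"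

definition repelling_fixed_point ::
    "(riemann_sphere \<Rightarrow> riemann_sphere) \<Rightarrow> riemann_sphere \<Rightarrow> bool" where
  "repelling_fixed_point h z \<longleftrightarrow> h z = z \<and> cmod (sphere_deriv h z) > 1"

section \<open>The space of non-constant rational maps\<close>

fun rat_fun :: "complex poly \<Rightarrow> complex poly \<Rightarrow> riemann_sphere \<Rightarrow> riemann_sphere" where
  "rat_fun p q (Fin z) = (if poly q z = 0 then Infty else Fin (poly p z / poly q z))"
| "rat_fun p q Infty =
     (let d = max (degree p) (degree q)
      in if coeff q d = 0 then Infty else Fin (coeff p d / coeff q d))"

typedef rational_map =
  "{h. (\<exists>p q. coprime p q \<and> h = rat_fun p q) \<and> \<not> h constant_on UNIV}"
  morphisms apply_rat Abs_rational_map
proof -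
  have "rat_fun [:0, 1:] 1 (Fin 0) \<noteq> rat_fun [:0, 1:] 1 (Fin 1)" by simp
  then have "\<not> rat_fun [:0, 1:] 1 constant_on UNIV"
    unfolding constant_on_def by (metis UNIV_I)
  moreover have "coprime [:0, 1:] (1 :: complex poly)" by simp
  ultimately show ?thesis by blast
qed

definition rat_degree :: "rational_map \<Rightarrow> nat" where
  "rat_degree g =
     (THE d. \<exists>p q. coprime p q \<and> apply_rat g = rat_fun p q \<and> d = max (degree p) (degree q))"

lemma associated_imp_degree_eq:
  fixes p q :: "complex poly"
  assumes "p dvd q" "q dvd p"
  shows "degree p = degree q"
proof (cases "p = 0 \<or> q = 0")
  case False
  then show ?thesis using assms by (simp add: dvd_imp_degree_le order_antisym)
qed (use assms in auto)

lemma rat_fun_eq_imp_degree_eq: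
  assumes "coprime p q" "coprime p' q'" "rat_fun p q = rat_fun p' q'"
  shows "max (degree p) (degree q) = max (degree p') (degree q')"
proof -
  have poly_eq: "poly p z * poly q' z = poly p' z * poly q z" for z
  proof -
    have "rat_fun p q (Fin z) = rat_fun p' q' (Fin z)" using assms(3) by simp
    then show ?thesis by (auto simp: frac_eq_eq split: if_splits)
  qed
  then have "poly (p * q') = poly (p' * q)" by auto
  then have eq: "p * q' = p' * q" by (simp only: poly_eq_poly_eq_iff)
  have "p dvd p' * q" "q dvd p * q'" "p' dvd p * q'" "q' dvd p' * q"
    using eq by (metis dvd_triv_left, metis dvd_triv_right, metis dvd_triv_left, metis dvd_triv_right)
  then have "p dvd p'" "q dvd q'" "p' dvd p" "q' dvd q"
    using assms(1,2)
    by (metis coprime_dvd_mult_left_iff coprime_dvd_mult_right_iff coprime_commute)+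
  then have "degree p = degree p'" "degree q = degree q'"
    by (metis associated_imp_degree_eq)+
  then show ?thesis by simp
qed

lemma rat_degree_eq:
  assumes "coprime p q" "apply_rat g = rat_fun p q"
  shows "rat_degree g = max (degree p) (degree q)"
  unfolding rat_degree_def
proof (rule the_equality)
  fix d
  assume "\<exists>p q. coprime p q \<and> apply_rat g = rat_fun p q \<and> d = max (degree p) (degree q)"
  then obtain p' q' where
    "coprime p' q'" "apply_rat g = rat_fun p' q'" "d = max (degree p') (degree q')" by blast
  then show "d = max (degree p) (degree q)"
    using rat_fun_eq_imp_degree_eq[of p' q' p q] assms by simp
qed (use assms in blast)

definition Rat_plus :: "rational_map set" where
  "Rat_plus = {g. rat_degree g \<ge> 2}"

instantiation rational_map :: metric_space
begin

definition dist_rational_map :: "rational_map \<Rightarrow> rational_map \<Rightarrow> real" where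
  "dist_rational_map f g = (SUP z. dist (apply_rat f z) (apply_rat g z))"

definition uniformity_rational_map :: "(rational_map \<times> rational_map) filter" where
  "uniformity_rational_map = (INF e\<in>{0<..}. principal {(x, y). dist x y < e})"

definition open_rational_map :: "rational_map set \<Rightarrow> bool" where
  "open_rational_map U \<longleftrightarrow>
     (\<forall>x\<in>U. eventually (\<lambda>(x', y). x' = x \<longrightarrow> y \<in> U) uniformity)"

instance
proof
  fix f g h :: rational_map
  have bdd: "bdd_above (range (\<lambda>z. dist (apply_rat f z) (apply_rat g z)))" for f g
    by (auto intro!: bdd_aboveI[of _ pi] dist_riemann_sphere_le_pi)
  have le: "dist (apply_rat f z) (apply_rat g z) \<le> dist f g" for f g z
    unfolding dist_rational_map_def by (intro cSUP_upper bdd) simp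
  show "dist f g = 0 \<longleftrightarrow> f = g"
  proof
    assume "dist f g = 0"
    then have "apply_rat f z = apply_rat g z" for z
      using le[of f z g] by simp
    then show "f = g" by (metis apply_rat_inject ext)
  qed (simp add: dist_rational_map_def)
  show "dist f g \<le> dist f h + dist g h"
    unfolding dist_rational_map_def[of f g]
  proof (rule cSUP_least)
    fix z
    show "dist (apply_rat f z) (apply_rat g z) \<le> dist f h + dist g h"
      using dist_triangle2[of "apply_rat f z" "apply_rat g z" "apply_rat h z"]
        le[of f z h] le[of g z h] by linarith
  qed simp
qed (simp_all add: uniformity_rational_map_def open_rational_map_def)

end

section \<open>Semigroups and minimal sets\<close>

inductive_set semigroup_generated ::
    "rational_map set \<Rightarrow> (riemann_sphere \<Rightarrow> riemann_sphere) set" for S where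
  gen: "g \<in> S \<Longrightarrow> apply_rat g \<in> semigroup_generated S"
| comp: "g \<in> semigroup_generated S \<Longrightarrow> h \<in> semigroup_generated S \<Longrightarrow>
    g \<circ> h \<in> semigroup_generated S"

definition Min_sets :: "(riemann_sphere \<Rightarrow> riemann_sphere) set \<Rightarrow> riemann_sphere set set" where
  "Min_sets G = {L. L \<noteq> {} \<and> compact L \<and> (\<forall>z\<in>L. L = closure {h z | h. h \<in> G})}"

section \<open>Spaces of probability measures\<close>

text \<open>A measure on a subset \<open>Y\<close> of a metric space has carrier \<open>Y\<close> and lives on the Borel sets
  of the subspace \<open>Y\<close>; supports are taken inside \<open>Y\<close>.\<close>

definition M1 :: "'a::metric_space set \<Rightarrow> 'a measure set" where
  "M1 Y = {\<tau>. sets \<tau> = sets (restrict_space borel Y) \<and> prob_space \<tau>}"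

definition supp :: "'a::metric_space measure \<Rightarrow> 'a set" where
  "supp \<tau> = {x \<in> space \<tau>. \<forall>U. open U \<and> x \<in> U \<longrightarrow> emeasure \<tau> (U \<inter> space \<tau>) > 0}"

definition M1c :: "'a::metric_space set \<Rightarrow> 'a measure set" where
  "M1c Y = {\<tau> \<in> M1 Y. compact (supp \<tau>)}"

definition weak_topology :: "'a::metric_space set \<Rightarrow> 'a measure topology" where
  "weak_topology Y = topology_generated_by
     {{\<tau> \<in> M1 Y. (\<integral>x. \<phi> x \<partial>\<tau>) \<in> U} | (\<phi> :: 'a \<Rightarrow> complex) U.
        continuous_on Y \<phi> \<and> bounded (\<phi> ` Y) \<and> open U}"

definition Cpt :: "'a::metric_space set \<Rightarrow> 'a set set" where
  "Cpt Y = {K. K \<subseteq> Y \<and> compact K \<and> K \<noteq> {}}"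

text \<open>The value \<open>0\<close> off the non-empty compact sets is a convention: \<^locale>\<open>Metric_space\<close> asks
  for non-negativity and symmetry everywhere.\<close>

definition hausdorff_dist :: "'a::metric_space set \<Rightarrow> 'a set \<Rightarrow> real" where
  "hausdorff_dist K L =
     (if K \<in> Cpt UNIV \<and> L \<in> Cpt UNIV
      then max (SUP x\<in>K. infdist x L) (SUP y\<in>L. infdist y K) else 0)"

lemma Metric_space_Cpt: "Metric_space (Cpt Y) hausdorff_dist"
proof -
  have bdd: "bdd_above ((\<lambda>x. infdist x L) ` K)" if "compact K" for K L :: "'a set"
    using that by (intro bounded_imp_bdd_above compact_imp_bounded compact_continuous_image)
      (auto intro!: continuous_intros)
  have sym: "hausdorff_dist K L = hausdorff_dist L K" for K L :: "'a set"
    by (auto simp: hausdorff_dist_def max.commute)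
  have le: "infdist x L \<le> hausdorff_dist K L"
    if "K \<in> Cpt UNIV" "L \<in> Cpt UNIV" "x \<in> K" for K L :: "'a set" and x
    using that cSUP_upper[OF that(3) bdd[of K L]]
    by (simp add: hausdorff_dist_def Cpt_def le_max_iff_disj)
  have bound: "hausdorff_dist K L \<le> e"
    if "K \<in> Cpt UNIV" "L \<in> Cpt UNIV"
      "\<And>x. x \<in> K \<Longrightarrow> infdist x L \<le> e" "\<And>y. y \<in> L \<Longrightarrow> infdist y K \<le> e"
    for K L :: "'a set" and e
    using that by (auto simp: hausdorff_dist_def Cpt_def intro!: cSUP_least)
  have nonneg: "0 \<le> hausdorff_dist K L" for K L :: "'a set"
  proof (cases "K \<in> Cpt UNIV \<and> L \<in> Cpt UNIV")
    case True
    then obtain x where "x \<in> K" by (auto simp: Cpt_def)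
    then show ?thesis
      using True le[of K L x] infdist_nonneg[of x L] by linarith
  qed (auto simp: hausdorff_dist_def)
  have zero: "K \<subseteq> L" if KL: "K \<in> Cpt UNIV" "L \<in> Cpt UNIV" "hausdorff_dist K L = 0"
    for K L :: "'a set"
  proof
    fix x assume "x \<in> K"
    then have "infdist x L = 0"
      using KL le[of K L x] infdist_nonneg[of x L] by simp
    then show "x \<in> L"
      using KL(2) by (simp add: Cpt_def in_closed_iff_infdist_zero compact_imp_closed)
  qed
  have self: "hausdorff_dist K K = 0" for K :: "'a set"
    using nonneg[of K K] bound[of K K 0] by (cases "K \<in> Cpt UNIV") (auto simp: hausdorff_dist_def)
  have tri: "infdist x M \<le> hausdorff_dist K L + hausdorff_dist L M"
    if KLM: "K \<in> Cpt UNIV" "L \<in> Cpt UNIV" "M \<in> Cpt UNIV" "x \<in> K"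
    for K L M :: "'a set" and x
  proof -
    have "infdist x M - hausdorff_dist L M \<le> dist x y" if "y \<in> L" for y
      using infdist_triangle[of x M y] le[OF KLM(2,3) that] by linarith
    then have "infdist x M - hausdorff_dist L M \<le> infdist x L"
      using KLM(2) by (simp add: Cpt_def infdist_notempty cINF_greatest)
    then show ?thesis
      using le[OF KLM(1,2,4)] by linarith
  qed
  have sub: "Cpt Y \<subseteq> Cpt UNIV" by (auto simp: Cpt_def)
  show ?thesis
  proof
    fix K L M assume "K \<in> Cpt Y" "L \<in> Cpt Y" "M \<in> Cpt Y"
    then have KLM: "K \<in> Cpt UNIV" "L \<in> Cpt UNIV" "M \<in> Cpt UNIV" using sub by auto
    show "hausdorff_dist K M \<le> hausdorff_dist K L + hausdorff_dist L M"
    proof (intro bound KLM)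
      fix y assume "y \<in> M"
      then show "infdist y K \<le> hausdorff_dist K L + hausdorff_dist L M"
        using tri[of M L K y] KLM sym[of L K] sym[of L M] by simp
    qed (use KLM tri in auto)
  next
    fix K L assume "K \<in> Cpt Y" "L \<in> Cpt Y"
    then have KL: "K \<in> Cpt UNIV" "L \<in> Cpt UNIV" using sub by auto
    show "hausdorff_dist K L = 0 \<longleftrightarrow> K = L"
      using KL zero[of K L] zero[of L K] sym[of K L] self by auto
  qed (use nonneg sym in auto)
qed

text \<open>The topology induced by \<open>\<tau> \<mapsto> (\<tau>, supp \<tau>)\<close>.\<close>

definition topology_O :: "'a::metric_space set \<Rightarrow> 'a measure topology" where
  "topology_O Y = pullback_topology (M1c Y) (\<lambda>\<tau>. (\<tau>, supp \<tau>))
     (prod_topology (weak_topology Y) (Metric_space.mtopology (Cpt Y) hausdorff_dist))"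

section \<open>Attracting minimal sets, mild and nice sets of maps, weak mean stability\<close>

abbreviation G_of :: "rational_map measure \<Rightarrow> (riemann_sphere \<Rightarrow> riemann_sphere) set" where
  "G_of \<tau> \<equiv> semigroup_generated (supp \<tau>)"

definition at_least_three :: "'a set \<Rightarrow> bool" where
  "at_least_three S \<longleftrightarrow> infinite S \<or> card S \<ge> 3"

text \<open>For \<open>\<gamma>s = [\<gamma>\<^sub>1, \<dots>, \<gamma>\<^sub>n]\<close>, \<open>fold apply_rat \<gamma>s\<close> is \<open>\<gamma>\<^sub>n \<circ> \<dots> \<circ> \<gamma>\<^sub>1\<close>.\<close>

definition attracting_for :: "rational_map measure \<Rightarrow> riemann_sphere set \<Rightarrow> bool" where
  "attracting_for \<tau> L \<longleftrightarrow> L \<in> Min_sets (G_of \<tau>) \<and>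
     (\<exists>A B. \<exists>n\<ge>1. open A \<and> open B \<and> at_least_three (- A) \<and>
        L \<subseteq> B \<and> closure B \<subseteq> A \<and>
        (\<forall>\<gamma>s. length \<gamma>s = n \<and> set \<gamma>s \<subseteq> supp \<tau> \<longrightarrow> fold apply_rat \<gamma>s ` A \<subseteq> B))"

definition mild :: "rational_map set \<Rightarrow> bool" where
  "mild Y \<longleftrightarrow> (\<forall>\<tau>\<in>M1c Y. \<exists>L. attracting_for \<tau> L)"

definition holomorphic_family ::
    "'l topology \<Rightarrow> ('l, 'e::complex_space) atlas \<Rightarrow> ('l \<Rightarrow> rational_map) \<Rightarrow> bool" where
  "holomorphic_family \<Lambda> A f \<longleftrightarrow>
     complex_manifold \<Lambda> A \<and> connected_space \<Lambda> \<and>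
     holomorphic_map (prod_topology euclidean \<Lambda>) (prod_atlas sphere_atlas A)
       euclidean sphere_atlas (\<lambda>(z, l). apply_rat (f l) z)"

definition weakly_nice :: "rational_map set \<Rightarrow> 'l topology \<Rightarrow> ('l \<Rightarrow> rational_map) \<Rightarrow> bool" where
  "weakly_nice Y \<Lambda> f \<longleftrightarrow>
     (\<exists>U. open U \<and> closedin (top_of_set U) Y) \<and>
     \<not> f constant_on topspace \<Lambda> \<and>
     Y = f ` topspace \<Lambda>"

text \<open>For \<open>ls = [\<lambda>\<^sub>1, \<dots>, \<lambda>\<^sub>n]\<close>, the \<open>foldr\<close> below is \<open>f \<lambda>\<^sub>1 \<circ> \<dots> \<circ> f \<lambda>\<^sub>n\<close>.\<close>

definition S_n :: "nat \<Rightarrow> 'l topology \<Rightarrow> ('l \<Rightarrow> rational_map) \<Rightarrow> riemann_sphere set" where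
  "S_n n \<Lambda> f = {z. (\<lambda>ls. foldr (\<lambda>l. apply_rat (f l)) ls z)
     constant_on {ls. length ls = n \<and> set ls \<subseteq> topspace \<Lambda>}}"

definition S_set :: "'l topology \<Rightarrow> ('l \<Rightarrow> rational_map) \<Rightarrow> riemann_sphere set" where
  "S_set \<Lambda> f = (\<Inter>n\<in>{1..}. S_n n \<Lambda> f)"

definition nice :: "rational_map set \<Rightarrow> 'l topology \<Rightarrow> ('l \<Rightarrow> rational_map) \<Rightarrow> bool" where
  "nice Y \<Lambda> f \<longleftrightarrow> weakly_nice Y \<Lambda> f \<and>
     (\<forall>\<tau>\<in>M1c Y. \<forall>L\<in>Min_sets (G_of \<tau>). L \<subseteq> S_set \<Lambda> f \<longrightarrow>
        (\<forall>z\<in>L. \<not> (\<lambda>l. sphere_deriv (apply_rat (f l)) z) constant_on topspace \<Lambda> \<or>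
               (\<forall>l\<in>topspace \<Lambda>. sphere_deriv (apply_rat (f l)) z = 0)))"

definition weakly_mean_stable :: "rational_map measure \<Rightarrow> bool" where
  "weakly_mean_stable \<tau> \<longleftrightarrow>
     (\<exists>n\<ge>1. \<exists>V\<^sub>1 V\<^sub>2. open V\<^sub>1 \<and> open V\<^sub>2 \<and> V\<^sub>1 \<noteq> {} \<and> V\<^sub>2 \<noteq> {} \<and>
        closure V\<^sub>1 \<subseteq> V\<^sub>2 \<and> at_least_three (- V\<^sub>2) \<and>
        (\<forall>\<gamma>s. length \<gamma>s = n \<and> set \<gamma>s \<subseteq> supp \<tau> \<longrightarrow> fold apply_rat \<gamma>s ` V\<^sub>2 \<subseteq> V\<^sub>1) \<and>
        (let D = (\<Inter>g\<in>G_of \<tau>. g -` (- V\<^sub>2)) in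
           finite D \<and>
           (\<forall>L\<in>Min_sets (G_of \<tau>). L \<subseteq> D \<longrightarrow>
              (\<exists>z\<in>L. \<exists>g\<in>G_of \<tau>. repelling_fixed_point g z))))"

end

theory Submission
  imports Defs "HOL-Complex_Analysis.Complex_Analysis"
begin

text \<open>Weak mean stability is a property of the support of \<open>\<tau>\<close>, and it survives small changes of a
  compact support: the trapping region persists, finitely many maps carry the points away from
  the finite exceptional set into it, and the exceptional points of the new system lie in small
  linearization discs of the old repelling fixed points, hence sit on repelling fixed points again.
  This gives openness.

  For density, replace the support by a finite net \<open>G0\<close>. By mildness some set is trapped by the words
  of a fixed length in the maps close to \<open>G0\<close>. Let \<open>R t\<close> be the image of the parameter balls of relative
  radius \<open>t\<close> around \<open>G0\<close>. Only finitely many points (the core) have an orbit that does not depend on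
  the parameter. For small \<open>t\<close> niceness makes each periodic core point either a repelling fixed point
  of a word in \<open>R t\<close>, or the centre of a disc trapped by the words of period length. Let \<open>H t\<close> be the
  set of points that never enter the traps found so far. At all but countably many \<open>t\<close>, an interior
  point \<open>y\<close> of \<open>H t\<close> is interior to \<open>H t'\<close> for some \<open>t' > t\<close>, and then its \<open>R t\<close>-orbit closure misses
  the core. Indeed a core point in it would be repelling; if it also had a contracting word, then
  varying one letter of a word fixing it would spread it over a punctured neighbourhood, which is
  impossible since a repelling fixed point is never interior to an invariant set that omits an open set,
  and otherwise uniform expansion keeps the orbit away from it. Off the core, values move openly with
  the parameter, so the words of some length map the orbit closure into the interior of itself: it
  yields a further trap. The points that enter none of these traps are finitely many core points
  with repelling orbits, and by compactness finitely many maps in \<open>R t\<close> suffice to see all this.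
  Giving these maps a small mass produces a weakly mean stable measure near \<open>\<tau>\<close>.\<close>

section \<open>Topology and charts of the sphere\<close>

text \<open>The obstacle is that orbits are not closed. Off the core, a bounded number of letters
  throws a point into the interior of any invariant set, but the closure of an orbit may reach the
  core, where the parameter moves no value and only derivatives can help. The device is a pair of
  levels t < t' with a compact set of maps between \<open>R t\<close> and \<open>R t'\<close>: limit
  points of an \<open>R t\<close>-orbit are then still images under maps of \<open>R t'\<close>, and
  a point interior to \<open>H t'\<close> can have core points only in the closure of its orbit, not
  in the orbit itself. The kind of a periodic core point must not change between the levels; being
  repelling or contracting is monotone in t and there are finitely many such points, so both kinds
  are constant for small t. Around a point that is both, one multiplier b with 0 < |b| < 1 and a
  disc of multipliers m around some a with |a| > 1 suffice: the products m^i b^j take every nonzero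
  value. This is why contraction is asked with a nonzero multiplier; niceness excludes derivatives
  along a cycle that are constant but nonzero.\<close>

lemma norm_stereo_diff_le: "norm (stereo x - stereo y) \<le> dist x y"
proof -
  let ?i = "stereo x \<bullet> stereo y"
  have i: "\<bar>?i\<bar> \<le> 1"
    using Cauchy_Schwarz_ineq2[of "stereo x" "stereo y"] by (simp add: stereo_unit)
  have d: "0 \<le> dist x y" "dist x y \<le> pi" by (simp_all add: dist_riemann_sphere_le_pi)
  \<comment> \<open>A chord of the unit sphere that spans the angle d has length 2 sin (d/2), which
    is at most d.\<close>
  have "(norm (stereo x - stereo y))\<^sup>2 = 2 - 2 * ?i"
    by (simp add: dot_norm_neg stereo_unit field_simps)
  also have "?i = cos (dist x y)" using i by (simp add: dist_riemann_sphere_def cos_arccos_abs)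
  also have "2 - 2 * cos (dist x y) = (2 * sin (dist x y / 2))\<^sup>2"
    using cos_double_sin[of "dist x y / 2"] by (simp add: power_mult_distrib)
  finally have "norm (stereo x - stereo y) \<le> \<bar>2 * sin (dist x y / 2)\<bar>"
    by (metis real_sqrt_abs abs_norm_cancel order_refl)
  also have "\<dots> = 2 * sin (dist x y / 2)"
    using d sin_ge_zero[of "dist x y / 2"] pi_gt_zero by linarith
  also have "\<dots> \<le> dist x y" using sin_x_le_x[of "dist x y / 2"] d by simp
  finally show ?thesis .
qed

text \<open>The arc is arccos of the inner product of the images, hence continuous in them;
  conversely the chord is bounded by the arc. Topology on the sphere thus becomes topology in a
  Euclidean space.\<close>

lemma tendsto_sphere_iff: "(g \<longlongrightarrow> x) F \<longleftrightarrow> ((\<lambda>a. stereo (g a)) \<longlongrightarrow> stereo x) F"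
proof
  assume "(g \<longlongrightarrow> x) F"
  then have "((\<lambda>a. dist (g a) x) \<longlongrightarrow> 0) F" by (rule tendsto_dist_iff[THEN iffD1])
  then have "((\<lambda>a. stereo (g a) - stereo x) \<longlongrightarrow> 0) F"
    by (rule Lim_null_comparison[rotated]) (simp add: norm_stereo_diff_le)
  then show "((\<lambda>a. stereo (g a)) \<longlongrightarrow> stereo x) F" by (simp add: LIM_zero_iff)
next
  assume "((\<lambda>a. stereo (g a)) \<longlongrightarrow> stereo x) F"
  then have "((\<lambda>a. stereo (g a) \<bullet> stereo x) \<longlongrightarrow> stereo x \<bullet> stereo x) F"
    by (intro tendsto_intros)
  then have l: "((\<lambda>a. stereo (g a) \<bullet> stereo x) \<longlongrightarrow> 1) F" by (simp add: dot_square_norm stereo_unit)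
  have b: "stereo y \<bullet> stereo x \<in> {-1..1}" for y
    using Cauchy_Schwarz_ineq2[of "stereo y" "stereo x"] by (simp add: stereo_unit abs_le_iff)
  have "((\<lambda>a. arccos (stereo (g a) \<bullet> stereo x)) \<longlongrightarrow> arccos 1) F"
    by (rule continuous_on_tendsto_compose[OF continuous_on_arccos' l]) (use b in auto)
  then show "(g \<longlongrightarrow> x) F"
    by (simp add: tendsto_dist_iff[of g] dist_riemann_sphere_def)
qed

lemma continuous_on_sphere_iff: "continuous_on A g \<longleftrightarrow> continuous_on A (\<lambda>a. stereo (g a))"
  unfolding continuous_on_def by (simp add: tendsto_sphere_iff)

lemma continuous_on_stereo: "continuous_on A stereo"
  using continuous_on_sphere_iff[of A "\<lambda>x. x"] by simp

text \<open>A chart centred at every point p: \<open>ic p\<close> is the inverse chart with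
  \<open>ic p 0 = p\<close>, \<open>cd p\<close> is the chart, and \<open>antip p\<close> is the one
  point outside its domain (in general not the antipode). It is a translate of one of the two
  standard coordinates, which keeps derivatives equal to those of
  \<open>sphere_deriv\<close>.\<close>

definition ic :: "riemann_sphere \<Rightarrow> complex \<Rightarrow> riemann_sphere" where
  "ic p w = (case p of Fin a \<Rightarrow> Fin (a + w) | Infty \<Rightarrow> if w = 0 then Infty else Fin (inverse w))"

definition cd :: "riemann_sphere \<Rightarrow> riemann_sphere \<Rightarrow> complex" where
  "cd p x = (case p of Fin a \<Rightarrow> fin_coord x - a | Infty \<Rightarrow> inf_coord x)"

definition antip :: "riemann_sphere \<Rightarrow> riemann_sphere" where
  "antip p = (case p of Fin a \<Rightarrow> Infty | Infty \<Rightarrow> Fin 0)"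

lemma ic_0 [simp]: "ic p 0 = p" by (auto simp: ic_def split: riemann_sphere.splits)
lemma cd_self [simp]: "cd p p = 0" by (auto simp: cd_def split: riemann_sphere.splits)
lemma cd_ic [simp]: "cd p (ic p w) = w"
  by (auto simp: ic_def cd_def split: riemann_sphere.splits)
lemma ic_neq_antip [simp]: "ic p w \<noteq> antip p"
  by (auto simp: ic_def antip_def split: riemann_sphere.splits)
lemma self_neq_antip [simp]: "p \<noteq> antip p"
  by (metis ic_0 ic_neq_antip)
lemma ic_cd: "x \<noteq> antip p \<Longrightarrow> ic p (cd p x) = x"
  by (cases x) (auto simp: ic_def cd_def antip_def split: riemann_sphere.splits)
lemma ic_inject [simp]: "ic p w = ic p w' \<longleftrightarrow> w = w'"
  by (metis cd_ic)

lemma one_plus_cmod2_neq: "1 + (cmod w)\<^sup>2 \<noteq> 0" "(cmod w)\<^sup>2 + 1 \<noteq> 0"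
  by (smt (verit) zero_le_power2)+

lemma continuous_on_Fin: "continuous_on A Fin"
  by (subst continuous_on_sphere_iff) (auto intro!: continuous_intros simp: one_plus_cmod2_neq)

text \<open>Inversion acts on the unit sphere by conjugating the complex coordinate and reversing
  the height, so the formula has no singularity at w = 0. This gives continuity of the chart at
  infinity.\<close>

lemma stereo_ic_Infty:
  "stereo (ic Infty w) = ((2 / (1 + (cmod w)\<^sup>2)) *\<^sub>R cnj w, (1 - (cmod w)\<^sup>2) / (1 + (cmod w)\<^sup>2))"
proof (cases "w = 0")
  case False
  have a: "complex_of_real (1 + (cmod w)\<^sup>2) \<noteq> 0" "complex_of_real ((cmod w)\<^sup>2) = w * cnj w"
    using one_plus_cmod2_neq by (simp_all only: of_real_eq_0_iff complex_norm_square not_False_eq_True)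
  have c: "1 + (cmod (inverse w))\<^sup>2 = (1 + (cmod w)\<^sup>2) / (cmod w)\<^sup>2"
    "(cmod (inverse w))\<^sup>2 - 1 = (1 - (cmod w)\<^sup>2) / (cmod w)\<^sup>2"
    using False by (simp_all add: norm_divide norm_inverse field_simps)
  have "(2 / (1 + (cmod (inverse w))\<^sup>2)) *\<^sub>R inverse w = (2 / (1 + (cmod w)\<^sup>2)) *\<^sub>R ((cmod w)\<^sup>2 *\<^sub>R inverse w)"
    by (simp add: c)
  also have "(cmod w)\<^sup>2 *\<^sub>R inverse w = cnj w"
    using False by (simp add: scaleR_conv_of_real a(2) del: of_real_power)
  finally show ?thesis
    using False c by (simp add: ic_def add.commute)
qed (simp add: ic_def)

lemma continuous_on_ic: "continuous_on A (ic p)"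
proof (cases p)
  case (Fin a)
  have "continuous_on A (\<lambda>w. Fin (a + w))"
    by (rule continuous_on_compose2[OF continuous_on_Fin[of UNIV]]) (auto intro!: continuous_intros)
  then show ?thesis using Fin by (simp add: ic_def[abs_def])
next
  case Infty
  then show ?thesis
    unfolding continuous_on_sphere_iff[of A]
    by (auto simp: stereo_ic_Infty one_plus_cmod2_neq intro!: continuous_intros)
qed

lemma fin_coord_stereo: "x \<noteq> Infty \<Longrightarrow> snd (stereo x) \<noteq> 1 \<and> fin_coord x = (1 / (1 - snd (stereo x))) *\<^sub>R fst (stereo x)"
proof -
  assume "x \<noteq> Infty"
  then obtain z where z: "x = Fin z" by (cases x) auto
  have "1 - snd (stereo x) = 2 / (1 + (cmod z)\<^sup>2)"
    using one_plus_cmod2_neq[of z] by (simp add: z field_simps)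
  then show ?thesis using one_plus_cmod2_neq[of z] by (auto simp: z)
qed

lemma inf_coord_stereo: "x \<noteq> Fin 0 \<Longrightarrow> snd (stereo x) \<noteq> - 1 \<and> inf_coord x = (1 / (1 + snd (stereo x))) *\<^sub>R cnj (fst (stereo x))"
proof -
  assume "x \<noteq> Fin 0"
  then have x: "x = ic Infty (inf_coord x)"
    using ic_cd[of x Infty] by (simp add: antip_def cd_def)
  define w where "w = inf_coord x"
  have e: "stereo x = ((2 / (1 + (cmod w)\<^sup>2)) *\<^sub>R cnj w, (1 - (cmod w)\<^sup>2) / (1 + (cmod w)\<^sup>2))"
    using stereo_ic_Infty[of w] by (simp only: w_def x[symmetric])
  have "1 + snd (stereo x) = 2 / (1 + (cmod w)\<^sup>2)"
    using one_plus_cmod2_neq[of w] by (simp add: e field_simps)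
  then have "snd (stereo x) \<noteq> - 1" "1 + snd (stereo x) = 2 / (1 + (cmod w)\<^sup>2)"
    using one_plus_cmod2_neq[of w] by (auto simp: divide_eq_0_iff)
  then show ?thesis using one_plus_cmod2_neq[of w] by (simp add: e w_def[symmetric])
qed

lemma continuous_on_cd: "antip p \<notin> A \<Longrightarrow> continuous_on A (cd p)"
proof (cases p)
  case (Fin a)
  assume "antip p \<notin> A"
  then have A: "x \<noteq> Infty" if "x \<in> A" for x using that Fin by (auto simp: antip_def)
  have "continuous_on A (\<lambda>x. (1 / (1 - snd (stereo x))) *\<^sub>R fst (stereo x) - a)"
    using A fin_coord_stereo by (intro continuous_intros continuous_on_stereo) auto
  then show ?thesis
    by (rule continuous_on_eq) (use A Fin in \<open>simp add: cd_def fin_coord_stereo\<close>)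
next
  case Infty
  assume "antip p \<notin> A"
  then have A: "x \<noteq> Fin 0" if "x \<in> A" for x using that Infty by (auto simp: antip_def)
  have "continuous_on A (\<lambda>x. (1 / (1 + snd (stereo x))) *\<^sub>R cnj (fst (stereo x)))"
    using A inf_coord_stereo by (intro continuous_intros continuous_on_stereo) (auto simp: add_eq_0_iff)
  then show ?thesis
    by (rule continuous_on_eq) (use A Infty in \<open>simp add: cd_def inf_coord_stereo\<close>)
qed

lemma isCont_cd: "x \<noteq> antip p \<Longrightarrow> isCont (cd p) x"
  using continuous_on_cd[of p "- {antip p}"] by (simp add: continuous_on_eq_continuous_at open_Compl)

lemma open_ic_image: "open W \<Longrightarrow> open (ic p ` W)"
proof -
  assume "open W"
  have "ic p ` W = (- {antip p}) \<inter> cd p -` W"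
  proof -
    have "x = ic p (cd p x)" if "x \<noteq> antip p" for x using ic_cd[OF that] by simp
    then show ?thesis by auto
  qed
  then show ?thesis
    using continuous_open_preimage[OF continuous_on_cd[of p "- {antip p}"] _ \<open>open W\<close>]
    by (simp add: open_Compl)
qed

lemma open_ic_vimage: "open U \<Longrightarrow> open {w. ic p w \<in> U}"
  using open_vimage[OF _ continuous_on_ic[of UNIV p]] by (simp add: vimage_def)

lemma obtain_ic_ball:
  assumes "open U" "p \<in> U"
  obtains r where "r > 0" "ic p ` ball 0 r \<subseteq> U"
proof -
  have "open {w. ic p w \<in> U}" "0 \<in> {w. ic p w \<in> U}" using open_ic_vimage assms by auto
  then obtain r where "r > 0" "ball 0 r \<subseteq> {w. ic p w \<in> U}" using open_contains_ball by blast
  then show ?thesis using that by blast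
qed

lemma infinite_open_sphere:
  fixes U :: "riemann_sphere set" assumes "open U" "U \<noteq> {}" shows "infinite U"
proof -
  obtain p where "p \<in> U" using assms by blast
  then obtain r where r: "r > 0" "ic p ` ball 0 r \<subseteq> U" using obtain_ic_ball assms by blast
  have "infinite (ball (0::complex) r)" using r by (simp add: uncountable_ball uncountable_infinite)
  then have "infinite (ic p ` ball 0 r)" by (subst finite_image_iff) (auto simp: inj_on_def)
  then show ?thesis using r finite_subset by blast
qed

text \<open>Every point has modulus at most 1 in one of the two standard coordinates. Both discs are
  compact and connected and share \<open>Fin 1\<close>, whence compactness and connectedness of the
  sphere.\<close>

lemma sphere_eq_discs: "(UNIV :: riemann_sphere set) = Fin ` cball 0 1 \<union> ic Infty ` cball 0 1"
proof -
  have "x \<in> Fin ` cball 0 1 \<union> ic Infty ` cball 0 1" for x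
  proof (cases x)
    case (Fin z)
    show ?thesis
    proof (cases "cmod z \<le> 1")
      case False
      then have "cmod (inverse z) \<le> 1" by (simp add: norm_inverse inverse_le_1_iff)
      moreover have "x = ic Infty (inverse z)" using Fin False by (auto simp: ic_def)
      ultimately have "cmod (inverse z) \<le> 1" "x = ic Infty (inverse z)" by auto
      then show ?thesis by (metis UnI2 image_eqI mem_cball_0)
    qed (use Fin in auto)
  next
    case Infty
    then show ?thesis by (metis UnI2 ic_0 image_eqI centre_in_cball zero_le_one)
  qed
  then show ?thesis by blast
qed

lemma compact_UNIV_sphere: "compact (UNIV :: riemann_sphere set)"
  unfolding sphere_eq_discs
  by (intro compact_Un compact_continuous_image continuous_on_Fin continuous_on_ic) auto

lemma closed_imp_compact_sphere: "closed A \<Longrightarrow> compact (A :: riemann_sphere set)"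
  using compact_Int_closed[OF compact_UNIV_sphere, of A] by simp

lemma connected_UNIV_sphere: "connected (UNIV :: riemann_sphere set)"
proof -
  have c: "connected (Fin ` cball 0 1)" "connected (ic Infty ` cball 0 1)"
    by (auto intro!: connected_continuous_image continuous_on_Fin continuous_on_ic)
  have "Fin 1 = ic Infty 1" by (simp add: ic_def)
  then have "Fin 1 \<in> Fin ` cball 0 1 \<inter> ic Infty ` cball 0 1"
    by (metis IntI image_eqI mem_cball_0 norm_one order_refl)
  then have "Fin ` cball 0 1 \<inter> ic Infty ` cball 0 1 \<noteq> {}" by force
  with c show ?thesis unfolding sphere_eq_discs by (rule connected_Un)
qed

lemma countable_basis_sphere:
  obtains B :: "riemann_sphere set set" where "countable B"
    "\<And>U p. open U \<Longrightarrow> p \<in> U \<Longrightarrow> \<exists>b\<in>B. p \<in> b \<and> b \<subseteq> U" "\<And>b. b \<in> B \<Longrightarrow> open b"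
proof -
  obtain C :: "complex set set" where C0: "countable C" "\<And>c. c \<in> C \<Longrightarrow> open c"
    "\<And>S. open S \<Longrightarrow> \<exists>U. U \<subseteq> C \<and> S = \<Union>U"
    using univ_second_countable by blast
  have C: "countable C" "\<And>c. c \<in> C \<Longrightarrow> open c"
    using C0 by auto
  have C3: "\<exists>b\<in>C. p \<in> b \<and> b \<subseteq> U" if "open U" "p \<in> U" for U p
    using C0(3)[OF that(1)] that(2) by blast
  let ?B = "(`) Fin ` C \<union> (`) (ic Infty) ` C"
  have 1: "\<exists>b\<in>?B. p \<in> b \<and> b \<subseteq> U" if U: "open U" "p \<in> U" for U p
  proof -
    have Fin_ic: "ic (Fin 0) = Fin" by (auto simp: ic_def)
    obtain q w where q: "q = Fin 0 \<or> q = Infty" "p = ic q w"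
      using that[of "Fin 0" "fin_coord p"] that[of Infty 0] by (cases p) (auto simp: Fin_ic)
    have "open {w. ic q w \<in> U}" "w \<in> {w. ic q w \<in> U}" using open_ic_vimage U q by auto
    then obtain c where c: "c \<in> C" "w \<in> c" "c \<subseteq> {w. ic q w \<in> U}" using C3 by blast
    have "ic q ` c \<in> ?B" using q(1) c(1) Fin_ic by auto
    then show ?thesis using c q by (intro bexI[of _ "ic q ` c"]) auto
  qed
  have 2: "open b" if "b \<in> ?B" for b
    using that C(2) open_ic_image[of _ Infty] open_ic_image[of _ "Fin 0"] by (auto simp: ic_def)
  have 3: "countable ?B" using C(1) by auto
  show ?thesis by (rule that[OF 3 1 2])
qed

section \<open>Sphere-valued holomorphic maps\<close>

lemma DERIV_local_eq:
  fixes f g :: "complex \<Rightarrow> complex"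
  assumes "(f has_field_derivative D) (at z)" "eventually (\<lambda>x. g x = f x) (nhds z)"
  shows "(g has_field_derivative D) (at z)"
  using DERIV_cong_ev[OF refl assms(2) refl] assms(1) by blast

lemma field_differentiable_local_eq:
  fixes f g :: "complex \<Rightarrow> complex"
  assumes "f field_differentiable (at z)" "eventually (\<lambda>x. g x = f x) (nhds z)"
  shows "g field_differentiable (at z)"
  using assms DERIV_local_eq unfolding field_differentiable_def by blast

lemma cd_ic_differentiable:
  assumes "ic p w \<noteq> antip q"
  shows "(\<lambda>w. cd q (ic p w)) field_differentiable (at w)"
proof (cases p)
  case p: (Fin a)
  show ?thesis
  proof (cases q)
    case (Fin b)
    then have "(\<lambda>w. cd q (ic p w)) = (\<lambda>w. a + w - b)" using p by (auto simp: cd_def ic_def)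
    then show ?thesis by (auto intro!: derivative_intros)
  next
    case Infty
    then have e: "(\<lambda>w. cd q (ic p w)) = (\<lambda>w. inverse (a + w))" using p by (auto simp: cd_def ic_def)
    have "a + w \<noteq> 0" using assms p Infty by (auto simp: ic_def antip_def)
    then show ?thesis unfolding e by (auto intro!: derivative_intros)
  qed
next
  case p: Infty
  show ?thesis
  proof (cases q)
    case (Fin b)
    then have e: "(\<lambda>w. cd q (ic p w)) = (\<lambda>w. inverse w - b)" using p by (auto simp: cd_def ic_def)
    have "w \<noteq> 0" using assms p Fin by (auto simp: ic_def antip_def)
    then show ?thesis unfolding e by (auto intro!: derivative_intros)
  next
    case Infty
    then have "(\<lambda>w. cd q (ic p w)) = (\<lambda>w. w)" using p by (auto simp: cd_def ic_def)
    then show ?thesis by (auto intro!: derivative_intros)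
  qed
qed

lemma eventually_neq_point:
  fixes u :: "complex \<Rightarrow> riemann_sphere"
  assumes "continuous_on S u" "open S" "z \<in> S" "u z \<noteq> a"
  shows "eventually (\<lambda>x. u x \<noteq> a) (nhds z)"
proof -
  have "open (S \<inter> u -` (- {a}))" using assms by (intro continuous_open_preimage) auto
  then show ?thesis using assms by (auto simp: eventually_nhds)
qed

lemma chart_change:
  assumes "continuous_on S u" "open S" "z \<in> S" "u z \<noteq> antip p" "u z \<noteq> antip q"
    and "(\<lambda>x. cd p (u x)) field_differentiable (at z)"
  shows "(\<lambda>x. cd q (u x)) field_differentiable (at z)"
proof (rule field_differentiable_local_eq)
  have "ic p (cd p (u z)) \<noteq> antip q" using assms by (simp add: ic_cd)
  then show "((\<lambda>w. cd q (ic p w)) \<circ> (\<lambda>x. cd p (u x))) field_differentiable (at z)"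
    using assms(6) cd_ic_differentiable by (intro field_differentiable_compose)
  show "\<forall>\<^sub>F x in nhds z. cd q (u x) = ((\<lambda>w. cd q (ic p w)) \<circ> (\<lambda>x. cd p (u x))) x"
    using eventually_neq_point[OF assms(1-4)] by eventually_elim (simp add: ic_cd)
qed

text \<open>Differentiability is demanded in every chart that contains the value, which is
  convenient when it is a hypothesis; by the change of charts a single chart suffices to establish
  it.\<close>

definition holo_into :: "complex set \<Rightarrow> (complex \<Rightarrow> riemann_sphere) \<Rightarrow> bool" where
  "holo_into S u \<longleftrightarrow> open S \<and> continuous_on S u \<and>
     (\<forall>z\<in>S. \<forall>q. u z \<noteq> antip q \<longrightarrow> (\<lambda>x. cd q (u x)) field_differentiable (at z))"

lemma holo_intoI:
  assumes "open S" "continuous_on S u"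
    "\<And>z. z \<in> S \<Longrightarrow> \<exists>p. u z \<noteq> antip p \<and> (\<lambda>x. cd p (u x)) field_differentiable (at z)"
  shows "holo_into S u"
  unfolding holo_into_def using assms chart_change[OF assms(2,1)] by metis

lemma holo_into_subset: "holo_into S u \<Longrightarrow> open T \<Longrightarrow> T \<subseteq> S \<Longrightarrow> holo_into T u"
  unfolding holo_into_def using continuous_on_subset by blast

lemma holo_into_cd_holomorphic:
  assumes "holo_into S u" "T \<subseteq> S" "\<And>x. x \<in> T \<Longrightarrow> u x \<noteq> antip q"
  shows "(\<lambda>x. cd q (u x)) holomorphic_on T"
  using assms unfolding holo_into_def holomorphic_on_def
  by (meson field_differentiable_at_within subsetD)

lemma holo_into_ball_chart:
  assumes "holo_into S u" "z \<in> S" "u z \<noteq> antip q"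
  obtains r where "r > 0" "ball z r \<subseteq> S" "\<And>x. x \<in> ball z r \<Longrightarrow> u x \<noteq> antip q"
    "(\<lambda>x. cd q (u x)) holomorphic_on ball z r"
proof -
  have "open (S \<inter> u -` (- {antip q}))" using assms
    by (intro continuous_open_preimage) (auto simp: holo_into_def)
  then obtain r where r: "r > 0" "ball z r \<subseteq> S \<inter> u -` (- {antip q})"
    using assms open_contains_ball[of "S \<inter> u -` (- {antip q})"] by blast
  show ?thesis
  proof (rule that[OF r(1)])
    show "ball z r \<subseteq> S" using r by blast
    show neq: "\<And>x. x \<in> ball z r \<Longrightarrow> u x \<noteq> antip q" using r by blast
    show "(\<lambda>x. cd q (u x)) holomorphic_on ball z r"
      by (rule holo_into_cd_holomorphic[OF assms(1)]) (use r neq in auto)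
  qed
qed

lemma holo_into_ic:
  assumes "k holomorphic_on S" "open S"
  shows "holo_into S (\<lambda>x. ic p (k x))"
proof (rule holo_intoI)
  show "continuous_on S (\<lambda>x. ic p (k x))"
    by (rule continuous_on_compose2[OF continuous_on_ic[of UNIV]])
      (use assms holomorphic_on_imp_continuous_on in auto)
  show "\<exists>q. ic p (k z) \<noteq> antip q \<and> (\<lambda>x. cd q (ic p (k x))) field_differentiable (at z)"
    if "z \<in> S" for z
    using that assms holomorphic_on_imp_differentiable_at[of k S z] by (intro exI[of _ p]) auto
qed (rule assms)

lemma holo_into_reparam:
  assumes "holo_into S u" "k holomorphic_on T" "open T" "k ` T \<subseteq> S"
  shows "holo_into T (\<lambda>x. u (k x))"
proof (rule holo_intoI)
  show "continuous_on T (\<lambda>x. u (k x))"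
    by (rule continuous_on_compose2[of S u])
      (use assms holomorphic_on_imp_continuous_on in \<open>auto simp: holo_into_def\<close>)
  show "\<exists>q. u (k z) \<noteq> antip q \<and> (\<lambda>x. cd q (u (k x))) field_differentiable (at z)"
    if "z \<in> T" for z
  proof (intro exI conjI)
    show "u (k z) \<noteq> antip (u (k z))" by simp
    then have "(\<lambda>x. cd (u (k z)) (u x)) field_differentiable (at (k z))"
      using assms that unfolding holo_into_def by blast
    moreover have "k field_differentiable (at z)"
      using that assms holomorphic_on_imp_differentiable_at by blast
    ultimately show "(\<lambda>x. cd (u (k z)) (u (k x))) field_differentiable (at z)"
      using field_differentiable_compose[of k z "\<lambda>x. cd (u (k z)) (u x)"] by (simp add: o_def)
  qed
qed (rule assms)

text \<open>Comparison is with a constant q only, so the chart centred at q reduces the question to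
  the identity theorem for complex functions. The set Z of points near which u equals q is open and
  relatively closed.\<close>

lemma holo_into_identity:
  assumes u: "holo_into S u" and "connected S" "open T" "T \<noteq> {}" "T \<subseteq> S"
    and T: "\<And>x. x \<in> T \<Longrightarrow> u x = q" and "z \<in> S"
  shows "u z = q"
proof -
  have S: "open S" "continuous_on S u" using u by (auto simp: holo_into_def)
  define Z where "Z = {z\<in>S. eventually (\<lambda>x. u x = q) (nhds z)}"
  have "open Z"
  proof (subst open_subopen, intro ballI)
    fix z assume "z \<in> Z"
    then obtain V where "open V" "z \<in> V" "\<forall>x\<in>V. u x = q" "z \<in> S"
      by (auto simp: Z_def eventually_nhds)
    then show "\<exists>V. open V \<and> z \<in> V \<and> V \<subseteq> Z"
      using S by (intro exI[of _ "V \<inter> S"]) (auto simp: Z_def eventually_nhds)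
  qed
  moreover have "open (S - Z)"
  proof (subst open_subopen, intro ballI)
    fix z assume z: "z \<in> S - Z"
    show "\<exists>V. open V \<and> z \<in> V \<and> V \<subseteq> S - Z"
    proof (cases "u z = q")
      case False
      have "open (S \<inter> u -` (- {q}))" using S by (intro continuous_open_preimage) auto
      then show ?thesis using z False
        by (intro exI[of _ "S \<inter> u -` (- {q})"]) (auto simp: Z_def dest: eventually_nhds_x_imp_x)
    next
      case True
      then obtain r where r: "r > 0" "ball z r \<subseteq> S" "\<And>x. x \<in> ball z r \<Longrightarrow> u x \<noteq> antip q"
        "(\<lambda>x. cd q (u x)) holomorphic_on ball z r"
        using holo_into_ball_chart[OF u, of z q] z by auto
      have "ball z r \<inter> Z = {}"
      proof (rule ccontr)
        assume "ball z r \<inter> Z \<noteq> {}"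
        then obtain x where x: "x \<in> ball z r" "x \<in> Z" by blast
        then obtain V where V: "open V" "x \<in> V" "\<forall>x\<in>V. u x = q" by (auto simp: Z_def eventually_nhds)
        have "cd q (u y) = 0" if "y \<in> ball z r" for y
        proof (rule analytic_continuation_open[of "ball z r \<inter> V" "ball z r" "\<lambda>x. cd q (u x)" "\<lambda>_. 0" y])
          show "\<And>w. w \<in> ball z r \<inter> V \<Longrightarrow> cd q (u w) = 0" using V by auto
        qed (use x V r that in auto)
        then have "u y = q" if "y \<in> ball z r" for y
          using ic_cd[OF r(3)[OF that]] that by simp
        then have "z \<in> Z" using r(1) z by (auto simp: Z_def eventually_nhds intro!: exI[of _ "ball z r"])
        then show False using z by blast
      qed
      then show ?thesis using r by (intro exI[of _ "ball z r"]) auto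
    qed
  qed
  moreover have "T \<subseteq> Z" using assms by (auto simp: Z_def eventually_nhds)
  ultimately have "S - Z = {}"
    using connectedD[OF \<open>connected S\<close>, of Z "S - Z"] \<open>T \<noteq> {}\<close> \<open>T \<subseteq> S\<close> unfolding Z_def by blast
  then have "z \<in> Z" using \<open>z \<in> S\<close> by blast
  then show ?thesis by (auto simp: Z_def dest: eventually_nhds_x_imp_x)
qed

text \<open>In the chart centred at the value p this is the classical open mapping theorem; the
  identity principle supplies non-constancy on a small ball.\<close>

lemma holo_into_open_mapping:
  assumes u: "holo_into S u" and "connected S" "\<not> u constant_on S" "open T" "T \<subseteq> S"
  shows "open (u ` T)"
proof (subst open_subopen, intro ballI)
  fix p assume "p \<in> u ` T"
  then obtain z where z: "z \<in> T" "p = u z" by blast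
  have "holo_into T u" using u assms holo_into_subset by blast
  then obtain r where r: "r > 0" "ball z r \<subseteq> T" "\<And>x. x \<in> ball z r \<Longrightarrow> u x \<noteq> antip p"
        "(\<lambda>x. cd p (u x)) holomorphic_on ball z r"
        using holo_into_ball_chart[of T u z p] z by auto
  have "\<not> (\<lambda>x. cd p (u x)) constant_on ball z r"
  proof
    assume "(\<lambda>x. cd p (u x)) constant_on ball z r"
    then have "cd p (u x) = 0" if "x \<in> ball z r" for x
      using that r(1) z unfolding constant_on_def by (metis cd_self centre_in_ball)
    then have b: "u x = p" if "x \<in> ball z r" for x using ic_cd[OF r(3)[OF that]] that by simp
    have "u x = p" if "x \<in> S" for x
      by (rule holo_into_identity[OF u \<open>connected S\<close>, of "ball z r"]) (use b r \<open>T \<subseteq> S\<close> that in auto)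
    then show False using assms(3) unfolding constant_on_def by blast
  qed
  then have "open ((\<lambda>x. cd p (u x)) ` ball z r)"
    using open_mapping_thm[OF r(4), of "ball z r"] by auto
  then have "open (ic p ` (\<lambda>x. cd p (u x)) ` ball z r)" by (rule open_ic_image)
  moreover have "ic p ` (\<lambda>x. cd p (u x)) ` ball z r = u ` ball z r"
    unfolding image_image by (rule image_cong) (use r ic_cd in auto)
  ultimately show "\<exists>V. open V \<and> p \<in> V \<and> V \<subseteq> u ` T"
    using r z by (intro exI[of _ "u ` ball z r"]) auto
qed

section \<open>Holomorphic self-maps of the sphere and their derivatives\<close>

definition hmap :: "(riemann_sphere \<Rightarrow> riemann_sphere) \<Rightarrow> bool" where
  "hmap g \<longleftrightarrow> continuous_on UNIV g \<and> (\<forall>p. holo_into UNIV (\<lambda>w. g (ic p w)))"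

lemma holo_into_hmap:
  assumes u: "holo_into S u" and g: "hmap g"
  shows "holo_into S (\<lambda>x. g (u x))"
proof (rule holo_intoI)
  show S: "open S" using u by (simp add: holo_into_def)
  have uc: "continuous_on S u" using u by (simp add: holo_into_def)
  show "continuous_on S (\<lambda>x. g (u x))"
    by (rule continuous_on_compose2[of UNIV g]) (use uc g in \<open>auto simp: hmap_def\<close>)
  show "\<exists>q. g (u z) \<noteq> antip q \<and> (\<lambda>x. cd q (g (u x))) field_differentiable (at z)"
    if z: "z \<in> S" for z
  proof (intro exI conjI)
    let ?p = "g (u z)" and ?r = "u z"
    show "g (u z) \<noteq> antip ?p" by simp
    show "(\<lambda>x. cd ?p (g (u x))) field_differentiable (at z)"
    proof (rule field_differentiable_local_eq)
      have "(\<lambda>x. cd ?r (u x)) field_differentiable (at z)"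
        using u z unfolding holo_into_def by simp
      moreover have "(\<lambda>w. cd ?p (g (ic ?r w))) field_differentiable (at (cd ?r (u z)))"
        using g unfolding hmap_def holo_into_def by simp
      ultimately show "((\<lambda>w. cd ?p (g (ic ?r w))) \<circ> (\<lambda>x. cd ?r (u x))) field_differentiable (at z)"
        by (intro field_differentiable_compose)
      show "\<forall>\<^sub>F x in nhds z. cd ?p (g (u x)) = ((\<lambda>w. cd ?p (g (ic ?r w))) \<circ> (\<lambda>x. cd ?r (u x))) x"
        using eventually_neq_point[OF uc S z self_neq_antip] by eventually_elim (simp add: ic_cd)
    qed
  qed
qed

lemma hmap_comp: "hmap g \<Longrightarrow> hmap h \<Longrightarrow> hmap (g \<circ> h)"
  using holo_into_hmap[of UNIV "\<lambda>w. h (ic _ w)" g] unfolding hmap_def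
  by (auto intro!: continuous_on_compose2[of UNIV g UNIV h])

lemma hmap_differentiable:
  "hmap g \<Longrightarrow> g (ic p w) \<noteq> antip q \<Longrightarrow> (\<lambda>w. cd q (g (ic p w))) field_differentiable (at w)"
  by (simp add: hmap_def holo_into_def)

text \<open>The charts of \<open>sphere_deriv\<close> and the centred charts differ by translations
  in source and target, which do not affect the derivative.\<close>

lemma sphere_deriv_DERIV:
  assumes "hmap h"
  shows "((\<lambda>w. cd (h x) (h (ic x w))) has_field_derivative sphere_deriv h x) (at 0)"
proof -
  have fd: "(\<lambda>w. cd (h x) (h (ic x w))) field_differentiable (at 0)"
    using hmap_differentiable[OF assms, of x 0 "h x"] by simp
  have "(\<lambda>w. cd (h x) (h (ic x w))) = (\<lambda>w. snd (chart_at (h x)) (h (inv_into (fst (chart_at x)) (snd (chart_at x)) (snd (chart_at x) x + w))) - (case h x of Fin b \<Rightarrow> b | Infty \<Rightarrow> 0))"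
  proof
    fix w
    have "inv_into (- {Infty}) fin_coord v = Fin v" for v
      by (rule inv_into_f_eq) (auto simp: inj_on_def elim: fin_coord.elims)
    moreover have "inv_into (- {Fin 0}) inf_coord v = ic Infty v" for v
      by (rule inv_into_f_eq) (auto simp: inj_on_def ic_def elim!: inf_coord.elims)
    ultimately show "cd (h x) (h (ic x w)) = snd (chart_at (h x)) (h (inv_into (fst (chart_at x)) (snd (chart_at x)) (snd (chart_at x) x + w))) - (case h x of Fin b \<Rightarrow> b | Infty \<Rightarrow> 0)"
      by (cases x; cases "h x") (auto simp: chart_at_def fin_chart_def inf_chart_def cd_def ic_def)
  qed
  then obtain b where e: "(\<lambda>w. cd (h x) (h (ic x w))) = (\<lambda>w. snd (chart_at (h x)) (h (inv_into (fst (chart_at x)) (snd (chart_at x)) (snd (chart_at x) x + w))) - b)"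
    by blast
  have "sphere_deriv h x = deriv (\<lambda>w. snd (chart_at (h x)) (h (inv_into (fst (chart_at x)) (snd (chart_at x)) (snd (chart_at x) x + w)))) 0"
    unfolding sphere_deriv_def Let_def case_prod_unfold
    by (subst deriv_shift_0) (simp add: o_def)
  also have "\<dots> = deriv (\<lambda>w. cd (h x) (h (ic x w))) 0"
  proof -
    obtain D where D: "((\<lambda>w. cd (h x) (h (ic x w))) has_field_derivative D) (at 0)"
      using fd by (auto simp: field_differentiable_def)
    then have "((\<lambda>w. cd (h x) (h (ic x w)) + b) has_field_derivative D) (at 0)"
      by (auto intro!: derivative_eq_intros)
    moreover have "(\<lambda>w. snd (chart_at (h x)) (h (inv_into (fst (chart_at x)) (snd (chart_at x)) (snd (chart_at x) x + w)))) = (\<lambda>w. cd (h x) (h (ic x w)) + b)"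
      by (rule ext) (use fun_cong[OF e] in \<open>simp add: algebra_simps\<close>)
    ultimately show ?thesis using D by (simp add: DERIV_imp_deriv)
  qed
  finally show ?thesis using fd by (simp add: DERIV_deriv_iff_field_differentiable)
qed

lemma DERIV_hmap_compose:
  assumes "hmap g" "((\<lambda>w. cd r (u w)) has_field_derivative D) (at z)" "u z = r"
    and "continuous_on S u" "open S" "z \<in> S"
  shows "((\<lambda>w. cd (g r) (g (u w))) has_field_derivative sphere_deriv g r * D) (at z)"
proof (rule DERIV_local_eq)
  have "((\<lambda>w. cd (g r) (g (ic r w))) has_field_derivative sphere_deriv g r) (at (cd r (u z)))"
    using sphere_deriv_DERIV[OF assms(1), of r] assms(3) by simp
  then show "((\<lambda>w. cd (g r) (g (ic r w))) \<circ> (\<lambda>w. cd r (u w)) has_field_derivative sphere_deriv g r * D) (at z)"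
    using assms(2) by (rule DERIV_chain)
  show "\<forall>\<^sub>F x in nhds z. cd (g r) (g (u x)) = ((\<lambda>w. cd (g r) (g (ic r w))) \<circ> (\<lambda>w. cd r (u w))) x"
    using eventually_neq_point[OF assms(4-6), of "antip r"] assms(3) by (auto elim!: eventually_mono simp: ic_cd)
qed

lemma sphere_deriv_comp:
  assumes "hmap g" "hmap h"
  shows "sphere_deriv (g \<circ> h) x = sphere_deriv g (h x) * sphere_deriv h x"
proof -
  have "((\<lambda>w. cd (g (h x)) (g (h (ic x w)))) has_field_derivative sphere_deriv g (h x) * sphere_deriv h x) (at 0)"
    by (rule DERIV_hmap_compose[OF assms(1) sphere_deriv_DERIV[OF assms(2)], where S=UNIV])
      (use assms in \<open>auto simp: hmap_def holo_into_def\<close>)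
  then show ?thesis
    using sphere_deriv_DERIV[OF hmap_comp[OF assms], of x] by (auto dest: DERIV_unique simp: o_def)
qed

text \<open>Changing the chart conjugates by a transition map, whose derivative A cancels against
  the derivative B of its inverse. This serves to read the multiplier of a perturbed fixed point in
  the chart centred at the old one.\<close>

lemma sphere_deriv_other_chart:
  assumes g: "hmap g" and "g x = x" "x = ic p w"
  shows "((\<lambda>w. cd p (g (ic p w))) has_field_derivative sphere_deriv g x) (at w)"
proof -
  have xp: "x \<noteq> antip p" using assms by simp
  have px: "ic p w = x" using assms by simp
  obtain A where A: "((\<lambda>v. cd p (ic x v)) has_field_derivative A) (at 0)"
    using cd_ic_differentiable[of x 0 p] xp by (auto simp: field_differentiable_def)
  obtain B where B: "((\<lambda>v. cd x (ic p v)) has_field_derivative B) (at w)"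
    using cd_ic_differentiable[of p w x] assms by (auto simp: field_differentiable_def)
  have cw: "cd x (ic p w) = 0" by (simp add: px)
  have ev: "\<forall>\<^sub>F v in nhds w. ic p v \<noteq> antip x"
    by (rule eventually_neq_point[OF continuous_on_ic[of UNIV] open_UNIV UNIV_I]) (simp add: px)
  have "((\<lambda>v. v) has_field_derivative A * B) (at w)"
  proof (rule DERIV_local_eq)
    show "((\<lambda>v. cd p (ic x v)) \<circ> (\<lambda>v. cd x (ic p v)) has_field_derivative A * B) (at w)"
      by (rule DERIV_chain) (use A B cw in auto)
    show "\<forall>\<^sub>F v in nhds w. v = ((\<lambda>v. cd p (ic x v)) \<circ> (\<lambda>v. cd x (ic p v))) v"
      using ev by eventually_elim (simp add: ic_cd)
  qed
  then have AB: "A * B = 1" using DERIV_ident DERIV_unique by blast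
  have gd: "((\<lambda>v. cd x (g (ic x v))) has_field_derivative sphere_deriv g x) (at 0)"
    using sphere_deriv_DERIV[OF g, of x] assms(2) by simp
  have "((\<lambda>w. cd p (g (ic p w))) has_field_derivative A * (sphere_deriv g x * B)) (at w)"
  proof (rule DERIV_local_eq)
    have "((\<lambda>v. cd x (g (ic x v))) \<circ> (\<lambda>v. cd x (ic p v)) has_field_derivative sphere_deriv g x * B) (at w)"
      by (rule DERIV_chain) (use gd B cw in auto)
    moreover have "cd x (g (ic x (cd x (ic p w)))) = 0" using cw assms(2) by simp
    ultimately show "((\<lambda>v. cd p (ic x v)) \<circ> ((\<lambda>v. cd x (g (ic x v))) \<circ> (\<lambda>v. cd x (ic p v))) has_field_derivative A * (sphere_deriv g x * B)) (at w)"
      by (intro DERIV_chain) (use A gd B cw in \<open>auto simp: px\<close>)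
    have "\<forall>\<^sub>F v in nhds w. g (ic p v) \<noteq> antip x"
      by (rule eventually_neq_point[of UNIV "\<lambda>v. g (ic p v)"]) (use assms(2) g in \<open>auto simp: hmap_def holo_into_def px\<close>)
    then show "\<forall>\<^sub>F v in nhds w. cd p (g (ic p v)) = ((\<lambda>v. cd p (ic x v)) \<circ> ((\<lambda>v. cd x (g (ic x v))) \<circ> (\<lambda>v. cd x (ic p v)))) v"
      using ev by eventually_elim (simp add: ic_cd)
  qed
  moreover have "A * (sphere_deriv g x * B) = sphere_deriv g x"
    using AB by (metis mult.assoc mult.commute mult.left_neutral)
  ultimately show ?thesis by simp
qed

section \<open>Rational maps\<close>

lemma holo_into_Un: "holo_into S u \<Longrightarrow> holo_into T u \<Longrightarrow> holo_into (S \<union> T) u"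
  unfolding holo_into_def by (auto intro: continuous_on_open_Un)

lemma holo_into_eq:
  assumes "holo_into S u" "\<And>x. x \<in> S \<Longrightarrow> v x = u x"
  shows "holo_into S v"
  unfolding holo_into_def
proof (intro conjI ballI allI impI)
  show S: "open S" using assms by (simp add: holo_into_def)
  show "continuous_on S v"
    using assms unfolding holo_into_def by (metis continuous_on_cong)
  fix z q assume z: "z \<in> S" "v z \<noteq> antip q"
  show "(\<lambda>x. cd q (v x)) field_differentiable (at z)"
  proof (rule field_differentiable_local_eq)
    show "(\<lambda>x. cd q (u x)) field_differentiable (at z)"
      using assms z unfolding holo_into_def by simp
    show "\<forall>\<^sub>F x in nhds z. cd q (v x) = cd q (u x)"
      using S z assms(2) by (auto simp: eventually_nhds intro!: exI[of _ S])
  qed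
qed

text \<open>Where Q does not vanish the coordinate is P/Q; where P does not vanish it is Q/P in the
  chart at infinity. These two open sets cover the plane.\<close>

lemma holo_into_quotient:
  assumes "P holomorphic_on UNIV" "Q holomorphic_on UNIV" "\<And>w. P w \<noteq> 0 \<or> Q w \<noteq> 0"
  shows "holo_into UNIV (\<lambda>w. if Q w = 0 then Infty else Fin (P w / Q w))" (is "holo_into UNIV ?u")
proof -
  have o: "open {w. R w \<noteq> 0}" if "R holomorphic_on UNIV" for R :: "complex \<Rightarrow> complex"
    using that by (intro open_Collect_neq holomorphic_on_imp_continuous_on) auto
  have "holo_into {w. Q w \<noteq> 0} ?u"
  proof (rule holo_into_eq)
    show "holo_into {w. Q w \<noteq> 0} (\<lambda>w. ic (Fin 0) (P w / Q w))"
      by (intro holo_into_ic holomorphic_on_divide o assms(2))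
        (use assms in \<open>auto intro: holomorphic_on_subset\<close>)
  qed (simp add: ic_def)
  moreover have "holo_into {w. P w \<noteq> 0} ?u"
  proof (rule holo_into_eq)
    show "holo_into {w. P w \<noteq> 0} (\<lambda>w. ic Infty (Q w / P w))"
      by (intro holo_into_ic holomorphic_on_divide o assms(1))
        (use assms in \<open>auto intro: holomorphic_on_subset\<close>)
  qed (simp add: ic_def)
  ultimately have "holo_into ({w. Q w \<noteq> 0} \<union> {w. P w \<noteq> 0}) ?u" by (rule holo_into_Un)
  moreover have "{w. Q w \<noteq> 0} \<union> {w. P w \<noteq> 0} = UNIV" using assms(3) by auto
  ultimately show ?thesis by simp
qed

lemma ic_Fin_0: "ic (Fin 0) = Fin"
  by (auto simp: ic_def)

lemma hmapI:
  assumes 1: "holo_into UNIV (\<lambda>w. g (Fin w))" and 2: "holo_into UNIV (\<lambda>w. g (ic Infty w))"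
  shows "hmap g"
proof -
  have c: "continuous_on (- {antip q}) g" if "holo_into UNIV (\<lambda>w. g (ic q w))" for q
  proof -
    have "continuous_on (- {antip q}) (\<lambda>x. g (ic q (cd q x)))"
      by (rule continuous_on_compose2[of UNIV "\<lambda>w. g (ic q w)"])
        (use that in \<open>auto simp: holo_into_def intro!: continuous_on_cd\<close>)
    then show ?thesis by (rule continuous_on_eq) (simp add: ic_cd)
  qed
  have "continuous_on (- {antip (Fin 0)} \<union> - {antip Infty}) g"
    by (intro continuous_on_open_Un c) (use assms in \<open>auto simp: ic_Fin_0\<close>)
  then have gc: "continuous_on UNIV g" by (simp add: antip_def Compl_Int[symmetric])
  have "holo_into UNIV (\<lambda>w. g (ic p w))" for p
  proof (cases p)
    case (Fin a)
    show ?thesis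
      using holo_into_reparam[OF 1, of "\<lambda>w. a + w" UNIV] Fin by (simp add: ic_def holomorphic_intros)
  qed (use 2 in simp)
  then show ?thesis using gc by (simp add: hmap_def)
qed

lemma poly_inverse_reversal:
  fixes p :: "complex poly"
  assumes "degree p \<le> d" "w \<noteq> 0"
  shows "(\<Sum>i\<le>d. coeff p i * w ^ (d - i)) = w ^ d * poly p (inverse w)"
proof -
  have "poly p (inverse w) = (\<Sum>i\<le>d. coeff p i * inverse w ^ i)"
    unfolding poly_altdef using assms(1)
    by (intro sum.mono_neutral_left) (auto simp: coeff_eq_0)
  then show ?thesis using assms(2)
    by (auto simp: sum_distrib_left power_diff power_inverse field_simps intro!: sum.cong)
qed

text \<open>At infinity both polynomials are reversed with the common degree d. The reversed pair
  has no common zero: away from 0 by coprimality, and at 0 because a polynomial of the larger degree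
  has a nonzero leading coefficient.\<close>

lemma hmap_apply_rat: "hmap (apply_rat g)"
proof -
  obtain p q where pq: "coprime p q" "apply_rat g = rat_fun p q"
    using apply_rat[of g] by blast
  have nz: "poly p w \<noteq> 0 \<or> poly q w \<noteq> 0" for w
    using coprime_poly_0[OF pq(1)] by blast
  have 1: "holo_into UNIV (\<lambda>w. apply_rat g (Fin w))"
    using holo_into_quotient[of "poly p" "poly q"] nz by (simp add: pq(2) holomorphic_intros)
  define d where "d = max (degree p) (degree q)"
  define P where "P = (\<lambda>w::complex. \<Sum>i\<le>d. coeff p i * w ^ (d - i))"
  define Q where "Q = (\<lambda>w::complex. \<Sum>i\<le>d. coeff q i * w ^ (d - i))"
  have rev: "P w = w ^ d * poly p (inverse w)" "Q w = w ^ d * poly q (inverse w)" if "w \<noteq> 0" for w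
    using poly_inverse_reversal[of _ d w] that by (auto simp: P_def Q_def d_def)
  have z: "(\<Sum>i\<le>d. coeff r i * 0 ^ (d - i)) = coeff r d" for r :: "complex poly"
  proof -
    have "(\<Sum>i\<le>d. coeff r i * 0 ^ (d - i)) = (\<Sum>i\<in>{d}. coeff r i * 0 ^ (d - i))"
      by (rule sum.mono_neutral_right) (auto simp: power_0_left)
    then show ?thesis by simp
  qed
  have zero: "P 0 = coeff p d" "Q 0 = coeff q d" by (simp_all add: P_def Q_def z)
  have PQ: "P w \<noteq> 0 \<or> Q w \<noteq> 0" for w
  proof (cases "w = 0")
    case False then show ?thesis using rev[OF False] nz[of "inverse w"] by auto
  next
    case True
    show ?thesis
    proof (rule ccontr)
      assume "\<not> ?thesis"
      then have "coeff p d = 0" "coeff q d = 0" using True zero by auto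
      then have "p = 0 \<and> q = 0"
        by (cases "degree p \<ge> degree q") (auto simp: d_def max_def split: if_splits)
      then show False using pq(1) by simp
    qed
  qed
  have "(\<lambda>w. apply_rat g (ic Infty w)) = (\<lambda>w. if Q w = 0 then Infty else Fin (P w / Q w))"
    by (rule ext) (auto simp: pq(2) ic_def rev zero d_def[symmetric] Let_def)
  moreover have "holo_into UNIV (\<lambda>w. if Q w = 0 then Infty else Fin (P w / Q w))"
    by (rule holo_into_quotient[OF _ _ PQ]) (auto simp: P_def Q_def intro!: holomorphic_intros)
  ultimately show ?thesis using hmapI[OF 1] by simp
qed

lemma continuous_on_apply_rat: "continuous_on A (apply_rat g)"
  using hmap_apply_rat[of g] unfolding hmap_def by (auto intro: continuous_on_subset)

text \<open>At a coincidence the cross difference p q' - p' q vanishes. If it vanished identically,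
  coprimality would make the two pairs proportional and the functions equal.\<close>

lemma finite_rat_fun_coincidence:
  assumes "coprime p q" "coprime p' q'" "rat_fun p q \<noteq> rat_fun p' q'"
  shows "finite {z. rat_fun p q (Fin z) = rat_fun p' q' (Fin z)}"
proof -
  let ?r = "p * q' - p' * q"
  have "?r \<noteq> 0"
  proof
    assume "?r = 0"
    then have e: "p * q' = p' * q" by simp
    have "p dvd p' * q" "p' dvd p * q'" using e by (metis dvd_triv_left)+
    then have d: "p dvd p'" "p' dvd p"
      using assms(1,2) by (metis coprime_dvd_mult_left_iff coprime_commute)+
    have "q dvd p * q'" "q' dvd p' * q" using e by (metis dvd_triv_right)+
    then have d': "q dvd q'" "q' dvd q"
      using assms(1,2) by (metis coprime_dvd_mult_right_iff coprime_commute)+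
    have "rat_fun p q = rat_fun p' q'"
    proof (cases "q = 0")
      case True
      then have "q' = 0" using d' by auto
      show ?thesis
      proof
        fix x show "rat_fun p q x = rat_fun p' q' x"
          by (cases x) (use True \<open>q' = 0\<close> in \<open>auto simp: Let_def\<close>)
      qed
    next
      case False
      then obtain u where u: "q' = q * u" using d' by (auto elim: dvdE)
      have "q' \<noteq> 0" using False d' by auto
      moreover have "degree q' = degree q" using associated_imp_degree_eq d' by metis
      ultimately have "degree u = 0" using u False by (metis add_cancel_right_right degree_mult_eq mult_eq_0_iff)
      then obtain c where c: "u = [:c:]" by (metis degree_eq_zeroE)
      have c0: "c \<noteq> 0" using u c \<open>q' \<noteq> 0\<close> by auto
      have q': "q' = smult c q" using u c by simp
      then have "q * (smult c p) = q * p'" using e by (simp add: mult.commute)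
      then have p': "p' = smult c p" using mult_left_cancel[OF False] by metis
      show ?thesis
      proof
        fix x show "rat_fun p q x = rat_fun p' q' x"
          by (cases x) (use c0 in \<open>auto simp: p' q' Let_def\<close>)
      qed
    qed
    then show False using assms(3) by simp
  qed
  have "{z. rat_fun p q (Fin z) = rat_fun p' q' (Fin z)} \<subseteq> {z. poly ?r z = 0}"
    by (auto simp: frac_eq_eq split: if_splits)
  then show ?thesis using poly_roots_finite[OF \<open>?r \<noteq> 0\<close>] finite_subset by blast
qed

lemma finite_sphereI: "finite {z. Fin z \<in> A} \<Longrightarrow> finite A"
proof -
  assume "finite {z. Fin z \<in> A}"
  then have "finite (insert Infty (Fin ` {z. Fin z \<in> A}))" by simp
  moreover have "A \<subseteq> insert Infty (Fin ` {z. Fin z \<in> A})"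
  proof
    fix x assume "x \<in> A" then show "x \<in> insert Infty (Fin ` {z. Fin z \<in> A})" by (cases x) auto
  qed
  ultimately show ?thesis using finite_subset by blast
qed

lemma finite_apply_rat_coincidence:
  assumes "g \<noteq> h" shows "finite {x. apply_rat g x = apply_rat h x}"
proof -
  obtain p q where pq: "coprime p q" "apply_rat g = rat_fun p q" using apply_rat[of g] by blast
  obtain p' q' where pq': "coprime p' q'" "apply_rat h = rat_fun p' q'" using apply_rat[of h] by blast
  have "rat_fun p q \<noteq> rat_fun p' q'" using assms pq pq' by (metis apply_rat_inject)
  from finite_rat_fun_coincidence[OF pq(1) pq'(1) this] show ?thesis
    by (intro finite_sphereI) (simp add: pq pq')
qed

lemma finite_apply_rat_fiber: "finite {x. apply_rat g x = y}"
proof -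
  obtain p q where pq: "coprime p q" "apply_rat g = rat_fun p q" using apply_rat[of g] by blast
  \<comment> \<open>The constant map with value y is itself a quotient of coprime polynomials, with
    denominator 0 when y is infinite, so a fibre is a coincidence set.\<close>
  obtain p' q' where pq': "coprime p' q'" "\<And>x. rat_fun p' q' x = y"
  proof (cases y)
    case (Fin c)
    have "rat_fun [:c:] 1 x = y" for x by (cases x) (auto simp: Let_def Fin)
    then show ?thesis by (intro that[of "[:c:]" 1]) auto
  next
    case Infty
    have "rat_fun 1 0 x = y" for x by (cases x) (auto simp: Let_def Infty)
    then show ?thesis by (intro that[of 1 0]) auto
  qed
  have "rat_fun p q \<noteq> rat_fun p' q'"
    using apply_rat[of g] pq' pq(2) unfolding constant_on_def by auto
  from finite_rat_fun_coincidence[OF pq(1) pq'(1) this] show ?thesis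
    by (intro finite_sphereI) (simp only: pq pq' mem_Collect_eq)
qed

section \<open>Words\<close>

lemma semigroup_generated_eq:
  "semigroup_generated S = {fold apply_rat gs | gs. gs \<noteq> [] \<and> set gs \<subseteq> S}" (is "_ = ?W")
proof
  show "semigroup_generated S \<subseteq> ?W"
  proof
    fix g assume "g \<in> semigroup_generated S"
    then show "g \<in> ?W"
    proof induction
      case (gen g)
      then show ?case by (intro CollectI exI[of _ "[g]"]) auto
    next
      case (comp g h)
      then obtain gs hs where "g = fold apply_rat gs" "h = fold apply_rat hs"
        "gs \<noteq> []" "set gs \<subseteq> S" "set hs \<subseteq> S" by blast
      then show ?case by (intro CollectI exI[of _ "hs @ gs"]) auto
    qed
  qed
  have "gs \<noteq> [] \<longrightarrow> set gs \<subseteq> S \<longrightarrow> fold apply_rat gs \<in> semigroup_generated S" for gs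
  proof (induction gs)
    case (Cons g gs)
    show ?case
    proof (cases "gs = []")
      case True
      then show ?thesis by (auto intro: semigroup_generated.gen)
    next
      case False
      show ?thesis
      proof (intro impI)
        assume "set (g # gs) \<subseteq> S"
        then have "fold apply_rat gs \<circ> apply_rat g \<in> semigroup_generated S"
          using Cons False by (intro semigroup_generated.comp semigroup_generated.gen) auto
        then show "fold apply_rat (g # gs) \<in> semigroup_generated S" by simp
      qed
    qed
  qed simp
  then show "?W \<subseteq> semigroup_generated S" by blast
qed

lemma semigroup_generated_mono: "S \<subseteq> T \<Longrightarrow> semigroup_generated S \<subseteq> semigroup_generated T"
  unfolding semigroup_generated_eq by blast

lemma hmap_id: "hmap (\<lambda>x. x)"
  unfolding hmap_def by (auto intro: holo_into_ic)

lemma hmap_fold: "hmap (fold apply_rat gs)"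
proof (induction gs)
  case Nil
  then show ?case using hmap_id by (simp add: id_def)
next
  case (Cons g gs)
  have "hmap (fold apply_rat gs \<circ> apply_rat g)" by (rule hmap_comp[OF Cons hmap_apply_rat])
  then show ?case by (simp add: o_def)
qed

lemma finite_fold_fiber: "finite A \<Longrightarrow> finite {x. fold apply_rat gs x \<in> A}"
proof (induction gs)
  case (Cons g gs)
  have "{x. fold apply_rat (g # gs) x \<in> A} = (\<Union>y\<in>{x. fold apply_rat gs x \<in> A}. {x. apply_rat g x = y})"
    by auto
  then show ?case using Cons finite_apply_rat_fiber by simp
qed simp

lemma hmap_semigroup: "g \<in> semigroup_generated S \<Longrightarrow> hmap g"
  unfolding semigroup_generated_eq using hmap_fold by blast

lemma hmap_continuous_on: "hmap g \<Longrightarrow> continuous_on A g"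
  unfolding hmap_def using continuous_on_subset by blast

lemma open_apply_rat_image:
  assumes "open U" shows "open (apply_rat g ` U)"
proof (subst open_subopen, intro ballI)
  fix y assume "y \<in> apply_rat g ` U"
  then obtain x where x: "x \<in> U" "y = apply_rat g x" by blast
  obtain r where r: "r > 0" "ic x ` ball 0 r \<subseteq> U" using obtain_ic_ball[OF assms x(1)] by blast
  have h: "holo_into (ball 0 r) (\<lambda>w. apply_rat g (ic x w))"
    using hmap_apply_rat holo_into_subset unfolding hmap_def by blast
  have "\<not> (\<lambda>w. apply_rat g (ic x w)) constant_on ball 0 r"
  proof
    assume "(\<lambda>w. apply_rat g (ic x w)) constant_on ball 0 r"
    then obtain c where "\<forall>w\<in>ball 0 r. apply_rat g (ic x w) = c" unfolding constant_on_def by blast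
    then have "ic x ` ball 0 r \<subseteq> {x. apply_rat g x = c}" by auto
    moreover have "infinite (ic x ` ball 0 r)"
      using infinite_open_sphere[OF open_ic_image[of "ball 0 r"]] r by simp
    ultimately show False using finite_apply_rat_fiber finite_subset by blast
  qed
  then have "open ((\<lambda>w. apply_rat g (ic x w)) ` ball 0 r)"
    using holo_into_open_mapping[OF h] by simp
  then show "\<exists>V. open V \<and> y \<in> V \<and> V \<subseteq> apply_rat g ` U"
  proof (intro exI[of _ "(\<lambda>w. apply_rat g (ic x w)) ` ball 0 r"] conjI)
    show "y \<in> (\<lambda>w. apply_rat g (ic x w)) ` ball 0 r"
      using r x by (intro image_eqI[of _ _ 0]) auto
    show "(\<lambda>w. apply_rat g (ic x w)) ` ball 0 r \<subseteq> apply_rat g ` U" using r by auto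
  qed
qed

lemma open_fold_image: "open U \<Longrightarrow> open (fold apply_rat gs ` U)"
proof (induction gs arbitrary: U)
  case (Cons g gs)
  then show ?case using open_apply_rat_image[of U g] Cons.IH[of "apply_rat g ` U"] by (simp add: image_comp)
qed simp

lemma dist_apply_rat_le: "dist (apply_rat f x) (apply_rat g x) \<le> dist f g"
  unfolding dist_rational_map_def
  by (rule cSUP_upper) (auto intro!: bdd_aboveI[of _ pi] dist_riemann_sphere_le_pi)

lemma continuous_on_apply_rat_pair: "continuous_on A (\<lambda>(g, x). apply_rat g x)"
proof (rule continuous_on_subset[OF _ subset_UNIV], unfold continuous_on_iff, intro ballI allI impI)
  fix y :: "rational_map \<times> riemann_sphere" and e :: real assume "e > 0"
  obtain g x where y: "y = (g, x)" by (cases y)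
  obtain d where d: "d > 0" "\<And>x'. dist x' x < d \<Longrightarrow> dist (apply_rat g x') (apply_rat g x) < e / 2"
    using continuous_on_apply_rat[of UNIV g] \<open>e > 0\<close> unfolding continuous_on_iff
    by (metis UNIV_I half_gt_zero)
  show "\<exists>d>0. \<forall>y'\<in>UNIV. dist y' y < d \<longrightarrow> dist (case y' of (g, x) \<Rightarrow> apply_rat g x) (case y of (g, x) \<Rightarrow> apply_rat g x) < e"
  proof (intro exI[of _ "min d (e/2)"] conjI ballI impI)
    fix y' assume "dist y' y < min d (e / 2)"
    moreover obtain g' x' where y': "y' = (g', x')" by (cases y')
    ultimately have "dist g' g < e / 2" "dist x' x < d"
      using dist_fst_le[of y' y] dist_snd_le[of y' y] by (auto simp: y)
    then have "dist (apply_rat g' x') (apply_rat g x') < e / 2" "dist (apply_rat g x') (apply_rat g x) < e / 2"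
      using d(2)[of x'] dist_apply_rat_le[of g' x' g] by linarith+
    then show "dist (case y' of (g, x) \<Rightarrow> apply_rat g x) (case y of (g, x) \<Rightarrow> apply_rat g x) < e"
      using dist_triangle[of "apply_rat g' x'" "apply_rat g x" "apply_rat g x'"] by (simp add: y y')
  qed (use d \<open>e > 0\<close> in auto)
qed

text \<open>The error of the first letter is controlled by uniform continuity of the remaining word
  on the compact sphere, the other errors by induction.\<close>

lemma fold_close:
  assumes "e > 0"
  shows "\<exists>d>0. \<forall>gs'. list_all2 (\<lambda>g g'. dist g g' < d) gs gs' \<longrightarrow>
    (\<forall>x. dist (fold apply_rat gs' x) (fold apply_rat gs x) < e)"
  using assms
proof (induction gs arbitrary: e)
  case Nil
  then show ?case by (intro exI[of _ 1]) auto
next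
  case (Cons g gs)
  obtain d where d: "d > 0" "\<And>gs' x. list_all2 (\<lambda>g g'. dist g g' < d) gs gs' \<Longrightarrow>
      dist (fold apply_rat gs' x) (fold apply_rat gs x) < e / 2"
    using Cons.IH[of "e/2"] Cons.prems by auto
  have "uniformly_continuous_on UNIV (fold apply_rat gs)"
    by (rule compact_uniformly_continuous[OF hmap_continuous_on[OF hmap_fold] compact_UNIV_sphere])
  then obtain d' where d': "d' > 0" "\<And>x y. dist x y < d' \<Longrightarrow> dist (fold apply_rat gs x) (fold apply_rat gs y) < e / 2"
    unfolding uniformly_continuous_on_def using Cons.prems by (metis UNIV_I half_gt_zero)
  show ?case
  proof (intro exI[of _ "min d d'"] conjI allI impI)
    fix gs'' x assume "list_all2 (\<lambda>g g'. dist g g' < min d d') (g # gs) gs''"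
    then obtain g' gs' where g: "gs'' = g' # gs'" "dist g g' < min d d'"
      "list_all2 (\<lambda>g g'. dist g g' < min d d') gs gs'"
      by (auto simp: list_all2_Cons1)
    have "list_all2 (\<lambda>g g'. dist g g' < d) gs gs'" using g(3) by (rule list_all2_mono) auto
    then have 1: "dist (fold apply_rat gs' (apply_rat g' x)) (fold apply_rat gs (apply_rat g' x)) < e / 2" by (rule d(2))
    have "dist (apply_rat g' x) (apply_rat g x) < d'"
      using dist_apply_rat_le[of g' x g] g(2) by (simp add: dist_commute)
    then have 2: "dist (fold apply_rat gs (apply_rat g' x)) (fold apply_rat gs (apply_rat g x)) < e / 2" by (rule d'(2))
    show "dist (fold apply_rat gs'' x) (fold apply_rat (g # gs) x) < e"
      using dist_triangle[of "fold apply_rat gs' (apply_rat g' x)" "fold apply_rat gs (apply_rat g x)" "fold apply_rat gs (apply_rat g' x)"] 1 2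
      by (simp add: g(1))
  qed (use d d' in auto)
qed

section \<open>Neighbourhoods of compact sets of maps and of points\<close>

definition thicken :: "real \<Rightarrow> 'a::metric_space set \<Rightarrow> 'a set" where
  "thicken d A = {y. \<exists>x\<in>A. dist x y < d}"

lemma thicken_eq: "thicken d A = (\<Union>x\<in>A. ball x d)"
  by (auto simp: thicken_def)

lemma thicken_mono: "d \<le> d' \<Longrightarrow> thicken d A \<subseteq> thicken d' A"
  unfolding thicken_def by force

lemma compact_thicken_subset:
  assumes "compact K" "open U" "K \<subseteq> U"
  obtains d where "d > 0" "thicken d K \<subseteq> U"
proof -
  obtain e where "e > 0" "(\<Union>x\<in>K. ball x e) \<subseteq> U" using compact_subset_open_imp_ball_epsilon_subset[OF assms] .
  then show ?thesis using that by (simp add: thicken_eq)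
qed

text \<open>A tube lemma for words: compactness leaves room for an error in the generators and in
  the starting point at once. The values of the first letter on K form a compact set again, which is
  why K varies in the induction.\<close>

lemma words_thicken:
  assumes "compact \<Sigma>" "compact K" "open U"
    and "\<And>gs x. length gs = n \<Longrightarrow> set gs \<subseteq> \<Sigma> \<Longrightarrow> x \<in> K \<Longrightarrow> fold apply_rat gs x \<in> U"
  shows "\<exists>d>0. \<forall>gs x. length gs = n \<longrightarrow> set gs \<subseteq> thicken d \<Sigma> \<longrightarrow> x \<in> thicken d K \<longrightarrow> fold apply_rat gs x \<in> U"
  using assms(2,4)
proof (induction n arbitrary: K)
  case 0
  have "K \<subseteq> U" using 0(2)[of "[]"] by auto
  then obtain d where "d > 0" "thicken d K \<subseteq> U" using compact_thicken_subset[OF 0(1) assms(3)] by blast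
  then show ?case by (intro exI[of _ d]) auto
next
  case (Suc n)
  let ?ev = "\<lambda>(g, x). apply_rat g x" and ?K = "(\<lambda>(g, x). apply_rat g x) ` (\<Sigma> \<times> K)"
  have K: "compact ?K"
    by (intro compact_continuous_image continuous_on_apply_rat_pair compact_Times assms(1) Suc.prems(1))
  have "fold apply_rat gs y \<in> U" if gs: "length gs = n" "set gs \<subseteq> \<Sigma>" "y \<in> ?K" for gs y
  proof -
    obtain g x where "g \<in> \<Sigma>" "x \<in> K" "y = apply_rat g x" using gs(3) by auto
    then show ?thesis using Suc.prems(2)[of "g # gs" x] gs by simp
  qed
  from Suc.IH[OF K this] obtain d where d: "d > 0"
    "\<And>gs x. length gs = n \<Longrightarrow> set gs \<subseteq> thicken d \<Sigma> \<Longrightarrow> x \<in> thicken d ?K \<Longrightarrow> fold apply_rat gs x \<in> U"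
    by blast
  have "open (?ev -` thicken d ?K)"
    by (rule open_vimage[OF _ continuous_on_apply_rat_pair]) (auto simp: thicken_eq)
  moreover have "\<Sigma> \<times> K \<subseteq> ?ev -` thicken d ?K"
  proof
    fix y assume "y \<in> \<Sigma> \<times> K"
    then have "?ev y \<in> ?K" by (rule imageI)
    then have "?ev y \<in> thicken d ?K" unfolding thicken_eq using d(1) by (intro UN_I[of "?ev y"]) auto
    then show "y \<in> ?ev -` thicken d ?K" by simp
  qed
  ultimately obtain d' where d': "d' > 0" "thicken d' (\<Sigma> \<times> K) \<subseteq> ?ev -` thicken d ?K"
    by (rule compact_thicken_subset[OF compact_Times[OF assms(1) Suc.prems(1)]])
  have ev: "apply_rat g x \<in> thicken d ?K" if gx: "g \<in> thicken (d'/2) \<Sigma>" "x \<in> thicken (d'/2) K" for g x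
  proof -
    obtain g0 x0 where g0: "g0 \<in> \<Sigma>" "dist g0 g < d'/2" and x0: "x0 \<in> K" "dist x0 x < d'/2"
      using gx by (auto simp: thicken_def)
    have "dist (g0, x0) (g, x) \<le> dist g0 g + dist x0 x"
      unfolding dist_Pair_Pair by (rule sqrt_sum_squares_le_sum) auto
    then have "dist (g0, x0) (g, x) < d'" using g0 x0 by linarith
    then have "(g, x) \<in> thicken d' (\<Sigma> \<times> K)"
      unfolding thicken_def mem_Collect_eq by (rule bexI[of _ "(g0, x0)"]) (use g0(1) x0(1) in simp)
    then have "?ev (g, x) \<in> thicken d ?K" using d'(2) by (meson subsetD vimageD)
    then show ?thesis by simp
  qed
  show ?case
  proof (intro exI[of _ "min d (d'/2)"] conjI allI impI)
    fix gs x
    assume gs: "length gs = Suc n" "set gs \<subseteq> thicken (min d (d'/2)) \<Sigma>" "x \<in> thicken (min d (d'/2)) K"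
    then obtain g hs where g: "gs = g # hs" "length hs = n" by (auto simp: length_Suc_conv)
    have "set gs \<subseteq> thicken d \<Sigma>" "set gs \<subseteq> thicken (d'/2) \<Sigma>" "x \<in> thicken (d'/2) K"
      using gs thicken_mono[OF min.cobounded1[of d "d'/2"], of \<Sigma>] thicken_mono[OF min.cobounded2[of d "d'/2"], of \<Sigma>]
        thicken_mono[OF min.cobounded2[of d "d'/2"], of K] by blast+
    then show "fold apply_rat gs x \<in> U" using d(2)[of hs "apply_rat g x"] ev[of g x] g by simp
  qed (use d d' in auto)
qed

section \<open>Repelling fixed points persist under perturbation\<close>

text \<open>Fixed points of G' are fixed points of w - (G' w - w) / (a - 1), a Newton step with the
  derivative frozen at a = \<open>deriv G 0\<close>. Closeness of G' to G makes it a contraction,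
  and the same linear estimate shows expansion away from the fixed point. The radius r stays free
  below r0 so that the discs can be made small later.\<close>

lemma repelling_perturb_analytic:
  assumes holG: "G holomorphic_on ball 0 R" and R: "R > 0" and G0: "cmod (deriv G 0) > 1" "G 0 = 0"
  obtains r0 where "r0 > 0" "2 * r0 \<le> R"
    "\<And>r. 0 < r \<Longrightarrow> r \<le> r0 \<Longrightarrow> \<exists>\<eta>>0. \<forall>G'. G' holomorphic_on ball 0 (2 * r) \<longrightarrow>
      (\<forall>w\<in>ball 0 (2 * r). cmod (G' w - G w) < \<eta>) \<longrightarrow>
      (\<exists>w'\<in>ball 0 r. G' w' = w' \<and> cmod (deriv G' w') > 1 \<and>
         (\<exists>\<mu>>1. \<forall>w\<in>ball 0 r. cmod (G' w - w') \<ge> \<mu> * cmod (w - w')))"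
proof -
  define a where "a = deriv G 0"
  \<comment> \<open>With |a| = 1 + 3 \<epsilon>, one \<epsilon> is spent on the deviation of the
    derivative of G' from a; the other two remain in the expansion factor 1 + 2 \<epsilon>.\<close>
  define \<epsilon> where "\<epsilon> = (cmod a - 1) / 3"
  have \<epsilon>: "\<epsilon> > 0" "cmod a = 1 + 3 * \<epsilon>" using G0 by (auto simp: \<epsilon>_def a_def)
  have a1: "cmod (a - 1) \<ge> 3 * \<epsilon>" using \<epsilon>(2) norm_triangle_ineq2[of a 1] by simp
  have "continuous_on (ball 0 R) (deriv G)"
    using holG by (intro holomorphic_on_imp_continuous_on holomorphic_deriv) auto
  then have "isCont (deriv G) 0" using R by (simp add: continuous_on_eq_continuous_at)
  then obtain r1 where r1: "r1 > 0" "\<And>w. cmod w < r1 \<Longrightarrow> cmod (deriv G w - a) < \<epsilon> / 2"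
    using \<epsilon>(1) unfolding continuous_at_eps_delta a_def
    by (metis diff_zero dist_norm half_gt_zero)
  define r0 where "r0 = min (R/2) r1"
  show thesis
  proof (rule that[of r0])
    show "r0 > 0" "2 * r0 \<le> R" using R r1 by (auto simp: r0_def)
    fix r :: real assume r: "0 < r" "r \<le> r0"
    show "\<exists>\<eta>>0. \<forall>G'. G' holomorphic_on ball 0 (2 * r) \<longrightarrow>
      (\<forall>w\<in>ball 0 (2 * r). cmod (G' w - G w) < \<eta>) \<longrightarrow>
      (\<exists>w'\<in>ball 0 r. G' w' = w' \<and> cmod (deriv G' w') > 1 \<and>
         (\<exists>\<mu>>1. \<forall>w\<in>ball 0 r. cmod (G' w - w') \<ge> \<mu> * cmod (w - w')))"
    \<comment> \<open>Cauchy's estimate on discs of radius r turns an error \<epsilon> r / 2 of the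
      values into \<epsilon> / 2 for the derivative; the other half is the oscillation of the
      derivative of G.\<close>
    proof (intro exI[of _ "\<epsilon> * r / 2"] conjI allI impI)
      show "\<epsilon> * r / 2 > 0" using \<epsilon> r by simp
      fix G' assume holG': "G' holomorphic_on ball 0 (2 * r)"
        and close: "\<forall>w\<in>ball 0 (2 * r). cmod (G' w - G w) < \<epsilon> * r / 2"
      have sub: "ball 0 (2 * r) \<subseteq> ball (0::complex) R" using r by (auto simp: r0_def)
      have holG2: "G holomorphic_on ball 0 (2 * r)" using holG sub holomorphic_on_subset by blast
      have dG': "cmod (deriv G' w - a) < \<epsilon>" if w: "w \<in> ball 0 r" for w
      proof -
        have cb: "cball w r \<subseteq> ball 0 (2 * r)"
        proof
          fix v assume "v \<in> cball w r"
          then show "v \<in> ball 0 (2 * r)" using w norm_triangle_ineq2[of v w]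
            by (auto simp: dist_norm norm_minus_commute)
        qed
        have holH: "(\<lambda>w. G' w - G w) holomorphic_on ball 0 (2 * r)"
          using holG' holG2 by (intro holomorphic_intros)
        have "cmod ((deriv ^^ 1) (\<lambda>w. G' w - G w) w) \<le> fact 1 * (\<epsilon> * r / 2) / r ^ 1"
        proof (rule Cauchy_higher_deriv_bound[where y = 0])
          show "(\<lambda>w. G' w - G w) holomorphic_on ball w r"
            using holH cb ball_subset_cball holomorphic_on_subset by blast
          show "continuous_on (cball w r) (\<lambda>w. G' w - G w)"
            using holH cb holomorphic_on_imp_continuous_on continuous_on_subset by blast
          show "G' v - G v \<in> ball 0 (\<epsilon> * r / 2)" if "v \<in> ball w r" for v
            using close cb that ball_subset_cball by (metis dist_0_norm mem_ball subsetD)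
        qed (use r in auto)
        then have "cmod (deriv (\<lambda>w. G' w - G w) w) \<le> \<epsilon> / 2" using r by simp
        moreover have "deriv (\<lambda>w. G' w - G w) w = deriv G' w - deriv G w"
        proof (rule deriv_diff)
          show "G' field_differentiable at w" "G field_differentiable at w"
            using holG' holG2 w r by (auto intro!: holomorphic_on_imp_differentiable_at[of _ "ball 0 (2*r)"])
        qed
        moreover have "cmod (deriv G w - a) < \<epsilon> / 2" using r1(2)[of w] w r by (auto simp: r0_def)
        ultimately show ?thesis
          using norm_triangle_ineq[of "deriv G' w - deriv G w" "deriv G w - a"] by simp
      qed
      have fd: "(G' has_field_derivative deriv G' w) (at w)" if "w \<in> ball 0 r" for w
        using holG' that r by (intro holomorphic_derivI[of _ "ball 0 (2*r)"]) auto
      have lin: "cmod (a * (w - v) - (G' w - G' v)) \<le> \<epsilon> * cmod (w - v)"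
        if "w \<in> ball 0 r" "v \<in> ball 0 r" for w v
      proof -
        have "cmod ((G' w - a * w) - (G' v - a * v)) \<le> \<epsilon> * cmod (w - v)"
        proof (rule field_differentiable_bound[of "ball 0 r" "\<lambda>w. G' w - a * w" "\<lambda>w. deriv G' w - a"])
          show "((\<lambda>w. G' w - a * w) has_field_derivative deriv G' z - a) (at z within ball 0 r)"
            if "z \<in> ball 0 r" for z
            using has_field_derivative_at_within[OF fd[OF that]]
            by (auto intro!: derivative_eq_intros)
          show "cmod (deriv G' z - a) \<le> \<epsilon>" if "z \<in> ball 0 r" for z using dG'[OF that] by simp
        qed (use that in auto)
        then show ?thesis by (simp add: norm_minus_commute algebra_simps)
      qed
      define T where "T = (\<lambda>w. w - (G' w - w) / (a - 1))"
      have an: "a - 1 \<noteq> 0" using a1 \<epsilon>(1) by auto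
      have cb2: "cball 0 (r/2) \<subseteq> ball (0::complex) r" using r by auto
      have T: "cmod (T w - T v) \<le> 1/3 * cmod (w - v)" if "w \<in> cball 0 (r/2)" "v \<in> cball 0 (r/2)" for w v
      proof -
        have t: "(a - 1) * T u = (a - 1) * u - (G' u - u)" for u
          using an by (simp add: T_def right_diff_distrib)
        have "T w - T v = ((a - 1) * T w - (a - 1) * T v) / (a - 1)"
          using an by (simp flip: right_diff_distrib)
        also have "(a - 1) * T w - (a - 1) * T v = a * (w - v) - (G' w - G' v)"
          unfolding t by (simp add: algebra_simps)
        finally have "T w - T v = (a * (w - v) - (G' w - G' v)) / (a - 1)" .
        then have "cmod (T w - T v) \<le> \<epsilon> * cmod (w - v) / cmod (a - 1)"
          using lin[OF subsetD[OF cb2 that(1)] subsetD[OF cb2 that(2)]]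
          by (auto simp: norm_divide intro!: divide_right_mono)
        also have "\<dots> \<le> \<epsilon> * cmod (w - v) / (3 * \<epsilon>)" using a1 \<epsilon>(1) an by (intro divide_left_mono mult_pos_pos) auto
        finally show ?thesis using \<epsilon>(1) by simp
      qed
      \<comment> \<open>T displaces the centre by at most r/6. With contraction ratio 1/3 the closed
        disc of radius r/2 is then mapped into itself.\<close>
      have "T 0 = - G' 0 / (a - 1)" by (simp add: T_def)
      then have "cmod (T 0) = cmod (G' 0) / cmod (a - 1)" by (simp add: norm_divide)
      also have "\<dots> \<le> (\<epsilon> * r / 2) / (3 * \<epsilon>)"
        using close r a1 \<epsilon>(1) G0(2) by (intro frac_le) (auto dest!: bspec[of _ _ 0])
      finally have T0: "cmod (T 0) \<le> r / 6" using \<epsilon>(1) by simp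
      have "\<exists>!x\<in>cball 0 (r/2). T x = x"
      proof (rule Banach_fix[where c = "1/3"])
        show "T ` cball 0 (r/2) \<subseteq> cball 0 (r/2)"
        proof (intro image_subsetI)
          fix w :: complex assume w: "w \<in> cball 0 (r/2)"
          have "cmod (T w) \<le> cmod (T w - T 0) + cmod (T 0)" using norm_triangle_ineq[of "T w - T 0" "T 0"] by simp
          also have "\<dots> \<le> 1/3 * cmod w + r / 6" using T[of w 0] w r T0 by simp
          also have "\<dots> \<le> r / 2" using w r by simp
          finally show "T w \<in> cball 0 (r/2)" by simp
        qed
        show "dist (T x) (T y) \<le> 1 / 3 * dist x y" if "x \<in> cball 0 (r / 2)" "y \<in> cball 0 (r / 2)" for x y
          using T[OF that] by (simp add: dist_norm)
      qed (use r in \<open>auto simp: complete_eq_closed\<close>)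
      then obtain w' where w': "w' \<in> cball 0 (r/2)" "T w' = w'" by blast
      then have fixw: "G' w' = w'" using an by (simp add: T_def)
      have w'r: "w' \<in> ball 0 r" using w' cb2 by blast
      show "\<exists>w'\<in>ball 0 r. G' w' = w' \<and> cmod (deriv G' w') > 1 \<and>
         (\<exists>\<mu>>1. \<forall>w\<in>ball 0 r. cmod (G' w - w') \<ge> \<mu> * cmod (w - w'))"
      proof (intro bexI[of _ w'] conjI exI[of _ "1 + 2 * \<epsilon>"] ballI)
        show "cmod (deriv G' w') > 1"
          using dG'[OF w'r] norm_triangle_ineq3[of "deriv G' w'" a] \<epsilon> by simp
        fix w :: complex assume "w \<in> ball 0 r"
        then have "cmod (a * (w - w') - (G' w - w')) \<le> \<epsilon> * cmod (w - w')" using lin[of w w'] w'r fixw by simp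
        moreover have "cmod (a * (w - w')) \<le> cmod (a * (w - w') - (G' w - w')) + cmod (G' w - w')"
          using norm_triangle_ineq[of "a * (w - w') - (G' w - w')" "G' w - w'"] by simp
        moreover have "cmod (a * (w - w')) = (1 + 3 * \<epsilon>) * cmod (w - w')" by (simp add: norm_mult \<epsilon>)
        ultimately show "(1 + 2 * \<epsilon>) * cmod (w - w') \<le> cmod (G' w - w')" by (simp add: algebra_simps)
      qed (use fixw w'r \<epsilon> in auto)
    qed
  qed
qed

text \<open>The second point need not belong to K, so this is more than uniform continuity on K. A
  Lebesgue number of a cover by balls on which the chart varies by less than \<eta>/2 provides
  \<delta>.\<close>

lemma cd_uniform:
  assumes "compact K" "K \<subseteq> - {antip p}" "\<eta> > 0"
  obtains \<delta> where "\<delta> > 0" "\<And>x y. x \<in> K \<Longrightarrow> dist x y < \<delta> \<Longrightarrow> y \<noteq> antip p \<and> cmod (cd p y - cd p x) < \<eta>"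
proof -
  have "\<exists>d>0. \<forall>y. dist x y < d \<longrightarrow> y \<noteq> antip p \<and> cmod (cd p y - cd p x) < \<eta> / 2" if "x \<in> K" for x
  proof -
    have x: "x \<noteq> antip p" using that assms(2) by auto
    obtain d where d: "d > 0" "\<And>y. dist y x < d \<Longrightarrow> dist (cd p y) (cd p x) < \<eta> / 2"
      using isCont_cd[OF x] assms(3) unfolding continuous_at_eps_delta by (metis half_gt_zero)
    show ?thesis
      by (intro exI[of _ "min d (dist x (antip p))"]) (use d x in \<open>auto simp: dist_norm dist_commute\<close>)
  qed
  then obtain d where d: "\<And>x. x \<in> K \<Longrightarrow> d x > 0"
    "\<And>x y. x \<in> K \<Longrightarrow> dist x y < d x \<Longrightarrow> y \<noteq> antip p \<and> cmod (cd p y - cd p x) < \<eta> / 2" by metis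
  have sub: "K \<subseteq> \<Union>((\<lambda>x. ball x (d x)) ` K)" using d(1) by (auto intro!: bexI)
  have op: "\<And>G. G \<in> (\<lambda>x. ball x (d x)) ` K \<Longrightarrow> open G" by auto
  obtain e where e: "e > 0" "\<And>x. x \<in> K \<Longrightarrow> \<exists>G\<in>(\<lambda>x. ball x (d x)) ` K. ball x e \<subseteq> G"
    using Heine_Borel_lemma[OF assms(1) sub op] by blast
  show ?thesis
  proof (rule that[OF e(1)])
    fix x y assume xy: "x \<in> K" "dist x y < e"
    obtain z where z: "z \<in> K" "ball x e \<subseteq> ball z (d z)" using e(2)[OF xy(1)] by auto
    have "x \<in> ball x e" "y \<in> ball x e" using xy e(1) by auto
    then have "x \<in> ball z (d z)" "y \<in> ball z (d z)" using z(2) by blast+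
    then have "dist z x < d z" "dist z y < d z" by auto
    then show "y \<noteq> antip p \<and> cmod (cd p y - cd p x) < \<eta>"
      using d(2)[OF z(1), of x] d(2)[OF z(1), of y]
        norm_triangle_ineq4[of "cd p y - cd p z" "cd p x - cd p z"] by auto
  qed
qed

text \<open>The last clause is what matters later: a whole g'-orbit inside the disc forces its
  starting point to be e', since chart distances from e' grow geometrically.\<close>

lemma repelling_perturb:
  assumes g: "hmap g" and rep: "repelling_fixed_point g e"
  obtains r0 where "r0 > 0"
    "\<And>r. 0 < r \<Longrightarrow> r \<le> r0 \<Longrightarrow> \<exists>\<eta>>0. \<forall>g'. hmap g' \<longrightarrow> (\<forall>x. dist (g' x) (g x) < \<eta>) \<longrightarrow>
      (\<exists>e'\<in>ic e ` ball 0 r. repelling_fixed_point g' e' \<and>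
         (\<forall>x. (\<forall>k. (g' ^^ k) x \<in> ic e ` ball 0 r) \<longrightarrow> x = e'))"
proof -
  have ge: "g e = e" "cmod (sphere_deriv g e) > 1" using rep by (auto simp: repelling_fixed_point_def)
  define G where "G = (\<lambda>w. cd e (g (ic e w)))"
  have hi: "holo_into UNIV (\<lambda>w. g (ic e w))" using g by (simp add: hmap_def)
  obtain R where R: "R > 0" "\<And>w. w \<in> ball 0 R \<Longrightarrow> g (ic e w) \<noteq> antip e" "G holomorphic_on ball 0 R"
    using holo_into_ball_chart[OF hi, of 0 e] ge by (auto simp: G_def)
  have "(G has_field_derivative sphere_deriv g e) (at 0)"
    using sphere_deriv_DERIV[OF g, of e] ge by (simp add: G_def)
  then have "cmod (deriv G 0) > 1" using ge by (simp add: DERIV_imp_deriv)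
  moreover have "G 0 = 0" using ge by (simp add: G_def)
  ultimately obtain r0 where r0: "r0 > 0" "2 * r0 \<le> R"
    "\<And>r. 0 < r \<Longrightarrow> r \<le> r0 \<Longrightarrow> \<exists>\<eta>>0. \<forall>G'. G' holomorphic_on ball 0 (2 * r) \<longrightarrow>
      (\<forall>w\<in>ball 0 (2 * r). cmod (G' w - G w) < \<eta>) \<longrightarrow>
      (\<exists>w'\<in>ball 0 r. G' w' = w' \<and> cmod (deriv G' w') > 1 \<and>
         (\<exists>\<mu>>1. \<forall>w\<in>ball 0 r. cmod (G' w - w') \<ge> \<mu> * cmod (w - w')))"
    using repelling_perturb_analytic[OF R(3,1)] by metis
  show ?thesis
  proof (rule that[of "r0/2"])
    show "r0 / 2 > 0" using r0 by simp
    fix r :: real assume r: "0 < r" "r \<le> r0 / 2"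
    obtain \<eta> where \<eta>: "\<eta> > 0" "\<And>G'. G' holomorphic_on ball 0 (2 * r) \<Longrightarrow>
      (\<forall>w\<in>ball 0 (2 * r). cmod (G' w - G w) < \<eta>) \<Longrightarrow>
      (\<exists>w'\<in>ball 0 r. G' w' = w' \<and> cmod (deriv G' w') > 1 \<and>
         (\<exists>\<mu>>1. \<forall>w\<in>ball 0 r. cmod (G' w - w') \<ge> \<mu> * cmod (w - w')))"
      using r0(3)[of r] r r0(1) by auto
    define K where "K = (\<lambda>w. g (ic e w)) ` cball 0 (2 * r)"
    have "compact K" unfolding K_def
      using hi by (intro compact_continuous_image) (auto simp: holo_into_def intro: continuous_on_subset)
    moreover have "cball 0 (2 * r) \<subseteq> ball (0::complex) R" using r r0 by auto
    then have "K \<subseteq> - {antip e}" unfolding K_def using R(2) by (intro image_subsetI) blast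
    ultimately obtain \<delta> where \<delta>: "\<delta> > 0"
      "\<And>x y. x \<in> K \<Longrightarrow> dist x y < \<delta> \<Longrightarrow> y \<noteq> antip e \<and> cmod (cd e y - cd e x) < \<eta>"
      using cd_uniform[of K e \<eta>] \<eta>(1) by metis
    show "\<exists>\<eta>>0. \<forall>g'. hmap g' \<longrightarrow> (\<forall>x. dist (g' x) (g x) < \<eta>) \<longrightarrow>
      (\<exists>e'\<in>ic e ` ball 0 r. repelling_fixed_point g' e' \<and>
         (\<forall>x. (\<forall>k. (g' ^^ k) x \<in> ic e ` ball 0 r) \<longrightarrow> x = e'))"
    proof (intro exI[of _ \<delta>] conjI allI impI)
      fix g' assume g': "hmap g'" and close: "\<forall>x. dist (g' x) (g x) < \<delta>"
      define G' where "G' = (\<lambda>w. cd e (g' (ic e w)))"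
      have near: "g' (ic e w) \<noteq> antip e" "cmod (G' w - G w) < \<eta>" if "w \<in> ball 0 (2 * r)" for w
        using \<delta>(2)[of "g (ic e w)" "g' (ic e w)"] close that
        by (auto simp: K_def G_def G'_def dist_commute)
      have hi': "holo_into UNIV (\<lambda>w. g' (ic e w))" using g' by (simp add: hmap_def)
      have "G' holomorphic_on ball 0 (2 * r)" unfolding G'_def
        by (rule holo_into_cd_holomorphic[OF hi']) (use near in auto)
      then obtain w' \<mu> where w': "w' \<in> ball 0 r" "G' w' = w'" "cmod (deriv G' w') > 1" "\<mu> > 1"
        "\<And>w. w \<in> ball 0 r \<Longrightarrow> cmod (G' w - w') \<ge> \<mu> * cmod (w - w')"
        using \<eta>(2)[of G'] near by metis
      have w2: "w' \<in> ball 0 (2 * r)" using w'(1) r by auto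
      have fixw: "g' (ic e w') = ic e w'"
        using w'(2) ic_cd[OF near(1)[OF w2]] by (simp add: G'_def)
      have "(G' has_field_derivative sphere_deriv g' (ic e w')) (at w')"
        using sphere_deriv_other_chart[OF g' fixw refl] by (simp add: G'_def)
      then have rep': "repelling_fixed_point g' (ic e w')"
        using w'(3) fixw by (simp add: repelling_fixed_point_def DERIV_imp_deriv)
      have leave: "x = ic e w'" if orb: "\<forall>k. (g' ^^ k) x \<in> ic e ` ball 0 r" for x
      proof -
        define W where "W = (\<lambda>k. cd e ((g' ^^ k) x))"
        have W: "W k \<in> ball 0 r" "(g' ^^ k) x = ic e (W k)" for k
          using orb[rule_format, of k] by (auto simp: W_def)
        have "W (Suc k) = G' (W k)" for k
          using W(2)[of k] by (simp add: W_def G'_def)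
        then have step: "cmod (W (Suc k) - w') \<ge> \<mu> * cmod (W k - w')" for k
          using w'(5)[OF W(1)[of k]] by simp
        have pow: "cmod (W k - w') \<ge> \<mu> ^ k * cmod (W 0 - w')" for k
        proof (induction k)
          case (Suc k)
          have "\<mu> ^ Suc k * cmod (W 0 - w') = \<mu> * (\<mu> ^ k * cmod (W 0 - w'))" by simp
          also have "\<dots> \<le> \<mu> * cmod (W k - w')" using Suc w'(4) by (intro mult_left_mono) auto
          finally show ?case using step[of k] by simp
        qed simp
        have bd: "cmod (W k - w') < 2 * r" for k
          using W(1)[of k] w'(1) norm_triangle_ineq4[of "W k" w'] by simp
        have "W 0 = w'"
        proof (rule ccontr)
          assume "W 0 \<noteq> w'"
          then have p: "cmod (W 0 - w') > 0" by simp
          obtain k where "2 * r / cmod (W 0 - w') < \<mu> ^ k" using real_arch_pow[OF w'(4)] by blast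
          then have "2 * r < \<mu> ^ k * cmod (W 0 - w')" using p by (simp add: field_simps)
          then show False using pow[of k] bd[of k] by simp
        qed
        then show ?thesis using W(2)[of 0] by simp
      qed
      show "\<exists>e'\<in>ic e ` ball 0 r. repelling_fixed_point g' e' \<and>
         (\<forall>x. (\<forall>k. (g' ^^ k) x \<in> ic e ` ball 0 r) \<longrightarrow> x = e')"
        using rep' leave w'(1) by (intro bexI[of _ "ic e w'"]) auto
    qed (rule \<delta>)
  qed
qed

section \<open>Stability under approximation of the generators\<close>

text \<open>\<open>stably S P\<close>: the property \<open>P\<close> holds for every set of maps that approximates a suitable
  finite part of \<open>S\<close>; these \<open>P\<close> form a filter.\<close>

definition stably :: "'a::metric_space set \<Rightarrow> ('a set \<Rightarrow> bool) \<Rightarrow> bool" where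
  "stably S P \<longleftrightarrow> (\<exists>F d. finite F \<and> F \<subseteq> S \<and> d > 0 \<and>
     (\<forall>S'. (\<forall>f\<in>F. \<exists>f'\<in>S'. dist f f' < d) \<longrightarrow> P S'))"

lemma stably_mono: "stably S P \<Longrightarrow> (\<And>S'. P S' \<Longrightarrow> Q S') \<Longrightarrow> stably S Q"
  unfolding stably_def by meson

lemma stably_True: "stably S (\<lambda>S'. True)"
  unfolding stably_def by (intro exI[of _ "{}"] exI[of _ 1]) auto

lemma stably_conj:
  assumes "stably S P" "stably S Q" shows "stably S (\<lambda>S'. P S' \<and> Q S')"
proof -
  obtain F d where F: "finite F" "F \<subseteq> S" "d > 0" "\<And>S'. (\<forall>f\<in>F. \<exists>f'\<in>S'. dist f f' < d) \<Longrightarrow> P S'"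
    using assms(1) unfolding stably_def by blast
  obtain F' d' where F': "finite F'" "F' \<subseteq> S" "d' > 0" "\<And>S'. (\<forall>f\<in>F'. \<exists>f'\<in>S'. dist f f' < d') \<Longrightarrow> Q S'"
    using assms(2) unfolding stably_def by blast
  show ?thesis unfolding stably_def
  proof (intro exI[of _ "F \<union> F'"] exI[of _ "min d d'"] conjI allI impI)
    fix S' assume H: "\<forall>f\<in>F \<union> F'. \<exists>f'\<in>S'. dist f f' < min d d'"
    show "P S'" by (rule F(4)) (use H in auto)
    show "Q S'" by (rule F'(4)) (use H in auto)
  qed (use F F' in auto)
qed

lemma stably_ball:
  assumes "finite I" "\<And>i. i \<in> I \<Longrightarrow> stably S (P i)"
  shows "stably S (\<lambda>S'. \<forall>i\<in>I. P i S')"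
  using assms
proof (induction I rule: finite_induct)
  case (insert i I)
  then have "stably S (\<lambda>S'. P i S' \<and> (\<forall>i\<in>I. P i S'))" by (intro stably_conj) auto
  then show ?case by simp
qed (simp add: stably_True)

lemma stably_semigroup:
  assumes "g \<in> semigroup_generated S" "e > 0"
  shows "stably S (\<lambda>S'. \<exists>g'\<in>semigroup_generated S'. \<forall>x. dist (g' x) (g x) < e)"
proof -
  obtain gs where gs: "g = fold apply_rat gs" "gs \<noteq> []" "set gs \<subseteq> S"
    using assms(1) unfolding semigroup_generated_eq by blast
  obtain d where d: "d > 0" "\<And>gs' x. list_all2 (\<lambda>g g'. dist g g' < d) gs gs' \<Longrightarrow>
      dist (fold apply_rat gs' x) (fold apply_rat gs x) < e"
    using fold_close[OF assms(2), of gs] by blast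
  show ?thesis unfolding stably_def
  proof (intro exI[of _ "set gs"] exI[of _ d] conjI allI impI)
    fix S' assume "\<forall>f\<in>set gs. \<exists>f'\<in>S'. dist f f' < d"
    then obtain k where k: "\<And>f. f \<in> set gs \<Longrightarrow> k f \<in> S' \<and> dist f (k f) < d" by metis
    have "list_all2 (\<lambda>g g'. dist g g' < d) gs (map k gs)"
      using k by (simp add: list_all2_map2 list_all2_same)
    moreover have "fold apply_rat (map k gs) \<in> semigroup_generated S'"
      unfolding semigroup_generated_eq using k gs(2) by (intro CollectI exI[of _ "map k gs"]) auto
    ultimately show "\<exists>g'\<in>semigroup_generated S'. \<forall>x. dist (g' x) (g x) < e"
      using d(2) gs(1) by blast
  qed (use gs d in auto)
qed

text \<open>For S the support of \<tau> and V the larger open set of weak mean stability this is the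
  exceptional set of the definition. The identity need not belong to the semigroup, so a priori x
  itself may lie in V.\<close>

definition never_enters :: "rational_map set \<Rightarrow> riemann_sphere set \<Rightarrow> riemann_sphere set" where
  "never_enters S V = {x. \<forall>g\<in>semigroup_generated S. g x \<notin> V}"

text \<open>A pointwise substitute for the condition on minimal sets: in a finite invariant set
  every orbit contains a minimal set, and the orbit of a point of a minimal set stays inside
  it.\<close>

definition ev_repelling :: "rational_map set \<Rightarrow> riemann_sphere \<Rightarrow> bool" where
  "ev_repelling S x \<longleftrightarrow> (\<exists>h\<in>semigroup_generated S. \<exists>g\<in>semigroup_generated S. repelling_fixed_point g (h x))"

lemma never_enters_invariant:
  "x \<in> never_enters S V \<Longrightarrow> g \<in> semigroup_generated S \<Longrightarrow> g x \<in> never_enters S V"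
  unfolding never_enters_def using semigroup_generated.comp by fastforce

text \<open>Each point outside N is carried into a member of the cover with margin 2e by a single
  element. Neighbourhoods that use up one e cover the compact complement of N finitely often; the
  other e absorbs the perturbation of these finitely many elements.\<close>

lemma stably_enters:
  assumes "\<And>U. U \<in> \<U> \<Longrightarrow> open U" "open N" "never_enters S (\<Union>\<U>) \<subseteq> N"
  obtains \<U>' where "finite \<U>'" "\<U>' \<subseteq> \<U>" "stably S (\<lambda>S'. never_enters S' (\<Union>\<U>') \<subseteq> N)"
proof -
  have "\<exists>g\<in>semigroup_generated S. \<exists>U\<in>\<U>. \<exists>e>0. ball (g x) (2 * e) \<subseteq> U" if x: "x \<in> - N" for x
  proof -
    obtain g U where gU: "g \<in> semigroup_generated S" "U \<in> \<U>" "g x \<in> U"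
      using assms(3) x unfolding never_enters_def by blast
    then obtain e where "e > 0" "ball (g x) e \<subseteq> U" using assms(1) open_contains_ball by metis
    then show ?thesis using gU by (intro bexI[of _ g] bexI[of _ U] exI[of _ "e/2"]) auto
  qed
  then obtain gg UU ee where c: "\<And>x. x \<in> - N \<Longrightarrow> gg x \<in> semigroup_generated S"
    "\<And>x. x \<in> - N \<Longrightarrow> UU x \<in> \<U>" "\<And>x. x \<in> - N \<Longrightarrow> ee x > 0"
    "\<And>x. x \<in> - N \<Longrightarrow> ball (gg x x) (2 * ee x) \<subseteq> UU x"
    by metis
  have "compact (- N)" using assms(2) by (intro closed_imp_compact_sphere) auto
  moreover have "open (gg x -` ball (gg x x) (ee x))" if "x \<in> - N" for x
    using c(1)[OF that] by (intro open_vimage hmap_continuous_on hmap_semigroup) auto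
  moreover have "- N \<subseteq> (\<Union>x\<in>- N. gg x -` ball (gg x x) (ee x))" using c(3) by force
  ultimately obtain I where I: "I \<subseteq> - N" "finite I" "- N \<subseteq> (\<Union>x\<in>I. gg x -` ball (gg x x) (ee x))"
    by (rule compactE_image)
  have "stably S (\<lambda>S'. \<forall>x\<in>I. \<exists>g'\<in>semigroup_generated S'. \<forall>y. dist (g' y) (gg x y) < ee x)"
    by (intro stably_ball I stably_semigroup) (use c I in auto)
  then have "stably S (\<lambda>S'. never_enters S' (\<Union>(UU ` I)) \<subseteq> N)"
  proof (rule stably_mono)
    fix S' assume S': "\<forall>x\<in>I. \<exists>g'\<in>semigroup_generated S'. \<forall>y. dist (g' y) (gg x y) < ee x"
    show "never_enters S' (\<Union>(UU ` I)) \<subseteq> N"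
    proof (rule ccontr)
      assume "\<not> ?thesis"
      then obtain y where y: "y \<in> never_enters S' (\<Union>(UU ` I))" "y \<in> - N" by blast
      then obtain x where x: "x \<in> I" "dist (gg x x) (gg x y) < ee x" using I(3) by auto
      obtain g' where g': "g' \<in> semigroup_generated S'" "\<And>y. dist (g' y) (gg x y) < ee x" using S' x by blast
      have "dist (gg x x) (g' y) < 2 * ee x"
        using dist_triangle[of "gg x x" "g' y" "gg x y"] x(2) g'(2)[of y] by (simp add: dist_commute)
      moreover have "x \<in> - N" using x(1) I(1) by blast
      ultimately have "g' y \<in> UU x" using c(4) by (meson mem_ball subsetD)
      then show False using y(1) g'(1) x(1) unfolding never_enters_def by blast
    qed
  qed
  then show ?thesis using that[of "UU ` I"] I c(2) by blast
qed


lemma finite_separation: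
  fixes D :: "'a::metric_space set"
  assumes "finite D"
  obtains s where "s > 0" "\<And>x y. x \<in> D \<Longrightarrow> y \<in> D \<Longrightarrow> dist x y < s \<Longrightarrow> x = y"
proof -
  have "\<forall>a\<in>D. \<exists>d>0. \<forall>x\<in>D. x \<noteq> a \<longrightarrow> d \<le> dist a x" using finite_set_avoid[OF assms] by blast
  then obtain d where d: "\<And>a. a \<in> D \<Longrightarrow> d a > 0" "\<And>a x. a \<in> D \<Longrightarrow> x \<in> D \<Longrightarrow> x \<noteq> a \<Longrightarrow> d a \<le> dist a x"
    by metis
  show ?thesis
  proof (rule that[of "Min (insert 1 (d ` D))"])
    show "Min (insert 1 (d ` D)) > 0" using assms d(1) by simp
    fix x y assume xy: "x \<in> D" "y \<in> D" "dist x y < Min (insert 1 (d ` D))"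
    have "Min (insert 1 (d ` D)) \<le> d x" using assms xy by (intro Min_le) auto
    then show "x = y" using d(2)[OF xy(1,2)] xy(3) by force
  qed
qed

lemma finite_semigroup_fiber: "g \<in> semigroup_generated S \<Longrightarrow> finite {x. g x = y}"
  unfolding semigroup_generated_eq using finite_fold_fiber[of "{y}"] by auto

lemma small_chart_disc:
  assumes "continuous_on UNIV g" "e > 0" "e' > 0"
  obtains r where "r > 0" "ic d ` ball 0 r \<subseteq> ball d e" "\<And>x. x \<in> ic d ` ball 0 r \<Longrightarrow> dist (g d) (g x) < e'"
proof -
  have "open (ball d e \<inter> g -` ball (g d) e')" using assms by (intro open_Int open_vimage) auto
  then obtain r where "r > 0" "ic d ` ball 0 r \<subseteq> ball d e \<inter> g -` ball (g d) e'"
    using obtain_ic_ball[of "ball d e \<inter> g -` ball (g d) e'" d] assms by auto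
  then have r: "r > 0" "ic d ` ball 0 r \<subseteq> ball d e" "ic d ` ball 0 r \<subseteq> g -` ball (g d) e'" by auto
  have "dist (g d) (g x) < e'" if "x \<in> ic d ` ball 0 r" for x using subsetD[OF r(3) that] by simp
  with r(1,2) show ?thesis by (rule that)
qed

text \<open>N is a union of small chart discs around D. A perturbed \<open>hh\<close> sends a point
  of E near a repelling point of D, and a perturbed \<open>gg\<close> then keeps it near; as E is
  invariant and contained in N, near means inside the disc of that point. An orbit that never leaves
  such a disc sits on the perturbed repelling fixed point, and finiteness of E follows from
  finiteness of fibres.\<close>

lemma repelling_neighbourhood:
  assumes D: "finite D" "\<And>g x. g \<in> semigroup_generated S \<Longrightarrow> x \<in> D \<Longrightarrow> g x \<in> D"
    "\<And>x. x \<in> D \<Longrightarrow> ev_repelling S x"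
  obtains N where "open N" "D \<subseteq> N"
    "stably S (\<lambda>S'. \<forall>E\<subseteq>N. (\<forall>g\<in>semigroup_generated S'. \<forall>x\<in>E. g x \<in> E) \<longrightarrow> finite E \<and> (\<forall>x\<in>E. ev_repelling S' x))"
proof -
  let ?G = "semigroup_generated S"
  define R where "R = {e\<in>D. \<exists>g\<in>?G. repelling_fixed_point g e}"
  have "\<forall>e\<in>R. \<exists>g\<in>?G. repelling_fixed_point g e" by (auto simp: R_def)
  then obtain gg where gg: "\<And>e. e \<in> R \<Longrightarrow> gg e \<in> ?G" "\<And>e. e \<in> R \<Longrightarrow> repelling_fixed_point (gg e) e" by metis
  have "\<forall>d\<in>D. \<exists>h\<in>?G. h d \<in> R"
  proof
    fix d assume d: "d \<in> D"
    then obtain h g where hg: "h \<in> ?G" "g \<in> ?G" "repelling_fixed_point g (h d)"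
      using D(3) unfolding ev_repelling_def by blast
    have "h d \<in> R" using D(2)[OF hg(1) d] hg(2,3) by (auto simp: R_def)
    then show "\<exists>h\<in>?G. h d \<in> R" using hg(1) by (rule bexI)
  qed
  then obtain hh where hh: "\<And>d. d \<in> D \<Longrightarrow> hh d \<in> ?G" "\<And>d. d \<in> D \<Longrightarrow> hh d d \<in> R" by metis
  have RD: "R \<subseteq> D" by (auto simp: R_def)
  obtain s0 where s0: "s0 > 0" "\<And>x y. x \<in> D \<Longrightarrow> y \<in> D \<Longrightarrow> dist x y < s0 \<Longrightarrow> x = y"
    using finite_separation[OF D(1)] by blast
  \<comment> \<open>A point within 2s of e that lies in the disc of some d, of radius at most s,
    puts d and e at distance less than 3s; hence d = e.\<close>
  define s where "s = s0 / 3"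
  have s: "s > 0" "\<And>x y. x \<in> D \<Longrightarrow> y \<in> D \<Longrightarrow> dist x y < 3 * s \<Longrightarrow> x = y" using s0 by (auto simp: s_def)
  define Q where "Q = (\<lambda>d r \<eta>. 0 < r \<and> 0 < \<eta> \<and> ic d ` ball 0 r \<subseteq> ball d s \<and> (\<forall>x\<in>ic d ` ball 0 r. dist (hh d d) (hh d x) < s) \<and>
     (d \<in> R \<longrightarrow> (\<forall>x\<in>ic d ` ball 0 r. dist d (gg d x) < s) \<and>
       (\<forall>g'. hmap g' \<longrightarrow> (\<forall>x. dist (g' x) (gg d x) < \<eta>) \<longrightarrow>
      (\<exists>e'\<in>ic d ` ball 0 r. repelling_fixed_point g' e' \<and>
         (\<forall>x. (\<forall>k. (g' ^^ k) x \<in> ic d ` ball 0 r) \<longrightarrow> x = e')))))"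
  have "\<exists>r \<eta>. Q d r \<eta>" if d: "d \<in> D" for d
  proof -
    have "continuous_on UNIV (hh d)" using hh(1)[OF d] hmap_semigroup hmap_continuous_on by blast
    then obtain r1 where r1: "r1 > 0" "ic d ` ball 0 r1 \<subseteq> ball d s" "\<And>x. x \<in> ic d ` ball 0 r1 \<Longrightarrow> dist (hh d d) (hh d x) < s"
      using small_chart_disc[of "hh d" s s] s(1) by metis
    show ?thesis
    proof (cases "d \<in> R")
      case False
      then show ?thesis using r1 unfolding Q_def by (intro exI[of _ r1] exI[of _ 1]) auto
    next
      case True
      have g: "hmap (gg d)" using gg(1)[OF True] hmap_semigroup by blast
      have gd: "gg d d = d" using gg(2)[OF True] by (simp add: repelling_fixed_point_def)
      obtain r2 where r2: "r2 > 0" "\<And>x. x \<in> ic d ` ball 0 r2 \<Longrightarrow> dist (gg d d) (gg d x) < s"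
        using small_chart_disc[OF hmap_continuous_on[OF g] s(1) s(1)] by metis
      obtain r0 where r0: "r0 > 0" "\<And>r. 0 < r \<Longrightarrow> r \<le> r0 \<Longrightarrow> \<exists>\<eta>>0. \<forall>g'. hmap g' \<longrightarrow> (\<forall>x. dist (g' x) (gg d x) < \<eta>) \<longrightarrow>
      (\<exists>e'\<in>ic d ` ball 0 r. repelling_fixed_point g' e' \<and>
         (\<forall>x. (\<forall>k. (g' ^^ k) x \<in> ic d ` ball 0 r) \<longrightarrow> x = e'))"
        using repelling_perturb[OF g gg(2)[OF True]] by blast
      define r where "r = min r0 (min r1 r2)"
      have r: "r > 0" "r \<le> r0" using r0 r1 r2 by (auto simp: r_def)
      have sub: "ic d ` ball 0 r \<subseteq> ic d ` ball 0 r1" "ic d ` ball 0 r \<subseteq> ic d ` ball 0 r2"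
        by (auto simp: r_def intro!: imageI)
      obtain \<eta> where \<eta>: "\<eta> > 0" "\<forall>g'. hmap g' \<longrightarrow> (\<forall>x. dist (g' x) (gg d x) < \<eta>) \<longrightarrow>
      (\<exists>e'\<in>ic d ` ball 0 r. repelling_fixed_point g' e' \<and>
         (\<forall>x. (\<forall>k. (g' ^^ k) x \<in> ic d ` ball 0 r) \<longrightarrow> x = e'))" using r0(2)[OF r] by blast
      have "ic d ` ball 0 r \<subseteq> ball d s" using r1(2) sub(1) by blast
      moreover have "\<forall>x\<in>ic d ` ball 0 r. dist (hh d d) (hh d x) < s" using r1(3) sub(1) by blast
      moreover have "\<forall>x\<in>ic d ` ball 0 r. dist d (gg d x) < s" using r2(2) sub(2) gd by auto
      ultimately have "Q d r \<eta>" unfolding Q_def using r(1) \<eta> by (intro conjI impI) assumption+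
      then show ?thesis by (intro exI)
    qed
  qed
  then obtain r \<eta> where Q: "\<And>d. d \<in> D \<Longrightarrow> Q d (r d) (\<eta> d)" by metis
  have r: "d \<in> D \<Longrightarrow> r d > 0" "d \<in> D \<Longrightarrow> \<eta> d > 0"
    "d \<in> D \<Longrightarrow> ic d ` ball 0 (r d) \<subseteq> ball d s"
    "d \<in> D \<Longrightarrow> x \<in> ic d ` ball 0 (r d) \<Longrightarrow> dist (hh d d) (hh d x) < s"
    "d \<in> R \<Longrightarrow> x \<in> ic d ` ball 0 (r d) \<Longrightarrow> dist d (gg d x) < s"
    "d \<in> R \<Longrightarrow> hmap g' \<Longrightarrow> (\<forall>x. dist (g' x) (gg d x) < \<eta> d) \<Longrightarrow>
      (\<exists>e'\<in>ic d ` ball 0 (r d). repelling_fixed_point g' e' \<and>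
         (\<forall>x. (\<forall>k. (g' ^^ k) x \<in> ic d ` ball 0 (r d)) \<longrightarrow> x = e'))"
    for d x g'
  proof -
    note QD = Q[of d, unfolded Q_def]
    show "r d > 0" "\<eta> d > 0" "ic d ` ball 0 (r d) \<subseteq> ball d s" if "d \<in> D"
      using QD[OF that] by simp_all
    show "dist (hh d d) (hh d x) < s" if "d \<in> D" "x \<in> ic d ` ball 0 (r d)"
      using QD[OF that(1)] that(2) by blast
    assume dR: "d \<in> R"
    then have dD: "d \<in> D" using RD by blast
    note QR = QD[OF dD, THEN conjunct2, THEN conjunct2, THEN conjunct2, THEN conjunct2, THEN mp, OF dR]
    show "dist d (gg d x) < s" if "x \<in> ic d ` ball 0 (r d)"
      using bspec[OF conjunct1[OF QR] that] .
    show "\<exists>e'\<in>ic d ` ball 0 (r d). repelling_fixed_point g' e' \<and>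
         (\<forall>x. (\<forall>k. (g' ^^ k) x \<in> ic d ` ball 0 (r d)) \<longrightarrow> x = e')"
      if "hmap g'" "\<forall>x. dist (g' x) (gg d x) < \<eta> d"
      using conjunct2[OF QR, THEN spec, THEN mp, THEN mp, OF that] .
  qed
  let ?N = "\<lambda>d. ic d ` ball 0 (r d)"
  define N where "N = (\<Union>d\<in>D. ?N d)"
  show ?thesis
  proof (rule that)
    show "open N" unfolding N_def by (intro open_UN ballI open_ic_image) auto
    show "D \<subseteq> N"
    proof
      fix d assume d: "d \<in> D"
      have "d \<in> ?N d" using r(1)[OF d] by (intro image_eqI[of _ _ 0]) auto
      then show "d \<in> N" using d by (auto simp: N_def)
    qed
    have 1: "stably S (\<lambda>S'. \<forall>d\<in>D. \<exists>h'\<in>semigroup_generated S'. \<forall>x. dist (h' x) (hh d x) < s)"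
      by (intro stably_ball D(1) stably_semigroup hh s)
    have 2: "stably S (\<lambda>S'. \<forall>d\<in>R. \<exists>g'\<in>semigroup_generated S'. \<forall>x. dist (g' x) (gg d x) < min s (\<eta> d))"
      by (intro stably_ball finite_subset[OF RD D(1)] stably_semigroup gg) (use r(2) s RD in auto)
    show "stably S (\<lambda>S'. \<forall>E\<subseteq>N. (\<forall>g\<in>semigroup_generated S'. \<forall>x\<in>E. g x \<in> E) \<longrightarrow> finite E \<and> (\<forall>x\<in>E. ev_repelling S' x))"
    proof (rule stably_mono[OF stably_conj[OF 1 2]], intro allI impI)
      fix S' E
      let ?G' = "semigroup_generated S'"
      assume A: "(\<forall>d\<in>D. \<exists>h'\<in>?G'. \<forall>x. dist (h' x) (hh d x) < s) \<and>
          (\<forall>d\<in>R. \<exists>g'\<in>?G'. \<forall>x. dist (g' x) (gg d x) < min s (\<eta> d))"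
        and E: "E \<subseteq> N" "\<forall>g\<in>?G'. \<forall>x\<in>E. g x \<in> E"
      obtain h' where h': "\<And>d. d \<in> D \<Longrightarrow> h' d \<in> ?G'" "\<And>d x. d \<in> D \<Longrightarrow> dist (h' d x) (hh d x) < s"
        using A by metis
      obtain g' where g': "\<And>d. d \<in> R \<Longrightarrow> g' d \<in> ?G'" "\<And>d x. d \<in> R \<Longrightarrow> dist (g' d x) (gg d x) < min s (\<eta> d)"
        using A by metis
      have "\<exists>e'\<in>?N d. repelling_fixed_point (g' d) e' \<and> (\<forall>x. (\<forall>k. (g' d ^^ k) x \<in> ?N d) \<longrightarrow> x = e')"
        if "d \<in> R" for d
        using g'[OF that] hmap_semigroup by (intro r(6)[OF that]) auto
      then obtain e' where e': "\<And>d. d \<in> R \<Longrightarrow> repelling_fixed_point (g' d) (e' d)"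
        "\<And>d x. d \<in> R \<Longrightarrow> (\<And>k. (g' d ^^ k) x \<in> ?N d) \<Longrightarrow> x = e' d" by metis
      have near: "y \<in> ?N e" if y: "y \<in> E" "e \<in> D" "dist e y < 2 * s" for y e
      proof -
        obtain d where d: "d \<in> D" "y \<in> ?N d" using y(1) E(1) by (auto simp: N_def)
        have "dist d y < s" using r(3)[OF d(1)] d(2) by auto
        then have "dist d e < 3 * s" using dist_triangle2[of d e y] y(3) by simp
        then show ?thesis using s(2)[OF d(1) y(2)] d by simp
      qed
      have main: "h' d x = e' (hh d d)" if x: "x \<in> E" "d \<in> D" "x \<in> ?N d" for x d
      proof -
        let ?e = "hh d d"
        have eR: "?e \<in> R" using hh(2) x(2) by blast
        have "dist ?e (h' d x) < 2 * s"
          using dist_triangle[of ?e "h' d x" "hh d x"] r(4)[OF x(2,3)] h'(2)[OF x(2), of x] by (simp add: dist_commute)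
        moreover have hE: "h' d x \<in> E" using E(2) h'(1)[OF x(2)] x(1) by blast
        ultimately have start: "h' d x \<in> ?N ?e" using near eR RD by blast
        \<comment> \<open>Invariance of E keeps the orbit in N, and proximity to \<open>?e\<close>
          selects the disc in which it lies.\<close>
        have "(g' ?e ^^ k) (h' d x) \<in> E \<and> (g' ?e ^^ k) (h' d x) \<in> ?N ?e" for k
        proof (induction k)
          case 0
          then show ?case using hE start by simp
        next
          case (Suc k)
          let ?y = "(g' ?e ^^ k) (h' d x)"
          have "g' ?e ?y \<in> E" using E(2) g'(1)[OF eR] Suc by blast
          moreover have "dist ?e (g' ?e ?y) < 2 * s"
            using dist_triangle[of ?e "g' ?e ?y" "gg ?e ?y"] r(5)[OF eR, of ?y] g'(2)[OF eR, of ?y] Suc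
            by (simp add: dist_commute)
          ultimately show ?case using near eR RD by auto
        qed
        then show ?thesis using e'(2)[OF eR] by blast
      qed
      have cover: "\<exists>d\<in>D. x \<in> ?N d \<and> h' d x = e' (hh d d)" if "x \<in> E" for x
        using that E(1) main unfolding N_def by blast
      show "finite E \<and> (\<forall>x\<in>E. ev_repelling S' x)"
      proof (intro conjI ballI)
        have "E \<subseteq> (\<Union>d\<in>D. {x. h' d x = e' (hh d d)})" using cover by blast
        moreover have "finite (\<Union>d\<in>D. {x. h' d x = e' (hh d d)})"
          using D(1) h'(1) finite_semigroup_fiber by blast
        ultimately show "finite E" by (rule finite_subset)
        fix x assume "x \<in> E"
        then obtain d where d: "d \<in> D" "h' d x = e' (hh d d)" using cover by blast
        then show "ev_repelling S' x"
          unfolding ev_repelling_def using h'(1) g'(1) hh(2) e'(1) by metis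
      qed
    qed
  qed
qed

text \<open>A finite subfamily is extracted because traps will be united finitely. Enlarging V only
  shrinks the exceptional set, so the conclusion can cover all larger V, and traps may still be
  added.\<close>

lemma stably_never_enters:
  assumes "\<And>U. U \<in> \<U> \<Longrightarrow> open U" "finite (never_enters S (\<Union>\<U>))"
    "\<And>d. d \<in> never_enters S (\<Union>\<U>) \<Longrightarrow> ev_repelling S d"
  obtains \<U>' where "finite \<U>'" "\<U>' \<subseteq> \<U>"
    "stably S (\<lambda>S'. \<forall>V. \<Union>\<U>' \<subseteq> V \<longrightarrow> finite (never_enters S' V) \<and> (\<forall>d\<in>never_enters S' V. ev_repelling S' d))"
proof -
  have inv: "g x \<in> never_enters S (\<Union>\<U>)" if "g \<in> semigroup_generated S" "x \<in> never_enters S (\<Union>\<U>)" for g x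
    by (rule never_enters_invariant[OF that(2,1)])
  obtain N where N: "open N" "never_enters S (\<Union>\<U>) \<subseteq> N"
    "stably S (\<lambda>S'. \<forall>E\<subseteq>N. (\<forall>g\<in>semigroup_generated S'. \<forall>x\<in>E. g x \<in> E) \<longrightarrow> finite E \<and> (\<forall>x\<in>E. ev_repelling S' x))"
  proof (rule repelling_neighbourhood[of "never_enters S (\<Union>\<U>)" S])
    show "finite (never_enters S (\<Union>\<U>))" by (rule assms(2))
    show "g x \<in> never_enters S (\<Union>\<U>)"
      if "g \<in> semigroup_generated S" "x \<in> never_enters S (\<Union>\<U>)" for g x by (rule inv[OF that])
    show "ev_repelling S x" if "x \<in> never_enters S (\<Union>\<U>)" for x by (rule assms(3)[OF that])
  qed (rule that)
  obtain \<U>' where U: "finite \<U>'" "\<U>' \<subseteq> \<U>" "stably S (\<lambda>S'. never_enters S' (\<Union>\<U>') \<subseteq> N)"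
    by (rule stably_enters[OF assms(1) N(1,2)])
  show ?thesis
  proof (rule that[OF U(1,2)], rule stably_mono[OF stably_conj[OF U(3) N(3)]], intro allI impI)
    fix S' V
    assume A: "never_enters S' (\<Union>\<U>') \<subseteq> N \<and> (\<forall>E\<subseteq>N. (\<forall>g\<in>semigroup_generated S'. \<forall>x\<in>E. g x \<in> E) \<longrightarrow> finite E \<and> (\<forall>x\<in>E. ev_repelling S' x))"
      and V: "\<Union>\<U>' \<subseteq> V"
    have "never_enters S' V \<subseteq> never_enters S' (\<Union>\<U>')" using V by (auto simp: never_enters_def)
    then have sub: "never_enters S' V \<subseteq> N" using A by blast
    have inv: "\<forall>g\<in>semigroup_generated S'. \<forall>x\<in>never_enters S' V. g x \<in> never_enters S' V"
      using never_enters_invariant[of _ S' V] by simp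
    show "finite (never_enters S' V) \<and> (\<forall>d\<in>never_enters S' V. ev_repelling S' d)"
      using conjunct2[OF A] sub inv by simp
  qed
qed

section \<open>Weak mean stability as a property of the support\<close>

text \<open>K takes the place of the closure of the smaller open set. No number of omitted points is
  prescribed, so traps are closed under finite unions.\<close>

definition traps :: "rational_map set \<Rightarrow> nat \<Rightarrow> riemann_sphere set \<Rightarrow> bool" where
  "traps S n V \<longleftrightarrow> n \<ge> 1 \<and> open V \<and> (\<exists>K. compact K \<and> K \<subseteq> V \<and>
     (\<forall>gs x. length gs = n \<longrightarrow> set gs \<subseteq> S \<longrightarrow> x \<in> V \<longrightarrow> fold apply_rat gs x \<in> K))"

text \<open>One omitted point is enough here because V can be shrunk towards its compact target.
  Both directions of the comparison with weak mean stability are proved below.\<close>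

definition wms :: "rational_map set \<Rightarrow> bool" where
  "wms S \<longleftrightarrow> (\<exists>n V. traps S n V \<and> V \<noteq> {} \<and> V \<noteq> UNIV \<and> finite (never_enters S V) \<and>
     (\<forall>d\<in>never_enters S V. ev_repelling S d))"

lemma open_thicken: "open (thicken d A)"
  by (auto simp: thicken_eq)

lemma subset_thicken: "d > 0 \<Longrightarrow> A \<subseteq> thicken d A"
  unfolding thicken_def by force

lemma closure_thicken_subset:
  assumes "d > 0" shows "closure (thicken d A) \<subseteq> thicken (2 * d) A"
proof
  fix y assume "y \<in> closure (thicken d A)"
  then obtain x where x: "x \<in> thicken d A" "dist x y < d" using assms unfolding closure_approachable by blast
  then obtain a where "a \<in> A" "dist a x < d" by (auto simp: thicken_def)
  then show "y \<in> thicken (2 * d) A"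
    using x(2) dist_triangle[of a y x] unfolding thicken_def by force
qed

text \<open>By continuity the words also map the closure of V into K. That closure is compact, so
  the tube lemma applies, with a closed neighbourhood of K inside V as new target.\<close>

lemma traps_thicken:
  assumes "compact S" "traps S n V"
  obtains d where "d > 0" "traps (thicken d S) n V"
proof -
  obtain K where n: "n \<ge> 1" "open V" and K: "compact K" "K \<subseteq> V"
    "\<And>gs x. length gs = n \<Longrightarrow> set gs \<subseteq> S \<Longrightarrow> x \<in> V \<Longrightarrow> fold apply_rat gs x \<in> K"
    using assms(2) unfolding traps_def by blast
  obtain e where e: "e > 0" "thicken e K \<subseteq> V" using compact_thicken_subset[OF K(1) n(2) K(2)] .
  have "fold apply_rat gs x \<in> thicken (e/2) K" if "length gs = n" "set gs \<subseteq> S" "x \<in> closure V" for gs x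
  proof -
    have "fold apply_rat gs ` closure V \<subseteq> K"
    proof (rule image_closure_subset)
      show "continuous_on (closure V) (fold apply_rat gs)" by (rule hmap_continuous_on[OF hmap_fold])
      show "closed K" using K(1) compact_imp_closed by blast
      show "fold apply_rat gs ` V \<subseteq> K" using K(3) that by blast
    qed
    then show ?thesis using that(3) subset_thicken[of "e/2" K] e(1) by auto
  qed
  from words_thicken[OF assms(1) closed_imp_compact_sphere[OF closed_closure] open_thicken this]
  obtain d where d: "d > 0" "\<And>gs x. length gs = n \<Longrightarrow> set gs \<subseteq> thicken d S \<Longrightarrow> x \<in> thicken d (closure V)
    \<Longrightarrow> fold apply_rat gs x \<in> thicken (e/2) K" by blast
  have "traps (thicken d S) n V" unfolding traps_def
  proof (intro conjI exI[of _ "closure (thicken (e/2) K)"] allI impI)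
    show "closure (thicken (e/2) K) \<subseteq> V" using closure_thicken_subset[of "e/2" K] e by auto
    show "fold apply_rat gs x \<in> closure (thicken (e / 2) K)"
      if "length gs = n" "set gs \<subseteq> thicken d S" "x \<in> V" for gs x
      using d(2)[OF that(1,2), of x] that(3) closure_subset subset_thicken[OF d(1), of "closure V"] by blast
  qed (use n closed_imp_compact_sphere in auto)
  then show ?thesis using that d(1) by blast
qed

text \<open>The two inclusions play separate roles: the first preserves the trap, the second
  supplies approximants of the finitely many maps that control the exceptional set. Together they
  describe a Hausdorff neighbourhood of S.\<close>

lemma wms_thicken:
  assumes "compact S" "wms S"
  obtains d where "d > 0" "\<And>S'. S' \<subseteq> thicken d S \<Longrightarrow> S \<subseteq> thicken d S' \<Longrightarrow> wms S'"
proof -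
  obtain n V where V: "traps S n V" "V \<noteq> {}" "V \<noteq> UNIV" "finite (never_enters S V)"
     "\<And>d. d\<in>never_enters S V \<Longrightarrow> ev_repelling S d" using assms(2) unfolding wms_def by blast
  obtain d1 where d1: "d1 > 0" "traps (thicken d1 S) n V" using traps_thicken[OF assms(1) V(1)] .
  have "open V" using V(1) by (simp add: traps_def)
  then have op: "open U" if "U \<in> {V}" for U using that by blast
  have fin: "finite (never_enters S (\<Union>{V}))" and ev: "\<And>d. d \<in> never_enters S (\<Union>{V}) \<Longrightarrow> ev_repelling S d"
    using V(4,5) by auto
  obtain \<U> where U: "finite \<U>" "\<U> \<subseteq> {V}"
    "stably S (\<lambda>S'. \<forall>W. \<Union>\<U> \<subseteq> W \<longrightarrow> finite (never_enters S' W) \<and> (\<forall>d\<in>never_enters S' W. ev_repelling S' d))"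
    by (rule stably_never_enters[OF op fin ev])
  obtain F d2 where F: "F \<subseteq> S" "d2 > 0" "\<And>S'. (\<forall>f\<in>F. \<exists>f'\<in>S'. dist f f' < d2) \<Longrightarrow>
     (\<forall>W. \<Union>\<U> \<subseteq> W \<longrightarrow> finite (never_enters S' W) \<and> (\<forall>d\<in>never_enters S' W. ev_repelling S' d))"
    using U(3) unfolding stably_def by blast
  show ?thesis
  proof (rule that[of "min d1 d2"])
    show "min d1 d2 > 0" using d1 F by simp
    fix S' assume S': "S' \<subseteq> thicken (min d1 d2) S" "S \<subseteq> thicken (min d1 d2) S'"
    have "S' \<subseteq> thicken d1 S" using S'(1) thicken_mono[OF min.cobounded1[of d1 d2]] by blast
    then have "traps S' n V" using d1(2) unfolding traps_def by (meson subset_trans)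
    moreover have "\<forall>f\<in>F. \<exists>f'\<in>S'. dist f f' < d2"
      using F(1) S'(2) unfolding thicken_def by (fastforce simp: dist_commute)
    moreover have "\<Union>\<U> \<subseteq> V" using U(2) by blast
    ultimately show "wms S'" unfolding wms_def using F(3) V(2,3) by blast
  qed
qed

lemma min_set_mem: "L \<in> Min_sets G \<Longrightarrow> x \<in> L \<Longrightarrow> g \<in> G \<Longrightarrow> g x \<in> L"
proof -
  assume A: "L \<in> Min_sets G" "x \<in> L" "g \<in> G"
  then have L: "closure {h x | h. h \<in> G} = L" by (simp add: Min_sets_def)
  have "g x \<in> {h x | h. h \<in> G}" using A(3) by blast
  from subsetD[OF closure_subset this] show "g x \<in> L" by (simp only: L)
qed

text \<open>Among the orbits of points in the orbit of d take one of least cardinality; every orbit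
  inside it must coincide with it, and finite sets are closed.\<close>

lemma finite_orbit_minimal:
  fixes G :: "(riemann_sphere \<Rightarrow> riemann_sphere) set"
  assumes G: "G \<noteq> {}" "\<And>g h. g \<in> G \<Longrightarrow> h \<in> G \<Longrightarrow> g \<circ> h \<in> G"
    and D: "finite D" "\<And>g x. g \<in> G \<Longrightarrow> x \<in> D \<Longrightarrow> g x \<in> D" and d: "d \<in> D"
  obtains L where "L \<in> Min_sets G" "L \<subseteq> D" "L \<subseteq> {g d | g. g \<in> G}"
proof -
  let ?o = "\<lambda>x. {g x | g. g \<in> G}"
  have oD: "?o x \<subseteq> D" if "x \<in> D" for x using D(2) that by blast
  have fin: "finite (?o x)" if "x \<in> D" for x using oD[OF that] D(1) finite_subset by blast
  have mono: "?o y \<subseteq> ?o x" if yx: "y \<in> ?o x" for x y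
  proof
    fix z assume "z \<in> ?o y"
    then obtain g where g: "g \<in> G" "z = g y" by blast
    obtain h where h: "h \<in> G" "y = h x" using yx by blast
    have "g \<in> G" "h \<in> G" "z = (g \<circ> h) x" using g h by auto
    then show "z \<in> ?o x" using G(2) by blast
  qed
  obtain g0 where g0: "g0 \<in> G" using G(1) by blast
  then have "g0 d \<in> ?o d" by blast
  from ex_has_least_nat[of "\<lambda>x. x \<in> ?o d", OF this, of "\<lambda>x. card (?o x)"]
  obtain x where x: "x \<in> ?o d" "\<And>y. y \<in> ?o d \<Longrightarrow> card (?o x) \<le> card (?o y)"
    by (elim exE conjE) simp
  have xD: "x \<in> D" using x(1) oD[OF d] by blast
  have eq: "?o z = ?o x" if "z \<in> ?o x" for z
  proof (rule card_subset_eq[OF fin[OF xD] mono[OF that]])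
    have "z \<in> ?o d" using that mono[OF x(1)] by blast
    then show "card (?o z) = card (?o x)"
      using x(2) card_mono[OF fin[OF xD] mono[OF that]] by (simp add: order_antisym)
  qed
  have "?o x \<in> Min_sets G" unfolding Min_sets_def
  proof (intro CollectI conjI ballI)
    show "?o x \<noteq> {}" using g0 by blast
    show "compact (?o x)" using fin[OF xD] by (rule finite_imp_compact)
    show "?o x = closure (?o z)" if "z \<in> ?o x" for z
      using eq[OF that] fin[OF xD] by (simp add: finite_imp_closed)
  qed
  then show ?thesis using oD[OF xD] mono[OF x(1)] by (rule that)
qed

lemma semigroup_generated_empty_iff: "semigroup_generated S = {} \<longleftrightarrow> S = {}"
proof
  show "S = {}" if "semigroup_generated S = {}" using that semigroup_generated.gen by blast
  show "semigroup_generated S = {}" if "S = {}" using that by (simp add: semigroup_generated_eq)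
qed

lemma never_enters_eq: "(\<Inter>g\<in>semigroup_generated S. g -` (- V)) = never_enters S V"
  by (auto simp: never_enters_def)

lemma wms_if_weakly_mean_stable:
  assumes "weakly_mean_stable \<tau>" shows "wms (supp \<tau>)"
proof -
  let ?S = "supp \<tau>"
  obtain n V1 V where W: "1 \<le> n \<and> open V \<and> V \<noteq> {} \<and> closure V1 \<subseteq> V \<and> at_least_three (- V) \<and>
      (\<forall>gs. length gs = n \<and> set gs \<subseteq> ?S \<longrightarrow> fold apply_rat gs ` V \<subseteq> V1) \<and> finite (never_enters ?S V) \<and>
      (\<forall>L\<in>Min_sets (semigroup_generated ?S). L \<subseteq> never_enters ?S V \<longrightarrow>
         (\<exists>z\<in>L. \<exists>g\<in>semigroup_generated ?S. repelling_fixed_point g z))"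
    using assms unfolding weakly_mean_stable_def never_enters_eq Let_def
    by (elim exE conjE) (rule that, (intro conjI; assumption))
  have V: "n \<ge> 1" "open V" "V \<noteq> {}" "closure V1 \<subseteq> V" "at_least_three (- V)"
    "\<And>gs. length gs = n \<Longrightarrow> set gs \<subseteq> ?S \<Longrightarrow> fold apply_rat gs ` V \<subseteq> V1"
    "finite (never_enters ?S V)"
    "\<And>L. L \<in> Min_sets (semigroup_generated ?S) \<Longrightarrow> L \<subseteq> never_enters ?S V \<Longrightarrow>
       \<exists>z\<in>L. \<exists>g\<in>semigroup_generated ?S. repelling_fixed_point g z"
    using W by simp_all
  show ?thesis unfolding wms_def
  proof (intro exI conjI ballI)
    show "traps ?S n V" unfolding traps_def
    proof (intro conjI exI[of _ "closure V1"] allI impI V(1,2,4))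
      show "compact (closure V1)" by (rule closed_imp_compact_sphere) simp
      show "fold apply_rat gs x \<in> closure V1" if "length gs = n" "set gs \<subseteq> ?S" "x \<in> V" for gs x
        using V(6)[OF that(1,2)] that(3) closure_subset by (meson image_subset_iff subsetD)
    qed
    show "V \<noteq> UNIV" using V(5) by (auto simp: at_least_three_def)
    fix d assume d: "d \<in> never_enters ?S V"
    \<comment> \<open>Without generators the exceptional set would be the whole sphere, which is
      infinite.\<close>
    have ne: "semigroup_generated ?S \<noteq> {}"
    proof
      assume "semigroup_generated ?S = {}"
      then have "never_enters ?S V = UNIV" by (auto simp: never_enters_def)
      then show False using V(7) infinite_open_sphere[of UNIV] by simp
    qed
    obtain L where L: "L \<in> Min_sets (semigroup_generated ?S)" "L \<subseteq> never_enters ?S V" "L \<subseteq> {g d |g. g \<in> semigroup_generated ?S}"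
    proof (rule finite_orbit_minimal[of "semigroup_generated ?S" "never_enters ?S V" d])
      show "semigroup_generated ?S \<noteq> {}" "finite (never_enters ?S V)" "d \<in> never_enters ?S V"
        by (fact ne V(7) d)+
      show "g x \<in> never_enters ?S V" if "g \<in> semigroup_generated ?S" "x \<in> never_enters ?S V" for g x
        by (rule never_enters_invariant[OF that(2,1)])
    qed (rule semigroup_generated.comp that; assumption)+
    then show "ev_repelling ?S d" using V(8)[OF L(1,2)] unfolding ev_repelling_def by blast
  qed (use V in auto)
qed

text \<open>V is replaced by a small neighbourhood of K whose complement contains a ball around the
  omitted point p. The exceptional set does not change: a visit to V is followed n letters later by
  a visit to K.\<close>

lemma weakly_mean_stable_if_wms:
  assumes "wms (supp \<tau>)" shows "weakly_mean_stable \<tau>"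
proof -
  let ?S = "supp \<tau>"
  obtain n V where V: "traps ?S n V" "V \<noteq> {}" "V \<noteq> UNIV" "finite (never_enters ?S V)"
     "\<And>d. d\<in>never_enters ?S V \<Longrightarrow> ev_repelling ?S d" using assms(1) unfolding wms_def by blast
  obtain K where n: "n \<ge> 1" "open V" and K: "compact K" "K \<subseteq> V"
    "\<And>gs x. length gs = n \<Longrightarrow> set gs \<subseteq> ?S \<Longrightarrow> x \<in> V \<Longrightarrow> fold apply_rat gs x \<in> K"
    using V(1) unfolding traps_def by blast
  obtain v p where vp: "v \<in> V" "p \<notin> V" using V(2,3) by blast
  \<comment> \<open>The point v keeps both open sets non-empty should K be empty.\<close>
  define K' where "K' = insert v K"
  have K': "compact K'" "K' \<subseteq> V" "K' \<noteq> {}" using K vp by (auto simp: K'_def)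
  have "K' \<subseteq> V - {p}" "open (V - {p})" using K' vp n by auto
  then obtain e0 where e0: "e0 > 0" "thicken e0 K' \<subseteq> V - {p}" using compact_thicken_subset[OF K'(1)] by metis
  define e where "e = e0 / 2"
  have e: "e > 0" "thicken (2 * e) K' \<subseteq> V - {p}" using e0 by (auto simp: e_def)
  define V2 where "V2 = thicken e K'"
  define V1 where "V1 = thicken (e/2) K'"
  have V2V: "V2 \<subseteq> V" using e thicken_mono[of e "2*e" K'] by (auto simp: V2_def)
  have "ball p e \<subseteq> - V2"
  proof
    fix x assume x: "x \<in> ball p e"
    show "x \<in> - V2"
    proof
      assume "x \<in> V2"
      then obtain k where k: "k \<in> K'" "dist k x < e" by (auto simp: V2_def thicken_def)
      then have "dist k p < 2 * e" using x dist_triangle[of k p x] by (simp add: dist_commute)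
      then have "p \<in> thicken (2 * e) K'" using k by (auto simp: thicken_def)
      then show False using e by blast
    qed
  qed
  then have inf: "infinite (- V2)" using infinite_open_sphere[of "ball p e"] e finite_subset by (metis centre_in_ball empty_iff open_ball)
  have D: "never_enters ?S V2 = never_enters ?S V"
  proof
    show "never_enters ?S V \<subseteq> never_enters ?S V2" using V2V by (auto simp: never_enters_def)
    show "never_enters ?S V2 \<subseteq> never_enters ?S V"
    proof
      fix x assume x: "x \<in> never_enters ?S V2"
      have "g x \<notin> V" if g: "g \<in> semigroup_generated ?S" for g
      proof
        assume gV: "g x \<in> V"
        obtain f where f: "f \<in> ?S" using g semigroup_generated_empty_iff by blast
        let ?w = "fold apply_rat (replicate n f)"
        have "set (replicate n f) \<subseteq> ?S" using f by auto
        then have wK: "?w (g x) \<in> K" by (rule K(3)[OF length_replicate _ gV])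
        have "?w \<in> semigroup_generated ?S" unfolding semigroup_generated_eq
          using f n by (intro CollectI exI[of _ "replicate n f"]) auto
        then have "(?w \<circ> g) x \<notin> V2" using semigroup_generated.comp[OF _ g] x unfolding never_enters_def by blast
        moreover have "K \<subseteq> V2" using subset_thicken[OF e(1), of K'] by (auto simp: V2_def K'_def)
        ultimately show False using wK by auto
      qed
      then show "x \<in> never_enters ?S V" by (auto simp: never_enters_def)
    qed
  qed
  show ?thesis unfolding weakly_mean_stable_def never_enters_eq Let_def
  proof (rule exI[of _ n], rule conjI[OF n(1)], rule exI[of _ V1], rule exI[of _ V2], intro conjI ballI impI allI)
    show "open V1" "open V2" by (auto simp: V1_def V2_def open_thicken)
    show "V1 \<noteq> {}" "V2 \<noteq> {}" using subset_thicken[of "e/2" K'] subset_thicken[of e K'] e K'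
      by (auto simp: V1_def V2_def)
    show "closure V1 \<subseteq> V2" using closure_thicken_subset[of "e/2" K'] e by (simp add: V1_def V2_def)
    show "at_least_three (- V2)" using inf by (simp add: at_least_three_def)
    show "finite (never_enters ?S V2)" using D V(4) by simp
    show "fold apply_rat gs ` V2 \<subseteq> V1" if "length gs = n \<and> set gs \<subseteq> ?S" for gs
    proof -
      have "fold apply_rat gs ` V2 \<subseteq> K" using K(3) that V2V by blast
      also have "K \<subseteq> V1" using subset_thicken[of "e/2" K'] e by (auto simp: V1_def K'_def)
      finally show ?thesis .
    qed
    show "\<exists>z\<in>L. \<exists>g\<in>semigroup_generated ?S. repelling_fixed_point g z"
      if L: "L \<in> Min_sets (semigroup_generated ?S)" "L \<subseteq> never_enters ?S V2" for L
    proof -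
      obtain x where x: "x \<in> L" using L(1) by (auto simp: Min_sets_def)
      then have "ev_repelling ?S x" using V(5) D L(2) by blast
      then show ?thesis unfolding ev_repelling_def using min_set_mem[OF L(1) x] by blast
    qed
  qed
qed

section \<open>Uniform first-order approximation in charts\<close>

lemma antip_neq_ic [simp]: "antip p \<noteq> ic p w"
  using ic_neq_antip[of p w] by metis

text \<open>The factor 2 comes from working on the closed disc of half the radius, where continuity
  up to the boundary is automatic.\<close>

lemma Cauchy_deriv_bound:
  assumes f: "f holomorphic_on ball 0 \<rho>" and \<rho>: "\<rho> > 0" and B: "\<And>w. w \<in> ball 0 \<rho> \<Longrightarrow> cmod (f w) < B"
  shows "cmod (deriv f 0) \<le> 2 * B / \<rho>"
proof -
  have sub: "cball 0 (\<rho>/2) \<subseteq> ball (0::complex) \<rho>" using \<rho> by auto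
  have "cmod ((deriv ^^ 1) f 0) \<le> fact 1 * B / (\<rho>/2) ^ 1"
  proof (rule Cauchy_higher_deriv_bound[where y = 0])
    show "f holomorphic_on ball 0 (\<rho>/2)"
      using f by (rule holomorphic_on_subset) (use \<rho> in auto)
    show "continuous_on (cball 0 (\<rho>/2)) f"
      using f sub holomorphic_on_imp_continuous_on continuous_on_subset by blast
    show "f w \<in> ball 0 B" if "w \<in> ball 0 (\<rho>/2)" for w using B[of w] that \<rho> by simp
  qed (use \<rho> in auto)
  then show ?thesis by (simp add: mult.commute)
qed

text \<open>Cauchy's estimate on discs of radius \<rho>/2 bounds the second derivative by 2 /
  (\<rho>/2)^2 = 8 / \<rho>^2, and Taylor's formula of order one does the rest.\<close>

lemma holomorphic_quadratic_bound:
  assumes f: "f holomorphic_on ball 0 \<rho>" and \<rho>: "\<rho> > 0" and B: "\<And>w. w \<in> ball 0 \<rho> \<Longrightarrow> cmod (f w) < 1"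
    and f0: "f 0 = 0" and w: "cmod w < \<rho> / 2"
  shows "cmod (f w - deriv f 0 * w) \<le> 8 / \<rho>\<^sup>2 * (cmod w)\<^sup>2"
proof -
  have "cmod ((deriv ^^ 0) f w - (\<Sum>i\<le>1. (deriv ^^ i) f 0 * (w - 0) ^ i / fact i)) \<le> (8 / \<rho>\<^sup>2) * cmod (w - 0) ^ Suc 1 / fact 1"
  proof (rule complex_Taylor[where S = "ball 0 (\<rho>/2)"])
    fix i :: nat and x :: complex assume x: "x \<in> ball 0 (\<rho>/2)"
    have "(deriv ^^ i) f holomorphic_on ball 0 \<rho>" using f by (intro holomorphic_higher_deriv) auto
    then have "((deriv ^^ i) f has_field_derivative deriv ((deriv ^^ i) f) x) (at x)"
      by (rule holomorphic_derivI) (use x \<rho> in auto)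
    then show "((deriv ^^ i) f has_field_derivative (deriv ^^ Suc i) f x) (at x within ball 0 (\<rho>/2))"
      by (simp add: has_field_derivative_at_within)
  next
    fix x :: complex assume x: "x \<in> ball 0 (\<rho>/2)"
    have sub: "cball x (\<rho>/2) \<subseteq> ball 0 \<rho>"
    proof
      fix v assume "v \<in> cball x (\<rho>/2)"
      then show "v \<in> ball 0 \<rho>" using x norm_triangle_ineq2[of v x] by (simp add: dist_norm norm_minus_commute)
    qed
    have sub': "ball x (\<rho>/2) \<subseteq> ball 0 \<rho>" using sub ball_subset_cball by blast
    have "cmod ((deriv ^^ 2) f x) \<le> fact 2 * 1 / (\<rho>/2) ^ 2"
    proof (rule Cauchy_higher_deriv_bound[where y = 0])
      show "f holomorphic_on ball x (\<rho>/2)" using f sub' by (rule holomorphic_on_subset)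
      show "continuous_on (cball x (\<rho>/2)) f"
        using f sub holomorphic_on_imp_continuous_on continuous_on_subset by blast
      show "f w \<in> ball 0 1" if "w \<in> ball x (\<rho>/2)" for w using B[OF subsetD[OF sub' that]] by simp
    qed (use \<rho> in auto)
    also have "fact 2 * 1 / (\<rho>/2) ^ 2 = 8 / \<rho>\<^sup>2" by (simp add: power_divide)
    finally show "cmod ((deriv ^^ Suc 1) f x) \<le> 8 / \<rho>\<^sup>2" by (simp add: numeral_2_eq_2)
  qed (use w \<rho> in auto)
  then show ?thesis by (simp add: f0 power2_eq_square)
qed

lemma chart_quadratic_bound:
  assumes g: "hmap g" and gx: "g x = y" and \<rho>: "\<rho> > 0"
    and U: "\<And>w. w \<in> ball 0 \<rho> \<Longrightarrow> g (ic x w) \<in> ic y ` ball 0 1" and w: "cmod w < \<rho> / 2"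
  shows "cmod (cd y (g (ic x w)) - sphere_deriv g x * w) \<le> 8 / \<rho>\<^sup>2 * (cmod w)\<^sup>2"
proof -
  let ?f = "\<lambda>w. cd y (g (ic x w))"
  have hi: "holo_into UNIV (\<lambda>w. g (ic x w))" using g by (simp add: hmap_def)
  have 1: "?f holomorphic_on ball 0 \<rho>"
  proof (rule holo_into_cd_holomorphic[OF hi])
    show "g (ic x v) \<noteq> antip y" if "v \<in> ball 0 \<rho>" for v using U[OF that] by auto
  qed simp
  have 2: "cmod (?f v) < 1" if "v \<in> ball 0 \<rho>" for v using U[OF that] by auto
  have "(?f has_field_derivative sphere_deriv g x) (at 0)" using sphere_deriv_DERIV[OF g, of x] gx by simp
  then have "deriv ?f 0 = sphere_deriv g x" by (rule DERIV_imp_deriv)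
  then show ?thesis using holomorphic_quadratic_bound[OF 1 \<rho> 2 _ w] gx by simp
qed

lemma words_chart_uniform:
  assumes "compact Q" "open U" "\<And>gs. length gs = n \<Longrightarrow> set gs \<subseteq> Q \<Longrightarrow> fold apply_rat gs x \<in> U"
  obtains \<rho> where "\<rho> > 0"
    "\<And>gs w. length gs = n \<Longrightarrow> set gs \<subseteq> Q \<Longrightarrow> w \<in> ball 0 \<rho> \<Longrightarrow> fold apply_rat gs (ic x w) \<in> U"
proof -
  have "\<exists>d>0. \<forall>gs y. length gs = n \<longrightarrow> set gs \<subseteq> thicken d Q \<longrightarrow> y \<in> thicken d {x} \<longrightarrow> fold apply_rat gs y \<in> U"
    by (rule words_thicken[OF assms(1) compact_sing assms(2)]) (use assms(3) in auto)
  then obtain d where d: "d > 0" "\<And>gs y. length gs = n \<Longrightarrow> set gs \<subseteq> thicken d Q \<Longrightarrow> y \<in> thicken d {x} \<Longrightarrow> fold apply_rat gs y \<in> U"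
    by blast
  obtain \<rho> where \<rho>: "\<rho> > 0" "ic x ` ball 0 \<rho> \<subseteq> ball x d" using obtain_ic_ball[of "ball x d" x] d(1) by auto
  show ?thesis
  proof (rule that[OF \<rho>(1)])
    fix gs w assume gs: "length gs = n" "set gs \<subseteq> Q" "w \<in> ball (0::complex) \<rho>"
    have "ic x w \<in> thicken d {x}" using subsetD[OF \<rho>(2) imageI[OF gs(3)]] by (simp add: thicken_eq)
    moreover have "set gs \<subseteq> thicken d Q" using gs(2) subset_thicken[OF d(1)] by blast
    ultimately show "fold apply_rat gs (ic x w) \<in> U" using d(2)[OF gs(1)] by blast
  qed
qed

text \<open>One radius serves all words of length n over the compact set Q. This uniformity lets the
  multipliers alone decide whether a disc is contracted or expanded by all these words.\<close>

lemma fixed_words_quadratic_bound: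
  assumes "compact Q" "\<And>gs. length gs = n \<Longrightarrow> set gs \<subseteq> Q \<Longrightarrow> fold apply_rat gs x = y"
  obtains \<rho> where "\<rho> > 0"
    "\<And>gs w. length gs = n \<Longrightarrow> set gs \<subseteq> Q \<Longrightarrow> w \<in> ball 0 \<rho> \<Longrightarrow> fold apply_rat gs (ic x w) \<in> ic y ` ball 0 1"
    "\<And>gs w. length gs = n \<Longrightarrow> set gs \<subseteq> Q \<Longrightarrow> cmod w < \<rho> / 2 \<Longrightarrow>
       cmod (cd y (fold apply_rat gs (ic x w)) - sphere_deriv (fold apply_rat gs) x * w) \<le> 8 / \<rho>\<^sup>2 * (cmod w)\<^sup>2"
proof -
  have mem: "fold apply_rat gs x \<in> ic y ` ball 0 1" if "length gs = n" "set gs \<subseteq> Q" for gs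
    using assms(2)[OF that] by (intro image_eqI[of _ _ 0]) auto
  obtain \<rho> where \<rho>: "\<rho> > 0"
    "\<And>gs w. length gs = n \<Longrightarrow> set gs \<subseteq> Q \<Longrightarrow> w \<in> ball 0 \<rho> \<Longrightarrow> fold apply_rat gs (ic x w) \<in> ic y ` ball 0 1"
    using words_chart_uniform[OF assms(1) open_ic_image[OF open_ball] mem] by metis
  show ?thesis
  proof (rule that[OF \<rho>])
    show "cmod (cd y (fold apply_rat gs (ic x w)) - sphere_deriv (fold apply_rat gs) x * w) \<le> 8 / \<rho>\<^sup>2 * (cmod w)\<^sup>2"
      if "length gs = n" "set gs \<subseteq> Q" "cmod w < \<rho> / 2" for gs w
      by (rule chart_quadratic_bound[OF hmap_fold assms(2)[OF that(1,2)] \<rho>(1) \<rho>(2)[OF that(1,2)] that(3)])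
  qed
qed

text \<open>On a disc so small that the quadratic error is at most \<theta>' - \<theta>, every word
  contracts by the factor \<theta>' < 1, so the smaller closed disc is a compact target.\<close>

lemma attracting_disc_traps:
  assumes Q: "compact Q" "n \<ge> 1" "\<And>gs. length gs = n \<Longrightarrow> set gs \<subseteq> Q \<Longrightarrow> fold apply_rat gs x = x"
    and \<theta>: "\<theta> < 1" "\<And>gs. length gs = n \<Longrightarrow> set gs \<subseteq> Q \<Longrightarrow> cmod (sphere_deriv (fold apply_rat gs) x) \<le> \<theta>"
    and W: "open W" "x \<in> W"
  obtains U where "x \<in> U" "U \<subseteq> W" "traps Q n U"
proof -
  obtain \<rho> where \<rho>: "\<rho> > 0"
    "\<And>gs w. length gs = n \<Longrightarrow> set gs \<subseteq> Q \<Longrightarrow> w \<in> ball 0 \<rho> \<Longrightarrow> fold apply_rat gs (ic x w) \<in> ic x ` ball 0 1"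
    "\<And>gs w. length gs = n \<Longrightarrow> set gs \<subseteq> Q \<Longrightarrow> cmod w < \<rho> / 2 \<Longrightarrow>
       cmod (cd x (fold apply_rat gs (ic x w)) - sphere_deriv (fold apply_rat gs) x * w) \<le> 8 / \<rho>\<^sup>2 * (cmod w)\<^sup>2"
    using fixed_words_quadratic_bound[OF Q(1,3)] by metis
  obtain r0 where r0: "r0 > 0" "ic x ` ball 0 r0 \<subseteq> W" using obtain_ic_ball[OF W] by blast
  \<comment> \<open>Half of the gap to 1 absorbs the quadratic error; the maximum with 0 covers the
    case of no words, where \<theta> may be negative.\<close>
  define \<theta>' where "\<theta>' = (1 + max \<theta> 0) / 2"
  define r where "r = min r0 (min (\<rho>/2) (\<rho>\<^sup>2 / 8 * (\<theta>' - max \<theta> 0)))"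
  have \<theta>': "max \<theta> 0 < \<theta>'" "\<theta>' < 1" using \<theta>(1) by (auto simp: \<theta>'_def max_def)
  have r: "r > 0" "r \<le> r0" "r \<le> \<rho> / 2" "r \<le> \<rho>\<^sup>2 / 8 * (\<theta>' - max \<theta> 0)"
    using r0(1) \<rho>(1) \<theta>'(1) by (auto simp: r_def)
  have "8 / \<rho>\<^sup>2 * r \<le> 8 / \<rho>\<^sup>2 * (\<rho>\<^sup>2 / 8 * (\<theta>' - max \<theta> 0))"
    using r(4) by (intro mult_left_mono) auto
  then have r8: "8 / \<rho>\<^sup>2 * r \<le> \<theta>' - max \<theta> 0" using \<rho>(1) by simp
  let ?U = "ic x ` ball 0 r"
  have "traps Q n ?U" unfolding traps_def
  proof (intro conjI exI[of _ "ic x ` cball 0 (\<theta>' * r)"] allI impI)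
    show "n \<ge> 1" by (rule Q(2))
    show "open ?U" by (intro open_ic_image) simp
    show "compact (ic x ` cball 0 (\<theta>' * r))" by (intro compact_continuous_image continuous_on_ic) simp
    show "ic x ` cball 0 (\<theta>' * r) \<subseteq> ?U"
    proof (intro image_mono subsetI)
      have "\<theta>' * r < r" using \<theta>'(2) r(1) mult_strict_right_mono[of \<theta>' 1 r] by simp
      then show "w \<in> ball 0 r" if "w \<in> cball 0 (\<theta>' * r)" for w :: complex using that by simp
    qed
    fix gs y assume gs: "length gs = n" "set gs \<subseteq> Q" and "y \<in> ?U"
    then obtain w where w: "y = ic x w" "cmod w < r" by auto
    let ?v = "cd x (fold apply_rat gs (ic x w))"
    have "cmod ?v \<le> cmod (?v - sphere_deriv (fold apply_rat gs) x * w) + cmod (sphere_deriv (fold apply_rat gs) x * w)"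
      using norm_triangle_ineq[of "?v - sphere_deriv (fold apply_rat gs) x * w" "sphere_deriv (fold apply_rat gs) x * w"] by simp
    also have "\<dots> \<le> 8 / \<rho>\<^sup>2 * (cmod w)\<^sup>2 + max \<theta> 0 * cmod w"
      using \<rho>(3)[OF gs, of w] w(2) r(3) \<theta>(2)[OF gs] by (intro add_mono) (auto simp: norm_mult intro!: mult_right_mono)
    also have "\<dots> = (8 / \<rho>\<^sup>2 * cmod w + max \<theta> 0) * cmod w" by (simp add: power2_eq_square algebra_simps)
    also have "\<dots> \<le> (8 / \<rho>\<^sup>2 * r + max \<theta> 0) * r"
      using w(2) r(1) by (intro mult_mono add_mono mult_left_mono) auto
    also have "\<dots> \<le> \<theta>' * r" using r8 r(1) by (intro mult_right_mono) auto
    finally have v: "?v \<in> cball 0 (\<theta>' * r)" by simp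
    have "fold apply_rat gs (ic x w) \<in> ic x ` ball 0 1" using \<rho>(2)[OF gs, of w] w(2) r(3) \<rho>(1) by simp
    then have "ic x ?v = fold apply_rat gs y" using w(1) by (auto simp: ic_cd)
    then show "fold apply_rat gs y \<in> ic x ` cball 0 (\<theta>' * r)" using v by (metis imageI)
  qed
  moreover have "x \<in> ?U" using r(1) by (intro image_eqI[of _ _ 0]) auto
  moreover have "?U \<subseteq> W" using r0(2) r(2) by (auto simp: image_subset_iff)
  ultimately show ?thesis by (intro that)
qed

text \<open>The radius lets the quadratic error consume at most \<theta> - 1. What remains is that
  distances to x do not shrink, which is all that the later induction along an orbit uses.\<close>

lemma expanding_words:
  assumes Q: "compact Q" "\<And>gs. length gs = n \<Longrightarrow> set gs \<subseteq> Q \<Longrightarrow> fold apply_rat gs x = x"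
    and \<theta>: "\<theta> > 1" "\<And>gs. length gs = n \<Longrightarrow> set gs \<subseteq> Q \<Longrightarrow> cmod (sphere_deriv (fold apply_rat gs) x) \<ge> \<theta>"
  obtains \<eta> where "\<eta> > 0" "\<And>gs w. length gs = n \<Longrightarrow> set gs \<subseteq> Q \<Longrightarrow> cmod w < \<eta> \<Longrightarrow>
     \<exists>w'. fold apply_rat gs (ic x w) = ic x w' \<and> cmod w \<le> cmod w'"
proof -
  obtain \<rho> where \<rho>: "\<rho> > 0"
    "\<And>gs w. length gs = n \<Longrightarrow> set gs \<subseteq> Q \<Longrightarrow> w \<in> ball 0 \<rho> \<Longrightarrow> fold apply_rat gs (ic x w) \<in> ic x ` ball 0 1"
    "\<And>gs w. length gs = n \<Longrightarrow> set gs \<subseteq> Q \<Longrightarrow> cmod w < \<rho> / 2 \<Longrightarrow>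
       cmod (cd x (fold apply_rat gs (ic x w)) - sphere_deriv (fold apply_rat gs) x * w) \<le> 8 / \<rho>\<^sup>2 * (cmod w)\<^sup>2"
    using fixed_words_quadratic_bound[OF Q] by metis
  define r where "r = min (\<rho>/2) (\<rho>\<^sup>2 / 8 * (\<theta> - 1))"
  have r: "r > 0" "r \<le> \<rho> / 2" "r \<le> \<rho>\<^sup>2 / 8 * (\<theta> - 1)" using \<rho>(1) \<theta>(1) by (auto simp: r_def)
  have "8 / \<rho>\<^sup>2 * r \<le> 8 / \<rho>\<^sup>2 * (\<rho>\<^sup>2 / 8 * (\<theta> - 1))"
    using r(3) by (intro mult_left_mono) auto
  then have r8: "8 / \<rho>\<^sup>2 * r \<le> \<theta> - 1" using \<rho>(1) by simp
  show ?thesis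
  proof (rule that[OF r(1)])
    fix gs and w :: complex assume gs: "length gs = n" "set gs \<subseteq> Q" and w: "cmod w < r"
    let ?v = "cd x (fold apply_rat gs (ic x w))" and ?m = "sphere_deriv (fold apply_rat gs) x"
    have "\<theta> * cmod w \<le> cmod (?m * w)" using \<theta>(2)[OF gs] by (auto simp: norm_mult intro!: mult_right_mono)
    also have "\<dots> \<le> cmod (?v - ?m * w) + cmod ?v"
      using norm_triangle_ineq4[of "?v" "?v - ?m * w"] by simp
    also have "cmod (?v - ?m * w) \<le> (8 / \<rho>\<^sup>2 * cmod w) * cmod w"
      using \<rho>(3)[OF gs, of w] w r(2) by (simp add: power2_eq_square)
    also have "\<dots> \<le> (8 / \<rho>\<^sup>2 * r) * cmod w" using w by (intro mult_right_mono mult_left_mono) auto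
    also have "\<dots> \<le> (\<theta> - 1) * cmod w" using r8 by (intro mult_right_mono) auto
    finally have v: "cmod w \<le> cmod ?v" by (simp add: algebra_simps)
    have "fold apply_rat gs (ic x w) \<in> ic x ` ball 0 1" using \<rho>(2)[OF gs, of w] w r(2) \<rho>(1) by simp
    then have "fold apply_rat gs (ic x w) = ic x ?v" by (auto simp: ic_cd)
    then show "\<exists>w'. fold apply_rat gs (ic x w) = ic x w' \<and> cmod w \<le> cmod w'" using v by blast
  qed
qed

text \<open>Maps close in the uniform metric have close chart expressions on a common disc, and
  Cauchy's estimate turns an error e \<rho> / 4 of the values into e / 2 for the
  derivatives.\<close>

lemma continuous_on_sphere_deriv:
  assumes "compact Q" "\<And>g. g \<in> Q \<Longrightarrow> apply_rat g x = y"
  shows "continuous_on Q (\<lambda>g. sphere_deriv (apply_rat g) x)"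
  unfolding continuous_on_iff
proof (intro ballI allI impI)
  fix g and e :: real assume g: "g \<in> Q" and e: "e > 0"
  have w1: "fold apply_rat gs x = y" if "length gs = 1" "set gs \<subseteq> Q" for gs
    using that assms(2) by (auto simp: length_Suc_conv)
  obtain \<rho> where \<rho>: "\<rho> > 0"
    "\<And>gs w. length gs = 1 \<Longrightarrow> set gs \<subseteq> Q \<Longrightarrow> w \<in> ball 0 \<rho> \<Longrightarrow> fold apply_rat gs (ic x w) \<in> ic y ` ball 0 1"
    using fixed_words_quadratic_bound[OF assms(1) w1] by metis
  have U: "apply_rat h (ic x w) \<in> ic y ` ball 0 1" if "h \<in> Q" "w \<in> ball 0 \<rho>" for h w
    using \<rho>(2)[of "[h]" w] that by simp
  have "compact (ic y ` cball 0 1)" by (intro compact_continuous_image continuous_on_ic) simp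
  moreover have "ic y ` cball 0 1 \<subseteq> - {antip y}" by auto
  moreover have "e * \<rho> / 4 > 0" using e \<rho>(1) by simp
  ultimately obtain d where d: "d > 0" "\<And>a b. a \<in> ic y ` cball 0 1 \<Longrightarrow> dist a b < d \<Longrightarrow>
      b \<noteq> antip y \<and> cmod (cd y b - cd y a) < e * \<rho> / 4"
    by (rule cd_uniform) blast
  have hol: "(\<lambda>w. cd y (apply_rat h (ic x w))) holomorphic_on ball 0 \<rho>" if "h \<in> Q" for h
  proof (rule holo_into_cd_holomorphic)
    show "holo_into UNIV (\<lambda>w. apply_rat h (ic x w))" using hmap_apply_rat by (simp add: hmap_def)
    show "apply_rat h (ic x v) \<noteq> antip y" if "v \<in> ball 0 \<rho>" for v using U[OF \<open>h \<in> Q\<close> that] by auto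
  qed simp
  have der: "((\<lambda>w. cd y (apply_rat h (ic x w))) has_field_derivative sphere_deriv (apply_rat h) x) (at 0)" if "h \<in> Q" for h
    using sphere_deriv_DERIV[OF hmap_apply_rat, of h x] assms(2)[OF that] by simp
  show "\<exists>d>0. \<forall>h\<in>Q. dist h g < d \<longrightarrow> dist (sphere_deriv (apply_rat h) x) (sphere_deriv (apply_rat g) x) < e"
  proof (intro exI[of _ d] conjI ballI impI d(1))
    fix h assume h: "h \<in> Q" "dist h g < d"
    let ?f = "\<lambda>w. cd y (apply_rat h (ic x w)) - cd y (apply_rat g (ic x w))"
    have "cmod (?f w) < e * \<rho> / 4" if w: "w \<in> ball 0 \<rho>" for w
    proof -
      have "ic y ` ball 0 1 \<subseteq> ic y ` cball 0 1" by (intro image_mono ball_subset_cball)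
      then have "apply_rat g (ic x w) \<in> ic y ` cball 0 1" using U[OF g w] by blast
      moreover have "dist (apply_rat g (ic x w)) (apply_rat h (ic x w)) < d"
        using dist_apply_rat_le[of g "ic x w" h] h(2) by (simp add: dist_commute)
      ultimately show ?thesis using d(2) by blast
    qed
    then have "cmod (deriv ?f 0) \<le> 2 * (e * \<rho> / 4) / \<rho>"
      by (intro Cauchy_deriv_bound \<rho>(1) holomorphic_intros hol h g)
    moreover have "(?f has_field_derivative sphere_deriv (apply_rat h) x - sphere_deriv (apply_rat g) x) (at 0)"
      by (intro DERIV_diff der h g)
    then have "deriv ?f 0 = sphere_deriv (apply_rat h) x - sphere_deriv (apply_rat g) x" by (rule DERIV_imp_deriv)
    ultimately show "dist (sphere_deriv (apply_rat h) x) (sphere_deriv (apply_rat g) x) < e"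
      using \<rho>(1) e by (simp add: dist_norm)
  qed
qed

section \<open>Holomorphic discs of rational maps\<close>

definition holo_disc :: "(complex \<Rightarrow> rational_map) \<Rightarrow> bool" where
  "holo_disc c \<longleftrightarrow> continuous_on (ball 0 1) c \<and> (\<forall>x. holo_into (ball 0 1) (\<lambda>\<zeta>. apply_rat (c \<zeta>) x))"

definition const_pts :: "rational_map set \<Rightarrow> riemann_sphere set" where
  "const_pts Y = {x. \<forall>g\<in>Y. \<forall>h\<in>Y. apply_rat g x = apply_rat h x}"

text \<open>\<open>R\<close> is open in \<open>Y\<close> in the sense of the parametrization: through each of its points there are
  holomorphic discs in \<open>R\<close> along which values and derivatives move unless they are constant on \<open>Y\<close>.\<close>

definition rich :: "rational_map set \<Rightarrow> rational_map set \<Rightarrow> bool" where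
  "rich Y R \<longleftrightarrow> R \<subseteq> Y \<and>
     (\<forall>g\<in>R. \<forall>x. x \<notin> const_pts Y \<longrightarrow> (\<exists>c. holo_disc c \<and> c ` ball 0 1 \<subseteq> R \<and> c 0 = g \<and>
        \<not> (\<lambda>\<zeta>. apply_rat (c \<zeta>) x) constant_on ball 0 1)) \<and>
     (\<forall>g\<in>R. \<forall>x\<in>const_pts Y. \<not> (\<lambda>g. sphere_deriv (apply_rat g) x) constant_on Y \<longrightarrow>
        (\<exists>c. holo_disc c \<and> c ` ball 0 1 \<subseteq> R \<and> c 0 = g \<and>
        \<not> (\<lambda>\<zeta>. sphere_deriv (apply_rat (c \<zeta>)) x) constant_on ball 0 1))"

text \<open>The open mapping theorem is applied in the parameter, with the point x fixed.\<close>

lemma rich_value_interior: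
  assumes "rich Y R" "g \<in> R" "x \<notin> const_pts Y"
  shows "apply_rat g x \<in> interior ((\<lambda>g. apply_rat g x) ` R)"
proof -
  obtain c where c: "holo_disc c" "c ` ball 0 1 \<subseteq> R" "c 0 = g"
    "\<not> (\<lambda>\<zeta>. apply_rat (c \<zeta>) x) constant_on ball 0 1"
    using assms unfolding rich_def by blast
  have "open ((\<lambda>\<zeta>. apply_rat (c \<zeta>) x) ` ball 0 1)"
    using c(1,4) by (intro holo_into_open_mapping[of "ball 0 1"]) (auto simp: holo_disc_def)
  moreover have "(\<lambda>\<zeta>. apply_rat (c \<zeta>) x) ` ball 0 1 \<subseteq> (\<lambda>g. apply_rat g x) ` R" using c(2) by auto
  moreover have "apply_rat g x \<in> (\<lambda>\<zeta>. apply_rat (c \<zeta>) x) ` ball 0 1" using c(3) by (intro image_eqI[of _ _ 0]) auto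
  ultimately show ?thesis by (meson interiorI)
qed

text \<open>A word is split at its first letter, which varies along the disc, while h stands for the
  remaining letters. The radius is uniform over a compact set of parameters.\<close>

lemma disc_family_bound:
  assumes c: "holo_disc c" and y: "\<And>\<zeta>. \<zeta> \<in> ball 0 1 \<Longrightarrow> apply_rat (c \<zeta>) x = y"
    and h: "hmap h" and K: "compact K" "K \<subseteq> ball 0 1"
  obtains \<rho> where "\<rho> > 0"
    "\<And>\<zeta> w. \<zeta> \<in> K \<Longrightarrow> w \<in> ball 0 \<rho> \<Longrightarrow> h (apply_rat (c \<zeta>) (ic x w)) \<in> ic (h y) ` ball 0 1"
    "\<And>\<zeta> w. \<zeta> \<in> K \<Longrightarrow> cmod w < \<rho> / 2 \<Longrightarrow>
       cmod (cd (h y) (h (apply_rat (c \<zeta>) (ic x w))) - sphere_deriv h y * sphere_deriv (apply_rat (c \<zeta>)) x * w) \<le> 8 / \<rho>\<^sup>2 * (cmod w)\<^sup>2"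
proof -
  have Q: "compact (c ` K)"
    using c K by (intro compact_continuous_image) (auto simp: holo_disc_def intro: continuous_on_subset)
  have U: "open (h -` ic (h y) ` ball 0 1)"
    by (intro open_vimage open_ic_image hmap_continuous_on h) auto
  have mem: "fold apply_rat gs x \<in> h -` ic (h y) ` ball 0 1" if gs: "length gs = 1" "set gs \<subseteq> c ` K" for gs
  proof -
    obtain g where "gs = [g]" using gs(1) by (cases gs) auto
    then obtain \<zeta> where "gs = [c \<zeta>]" "\<zeta> \<in> K" using gs(2) by auto
    then show ?thesis using y K(2) by (auto intro!: image_eqI[of _ _ 0])
  qed
  obtain \<rho> where \<rho>: "\<rho> > 0"
    "\<And>gs w. length gs = 1 \<Longrightarrow> set gs \<subseteq> c ` K \<Longrightarrow> w \<in> ball 0 \<rho> \<Longrightarrow> fold apply_rat gs (ic x w) \<in> h -` ic (h y) ` ball 0 1"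
    using words_chart_uniform[OF Q U mem] by metis
  have \<rho>2: "h (apply_rat (c \<zeta>) (ic x w)) \<in> ic (h y) ` ball 0 1" if "\<zeta> \<in> K" "w \<in> ball 0 \<rho>" for \<zeta> w
    using \<rho>(2)[of "[c \<zeta>]" w] that by simp
  show ?thesis
  proof (rule that[OF \<rho>(1) \<rho>2])
    fix \<zeta> and w :: complex assume A: "\<zeta> \<in> K" "cmod w < \<rho> / 2"
    have cy: "apply_rat (c \<zeta>) x = y" using y K(2) A(1) by blast
    have "cmod (cd (h y) ((h \<circ> apply_rat (c \<zeta>)) (ic x w)) - sphere_deriv (h \<circ> apply_rat (c \<zeta>)) x * w) \<le> 8 / \<rho>\<^sup>2 * (cmod w)\<^sup>2"
      by (rule chart_quadratic_bound[OF hmap_comp[OF h hmap_apply_rat] _ \<rho>(1) _ A(2)]) (use cy \<rho>2[OF A(1)] in auto)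
    then show "cmod (cd (h y) (h (apply_rat (c \<zeta>) (ic x w))) - sphere_deriv h y * sphere_deriv (apply_rat (c \<zeta>)) x * w) \<le> 8 / \<rho>\<^sup>2 * (cmod w)\<^sup>2"
      by (simp add: sphere_deriv_comp[OF h hmap_apply_rat] cy)
  qed
qed

lemma disc_value_holomorphic:
  assumes c: "holo_disc c" and h: "hmap h" and S: "S \<subseteq> ball 0 1" "open S"
    and U: "\<And>\<zeta>. \<zeta> \<in> S \<Longrightarrow> h (apply_rat (c \<zeta>) x) \<noteq> antip q"
  shows "(\<lambda>\<zeta>. cd q (h (apply_rat (c \<zeta>) x))) holomorphic_on S"
proof (rule holo_into_cd_holomorphic)
  show "holo_into (ball 0 1) (\<lambda>\<zeta>. h (apply_rat (c \<zeta>) x))"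
    by (rule holo_into_hmap[OF _ h]) (use c in \<open>simp add: holo_disc_def\<close>)
qed (fact S(1) U)+

text \<open>With the value at x fixed, the derivative is the locally uniform limit of difference
  quotients in the sphere variable, each of which is holomorphic in the parameter.\<close>

lemma disc_deriv_holomorphic:
  assumes c: "holo_disc c" and y: "\<And>\<zeta>. \<zeta> \<in> ball 0 1 \<Longrightarrow> apply_rat (c \<zeta>) x = y"
  shows "(\<lambda>\<zeta>. sphere_deriv (apply_rat (c \<zeta>)) x) holomorphic_on ball 0 1"
  unfolding holomorphic_on_def
proof
  fix \<zeta>0 :: complex assume \<zeta>0: "\<zeta>0 \<in> ball 0 1"
  let ?D = "\<lambda>\<zeta>. sphere_deriv (apply_rat (c \<zeta>)) x"
  obtain s where s: "s > 0" "cball \<zeta>0 s \<subseteq> ball 0 1" 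
    using open_contains_cball[THEN iffD1, OF open_ball, THEN bspec, OF \<zeta>0] by (elim exE conjE)
  have idd: "sphere_deriv (\<lambda>x. x) y = 1"
    using sphere_deriv_DERIV[OF hmap_id, of y] DERIV_unique[OF _ DERIV_ident] by simp
  obtain \<rho> where \<rho>: "\<rho> > 0"
    "\<And>\<zeta> w. \<zeta> \<in> cball \<zeta>0 s \<Longrightarrow> w \<in> ball 0 \<rho> \<Longrightarrow> apply_rat (c \<zeta>) (ic x w) \<in> ic y ` ball 0 1"
    "\<And>\<zeta> w. \<zeta> \<in> cball \<zeta>0 s \<Longrightarrow> cmod w < \<rho> / 2 \<Longrightarrow>
       cmod (cd y (apply_rat (c \<zeta>) (ic x w)) - sphere_deriv (apply_rat (c \<zeta>)) x * w) \<le> 8 / \<rho>\<^sup>2 * (cmod w)\<^sup>2"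
    using disc_family_bound[OF c y hmap_id compact_cball s(2)] unfolding idd mult_1 by metis
  \<comment> \<open>Nonzero increments below \<rho>/2, where the quadratic bound is available, that
    tend to 0.\<close>
  define wn where "wn = (\<lambda>n. complex_of_real (\<rho> / (2 + real (Suc n))))"
  have wn3: "cmod (wn n) = \<rho> / (2 + real (Suc n))" for n
    using \<rho>(1) unfolding wn_def norm_of_real by simp
  have wn: "cmod (wn n) < \<rho> / 2" "wn n \<noteq> 0" "cmod (wn n) = \<rho> / (2 + real (Suc n))" for n
  proof -
    show "cmod (wn n) < \<rho> / 2" unfolding wn3 using \<rho>(1) by (intro divide_strict_left_mono) auto
    have "cmod (wn n) > 0" unfolding wn3 using \<rho>(1) by (intro divide_pos_pos) auto
    then show "wn n \<noteq> 0" by auto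
  qed (rule wn3)
  have lim: "(\<lambda>n. 8 / \<rho>\<^sup>2 * cmod (wn n)) \<longlonglongrightarrow> 0"
  proof -
    have "(\<lambda>n. \<rho> / (2 + real (Suc n))) \<longlonglongrightarrow> 0" by real_asymp
    then show ?thesis unfolding wn(3) by (rule tendsto_mult_right_zero)
  qed
  define fn where "fn = (\<lambda>n \<zeta>. cd y (apply_rat (c \<zeta>) (ic x (wn n))) / wn n)"
  have fn: "cmod (fn n \<zeta> - ?D \<zeta>) \<le> 8 / \<rho>\<^sup>2 * cmod (wn n)" if "\<zeta> \<in> cball \<zeta>0 s" for n \<zeta>
  proof -
    have eq: "fn n \<zeta> - ?D \<zeta> = (cd y (apply_rat (c \<zeta>) (ic x (wn n))) - ?D \<zeta> * wn n) / wn n"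
      using wn(2)[of n] by (simp add: fn_def diff_divide_distrib)
    have "cmod (fn n \<zeta> - ?D \<zeta>) \<le> (8 / \<rho>\<^sup>2 * (cmod (wn n))\<^sup>2) / cmod (wn n)"
      unfolding eq norm_divide by (rule divide_right_mono[OF \<rho>(3)[OF that wn(1)[of n]]]) simp
    also have "\<dots> = 8 / \<rho>\<^sup>2 * cmod (wn n)" using wn(2)[of n] by (simp add: power2_eq_square)
    finally show ?thesis .
  qed
  have "?D holomorphic_on ball \<zeta>0 s"
  proof (rule holomorphic_uniform_sequence)
    show "fn n holomorphic_on ball \<zeta>0 s" for n
    proof -
      have "(\<lambda>\<zeta>. cd y ((\<lambda>x. x) (apply_rat (c \<zeta>) (ic x (wn n))))) holomorphic_on ball \<zeta>0 s"
      proof (rule disc_value_holomorphic[OF c hmap_id])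
        show "ball \<zeta>0 s \<subseteq> ball 0 1" using s(2) ball_subset_cball by blast
        show "apply_rat (c \<zeta>) (ic x (wn n)) \<noteq> antip y" if "\<zeta> \<in> ball \<zeta>0 s" for \<zeta>
          using \<rho>(2)[of \<zeta> "wn n"] that wn(1)[of n] \<rho>(1) by auto
      qed simp
      then show ?thesis unfolding fn_def by (intro holomorphic_intros) (use wn(2) in auto)
    qed
    fix \<zeta>1 assume \<zeta>1: "\<zeta>1 \<in> ball \<zeta>0 s"
    obtain d where d: "d > 0" "cball \<zeta>1 d \<subseteq> ball \<zeta>0 s" 
      using open_contains_cball[THEN iffD1, OF open_ball, THEN bspec, OF \<zeta>1] by (elim exE conjE)
    show "\<exists>d>0. cball \<zeta>1 d \<subseteq> ball \<zeta>0 s \<and> uniform_limit (cball \<zeta>1 d) fn ?D sequentially"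
    proof (intro exI[of _ d] conjI d)
      show "uniform_limit (cball \<zeta>1 d) fn ?D sequentially"
      proof (rule uniform_limitI)
        fix e :: real assume "e > 0"
        with lim have "\<forall>\<^sub>F n in sequentially. 8 / \<rho>\<^sup>2 * cmod (wn n) < e" by (rule order_tendstoD)
        then show "\<forall>\<^sub>F n in sequentially. \<forall>\<zeta>\<in>cball \<zeta>1 d. dist (fn n \<zeta>) (?D \<zeta>) < e"
        proof eventually_elim
          case (elim n)
          have "cball \<zeta>1 d \<subseteq> cball \<zeta>0 s" using d(2) ball_subset_cball by blast
          then show ?case using fn[of _ n] elim by (fastforce simp: dist_norm)
        qed
      qed
    qed
  qed simp
  then have "?D field_differentiable at \<zeta>0"
    by (rule holomorphic_on_imp_differentiable_at) (use s(1) in auto)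
  then show "?D field_differentiable at \<zeta>0 within ball 0 1" by (rule field_differentiable_at_within)
qed

lemma rich_disc_deriv:
  assumes "rich Y R" "g \<in> R" "x \<in> const_pts Y" "\<not> (\<lambda>g. sphere_deriv (apply_rat g) x) constant_on Y"
  obtains c where "holo_disc c" "c ` ball 0 1 \<subseteq> R" "c 0 = g"
    "\<And>\<zeta>. \<zeta> \<in> ball 0 1 \<Longrightarrow> apply_rat (c \<zeta>) x = apply_rat g x"
    "\<not> (\<lambda>\<zeta>. sphere_deriv (apply_rat (c \<zeta>)) x) constant_on ball 0 1"
    "(\<lambda>\<zeta>. sphere_deriv (apply_rat (c \<zeta>)) x) holomorphic_on ball 0 1"
proof -
  obtain c where c: "holo_disc c" "c ` ball 0 1 \<subseteq> R" "c 0 = g"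
    "\<not> (\<lambda>\<zeta>. sphere_deriv (apply_rat (c \<zeta>)) x) constant_on ball 0 1"
    using assms unfolding rich_def by blast
  have RY: "R \<subseteq> Y" using assms(1) by (simp add: rich_def)
  have y: "apply_rat (c \<zeta>) x = apply_rat g x" if "\<zeta> \<in> ball 0 1" for \<zeta>
    using assms(2,3) c(2) RY that unfolding const_pts_def by blast
  show ?thesis by (rule that[OF c(1-3) y c(4) disc_deriv_holomorphic[OF c(1) y]])
qed

lemma rich_deriv_interior:
  assumes "rich Y R" "g \<in> R" "x \<in> const_pts Y" "\<not> (\<lambda>g. sphere_deriv (apply_rat g) x) constant_on Y"
  shows "sphere_deriv (apply_rat g) x \<in> interior ((\<lambda>g. sphere_deriv (apply_rat g) x) ` R)"
proof -
  obtain c where c: "holo_disc c" "c ` ball 0 1 \<subseteq> R" "c 0 = g"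
    "\<not> (\<lambda>\<zeta>. sphere_deriv (apply_rat (c \<zeta>)) x) constant_on ball 0 1"
    "(\<lambda>\<zeta>. sphere_deriv (apply_rat (c \<zeta>)) x) holomorphic_on ball 0 1"
    using rich_disc_deriv[OF assms] by metis
  have "open ((\<lambda>\<zeta>. sphere_deriv (apply_rat (c \<zeta>)) x) ` ball 0 1)"
    using c(4) by (intro open_mapping_thm[OF c(5)]) auto
  moreover have "(\<lambda>\<zeta>. sphere_deriv (apply_rat (c \<zeta>)) x) ` ball 0 1 \<subseteq> (\<lambda>g. sphere_deriv (apply_rat g) x) ` R" using c(2) by auto
  moreover have "sphere_deriv (apply_rat g) x \<in> (\<lambda>\<zeta>. sphere_deriv (apply_rat (c \<zeta>)) x) ` ball 0 1"
    using c(3) by (intro image_eqI[of _ _ 0]) auto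
  ultimately show ?thesis by (meson interiorI)
qed

section \<open>Spreading around a point that is both attracting and repelling\<close>

text \<open>After division by w, the chart value of the word differs from the multiplier
  \<open>\<Phi> \<zeta>\<close> by a multiple of |w|, uniformly for \<zeta> in a disc on whose
  boundary \<Phi> stays away from a. A minimum modulus argument then finds \<zeta> that realizes a
  given m near a exactly, not only to first order.\<close>

lemma rich_fill:
  assumes R: "rich Y R" "g \<in> R" "x \<in> const_pts Y" "\<not> (\<lambda>g. sphere_deriv (apply_rat g) x) constant_on Y"
    and h: "hmap h" "h (apply_rat g x) = x"
    and a: "a = sphere_deriv h (apply_rat g x) * sphere_deriv (apply_rat g) x" "a \<noteq> 0"
  obtains \<rho> r where "\<rho> > 0" "r > 0"
    "\<And>w m. w \<noteq> 0 \<Longrightarrow> cmod w < r \<Longrightarrow> cmod (m - a) < \<rho> \<Longrightarrow> \<exists>g'\<in>R. h (apply_rat g' (ic x w)) = ic x (m * w)"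
proof -
  define y where "y = apply_rat g x"
  have hy: "h y = x" using h by (simp add: y_def)
  obtain c where c: "holo_disc c" "c ` ball 0 1 \<subseteq> R" "c 0 = g"
    "\<And>\<zeta>. \<zeta> \<in> ball 0 1 \<Longrightarrow> apply_rat (c \<zeta>) x = y"
    "\<not> (\<lambda>\<zeta>. sphere_deriv (apply_rat (c \<zeta>)) x) constant_on ball 0 1"
    "(\<lambda>\<zeta>. sphere_deriv (apply_rat (c \<zeta>)) x) holomorphic_on ball 0 1"
    using rich_disc_deriv[OF R] unfolding y_def by blast
  define b where "b = sphere_deriv h y"
  have b0: "b \<noteq> 0" using a by (auto simp: b_def y_def)
  define \<Phi> where "\<Phi> = (\<lambda>\<zeta>. b * sphere_deriv (apply_rat (c \<zeta>)) x)"
  have \<Phi>: "\<Phi> holomorphic_on ball 0 1" unfolding \<Phi>_def by (intro holomorphic_intros c(6))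
  have \<Phi>0: "\<Phi> 0 = a" by (simp add: \<Phi>_def c(3) a(1) b_def y_def)
  obtain \<beta> where \<beta>: "\<beta> \<in> ball 0 1" "\<Phi> \<beta> - a \<noteq> 0"
  proof (rule ccontr)
    assume "\<not> thesis"
    then have "\<Phi> \<zeta> = a" if "\<zeta> \<in> ball 0 1" for \<zeta> using \<open>\<And>\<beta>. \<beta> \<in> ball 0 1 \<Longrightarrow> \<Phi> \<beta> - a \<noteq> 0 \<Longrightarrow> thesis\<close>[OF that] by fastforce
    then have "sphere_deriv (apply_rat (c \<zeta>)) x = a / b" if "\<zeta> \<in> ball 0 1" for \<zeta>
      using that b0 by (simp add: \<Phi>_def field_simps)
    then show False using c(5) unfolding constant_on_def by blast
  qed
  have hol: "(\<lambda>\<zeta>. \<Phi> \<zeta> - a) holomorphic_on ball 0 1" by (intro holomorphic_intros \<Phi>)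
  obtain r1 where r1: "r1 > 0" "ball 0 r1 \<subseteq> ball (0::complex) 1" "\<And>z. z \<in> ball 0 r1 - {0} \<Longrightarrow> \<Phi> z - a \<noteq> 0"
    using isolated_zeros[OF hol open_ball connected_ball, of 0 \<beta>] \<beta> \<Phi>0 by auto
  define s where "s = r1 / 2"
  have s: "s > 0" "cball 0 s \<subseteq> ball (0::complex) 1" "sphere 0 s \<subseteq> ball (0::complex) r1 - {0}"
  proof -
    show s0: "s > 0" using r1(1) by (simp add: s_def)
    have "cball 0 s \<subseteq> ball (0::complex) r1" using r1(1) by (auto simp: s_def)
    then show "cball 0 s \<subseteq> ball (0::complex) 1" using r1(2) by blast
    show "sphere 0 s \<subseteq> ball (0::complex) r1 - {0}" using r1(1) by (auto simp: s_def)
  qed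
  have "continuous_on (sphere 0 s) (\<lambda>\<zeta>. cmod (\<Phi> \<zeta> - a))"
  proof (intro continuous_intros)
    have "sphere 0 s \<subseteq> ball (0::complex) 1" using s(3) r1(2) by blast
    then show "continuous_on (sphere 0 s) \<Phi>"
      using holomorphic_on_imp_continuous_on[OF \<Phi>] continuous_on_subset by blast
  qed
  then obtain z0 where z0: "z0 \<in> sphere 0 s" "\<And>z. z \<in> sphere 0 s \<Longrightarrow> cmod (\<Phi> z0 - a) \<le> cmod (\<Phi> z - a)"
    using continuous_attains_inf[of "sphere (0::complex) s" "\<lambda>\<zeta>. cmod (\<Phi> \<zeta> - a)"] s(1) by auto
  \<comment> \<open>A quarter, because at the boundary the first-order error and the shift from a to
    m cost less than \<rho> each, leaving more than 2 \<rho>, while at the centre the same two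
    errors add up to less than 2 \<rho>.\<close>
  define \<rho> where "\<rho> = cmod (\<Phi> z0 - a) / 4"
  have "\<Phi> z0 - a \<noteq> 0" by (rule r1(3)[OF subsetD[OF s(3) z0(1)]])
  then have \<rho>: "\<rho> > 0" by (simp add: \<rho>_def)
  have bd: "4 * \<rho> \<le> cmod (\<Phi> z - a)" if "z \<in> sphere 0 s" for z using z0(2)[OF that] by (simp add: \<rho>_def)
  obtain \<rho>0 where \<rho>0: "\<rho>0 > 0"
    "\<And>\<zeta> w. \<zeta> \<in> cball 0 s \<Longrightarrow> w \<in> ball 0 \<rho>0 \<Longrightarrow> h (apply_rat (c \<zeta>) (ic x w)) \<in> ic x ` ball 0 1"
    "\<And>\<zeta> w. \<zeta> \<in> cball 0 s \<Longrightarrow> cmod w < \<rho>0 / 2 \<Longrightarrow>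
       cmod (cd x (h (apply_rat (c \<zeta>) (ic x w))) - \<Phi> \<zeta> * w) \<le> 8 / \<rho>0\<^sup>2 * (cmod w)\<^sup>2"
    using disc_family_bound[OF c(1,4) h(1) compact_cball s(2), unfolded hy b_def[symmetric]]
    unfolding \<Phi>_def by metis
  define r where "r = min (\<rho>0 / 2) (\<rho>0\<^sup>2 / 8 * \<rho>)"
  have r: "r > 0" "r \<le> \<rho>0 / 2" "r \<le> \<rho>0\<^sup>2 / 8 * \<rho>" using \<rho> \<rho>0(1) by (auto simp: r_def)
  show ?thesis
  proof (rule that[OF \<rho> r(1)])
    fix w m :: complex assume w: "w \<noteq> 0" "cmod w < r" and m: "cmod (m - a) < \<rho>"
    define K where "K = (\<lambda>\<zeta>. cd x (h (apply_rat (c \<zeta>) (ic x w))))"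
    have wb: "w \<in> ball 0 \<rho>0" "cmod w < \<rho>0 / 2" using w(2) r(2) \<rho>0(1) by auto
    have "8 / \<rho>0\<^sup>2 * cmod w < 8 / \<rho>0\<^sup>2 * (\<rho>0\<^sup>2 / 8 * \<rho>)" using w(2) r(3) \<rho>0(1) by (intro mult_strict_left_mono) auto
    then have small: "8 / \<rho>0\<^sup>2 * cmod w < \<rho>" using \<rho>0(1) by simp
    have K: "cmod (K \<zeta> / w - \<Phi> \<zeta>) < \<rho>" if "\<zeta> \<in> cball 0 s" for \<zeta>
    proof -
      have eq: "K \<zeta> / w - \<Phi> \<zeta> = (K \<zeta> - \<Phi> \<zeta> * w) / w" using w(1) by (simp add: diff_divide_distrib)
      have kb: "cmod (K \<zeta> - \<Phi> \<zeta> * w) \<le> 8 / \<rho>0\<^sup>2 * (cmod w)\<^sup>2"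
        using \<rho>0(3)[OF that wb(2)] by (simp only: K_def)
      have "cmod (K \<zeta> / w - \<Phi> \<zeta>) \<le> (8 / \<rho>0\<^sup>2 * (cmod w)\<^sup>2) / cmod w"
        unfolding eq norm_divide by (rule divide_right_mono[OF kb]) simp
      also have "\<dots> = 8 / \<rho>0\<^sup>2 * cmod w" using w(1) by (simp add: power2_eq_square)
      finally show ?thesis using small by simp
    qed
    have val: "h (apply_rat (c \<zeta>) (ic x w)) \<noteq> antip x" if "\<zeta> \<in> cball 0 s" for \<zeta>
      using \<rho>0(2)[OF that wb(1)] by auto
    define F where "F = (\<lambda>\<zeta>. K \<zeta> / w - m)"
    have Kc: "continuous_on (cball 0 s) K" unfolding K_def
    proof (rule continuous_on_compose2[OF continuous_on_cd[of x "- {antip x}"]])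
      have "holo_into (ball 0 1) (\<lambda>\<zeta>. h (apply_rat (c \<zeta>) (ic x w)))"
        by (rule holo_into_hmap[OF _ h(1)]) (use c(1) in \<open>simp add: holo_disc_def\<close>)
      then show "continuous_on (cball 0 s) (\<lambda>\<zeta>. h (apply_rat (c \<zeta>) (ic x w)))"
        using s(2) continuous_on_subset unfolding holo_into_def by blast
      show "(\<lambda>\<zeta>. h (apply_rat (c \<zeta>) (ic x w))) ` cball 0 s \<subseteq> - {antip x}"
        by (intro image_subsetI) (use val in blast)
    qed simp
    have sb: "ball 0 s \<subseteq> cball (0::complex) s" by (rule ball_subset_cball)
    have sb1: "ball 0 s \<subseteq> ball (0::complex) 1" using s(2) sb by (rule subset_trans[rotated])
    have Kh: "K holomorphic_on ball 0 s" unfolding K_def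
      by (rule disc_value_holomorphic[OF c(1) h(1) sb1 open_ball val[OF subsetD[OF sb]]])
    obtain \<zeta> where \<zeta>: "\<zeta> \<in> ball 0 s" "F \<zeta> = 0"
    proof (rule holomorphic_contract_to_zero[of 0 s F])
      show "continuous_on (cball 0 s) F" unfolding F_def by (intro continuous_intros Kc) (use w(1) in auto)
      show "F holomorphic_on ball 0 s" unfolding F_def by (intro holomorphic_intros Kh) (use w(1) in auto)
      fix z :: complex assume z: "cmod (0 - z) = s"
      have z': "z \<in> sphere 0 s" "z \<in> cball 0 s" using z by auto
      have "F 0 = (K 0 / w - \<Phi> 0) - (m - a)" by (simp add: F_def \<Phi>0)
      then have "cmod (F 0) \<le> cmod (K 0 / w - \<Phi> 0) + cmod (m - a)" by (metis norm_triangle_ineq4)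
      also have "\<dots> < 2 * \<rho>" using K[of 0] m s(1) by simp
      finally have 1: "cmod (F 0) < 2 * \<rho>" .
      have eq: "\<Phi> z - a = F z - (K z / w - \<Phi> z) + (m - a)" by (simp add: F_def)
      have "cmod (\<Phi> z - a) \<le> cmod (F z - (K z / w - \<Phi> z)) + cmod (m - a)"
        unfolding eq by (rule norm_triangle_ineq)
      also have "cmod (F z - (K z / w - \<Phi> z)) \<le> cmod (F z) + cmod (K z / w - \<Phi> z)"
        by (rule norm_triangle_ineq4)
      finally have "2 * \<rho> < cmod (F z)" using bd[OF z'(1)] K[OF z'(2)] m by simp
      with 1 show "cmod (F 0) < cmod (F z)" by simp
    qed (use s(1) in auto)
    have "K \<zeta> = m * w" using \<zeta>(2) w(1) by (simp add: F_def field_simps)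
    then have "h (apply_rat (c \<zeta>) (ic x w)) = ic x (m * w)"
      using ic_cd[OF val[OF subsetD[OF sb \<zeta>(1)]]] by (simp add: K_def)
    moreover have "c \<zeta> \<in> R" using c(2) \<zeta>(1) sb1 by blast
    ultimately show "\<exists>g'\<in>R. h (apply_rat g' (ic x w)) = ic x (m * w)" by blast
  qed
qed

text \<open>For large i choose j such that s = q / (a^i b^j) has modulus in (|b|, 1]. Then |Ln s| is
  bounded independently of i, so the i-th root exp (Ln s / i) is close to 1 and can be absorbed by
  taking m = a exp (Ln s / i).\<close>

lemma multiplier_combination:
  fixes a b q :: complex
  assumes a: "cmod a > 1" and b: "0 < cmod b" "cmod b < 1" and \<rho>: "\<rho> > 0" and q: "q \<noteq> 0"
  obtains i j m where "cmod (m - a) < \<rho>" "cmod m > 1" "m ^ i * b ^ j = q"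
proof -
  define B where "B = \<bar>ln (cmod b)\<bar> + pi"
  \<comment> \<open>The second bound ensures |m| > 1.\<close>
  define \<epsilon> where "\<epsilon> = min \<rho> (cmod a - 1)"
  have B: "B > 0" using pi_gt_zero by (simp add: B_def add_nonneg_pos)
  have \<epsilon>: "\<epsilon> > 0" "\<epsilon> \<le> \<rho>" "\<epsilon> \<le> cmod a - 1" using a \<rho> by (auto simp: \<epsilon>_def)
  have "isCont exp (0::complex)" by simp
  moreover have "\<epsilon> / cmod a > 0" using a \<epsilon>(1) by (intro divide_pos_pos) auto
  ultimately obtain \<delta> where \<delta>: "\<delta> > 0" "\<And>z::complex. cmod z < \<delta> \<Longrightarrow> cmod (exp z - 1) < \<epsilon> / cmod a"
    unfolding continuous_at_eps_delta by (metis dist_norm diff_zero exp_zero)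
  obtain n1 where n1: "cmod q < cmod a ^ n1" using real_arch_pow[OF a] by blast
  obtain n2 where n2: "B / \<delta> < real n2" using reals_Archimedean2 by blast
  define i where "i = Suc (max n1 n2)"
  have i: "cmod q \<le> cmod a ^ i" "B / \<delta> < real i" "i > 0"
  proof -
    have "cmod a ^ n1 \<le> cmod a ^ i" using a by (intro power_increasing) (auto simp: i_def)
    then show "cmod q \<le> cmod a ^ i" using n1 by simp
    show "B / \<delta> < real i" using n2 by (simp add: i_def)
    show "i > 0" by (simp add: i_def)
  qed
  define t where "t = cmod q / cmod a ^ i"
  have ai: "cmod a ^ i > 0" by (rule zero_less_power) (use a in linarith)
  have t: "0 < t" "t \<le> 1" using i(1) ai q by (auto simp: t_def)
  obtain n where n: "cmod b ^ n < t" using real_arch_pow_inv[OF t(1) b(2)] by blast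
  \<comment> \<open>Here j = k - 1 is the last exponent with t <= |b|^j, so that |b| < |s| <=
    1.\<close>
  define k where "k = (LEAST n. cmod b ^ n < t)"
  have k: "cmod b ^ k < t" unfolding k_def using n by (rule LeastI)
  have "k \<noteq> 0" using k t(2) by (intro notI) simp
  then obtain j where j: "k = Suc j" using not0_implies_Suc by blast
  have j2: "t \<le> cmod b ^ j"
  proof (rule ccontr)
    assume "\<not> ?thesis"
    then have "k \<le> j" unfolding k_def by (intro Least_le) simp
    then show False using j by simp
  qed
  define s where "s = q / (a ^ i * b ^ j)"
  have bj: "cmod b ^ j > 0" using b by simp
  have s1: "cmod s = t / cmod b ^ j" by (simp add: s_def t_def norm_divide norm_mult norm_power)
  have s2: "cmod b < cmod s" "cmod s \<le> 1" "s \<noteq> 0"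
  proof -
    show "cmod b < cmod s" using k bj unfolding s1 j by (simp add: pos_less_divide_eq)
    then show "s \<noteq> 0" using b(1) by auto
    show "cmod s \<le> 1" unfolding s1 using j2 bj by simp
  qed
  have "ln (cmod b) < ln (cmod s)" "ln (cmod s) \<le> 0" using s2 b by auto
  then have "\<bar>Re (Ln s)\<bar> \<le> \<bar>ln (cmod b)\<bar>" using s2(3) by simp
  moreover have "\<bar>Im (Ln s)\<bar> \<le> pi" using mpi_less_Im_Ln[OF s2(3)] Im_Ln_le_pi[OF s2(3)] by simp
  ultimately have L: "cmod (Ln s) \<le> B" using cmod_le[of "Ln s"] by (simp add: B_def)
  define m where "m = a * exp (Ln s / of_nat i)"
  have "cmod (Ln s / of_nat i) = cmod (Ln s) / real i" by (simp add: norm_divide)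
  also have "\<dots> \<le> B / real i" using L by (intro divide_right_mono) auto
  also have "\<dots> < \<delta>" using i(2,3) \<delta>(1) B by (simp add: field_simps)
  finally have "cmod (exp (Ln s / of_nat i) - 1) < \<epsilon> / cmod a" by (rule \<delta>(2))
  moreover have "cmod a > 0" using a by linarith
  ultimately have "cmod a * cmod (exp (Ln s / of_nat i) - 1) < \<epsilon>"
    by (simp only: pos_less_divide_eq mult.commute)
  moreover have "m - a = a * (exp (Ln s / of_nat i) - 1)" by (simp add: m_def right_diff_distrib)
  ultimately have ma: "cmod (m - a) < \<epsilon>" by (simp add: norm_mult)
  have "a \<noteq> 0" "b \<noteq> 0" using a b by auto
  then have "a ^ i \<noteq> 0" "b ^ j \<noteq> 0" by simp_all
  have "m ^ i = a ^ i * exp (Ln s)"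
    using i(3) by (simp add: m_def power_mult_distrib flip: exp_of_nat_mult)
  then have mi: "m ^ i * b ^ j = q"
    using s2(3) \<open>a ^ i \<noteq> 0\<close> \<open>b ^ j \<noteq> 0\<close> by (simp add: s_def)
  show ?thesis
  proof (rule that[OF _ _ mi])
    show "cmod (m - a) < \<rho>" using ma \<epsilon>(2) by simp
    show "cmod m > 1" using ma \<epsilon>(3) norm_triangle_ineq2[of a "a - m"] by (simp add: norm_minus_commute)
  qed
qed

text \<open>The order matters: first the contracting steps, then the expanding ones. Since |m| > 1,
  the moduli of the second phase increase up to |w| < r, so no intermediate point leaves the disc in
  which the steps are available.\<close>

lemma punctured_disc_filled:
  assumes a: "cmod a > 1" and b: "0 < cmod b" "cmod b < 1" and \<rho>: "\<rho> > 0"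
    and A: "\<And>w m. w \<noteq> 0 \<Longrightarrow> cmod w < r \<Longrightarrow> cmod (m - a) < \<rho> \<Longrightarrow> ic x w \<in> H \<Longrightarrow> ic x (m * w) \<in> H"
    and B: "\<And>w. w \<noteq> 0 \<Longrightarrow> cmod w < r \<Longrightarrow> ic x w \<in> H \<Longrightarrow> ic x (b * w) \<in> H"
    and w0: "w0 \<noteq> 0" "cmod w0 < r" "ic x w0 \<in> H" and w: "w \<noteq> 0" "cmod w < r"
  shows "ic x w \<in> H"
proof -
  obtain i j m where m: "cmod (m - a) < \<rho>" "cmod m > 1" "m ^ i * b ^ j = w / w0"
    by (rule multiplier_combination[OF a b \<rho>, of "w / w0"]) (use w w0 in auto)
  have bk: "ic x (b ^ k * w0) \<in> H" for k
  proof (induction k)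
    case (Suc k)
    have "cmod b ^ k * cmod w0 \<le> 1 * cmod w0" using b by (intro mult_right_mono power_le_one) auto
    then have "cmod (b ^ k * w0) < r" using w0(2) by (simp add: norm_mult norm_power)
    moreover have "b ^ k * w0 \<noteq> 0" using b w0 by auto
    ultimately have "ic x (b * (b ^ k * w0)) \<in> H" using B Suc by blast
    then show ?case by (simp add: mult.assoc)
  qed (use w0 in simp)
  have fin: "m ^ i * (b ^ j * w0) = w" using m(3) w0(1) by (simp add: field_simps)
  have b0: "b ^ j * w0 \<noteq> 0" using b w0 by auto
  have "k \<le> i \<longrightarrow> ic x (m ^ k * (b ^ j * w0)) \<in> H" for k
  proof (induction k)
    case (Suc k)
    show ?case
    proof
      assume k: "Suc k \<le> i"
      have "cmod m ^ k \<le> cmod m ^ i" using m(2) k by (intro power_increasing) auto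
      then have "cmod (m ^ k * (b ^ j * w0)) \<le> cmod (m ^ i * (b ^ j * w0))"
        by (simp add: norm_mult norm_power mult_right_mono)
      then have "cmod (m ^ k * (b ^ j * w0)) < r" using fin w(2) by simp
      moreover have "m ^ k * (b ^ j * w0) \<noteq> 0" using b0 m(2) by auto
      ultimately have "ic x (m * (m ^ k * (b ^ j * w0))) \<in> H" using A m(1) Suc k by simp
      then show "ic x (m ^ Suc k * (b ^ j * w0)) \<in> H" by (simp add: mult.assoc)
    qed
  qed (use bk in simp)
  from this[of i] fin show ?thesis by simp
qed

section \<open>A repelling fixed point in the interior of an invariant set\<close>

lemma hmap_funpow: "hmap g \<Longrightarrow> hmap (g ^^ k)"
proof (induction k)
  case 0
  then show ?case using hmap_id by (simp add: id_def)
next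
  case (Suc k)
  have "hmap (g \<circ> g ^^ k)" by (rule hmap_comp) (use Suc in auto)
  then show ?case by (simp add: o_def)
qed

lemma sphere_deriv_funpow:
  assumes "hmap g" "g x = x"
  shows "(g ^^ k) x = x \<and> sphere_deriv (g ^^ k) x = sphere_deriv g x ^ k"
proof (induction k)
  case 0
  have "sphere_deriv (\<lambda>x. x) x = 1"
    using sphere_deriv_DERIV[OF hmap_id, of x] DERIV_unique[OF _ DERIV_ident] by simp
  then show ?case by (simp add: id_def)
next
  case (Suc k)
  have "sphere_deriv (g \<circ> g ^^ k) x = sphere_deriv g x * sphere_deriv g x ^ k"
    using sphere_deriv_comp[OF assms(1) hmap_funpow[OF assms(1)], of k x] Suc by simp
  then show ?case using Suc assms(2) by (simp add: o_def)
qed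

text \<open>Reading the iterates in a coordinate that sends a point of the omitted set to infinity
  makes them uniformly bounded on a disc around x. Cauchy's estimate then bounds their derivatives
  at x, which however grow like powers of the multiplier.\<close>

lemma no_interior_repelling_point:
  assumes g: "hmap g" "repelling_fixed_point g x" and H: "\<And>y. y \<in> H \<Longrightarrow> g y \<in> H"
    and U: "open U" "x \<in> U" "U \<subseteq> H" and A: "open A" "A \<noteq> {}" "A \<inter> H = {}"
  shows False
proof -
  have gx: "g x = x" "cmod (sphere_deriv g x) > 1" using g(2) by (auto simp: repelling_fixed_point_def)
  have "A \<noteq> {Infty}" using infinite_open_sphere[OF A(1,2)] by auto
  then obtain p where "p \<in> A" "p \<noteq> Infty" using A(2) by blast
  then obtain a where a: "Fin a \<in> A" by (cases p) auto
  have "open {w. ic (Fin 0) w \<in> A}" by (rule open_ic_vimage[OF A(1)])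
  then obtain \<rho> where \<rho>: "\<rho> > 0" "ball a \<rho> \<subseteq> {w. Fin w \<in> A}"
    using a open_contains_ball[of "{w. Fin w \<in> A}"] by (auto simp: ic_Fin_0)
  \<comment> \<open>Translation of the centre a of the omitted disc to 0; in the coordinate 1/z the
    image of H is then bounded.\<close>
  define T where "T = (\<lambda>x. case x of Fin z \<Rightarrow> Fin (z - a) | Infty \<Rightarrow> Infty)"
  have T: "hmap T"
  proof (rule hmapI)
    have "holo_into UNIV (\<lambda>w. ic (Fin (- a)) w)" by (rule holo_into_ic) auto
    then show "holo_into UNIV (\<lambda>w. T (Fin w))" by (rule holo_into_eq) (simp add: T_def ic_def)
    have "holo_into UNIV (\<lambda>w. if w = 0 then Infty else Fin ((1 - a * w) / w))"
      by (rule holo_into_quotient) (auto intro!: holomorphic_intros)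
    then show "holo_into UNIV (\<lambda>w. T (ic Infty w))"
      by (rule holo_into_eq) (auto simp: T_def ic_def field_simps)
  qed
  have Tinj: "T u = T v \<longleftrightarrow> u = v" for u v by (cases u; cases v) (auto simp: T_def)
  have Tanti: "T u = antip Infty \<longleftrightarrow> u = Fin a" for u by (cases u) (auto simp: T_def antip_def)
  have bound: "T y \<noteq> antip Infty" "cmod (cd Infty (T y)) < 2 / \<rho>" if "y \<in> H" for y
  proof -
    have yA: "y \<notin> A" using that A(3) by blast
    then show "T y \<noteq> antip Infty" using a Tanti by auto
    show "cmod (cd Infty (T y)) < 2 / \<rho>"
    proof (cases y)
      case (Fin z)
      have "\<not> cmod (z - a) < \<rho>"
        using yA Fin \<rho>(2) by (auto simp: dist_norm norm_minus_commute subset_iff)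
      then have "inverse (cmod (z - a)) \<le> inverse \<rho>" using \<rho>(1) by (intro le_imp_inverse_le) auto
      also have "\<dots> < 2 / \<rho>" using \<rho>(1) by (simp add: field_simps)
      finally show ?thesis using Fin by (simp add: T_def cd_def norm_inverse)
    next
      case Infty
      then show ?thesis using \<rho>(1) by (simp add: T_def cd_def)
    qed
  qed
  obtain r where r: "r > 0" "ic x ` ball 0 r \<subseteq> U" using obtain_ic_ball[OF U(1,2)] by blast
  define \<psi> where "\<psi> = (\<lambda>w. cd Infty (T (ic x w)))"
  have xa: "ic x w \<noteq> Fin a" if "w \<in> ball 0 r" for w
    using bound(1) that r(2) U(3) Tanti by blast
  have "\<psi> holomorphic_on ball 0 r" unfolding \<psi>_def
  proof (rule holo_into_cd_holomorphic)
    show "holo_into UNIV (\<lambda>w. T (ic x w))" using T by (simp add: hmap_def)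
  qed (use xa Tanti in auto)
  moreover have "inj_on \<psi> (ball 0 r)"
  proof (rule inj_onI)
    fix u v assume uv: "u \<in> ball 0 r" "v \<in> ball 0 r" "\<psi> u = \<psi> v"
    have "T (ic x u) = T (ic x v)"
      using ic_cd[of "T (ic x u)" Infty] ic_cd[of "T (ic x v)" Infty] uv xa Tanti unfolding \<psi>_def by metis
    then show "u = v" by (simp add: Tinj)
  qed
  ultimately have C0: "deriv \<psi> 0 \<noteq> 0" and \<psi>d: "(\<psi> has_field_derivative deriv \<psi> 0) (at 0)"
    using holomorphic_injective_imp_regular[of \<psi> "ball 0 r" 0] holomorphic_derivI[of \<psi> "ball 0 r" 0] r(1) by auto
  have gH: "(g ^^ k) y \<in> H" if "y \<in> H" for k y by (induction k) (use H that in auto)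
  have est: "cmod (deriv \<psi> 0) * cmod (sphere_deriv g x) ^ k \<le> 2 * (2 / \<rho>) / r" for k
  proof -
    let ?f = "\<lambda>w. cd Infty (T ((g ^^ k) (ic x w)))"
    have memH: "(g ^^ k) (ic x w) \<in> H" if "w \<in> ball 0 r" for w using gH that r(2) U(3) by blast
    have hk: "hmap (g ^^ k)" by (rule hmap_funpow[OF g(1)])
    have "?f holomorphic_on ball 0 r"
    proof (rule holo_into_cd_holomorphic)
      show "holo_into UNIV (\<lambda>w. T ((g ^^ k) (ic x w)))"
        by (rule holo_into_hmap[OF _ T]) (use hk in \<open>simp add: hmap_def\<close>)
    qed (use memH bound in auto)
    then have le: "cmod (deriv ?f 0) \<le> 2 * (2 / \<rho>) / r"
      by (rule Cauchy_deriv_bound[OF _ r(1)]) (use memH bound in auto)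
    have fk: "(g ^^ k) x = x" "sphere_deriv (g ^^ k) x = sphere_deriv g x ^ k"
      using sphere_deriv_funpow[OF g(1) gx(1)] by auto
    have inner: "((\<lambda>w. cd x ((g ^^ k) (ic x w))) has_field_derivative sphere_deriv g x ^ k) (at 0)"
      using sphere_deriv_DERIV[OF hk, of x] fk by simp
    have "(?f has_field_derivative deriv \<psi> 0 * sphere_deriv g x ^ k) (at 0)"
    proof (rule DERIV_local_eq)
      show "(\<psi> \<circ> (\<lambda>w. cd x ((g ^^ k) (ic x w))) has_field_derivative deriv \<psi> 0 * sphere_deriv g x ^ k) (at 0)"
        by (rule DERIV_chain[OF _ inner]) (use \<psi>d fk in simp)
      have "\<forall>\<^sub>F w in nhds 0. (g ^^ k) (ic x w) \<noteq> antip x"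
        by (rule eventually_neq_point[of UNIV "\<lambda>w. (g ^^ k) (ic x w)"])
          (use hk fk in \<open>auto simp: hmap_def holo_into_def\<close>)
      then show "\<forall>\<^sub>F w in nhds 0. ?f w = (\<psi> \<circ> (\<lambda>w. cd x ((g ^^ k) (ic x w)))) w"
        by eventually_elim (simp add: \<psi>_def ic_cd)
    qed
    then have "deriv ?f 0 = deriv \<psi> 0 * sphere_deriv g x ^ k" by (rule DERIV_imp_deriv)
    then show ?thesis using le by (simp add: norm_mult norm_power)
  qed
  obtain k where k: "2 * (2 / \<rho>) / r / cmod (deriv \<psi> 0) < cmod (sphere_deriv g x) ^ k"
    using real_arch_pow[OF gx(2)] by blast
  have "cmod (deriv \<psi> 0) > 0" using C0 by simp
  from pos_divide_less_eq[THEN iffD1, OF this k]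
  have "2 * (2 / \<rho>) / r < cmod (deriv \<psi> 0) * cmod (sphere_deriv g x) ^ k" by (simp only: mult.commute)
  then show False using est[of k] by simp
qed

section \<open>Common dynamics on the points with parameter independent orbits\<close>

text \<open>The empty word is included, so x itself is a point of constant value. All words of equal
  length agree at x, which will place the core inside S(W).\<close>

definition core :: "rational_map set \<Rightarrow> riemann_sphere set" where
  "core Y = {x. \<forall>gs. set gs \<subseteq> Y \<longrightarrow> fold apply_rat gs x \<in> const_pts Y}"

definition repelling_in :: "rational_map set \<Rightarrow> riemann_sphere \<Rightarrow> bool" where
  "repelling_in S x \<longleftrightarrow> (\<exists>g\<in>semigroup_generated S. repelling_fixed_point g x)"

text \<open>The multiplier must not vanish, because powers of it are used as factors of arbitrary
  nonzero numbers in \<open>multiplier_combination\<close>.\<close>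

definition contracting_in :: "rational_map set \<Rightarrow> riemann_sphere \<Rightarrow> bool" where
  "contracting_in S x \<longleftrightarrow> (\<exists>gs. gs \<noteq> [] \<and> set gs \<subseteq> S \<and> fold apply_rat gs x = x \<and>
     0 < cmod (sphere_deriv (fold apply_rat gs) x) \<and> cmod (sphere_deriv (fold apply_rat gs) x) < 1)"

lemma repelling_in_iff:
  "repelling_in S x \<longleftrightarrow> (\<exists>gs. gs \<noteq> [] \<and> set gs \<subseteq> S \<and> fold apply_rat gs x = x \<and>
     1 < cmod (sphere_deriv (fold apply_rat gs) x))"
  unfolding repelling_in_def semigroup_generated_eq repelling_fixed_point_def by blast

lemma repelling_in_mono: "S \<subseteq> T \<Longrightarrow> repelling_in S x \<Longrightarrow> repelling_in T x"
  unfolding repelling_in_def using semigroup_generated_mono by blast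

lemma contracting_in_mono: "S \<subseteq> T \<Longrightarrow> contracting_in S x \<Longrightarrow> contracting_in T x"
  unfolding contracting_in_def by blast

lemma sphere_deriv_fold_Cons:
  "sphere_deriv (fold apply_rat (g # gs)) x =
   sphere_deriv (fold apply_rat gs) (apply_rat g x) * sphere_deriv (apply_rat g) x"
  using sphere_deriv_comp[OF hmap_fold hmap_apply_rat, of gs g x] by (simp add: o_def)

lemma sphere_deriv_ident: "sphere_deriv (\<lambda>x. x) x = 1"
  using sphere_deriv_DERIV[OF hmap_id, of x] DERIV_unique[OF _ DERIV_ident] by simp

lemma interior_larger:
  fixes v :: complex assumes "v \<in> interior S" "v \<noteq> 0"
  shows "\<exists>z\<in>S. cmod v < cmod z"
proof -
  obtain e where e: "e > 0" "ball v e \<subseteq> S" using assms(1) by (auto simp: mem_interior)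
  define z where "z = v + of_real (e / 2 / cmod v) * v"
  have nv: "cmod v > 0" using assms(2) by simp
  have "cmod (z - v) = e / 2" using nv e(1) by (simp add: z_def norm_mult norm_divide)
  then have zS: "z \<in> S" using e by (auto simp: dist_norm norm_minus_commute subset_iff)
  have zeq: "z = of_real (1 + e / 2 / cmod v) * v" by (simp add: z_def algebra_simps)
  have "e / 2 / cmod v \<ge> 0" using nv e(1) by (intro divide_nonneg_pos) auto
  then have "\<bar>1 + e / 2 / cmod v\<bar> = 1 + e / 2 / cmod v" by linarith
  then have "cmod z = (1 + e / 2 / cmod v) * cmod v" unfolding zeq norm_mult norm_of_real by (simp only:)
  also have "\<dots> = cmod v + e / 2" using nv by (simp add: distrib_right)
  finally have "cmod z = cmod v + e / 2" .
  then show ?thesis using e(1) zS by (intro bexI[of _ z]) auto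
qed

lemma interior_smaller:
  fixes v :: complex assumes "v \<in> interior S" "v \<noteq> 0"
  shows "\<exists>z\<in>S. z \<noteq> 0 \<and> cmod z < cmod v"
proof -
  obtain e where e: "e > 0" "ball v e \<subseteq> S" using assms(1) by (auto simp: mem_interior)
  have nv: "cmod v > 0" using assms(2) by simp
  define d where "d = min (1/2) (e / 2 / cmod v)"
  have d: "0 < d" "d < 1" "d * cmod v < e"
  proof -
    show "0 < d" "d < 1" using e(1) nv by (auto simp: d_def)
    have "d * cmod v \<le> (e / 2 / cmod v) * cmod v" using nv by (intro mult_right_mono) (auto simp: d_def)
    then show "d * cmod v < e" using nv e(1) by simp
  qed
  define z where "z = of_real (1 - d) * v"
  have "z - v = - (of_real d * v)" by (simp add: z_def algebra_simps)
  then have "cmod (z - v) = d * cmod v" using d(1) by (simp add: norm_mult)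
  then have zS: "z \<in> S" using e d(3) by (auto simp: dist_norm norm_minus_commute subset_iff)
  have "cmod z = (1 - d) * cmod v" unfolding z_def norm_mult norm_of_real using d(2) by simp
  moreover have "d * cmod v > 0" using d(1) nv by (rule mult_pos_pos)
  ultimately have "cmod z < cmod v" by (simp add: algebra_simps)
  moreover have "z \<noteq> 0" using d(2) assms(2) by (auto simp: z_def simp del: of_real_diff)
  ultimately show ?thesis using zS by (intro bexI[of _ z] conjI)
qed

lemma interior_nonzero:
  fixes v :: complex assumes "v \<in> interior S" "e > 0"
  shows "\<exists>z\<in>S. z \<noteq> 0 \<and> cmod z \<le> cmod v + e"
proof (cases "v = 0")
  case True
  obtain r where r: "r > 0" "ball v r \<subseteq> S" using assms(1) by (auto simp: mem_interior)
  define u where "u = min (r / 2) e"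
  define z where "z = complex_of_real u"
  have u: "u > 0" "u \<le> e" "u < r" using r(1) assms(2) by (auto simp: u_def)
  have z: "cmod z = u" using u(1) by (simp add: z_def)
  then have "z \<in> S" using r True u(3) by (auto simp: subset_iff)
  moreover have "z \<noteq> 0" using z u(1) by auto
  moreover have "cmod z \<le> cmod v + e" using z u(2) norm_ge_zero[of v] by linarith
  ultimately show ?thesis by blast
next
  case False
  have "v \<in> S" using assms(1) interior_subset by blast
  then show ?thesis using False assms(2) by (intro bexI[of _ v]) auto
qed

text \<open>A finite set covered by its own image is permuted, and two powers of the permutation
  agree; the difference of the exponents is a period common to all points.\<close>

lemma finite_surj_periodic:
  assumes "finite T" "T \<subseteq> f ` T"
  obtains p where "p \<ge> 1" "\<And>x. x \<in> T \<Longrightarrow> (f ^^ p) x = x"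
proof -
  have eq: "f ` T = T"
  proof (rule sym, rule card_seteq)
    show "card (f ` T) \<le> card T" by (rule card_image_le[OF assms(1)])
  qed (use assms in auto)
  have pow: "(f ^^ k) ` T = T" for k
  proof (induction k)
    case (Suc k)
    have "(f ^^ Suc k) ` T = f ` (f ^^ k) ` T" by (simp add: image_comp)
    then show ?case using Suc eq by simp
  qed simp
  have "finite (PiE T (\<lambda>_. T))" using assms(1) by (intro finite_PiE) auto
  moreover have "(f ^^ k) y \<in> T" if "y \<in> T" for k y using imageI[OF that, of "f ^^ k"] pow[of k] by simp
  then have "range (\<lambda>k. restrict (f ^^ k) T) \<subseteq> PiE T (\<lambda>_. T)" by (intro image_subsetI restrict_PiE_iff[THEN iffD2] ballI)
  ultimately have "finite (range (\<lambda>k. restrict (f ^^ k) T))" by (rule finite_subset[rotated])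
  then have "\<not> inj (\<lambda>k. restrict (f ^^ k) T)" using finite_imageD infinite_UNIV_nat by blast
  then obtain i j where ij: "i < j" "restrict (f ^^ i) T = restrict (f ^^ j) T"
    unfolding inj_def by (metis linorder_neqE_nat)
  show ?thesis
  proof (rule that[of "j - i"])
    show "j - i \<ge> 1" using ij by simp
    fix x assume "x \<in> T"
    then obtain x' where x': "x' \<in> T" "x = (f ^^ i) x'" using pow[of i] by blast
    have "(f ^^ (j - i)) x = (f ^^ (j - i + i)) x'" unfolding x'(2) by (simp add: funpow_add)
    also have "\<dots> = (f ^^ i) x'" using ij(1) fun_cong[OF ij(2), of x'] x'(1) by simp
    finally show "(f ^^ (j - i)) x = x" using x'(2) by simp
  qed
qed

text \<open>What the density argument uses of the parameter space: levels \<open>R t\<close> of maps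
  along which values and derivatives move, with a compact set of maps between any two levels in
  place of closures. Niceness enters only at core points fixed by all words of some length.\<close>

locale level_family =
  fixes Y :: "rational_map set" and R :: "real \<Rightarrow> rational_map set"
  assumes fin: "finite (const_pts Y)"
    and rich: "0 < t \<Longrightarrow> t \<le> 1 \<Longrightarrow> rich Y (R t)"
    and ne: "0 < t \<Longrightarrow> t \<le> 1 \<Longrightarrow> R t \<noteq> {}"
    and cpt: "0 < s \<Longrightarrow> s < t \<Longrightarrow> t \<le> 1 \<Longrightarrow> \<exists>Q. compact Q \<and> R s \<subseteq> Q \<and> Q \<subseteq> R t"
    and nice: "x \<in> core Y \<Longrightarrow> p \<ge> 1 \<Longrightarrow> (\<And>gs. length gs = p \<Longrightarrow> set gs \<subseteq> Y \<Longrightarrow> fold apply_rat gs x = x) \<Longrightarrow>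
      \<not> (\<lambda>g. sphere_deriv (apply_rat g) x) constant_on Y \<or> (\<forall>g\<in>Y. sphere_deriv (apply_rat g) x = 0)"
begin

text \<open>The choice does not matter on points of constant value, where all maps of Y agree; on
  the core it is the common dynamics.\<close>

definition \<sigma> :: "riemann_sphere \<Rightarrow> riemann_sphere" where
  "\<sigma> = apply_rat (SOME g. g \<in> Y)"

definition Per :: "riemann_sphere set" where
  "Per = {x \<in> core Y. \<exists>p\<ge>1. (\<sigma> ^^ p) x = x}"

lemma R_subset: "0 < t \<Longrightarrow> t \<le> 1 \<Longrightarrow> R t \<subseteq> Y"
  using rich[of t] by (simp add: rich_def)

lemma R_mono: "0 < s \<Longrightarrow> s \<le> t \<Longrightarrow> t \<le> 1 \<Longrightarrow> R s \<subseteq> R t"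
  using cpt[of s t] by (cases "s = t") auto

lemma Y_some: "(SOME g. g \<in> Y) \<in> Y"
proof -
  have "Y \<noteq> {}" using ne[of 1] R_subset[of 1] by auto
  then show ?thesis by (simp add: some_in_eq)
qed

lemma core_const: "x \<in> core Y \<Longrightarrow> x \<in> const_pts Y"
  unfolding core_def by (auto dest: spec[of _ "[]"])

lemma finite_core: "finite (core Y)"
  using core_const finite_subset[OF _ fin] by blast

lemma const_step: "x \<in> const_pts Y \<Longrightarrow> g \<in> Y \<Longrightarrow> apply_rat g x = \<sigma> x"
  using Y_some unfolding const_pts_def \<sigma>_def by blast

lemma core_step: "x \<in> core Y \<Longrightarrow> g \<in> Y \<Longrightarrow> apply_rat g x = \<sigma> x"
  using core_const const_step by blast

lemma core_sigma: assumes "x \<in> core Y" shows "\<sigma> x \<in> core Y"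
  unfolding core_def
proof (intro CollectI allI impI)
  fix gs assume "set gs \<subseteq> Y"
  then have "set ((SOME g. g \<in> Y) # gs) \<subseteq> Y" using Y_some by simp
  then have "fold apply_rat ((SOME g. g \<in> Y) # gs) x \<in> const_pts Y" using assms unfolding core_def by blast
  then show "fold apply_rat gs (\<sigma> x) \<in> const_pts Y" by (simp add: \<sigma>_def)
qed

lemma core_if_sigma: assumes "x \<in> const_pts Y" "\<sigma> x \<in> core Y" shows "x \<in> core Y"
  unfolding core_def
proof (intro CollectI allI impI)
  fix gs assume gs: "set gs \<subseteq> Y"
  show "fold apply_rat gs x \<in> const_pts Y"
  proof (cases gs)
    case (Cons g hs)
    have "apply_rat g x = \<sigma> x" using const_step[OF assms(1)] gs Cons by simp
    then show ?thesis using assms(2) gs Cons unfolding core_def by simp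
  qed (use assms in simp)
qed

lemma core_funpow: "x \<in> core Y \<Longrightarrow> (\<sigma> ^^ k) x \<in> core Y"
  by (induction k) (auto intro: core_sigma)

lemma core_word: "x \<in> core Y \<Longrightarrow> set gs \<subseteq> Y \<Longrightarrow> fold apply_rat gs x = (\<sigma> ^^ length gs) x"
proof (induction gs arbitrary: x)
  case (Cons g gs)
  have "fold apply_rat (g # gs) x = fold apply_rat gs (\<sigma> x)" using core_step[of x g] Cons.prems by simp
  also have "\<dots> = (\<sigma> ^^ length gs) (\<sigma> x)" using Cons.IH core_sigma Cons.prems by simp
  finally show ?case by (simp add: funpow_swap1)
qed simp

lemma Per_core: "x \<in> Per \<Longrightarrow> x \<in> core Y"
  by (simp add: Per_def)

lemma finite_Per: "finite Per"
  using finite_core by (rule finite_subset[rotated]) (auto simp: Per_def)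

lemma Per_funpow: assumes "x \<in> Per" shows "(\<sigma> ^^ k) x \<in> Per"
proof -
  obtain p where p: "p \<ge> 1" "(\<sigma> ^^ p) x = x" "x \<in> core Y" using assms by (auto simp: Per_def)
  have "(\<sigma> ^^ p) ((\<sigma> ^^ k) x) = (\<sigma> ^^ k) ((\<sigma> ^^ p) x)"
    by (metis add.commute comp_apply funpow_add)
  then show ?thesis using p core_funpow by (auto simp: Per_def)
qed

lemma nice_Per:
  assumes "x \<in> Per" "g \<in> Y" "sphere_deriv (apply_rat g) x \<noteq> 0"
  shows "\<not> (\<lambda>g. sphere_deriv (apply_rat g) x) constant_on Y"
proof -
  obtain p where p: "p \<ge> 1" "(\<sigma> ^^ p) x = x" "x \<in> core Y" using assms(1) by (auto simp: Per_def)
  have "fold apply_rat gs x = x" if "length gs = p" "set gs \<subseteq> Y" for gs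
    using core_word[OF p(3) that(2)] that(1) p(2) by simp
  from nice[OF p(3,1) this] show ?thesis using assms(2,3) by blast
qed

lemma core_reaches_Per: assumes "x \<in> core Y" shows "\<exists>k\<ge>1. (\<sigma> ^^ k) x \<in> Per"
proof -
  have "range (\<lambda>k. (\<sigma> ^^ k) x) \<subseteq> core Y" using core_funpow[OF assms] by auto
  then have "finite (range (\<lambda>k. (\<sigma> ^^ k) x))" using finite_core finite_subset by blast
  then have "\<not> inj (\<lambda>k. (\<sigma> ^^ k) x)" using finite_imageD infinite_UNIV_nat by blast
  then obtain i j where ij: "i < j" "(\<sigma> ^^ i) x = (\<sigma> ^^ j) x"
    unfolding inj_def by (metis linorder_neqE_nat)
  have "(\<sigma> ^^ (j - i)) ((\<sigma> ^^ i) x) = (\<sigma> ^^ (j - i + i)) x" by (simp only: funpow_add comp_apply)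
  also have "\<dots> = (\<sigma> ^^ i) x" using ij by simp
  finally have "(\<sigma> ^^ i) x \<in> Per" using ij(1) core_funpow[OF assms] by (auto simp: Per_def intro!: exI[of _ "j - i"])
  \<comment> \<open>A further step makes the exponent positive, so that the passage is realized by
    an element of the semigroup.\<close>
  then have "(\<sigma> ^^ 1) ((\<sigma> ^^ i) x) \<in> Per" by (rule Per_funpow)
  then show ?thesis by (intro exI[of _ "Suc i"]) simp
qed

text \<open>Points with infinite branching: every word along their orbit can be modified to have a
  nonzero multiplier.\<close>

definition moving :: "riemann_sphere \<Rightarrow> bool" where
  "moving x \<longleftrightarrow> x \<in> core Y \<and> (\<forall>i. \<not> (\<lambda>g. sphere_deriv (apply_rat g) ((\<sigma> ^^ i) x)) constant_on Y)"

lemma moving_sigma: "moving x \<Longrightarrow> moving (\<sigma> x)"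
  unfolding moving_def using core_sigma by (metis comp_apply funpow_Suc_right)

lemma multiplier_zero:
  assumes "x \<in> core Y" "set gs \<subseteq> Y" "i < length gs" "\<forall>g\<in>Y. sphere_deriv (apply_rat g) ((\<sigma> ^^ i) x) = 0"
  shows "sphere_deriv (fold apply_rat gs) x = 0"
  using assms
proof (induction gs arbitrary: x i)
  case (Cons g gs)
  have gx: "apply_rat g x = \<sigma> x" using core_step Cons.prems by simp
  show ?case
  proof (cases i)
    case 0
    then have "sphere_deriv (apply_rat g) x = 0" using Cons.prems by simp
    then show ?thesis unfolding sphere_deriv_fold_Cons by simp
  next
    case (Suc k)
    have "sphere_deriv (fold apply_rat gs) (\<sigma> x) = 0"
    proof (rule Cons.IH[of "\<sigma> x" k])
      show "\<forall>g\<in>Y. sphere_deriv (apply_rat g) ((\<sigma> ^^ k) (\<sigma> x)) = 0"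
        using Cons.prems(4) Suc by (simp add: funpow_swap1)
    qed (use Cons.prems Suc core_sigma in auto)
    then show ?thesis unfolding sphere_deriv_fold_Cons gx by simp
  qed
qed simp

text \<open>If the derivative were constant in the parameter somewhere on the cycle, niceness would
  make it vanish for all maps, and then every multiplier around the cycle would vanish, the
  repelling one included.\<close>

lemma moving_if_repelling:
  assumes "x \<in> Per" "repelling_in (R t) x" "0 < t" "t \<le> 1"
  shows "moving x"
  unfolding moving_def
proof (intro conjI allI)
  show c: "x \<in> core Y" using assms Per_core by blast
  obtain gs where gs: "gs \<noteq> []" "set gs \<subseteq> R t" "fold apply_rat gs x = x" "1 < cmod (sphere_deriv (fold apply_rat gs) x)"
    using assms(2) unfolding repelling_in_iff by blast
  have gY: "set gs \<subseteq> Y" using gs(2) R_subset[OF assms(3,4)] by blast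
  have fix_x: "(\<sigma> ^^ length gs) x = x" using core_word[OF c gY] gs(3) by simp
  fix i
  show "\<not> (\<lambda>g. sphere_deriv (apply_rat g) ((\<sigma> ^^ i) x)) constant_on Y"
  proof
    assume const: "(\<lambda>g. sphere_deriv (apply_rat g) ((\<sigma> ^^ i) x)) constant_on Y"
    have zero: "\<forall>g\<in>Y. sphere_deriv (apply_rat g) ((\<sigma> ^^ i) x) = 0"
      using nice_Per[OF Per_funpow[OF assms(1)]] const by blast
    have "(\<sigma> ^^ (i mod length gs)) x = (\<sigma> ^^ i) x" by (rule funpow_mod_eq[OF fix_x])
    then have "sphere_deriv (fold apply_rat gs) x = 0"
      using multiplier_zero[OF c gY, of "i mod length gs"] zero gs(1) by simp
    then show False using gs(4) by simp
  qed
qed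

text \<open>Along a common orbit the modulus of a multiplier is a product to which each letter
  contributes independently, so choosing an extremal letter at every position is optimal;
  compactness of Q provides these letters.\<close>

lemma extremal_word:
  assumes Q: "compact Q" "Q \<noteq> {}" "Q \<subseteq> Y" and x: "x \<in> core Y"
  shows "\<exists>gs. length gs = n \<and> set gs \<subseteq> Q \<and> (\<forall>hs. length hs = n \<longrightarrow> set hs \<subseteq> Q \<longrightarrow>
      cmod (sphere_deriv (fold apply_rat hs) x) \<le> cmod (sphere_deriv (fold apply_rat gs) x))"
    and "\<exists>gs. length gs = n \<and> set gs \<subseteq> Q \<and> (\<forall>hs. length hs = n \<longrightarrow> set hs \<subseteq> Q \<longrightarrow>
      cmod (sphere_deriv (fold apply_rat gs) x) \<le> cmod (sphere_deriv (fold apply_rat hs) x))"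
proof -
  have "(\<exists>gs. length gs = n \<and> set gs \<subseteq> Q \<and> (\<forall>hs. length hs = n \<longrightarrow> set hs \<subseteq> Q \<longrightarrow>
      cmod (sphere_deriv (fold apply_rat hs) x) \<le> cmod (sphere_deriv (fold apply_rat gs) x))) \<and>
     (\<exists>gs. length gs = n \<and> set gs \<subseteq> Q \<and> (\<forall>hs. length hs = n \<longrightarrow> set hs \<subseteq> Q \<longrightarrow>
      cmod (sphere_deriv (fold apply_rat gs) x) \<le> cmod (sphere_deriv (fold apply_rat hs) x)))"
    using x
  proof (induction n arbitrary: x)
    case 0
    show ?case by (intro conjI exI[of _ "[]"]) auto
  next
    case (Suc n)
    have gx: "apply_rat g x = \<sigma> x" if "g \<in> Q" for g using core_step[OF Suc.prems] that Q(3) by blast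
    have "continuous_on Q (\<lambda>g. sphere_deriv (apply_rat g) x)" by (rule continuous_on_sphere_deriv[OF Q(1) gx])
    then have c: "continuous_on Q (\<lambda>g. cmod (sphere_deriv (apply_rat g) x))" by (rule continuous_on_norm)
    obtain g1 where g1: "g1 \<in> Q" "\<And>g. g \<in> Q \<Longrightarrow> cmod (sphere_deriv (apply_rat g) x) \<le> cmod (sphere_deriv (apply_rat g1) x)"
      using continuous_attains_sup[OF Q(1,2) c] by blast
    obtain g2 where g2: "g2 \<in> Q" "\<And>g. g \<in> Q \<Longrightarrow> cmod (sphere_deriv (apply_rat g2) x) \<le> cmod (sphere_deriv (apply_rat g) x)"
      using continuous_attains_inf[OF Q(1,2) c] by blast
    obtain gs1 where gs1: "length gs1 = n" "set gs1 \<subseteq> Q" "\<And>hs. length hs = n \<Longrightarrow> set hs \<subseteq> Q \<Longrightarrow>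
      cmod (sphere_deriv (fold apply_rat hs) (\<sigma> x)) \<le> cmod (sphere_deriv (fold apply_rat gs1) (\<sigma> x))"
      using Suc.IH[OF core_sigma[OF Suc.prems]] by blast
    obtain gs2 where gs2: "length gs2 = n" "set gs2 \<subseteq> Q" "\<And>hs. length hs = n \<Longrightarrow> set hs \<subseteq> Q \<Longrightarrow>
      cmod (sphere_deriv (fold apply_rat gs2) (\<sigma> x)) \<le> cmod (sphere_deriv (fold apply_rat hs) (\<sigma> x))"
      using Suc.IH[OF core_sigma[OF Suc.prems]] by blast
    have dec: "cmod (sphere_deriv (fold apply_rat (g # gs)) x) =
        cmod (sphere_deriv (fold apply_rat gs) (\<sigma> x)) * cmod (sphere_deriv (apply_rat g) x)" if "g \<in> Q" for g gs
      unfolding sphere_deriv_fold_Cons gx[OF that] norm_mult ..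
    have split: "\<exists>h hs'. hs = h # hs' \<and> h \<in> Q \<and> length hs' = n \<and> set hs' \<subseteq> Q" if "length hs = Suc n" "set hs \<subseteq> Q" for hs
      using that by (cases hs) auto
    have "cmod (sphere_deriv (fold apply_rat hs) x) \<le> cmod (sphere_deriv (fold apply_rat (g1 # gs1)) x) \<and>
        cmod (sphere_deriv (fold apply_rat (g2 # gs2)) x) \<le> cmod (sphere_deriv (fold apply_rat hs) x)"
      if hs0: "length hs = Suc n" "set hs \<subseteq> Q" for hs
    proof
      obtain h hs' where hs: "hs = h # hs'" "h \<in> Q" "length hs' = n" "set hs' \<subseteq> Q" using split[OF hs0] by blast
      show "cmod (sphere_deriv (fold apply_rat hs) x) \<le> cmod (sphere_deriv (fold apply_rat (g1 # gs1)) x)"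
        unfolding hs(1) dec[OF hs(2)] dec[OF g1(1)]
        by (intro mult_mono gs1(3) g1(2) hs) auto
      show "cmod (sphere_deriv (fold apply_rat (g2 # gs2)) x) \<le> cmod (sphere_deriv (fold apply_rat hs) x)"
        unfolding hs(1) dec[OF hs(2)] dec[OF g2(1)]
        by (intro mult_mono gs2(3) g2(2) hs) auto
    qed
    moreover have "length (g1 # gs1) = Suc n" "set (g1 # gs1) \<subseteq> Q" "length (g2 # gs2) = Suc n" "set (g2 # gs2) \<subseteq> Q"
      using g1(1) g2(1) gs1(1,2) gs2(1,2) by auto
    ultimately show ?case by blast
  qed
  then show "\<exists>gs. length gs = n \<and> set gs \<subseteq> Q \<and> (\<forall>hs. length hs = n \<longrightarrow> set hs \<subseteq> Q \<longrightarrow>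
      cmod (sphere_deriv (fold apply_rat hs) x) \<le> cmod (sphere_deriv (fold apply_rat gs) x))"
    and "\<exists>gs. length gs = n \<and> set gs \<subseteq> Q \<and> (\<forall>hs. length hs = n \<longrightarrow> set hs \<subseteq> Q \<longrightarrow>
      cmod (sphere_deriv (fold apply_rat gs) x) \<le> cmod (sphere_deriv (fold apply_rat hs) x))" by (rule conjunct1, rule conjunct2)
qed

text \<open>No word of period length p at level t has a multiplier above 1. Over a compact Q between
  the levels the maximum is attained, and were it 1, moving the first letter inside
  \<open>R t\<close> would push it beyond 1. The strict bound gives a trapped disc, at the price of
  passing from t to s.\<close>

lemma attracting_trap:
  assumes x: "x \<in> Per" "\<not> repelling_in (R t) x" and t: "0 < s" "s < t" "t \<le> 1" and W: "open W" "x \<in> W"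
  obtains p U where "x \<in> U" "U \<subseteq> W" "traps (R s) p U"
proof -
  obtain Q where Q: "compact Q" "R s \<subseteq> Q" "Q \<subseteq> R t" using cpt[OF t] by blast
  have QY: "Q \<subseteq> Y" using Q(3) R_subset[of t] t by auto
  have Qne: "Q \<noteq> {}" using Q(2) ne[of s] t by auto
  obtain p where p: "p \<ge> 1" "(\<sigma> ^^ p) x = x" and c: "x \<in> core Y" using x(1) by (auto simp: Per_def)
  have fixed: "fold apply_rat gs x = x" if "length gs = p" "set gs \<subseteq> Y" for gs
    using core_word[OF c that(2)] that(1) p(2) by simp
  have le1: "cmod (sphere_deriv (fold apply_rat gs) x) \<le> 1" if gs: "length gs = p" "set gs \<subseteq> R t" for gs
  proof (rule ccontr)
    assume "\<not> ?thesis"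
    then have "1 < cmod (sphere_deriv (fold apply_rat gs) x)" by simp
    moreover have "set gs \<subseteq> Y" using gs(2) R_subset[of t] t by auto
    moreover have "gs \<noteq> []" using gs(1) p(1) by auto
    ultimately have "repelling_in (R t) x" unfolding repelling_in_iff using gs fixed[OF gs(1)] by blast
    then show False using x(2) by blast
  qed
  obtain gs where gs: "length gs = p" "set gs \<subseteq> Q" "\<And>hs. length hs = p \<Longrightarrow> set hs \<subseteq> Q \<Longrightarrow>
      cmod (sphere_deriv (fold apply_rat hs) x) \<le> cmod (sphere_deriv (fold apply_rat gs) x)"
    using extremal_word(1)[OF Q(1) Qne QY c, of p] by blast
  have "cmod (sphere_deriv (fold apply_rat gs) x) < 1"
  proof (rule ccontr)
    assume "\<not> ?thesis"
    then have eq1: "cmod (sphere_deriv (fold apply_rat gs) x) = 1" using le1[OF gs(1)] gs(2) Q(3) by force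
    obtain g hs where g: "gs = g # hs" using gs(1) p(1) by (cases gs) auto
    have gR: "g \<in> R t" "set hs \<subseteq> R t" using gs(2) g Q(3) by auto
    have gY: "g \<in> Y" using gR(1) R_subset[of t] t by auto
    have D0: "sphere_deriv (apply_rat g) x \<noteq> 0"
    proof
      assume "sphere_deriv (apply_rat g) x = 0"
      then show False using eq1 unfolding g sphere_deriv_fold_Cons by simp
    qed
    have "sphere_deriv (apply_rat g) x \<in> interior ((\<lambda>g. sphere_deriv (apply_rat g) x) ` R t)"
      using t by (intro rich_deriv_interior[OF rich[of t] gR(1) core_const[OF c] nice_Per[OF x(1) gY D0]]) auto
    then obtain g' where g': "g' \<in> R t" "cmod (sphere_deriv (apply_rat g) x) < cmod (sphere_deriv (apply_rat g') x)"
      using interior_larger[OF _ D0] by blast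
    have g'Y: "g' \<in> Y" using g'(1) R_subset[of t] t by auto
    have "cmod (sphere_deriv (fold apply_rat hs) (\<sigma> x)) > 0"
    proof (rule ccontr)
      assume "\<not> ?thesis"
      then show False using eq1 unfolding g sphere_deriv_fold_Cons core_step[OF c gY] by simp
    qed
    then have "cmod (sphere_deriv (fold apply_rat (g # hs)) x) < cmod (sphere_deriv (fold apply_rat (g' # hs)) x)"
      unfolding sphere_deriv_fold_Cons core_step[OF c gY] core_step[OF c g'Y] norm_mult
      using g'(2) by (rule mult_strict_left_mono[rotated])
    moreover have "cmod (sphere_deriv (fold apply_rat (g' # hs)) x) \<le> 1"
      by (rule le1) (use gs(1) g g'(1) gR(2) in auto)
    ultimately show False using eq1 g by simp
  qed
  moreover have "fold apply_rat hs x = x" if "length hs = p" "set hs \<subseteq> Q" for hs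
    using fixed that QY by blast
  ultimately obtain U where U: "x \<in> U" "U \<subseteq> W" "traps Q p U"
    using attracting_disc_traps[OF Q(1) p(1) _ _ gs(3) W] by blast
  have "traps (R s) p U" using U(3) Q(2) unfolding traps_def by (meson subset_trans)
  with U show ?thesis by (intro that)
qed

lemma approximate_by_nonzero:
  assumes "moving x" "set gs \<subseteq> R t" "0 < t" "t \<le> 1" "e > 0"
  shows "\<exists>hs. length hs = length gs \<and> set hs \<subseteq> R t \<and> sphere_deriv (fold apply_rat hs) x \<noteq> 0 \<and>
     cmod (sphere_deriv (fold apply_rat hs) x) \<le> cmod (sphere_deriv (fold apply_rat gs) x) + e"
  using assms(1,2,5)
proof (induction gs arbitrary: x e)
  case Nil
  then show ?case by (intro exI[of _ "[]"]) (simp add: sphere_deriv_ident id_def)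
next
  case (Cons g gs)
  have c: "x \<in> core Y" using Cons.prems(1) by (simp add: moving_def)
  have stp: "apply_rat h x = \<sigma> x" if "h \<in> R t" for h
    using core_step[OF c] R_subset[OF assms(3,4)] that by blast
  have gR: "g \<in> R t" "set gs \<subseteq> R t" using Cons.prems(2) by auto
  let ?m = "cmod (sphere_deriv (fold apply_rat gs) (\<sigma> x))" and ?d = "cmod (sphere_deriv (apply_rat g) x)"
  \<comment> \<open>The perturbed product (m + \<delta>) (d + \<delta>) exceeds m d by at most
    \<delta> (m + d + 1) as long as \<delta> <= 1.\<close>
  define \<delta> where "\<delta> = min 1 (e / (?m + ?d + 1))"
  have pos: "?m + ?d + 1 > 0" by (smt (verit) norm_ge_zero)
  have \<delta>: "\<delta> > 0" "\<delta> \<le> 1" "\<delta> * (?m + ?d + 1) \<le> e"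
  proof -
    show "\<delta> > 0" "\<delta> \<le> 1" using pos Cons.prems(3) by (auto simp: \<delta>_def)
    have "\<delta> * (?m + ?d + 1) \<le> e / (?m + ?d + 1) * (?m + ?d + 1)"
      using pos by (intro mult_right_mono) (auto simp: \<delta>_def)
    then show "\<delta> * (?m + ?d + 1) \<le> e" using pos by simp
  qed
  obtain hs where hs: "length hs = length gs" "set hs \<subseteq> R t" "sphere_deriv (fold apply_rat hs) (\<sigma> x) \<noteq> 0"
     "cmod (sphere_deriv (fold apply_rat hs) (\<sigma> x)) \<le> ?m + \<delta>"
    using Cons.IH[OF moving_sigma[OF Cons.prems(1)] gR(2) \<delta>(1)] by blast
  have nc: "\<not> (\<lambda>g. sphere_deriv (apply_rat g) x) constant_on Y"
    using Cons.prems(1) unfolding moving_def by (auto dest: spec[of _ 0])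
  have "sphere_deriv (apply_rat g) x \<in> interior ((\<lambda>g. sphere_deriv (apply_rat g) x) ` R t)"
    by (rule rich_deriv_interior[OF rich[OF assms(3,4)] gR(1) core_const[OF c] nc])
  from interior_nonzero[OF this \<delta>(1)] obtain h where h: "h \<in> R t" "sphere_deriv (apply_rat h) x \<noteq> 0"
     "cmod (sphere_deriv (apply_rat h) x) \<le> ?d + \<delta>" by blast
  show ?case
  proof (intro exI[of _ "h # hs"] conjI)
    show "sphere_deriv (fold apply_rat (h # hs)) x \<noteq> 0"
      unfolding sphere_deriv_fold_Cons stp[OF h(1)] using hs(3) h(2) by simp
    have "cmod (sphere_deriv (fold apply_rat (h # hs)) x) \<le> (?m + \<delta>) * (?d + \<delta>)"
      unfolding sphere_deriv_fold_Cons stp[OF h(1)] norm_mult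
      using hs(4) h(3) \<delta>(1) by (intro mult_mono) auto
    also have "\<dots> = ?m * ?d + \<delta> * (?m + ?d + \<delta>)" by (simp add: algebra_simps)
    also have "\<dots> \<le> ?m * ?d + e"
    proof -
      have "\<delta> * (?m + ?d + \<delta>) \<le> \<delta> * (?m + ?d + 1)" using \<delta> by (intro mult_left_mono) auto
      then show ?thesis using \<delta>(3) by linarith
    qed
    also have "?m * ?d = cmod (sphere_deriv (fold apply_rat (g # gs)) x)"
      unfolding sphere_deriv_fold_Cons stp[OF gR(1)] norm_mult ..
    finally show "cmod (sphere_deriv (fold apply_rat (h # hs)) x) \<le> cmod (sphere_deriv (fold apply_rat (g # gs)) x) + e" .
  qed (use hs(1,2) h(1) in auto)
qed

text \<open>The counterpart of \<open>attracting_trap\<close> for the least modulus over Q. A value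
  below 1 could be made nonzero while staying below 1, and the value 1 could be lowered by moving
  the first letter; either would produce a contracting word.\<close>

lemma expanding_multipliers:
  assumes x: "x \<in> Per" "repelling_in (R t) x" "\<not> contracting_in (R t) x" and t: "0 < t" "t \<le> 1"
    and Q: "compact Q" "Q \<noteq> {}" "Q \<subseteq> R t" and p: "p \<ge> 1" "(\<sigma> ^^ p) x = x"
  obtains \<theta> where "\<theta> > 1" "\<And>gs. length gs = p \<Longrightarrow> set gs \<subseteq> Q \<Longrightarrow> \<theta> \<le> cmod (sphere_deriv (fold apply_rat gs) x)"
proof -
  have c: "x \<in> core Y" using x(1) Per_core by blast
  have QY: "Q \<subseteq> Y" using Q(3) R_subset[OF t] by blast
  have fixed: "fold apply_rat gs x = x" if "length gs = p" "set gs \<subseteq> Y" for gs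
    using core_word[OF c that(2)] that(1) p(2) by simp
  have nocon: "\<not> (0 < cmod (sphere_deriv (fold apply_rat gs) x) \<and> cmod (sphere_deriv (fold apply_rat gs) x) < 1)"
    if gs: "length gs = p" "set gs \<subseteq> R t" for gs
  proof
    assume "0 < cmod (sphere_deriv (fold apply_rat gs) x) \<and> cmod (sphere_deriv (fold apply_rat gs) x) < 1"
    moreover have "set gs \<subseteq> Y" using gs(2) R_subset[OF t] by blast
    moreover have "gs \<noteq> []" using gs(1) p(1) by auto
    ultimately have "contracting_in (R t) x" unfolding contracting_in_def using gs fixed[OF gs(1)] by blast
    then show False using x(3) by blast
  qed
  obtain gs where gs: "length gs = p" "set gs \<subseteq> Q" "\<And>hs. length hs = p \<Longrightarrow> set hs \<subseteq> Q \<Longrightarrow>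
      cmod (sphere_deriv (fold apply_rat gs) x) \<le> cmod (sphere_deriv (fold apply_rat hs) x)"
    using extremal_word(2)[OF Q(1,2) QY c, of p] by blast
  have gsR: "set gs \<subseteq> R t" using gs(2) Q(3) by blast
  let ?m = "cmod (sphere_deriv (fold apply_rat gs) x)"
  have "?m > 1"
  proof (rule ccontr)
    assume "\<not> ?thesis"
    then consider "?m < 1" | "?m = 1" by linarith
    then show False
    proof cases
      case 1
      obtain hs where hs: "length hs = length gs" "set hs \<subseteq> R t" "sphere_deriv (fold apply_rat hs) x \<noteq> 0"
        "cmod (sphere_deriv (fold apply_rat hs) x) \<le> ?m + (1 - ?m) / 2"
        using approximate_by_nonzero[OF moving_if_repelling[OF x(1,2) t] gsR t, of "(1 - ?m) / 2"] 1 by auto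
      have "cmod (sphere_deriv (fold apply_rat hs) x) < 1" using hs(4) 1 by (simp add: field_simps)
      then show False using nocon[of hs] hs gs(1) by simp
    next
      case 2
      obtain g hs where g: "gs = g # hs" using gs(1) p(1) by (cases gs) auto
      have gR: "g \<in> R t" "set hs \<subseteq> R t" using gsR g by auto
      have gY: "g \<in> Y" using gR(1) R_subset[OF t] by auto
      have D0: "sphere_deriv (apply_rat g) x \<noteq> 0"
      proof
        assume "sphere_deriv (apply_rat g) x = 0"
        then show False using 2 unfolding g sphere_deriv_fold_Cons by simp
      qed
      have "sphere_deriv (apply_rat g) x \<in> interior ((\<lambda>g. sphere_deriv (apply_rat g) x) ` R t)"
        by (rule rich_deriv_interior[OF rich[OF t] gR(1) core_const[OF c] nice_Per[OF x(1) gY D0]])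
      then obtain g' where g': "g' \<in> R t" "sphere_deriv (apply_rat g') x \<noteq> 0"
        "cmod (sphere_deriv (apply_rat g') x) < cmod (sphere_deriv (apply_rat g) x)"
        using interior_smaller[OF _ D0] by blast
      have g'Y: "g' \<in> Y" using g'(1) R_subset[OF t] by auto
      have hs0: "cmod (sphere_deriv (fold apply_rat hs) (\<sigma> x)) > 0"
      proof (rule ccontr)
        assume "\<not> ?thesis"
        then show False using 2 unfolding g sphere_deriv_fold_Cons core_step[OF c gY] by simp
      qed
      then have "cmod (sphere_deriv (fold apply_rat (g' # hs)) x) < cmod (sphere_deriv (fold apply_rat (g # hs)) x)"
        unfolding sphere_deriv_fold_Cons core_step[OF c gY] core_step[OF c g'Y] norm_mult
        using g'(3) by (rule mult_strict_left_mono[rotated])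
      then have "cmod (sphere_deriv (fold apply_rat (g' # hs)) x) < 1" using 2 g by simp
      moreover have "0 < cmod (sphere_deriv (fold apply_rat (g' # hs)) x)"
        unfolding sphere_deriv_fold_Cons core_step[OF c g'Y] norm_mult using hs0 g'(2) by simp
      moreover have "length (g' # hs) = p" "set (g' # hs) \<subseteq> R t" using gs(1) g g'(1) gR(2) by auto
      ultimately show False using nocon by blast
    qed
  qed
  then show ?thesis using gs(3) by (rule that)
qed

text \<open>Near x, \<open>rich_fill\<close> realizes multiplication by every number close to the
  multiplier of a word through x, by varying its first letter depending on the point. A repelling
  and a contracting word together fulfil the hypotheses of
  \<open>punctured_disc_filled\<close>.\<close>

lemma mixed_point_interior:
  assumes x: "x \<in> Per" "repelling_in (R t) x" "contracting_in (R t) x" and t: "0 < t" "t \<le> 1"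
    and H: "\<And>g y. g \<in> R t \<Longrightarrow> y \<in> H \<Longrightarrow> apply_rat g y \<in> H" "x \<in> H"
    and near: "\<And>r. r > 0 \<Longrightarrow> \<exists>w. w \<noteq> 0 \<and> cmod w < r \<and> ic x w \<in> H"
  shows "x \<in> interior H"
proof -
  have c: "x \<in> core Y" using x(1) Per_core by blast
  have HW: "fold apply_rat gs y \<in> H" if "set gs \<subseteq> R t" "y \<in> H" for gs y
    using that by (induction gs arbitrary: y) (auto intro: H(1))
  have fill: "\<exists>\<rho>>0. \<exists>r>0. \<forall>w m. w \<noteq> 0 \<longrightarrow> cmod w < r \<longrightarrow> cmod (m - sphere_deriv (fold apply_rat gs) x) < \<rho> \<longrightarrow>
      ic x w \<in> H \<longrightarrow> ic x (m * w) \<in> H"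
    if gs: "gs \<noteq> []" "set gs \<subseteq> R t" "fold apply_rat gs x = x" "sphere_deriv (fold apply_rat gs) x \<noteq> 0" for gs
  proof -
    obtain g hs where g: "gs = g # hs" using gs(1) by (cases gs) auto
    have gR: "g \<in> R t" "set hs \<subseteq> R t" using gs(2) g by auto
    have gY: "g \<in> Y" using gR(1) R_subset[OF t] by auto
    have D0: "sphere_deriv (apply_rat g) x \<noteq> 0"
    proof
      assume "sphere_deriv (apply_rat g) x = 0"
      then show False using gs(4) unfolding g sphere_deriv_fold_Cons by simp
    qed
    have hx: "fold apply_rat hs (apply_rat g x) = x" using gs(3) g by simp
    obtain \<rho> r where \<rho>: "\<rho> > 0" "r > 0" "\<And>w m. w \<noteq> 0 \<Longrightarrow> cmod w < r \<Longrightarrow> cmod (m - sphere_deriv (fold apply_rat gs) x) < \<rho> \<Longrightarrow>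
        \<exists>g'\<in>R t. fold apply_rat hs (apply_rat g' (ic x w)) = ic x (m * w)"
      using rich_fill[OF rich[OF t] gR(1) core_const[OF c] nice_Per[OF x(1) gY D0] hmap_fold hx
          sphere_deriv_fold_Cons gs(4)[unfolded g]] unfolding g by blast
    have "ic x (m * w) \<in> H" if w: "w \<noteq> 0" "cmod w < r" "cmod (m - sphere_deriv (fold apply_rat gs) x) < \<rho>" "ic x w \<in> H" for w m
    proof -
      obtain g' where g': "g' \<in> R t" "fold apply_rat hs (apply_rat g' (ic x w)) = ic x (m * w)" using \<rho>(3)[OF w(1-3)] by blast
      have "fold apply_rat hs (apply_rat g' (ic x w)) \<in> H" by (rule HW[OF gR(2) H(1)[OF g'(1) w(4)]])
      then show ?thesis using g'(2) by simp
    qed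
    then show ?thesis using \<rho>(1,2) by blast
  qed
  obtain gs where gs: "gs \<noteq> []" "set gs \<subseteq> R t" "fold apply_rat gs x = x" "1 < cmod (sphere_deriv (fold apply_rat gs) x)"
    using x(2) unfolding repelling_in_iff by blast
  obtain hs where hs: "hs \<noteq> []" "set hs \<subseteq> R t" "fold apply_rat hs x = x"
    "0 < cmod (sphere_deriv (fold apply_rat hs) x)" "cmod (sphere_deriv (fold apply_rat hs) x) < 1"
    using x(3) unfolding contracting_in_def by blast
  define a where "a = sphere_deriv (fold apply_rat gs) x"
  define b where "b = sphere_deriv (fold apply_rat hs) x"
  have "sphere_deriv (fold apply_rat gs) x \<noteq> 0" using gs(4) by auto
  from fill[OF gs(1-3) this] obtain \<rho> r1 where A: "\<rho> > 0" "r1 > 0" "\<And>w m. w \<noteq> 0 \<Longrightarrow> cmod w < r1 \<Longrightarrow> cmod (m - a) < \<rho> \<Longrightarrow>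
      ic x w \<in> H \<Longrightarrow> ic x (m * w) \<in> H" unfolding a_def by blast
  have "sphere_deriv (fold apply_rat hs) x \<noteq> 0" using hs(4) by auto
  from fill[OF hs(1-3) this] obtain \<rho>' r2 where B: "\<rho>' > 0" "r2 > 0" "\<And>w m. w \<noteq> 0 \<Longrightarrow> cmod w < r2 \<Longrightarrow> cmod (m - b) < \<rho>' \<Longrightarrow>
      ic x w \<in> H \<Longrightarrow> ic x (m * w) \<in> H" unfolding b_def by blast
  define r where "r = min r1 r2"
  have r: "r > 0" "r \<le> r1" "r \<le> r2" using A B by (auto simp: r_def)
  obtain w0 where w0: "w0 \<noteq> 0" "cmod w0 < r" "ic x w0 \<in> H" using near[OF r(1)] by blast
  have "ic x w \<in> H" if w: "cmod w < r" for w
  proof (cases "w = 0")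
    case False
    show ?thesis
    proof (rule punctured_disc_filled[of a b \<rho> r x H w0 w])
      show "cmod a > 1" "0 < cmod b" "cmod b < 1" using gs(4) hs(4,5) by (auto simp: a_def b_def)
      show "ic x (m * w) \<in> H" if "w \<noteq> 0" "cmod w < r" "cmod (m - a) < \<rho>" "ic x w \<in> H" for w m
        by (rule A(3)) (use that r in auto)
      show "ic x (b * w) \<in> H" if "w \<noteq> 0" "cmod w < r" "ic x w \<in> H" for w
        by (rule B(3)) (use that r B(1) in auto)
    qed (use A(1) w0 False w in auto)
  qed (use H(2) in simp)
  then have "ic x ` ball 0 r \<subseteq> H" by auto
  moreover have "open (ic x ` ball 0 r)" by (intro open_ic_image) simp
  moreover have "x \<in> ic x ` ball 0 r" using r(1) by (intro image_eqI[of _ _ 0]) auto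
  ultimately show ?thesis by (meson interiorI)
qed

end

section \<open>Density for finitely many generators\<close>

lemma traps_subset: "traps S n V \<Longrightarrow> T \<subseteq> S \<Longrightarrow> traps T n V"
  unfolding traps_def by (meson subset_trans)

lemma traps_multiple:
  assumes "traps S n V" "k \<ge> 1" shows "traps S (k * n) V"
proof -
  obtain K where n: "n \<ge> 1" "open V" and K: "compact K" "K \<subseteq> V"
    "\<And>gs x. length gs = n \<Longrightarrow> set gs \<subseteq> S \<Longrightarrow> x \<in> V \<Longrightarrow> fold apply_rat gs x \<in> K"
    using assms(1) unfolding traps_def by blast
  have step: "fold apply_rat gs x \<in> K" if "length gs = Suc j * n" "set gs \<subseteq> S" "x \<in> V" for gs x j
    using that
  proof (induction j arbitrary: gs x)
    case (Suc j)
    have "set (take n gs) \<subseteq> S" "set (drop n gs) \<subseteq> S" using Suc.prems(2) set_take_subset set_drop_subset by (metis subset_trans)+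
    moreover have "length (take n gs) = n" "length (drop n gs) = Suc j * n" using Suc.prems(1) by auto
    ultimately have "fold apply_rat (take n gs) x \<in> V" "length (drop n gs) = Suc j * n" "set (drop n gs) \<subseteq> S"
      using K(2) K(3)[of "take n gs" x] Suc.prems(3) by auto
    then have "fold apply_rat (drop n gs) (fold apply_rat (take n gs) x) \<in> K" using Suc.IH by blast
    moreover have "fold apply_rat gs x = fold apply_rat (drop n gs) (fold apply_rat (take n gs) x)"
      by (metis append_take_drop_id comp_apply fold_append)
    ultimately show ?case by simp
  qed (use K in auto)
  show ?thesis unfolding traps_def
  proof (intro conjI exI[of _ K] allI impI n(2) K(1,2))
    show "k * n \<ge> 1" using n(1) assms(2) by simp
    show "fold apply_rat gs x \<in> K" if "length gs = k * n" "set gs \<subseteq> S" "x \<in> V" for gs x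
      using step[of gs "k - 1" x] that assms(2) by simp
  qed
qed

text \<open>A trap for words of length n is a trap for all multiples of n, and n * m is a common
  multiple.\<close>

lemma traps_Un:
  assumes "traps S n V" "traps S m W" shows "traps S (n * m) (V \<union> W)"
proof -
  have nm: "n \<ge> 1" "m \<ge> 1" using assms by (auto simp: traps_def)
  have 1: "traps S (n * m) V" using traps_multiple[OF assms(1) nm(2)] by (simp add: mult.commute)
  have 2: "traps S (n * m) W" by (rule traps_multiple[OF assms(2) nm(1)])
  obtain K where K: "compact K" "K \<subseteq> V" "\<And>gs x. length gs = n * m \<Longrightarrow> set gs \<subseteq> S \<Longrightarrow> x \<in> V \<Longrightarrow> fold apply_rat gs x \<in> K"
    using 1 unfolding traps_def by blast
  obtain L where L: "compact L" "L \<subseteq> W" "\<And>gs x. length gs = n * m \<Longrightarrow> set gs \<subseteq> S \<Longrightarrow> x \<in> W \<Longrightarrow> fold apply_rat gs x \<in> L"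
    using 2 unfolding traps_def by blast
  have o: "open V" "open W" "n * m \<ge> 1" using 1 2 by (auto simp: traps_def)
  show ?thesis unfolding traps_def
    by (intro conjI exI[of _ "K \<union> L"] compact_Un open_Un o K(1) L(1)) (use K L in auto)
qed

lemma traps_Un_finite:
  assumes "finite I" "\<And>i. i \<in> I \<Longrightarrow> \<exists>n. traps S n (V i)" "\<exists>n. traps S n W"
  shows "\<exists>n. traps S n (W \<union> (\<Union>i\<in>I. V i))"
  using assms
proof (induction I rule: finite_induct)
  case (insert i I)
  obtain n where n: "traps S n (W \<union> (\<Union>i\<in>I. V i))" using insert by auto
  obtain m where m: "traps S m (V i)" using insert by auto
  have "W \<union> (\<Union>i\<in>insert i I. V i) = (W \<union> (\<Union>i\<in>I. V i)) \<union> V i" by auto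
  then show ?case using traps_Un[OF n m] by metis
qed simp

lemma compact_words_image:
  assumes "compact Q" "compact K"
  shows "compact {fold apply_rat gs x | gs x. length gs = n \<and> set gs \<subseteq> Q \<and> x \<in> K}"
  using assms(2)
proof (induction n arbitrary: K)
  case 0
  have "{fold apply_rat gs x | gs x. length gs = 0 \<and> set gs \<subseteq> Q \<and> x \<in> K} = K" by auto
  then show ?case using 0 by simp
next
  case (Suc n)
  let ?K = "(\<lambda>(g, x). apply_rat g x) ` (Q \<times> K)"
  have "{fold apply_rat gs x | gs x. length gs = Suc n \<and> set gs \<subseteq> Q \<and> x \<in> K} =
      {fold apply_rat gs x | gs x. length gs = n \<and> set gs \<subseteq> Q \<and> x \<in> ?K}" (is "?A = ?B")
  proof
    show "?A \<subseteq> ?B"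
    proof
      fix z assume "z \<in> ?A"
      then obtain gs x where z: "z = fold apply_rat gs x" "length gs = Suc n" "set gs \<subseteq> Q" "x \<in> K" by blast
      then obtain g hs where g: "gs = g # hs" by (cases gs) auto
      have "apply_rat g x \<in> ?K" using z g by (intro image_eqI[of _ _ "(g, x)"]) auto
      then show "z \<in> ?B" using z g by (intro CollectI exI[of _ hs] exI[of _ "apply_rat g x"]) auto
    qed
    show "?B \<subseteq> ?A"
    proof
      fix z assume "z \<in> ?B"
      then obtain gs y where z: "z = fold apply_rat gs y" "length gs = n" "set gs \<subseteq> Q" "y \<in> ?K" by blast
      then obtain g x where gx: "g \<in> Q" "x \<in> K" "y = apply_rat g x" by auto
      then show "z \<in> ?A" using z by (intro CollectI exI[of _ "g # gs"] exI[of _ x]) auto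
    qed
  qed
  moreover have "compact ?K"
    by (intro compact_continuous_image continuous_on_apply_rat_pair compact_Times assms(1) Suc.prems)
  ultimately show ?case using Suc.IH by simp
qed

lemma closed_never_enters: "open V \<Longrightarrow> closed (never_enters S V)"
proof -
  assume V: "open V"
  have eq: "never_enters S V = (\<Inter>g\<in>semigroup_generated S. - (g -` V))" by (auto simp: never_enters_def)
  show ?thesis unfolding eq
    by (intro closed_INT ballI closed_Compl open_vimage V hmap_continuous_on hmap_semigroup)
qed

lemma never_enters_antimono: "S \<subseteq> T \<Longrightarrow> never_enters T V \<subseteq> never_enters S V"
  using semigroup_generated_mono unfolding never_enters_def by blast

lemma never_enters_step: "x \<in> never_enters S V \<Longrightarrow> g \<in> S \<Longrightarrow> apply_rat g x \<in> never_enters S V"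
  by (rule never_enters_invariant[OF _ semigroup_generated.gen])

lemma word_interior:
  assumes "\<And>g y. g \<in> S \<Longrightarrow> y \<in> H \<Longrightarrow> apply_rat g y \<in> H" "set gs \<subseteq> S" "x \<in> interior H"
  shows "fold apply_rat gs x \<in> interior H"
proof -
  have HW: "fold apply_rat gs y \<in> H" if "set gs \<subseteq> S" "y \<in> H" for gs y
    using that by (induction gs arbitrary: y) (auto intro: assms(1))
  have "fold apply_rat gs ` interior H \<subseteq> H"
    using HW[OF assms(2)] interior_subset by blast
  moreover have "open (fold apply_rat gs ` interior H)" by (rule open_fold_image[OF open_interior])
  ultimately show ?thesis using assms(3) by (meson imageI interiorI)
qed

lemma trap_disjoint_never_enters:
  assumes "traps S n V" "S \<noteq> {}" "x \<in> V" shows "x \<notin> never_enters S V"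
proof -
  obtain f where f: "f \<in> S" using assms(2) by blast
  have n: "n \<ge> 1" using assms(1) by (simp add: traps_def)
  have s: "set (replicate n f) \<subseteq> S" using f by auto
  have "fold apply_rat (replicate n f) x \<in> V"
    using assms(1,3) s unfolding traps_def by (metis length_replicate subsetD)
  moreover have "fold apply_rat (replicate n f) \<in> semigroup_generated S" unfolding semigroup_generated_eq
    using s n by (intro CollectI exI[of _ "replicate n f"]) auto
  ultimately show ?thesis unfolding never_enters_def by blast
qed

text \<open>For a predicate that increases with the level, the second alternative means failure at
  every level up to t. It is applied to being repelling and to being contracting.\<close>

lemma eventually_constant_predicates:
  fixes B :: "real \<Rightarrow> 'a \<Rightarrow> bool"
  assumes "finite P"
  obtains t where "0 < t" "t \<le> 1" "\<And>x. x \<in> P \<Longrightarrow> (\<forall>s. 0 < s \<longrightarrow> s \<le> 1 \<longrightarrow> B s x) \<or> (\<exists>s. t \<le> s \<and> s \<le> 1 \<and> \<not> B s x)"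
proof -
  have "\<exists>t. 0 < t \<and> t \<le> 1 \<and> ((\<forall>s. 0 < s \<longrightarrow> s \<le> 1 \<longrightarrow> B s x) \<or> \<not> B t x)" for x
    by (metis zero_less_one order_refl)
  then obtain t where t: "\<And>x. 0 < t x" "\<And>x. t x \<le> 1" "\<And>x. (\<forall>s. 0 < s \<longrightarrow> s \<le> 1 \<longrightarrow> B s x) \<or> \<not> B (t x) x" by metis
  show ?thesis
  proof (rule that[of "Min (insert 1 (t ` P))"])
    show "0 < Min (insert 1 (t ` P))" "Min (insert 1 (t ` P)) \<le> 1" using assms t(1) by auto
    fix x assume "x \<in> P"
    then have "Min (insert 1 (t ` P)) \<le> t x" using assms by (intro Min_le) auto
    then show "(\<forall>s. 0 < s \<longrightarrow> s \<le> 1 \<longrightarrow> B s x) \<or> (\<exists>s. Min (insert 1 (t ` P)) \<le> s \<and> s \<le> 1 \<and> \<not> B s x)"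
      using t(2,3) by blast
  qed
qed

text \<open>All but countably many levels \<open>t\<close> will do: the sphere has a countable basis, and a basic set
  contained in some \<open>H t\<close> but in no later \<open>H t'\<close> rules out that one level only.\<close>

lemma good_level:
  fixes H :: "real \<Rightarrow> riemann_sphere set"
  assumes t: "0 < t2" and anti: "\<And>s t. 0 < s \<Longrightarrow> s \<le> t \<Longrightarrow> t \<le> t2 \<Longrightarrow> H t \<subseteq> H s"
  obtains t where "0 < t" "t < t2" "\<And>y. y \<in> interior (H t) \<Longrightarrow> \<exists>t'. t < t' \<and> t' < t2 \<and> y \<in> interior (H t')"
proof -
  obtain B :: "riemann_sphere set set" where B: "countable B"
    "\<And>U p. open U \<Longrightarrow> p \<in> U \<Longrightarrow> \<exists>b\<in>B. p \<in> b \<and> b \<subseteq> U" "\<And>b. b \<in> B \<Longrightarrow> open b"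
    using countable_basis_sphere by metis
  define bad where "bad = (\<lambda>b. {t. 0 < t \<and> t < t2 \<and> b \<subseteq> H t \<and> (\<forall>t'. t < t' \<and> t' < t2 \<longrightarrow> \<not> b \<subseteq> H t')})"
  have one: "s = t" if "s \<in> bad b" "t \<in> bad b" for s t b
  proof (rule ccontr)
    assume "s \<noteq> t"
    then consider "s < t" | "t < s" by linarith
    then show False using that unfolding bad_def by cases blast+
  qed
  have "countable (bad b)" for b
  proof (cases "bad b = {}")
    case False
    then obtain s where "s \<in> bad b" by blast
    then have "bad b \<subseteq> {s}" using one by blast
    then show ?thesis using countable_subset by blast
  qed simp
  then have "countable (\<Union>b\<in>B. bad b)" using B(1) by (intro countable_UN)
  moreover have "uncountable {0<..<t2}" using t by (simp add: uncountable_open_interval)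
  ultimately have "\<not> {0<..<t2} \<subseteq> (\<Union>b\<in>B. bad b)" using countable_subset by blast
  then obtain s where s0: "s \<in> {0<..<t2}" "s \<notin> (\<Union>b\<in>B. bad b)" by blast
  have s: "0 < s" "s < t2" "\<And>b. b \<in> B \<Longrightarrow> s \<notin> bad b" using s0 by auto
  show ?thesis
  proof (rule that[OF s(1,2)])
    fix y assume "y \<in> interior (H s)"
    then obtain b where b: "b \<in> B" "y \<in> b" "b \<subseteq> interior (H s)" using B(2)[OF open_interior] by blast
    have "b \<subseteq> H s" using b(3) interior_subset by blast
    then obtain t' where t': "s < t'" "t' < t2" "b \<subseteq> H t'" using s(3)[OF b(1)] s(1,2) unfolding bad_def by blast
    have "y \<in> interior (H t')" using b(2) t'(3) B(3)[OF b(1)] by (rule_tac interiorI)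
    then show "\<exists>t'. s < t' \<and> t' < t2 \<and> y \<in> interior (H t')" using t' by blast
  qed
qed

section \<open>Escape from the points of constant value\<close>

context level_family
begin

text \<open>An orbit with \<open>card (const_pts Y) + 1\<close> consecutive points of constant value
  repeats itself, so it never leaves them and x belongs to the core. The bound is uniform in x,
  which later gives one word length for a whole orbit closure.\<close>

lemma escape_const_pts:
  assumes "x \<notin> core Y"
  shows "\<exists>i \<le> card (const_pts Y). (\<sigma> ^^ i) x \<notin> const_pts Y \<and> (\<forall>k<i. (\<sigma> ^^ k) x \<in> const_pts Y)"
proof -
  have "\<exists>i \<le> card (const_pts Y). (\<sigma> ^^ i) x \<notin> const_pts Y"
  proof (rule ccontr)
    assume "\<not> ?thesis"
    then have all: "(\<sigma> ^^ i) x \<in> const_pts Y" if "i \<le> card (const_pts Y)" for i using that by blast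
    have "card ((\<lambda>i. (\<sigma> ^^ i) x) ` {..card (const_pts Y)}) \<le> card (const_pts Y)"
      using all by (intro card_mono fin) auto
    then have "\<not> inj_on (\<lambda>i. (\<sigma> ^^ i) x) {..card (const_pts Y)}"
      using card_image[of "\<lambda>i. (\<sigma> ^^ i) x" "{..card (const_pts Y)}"] by auto
    then obtain i j where ij: "i < j" "j \<le> card (const_pts Y)" "(\<sigma> ^^ i) x = (\<sigma> ^^ j) x"
      unfolding inj_on_def by (metis atMost_iff linorder_neqE_nat)
    have every: "\<exists>k < j. (\<sigma> ^^ m) x = (\<sigma> ^^ k) x" for m
    proof (induction m)
      case 0
      then show ?case using ij(1) by (intro exI[of _ 0]) auto
    next
      case (Suc m)
      then obtain k where k: "k < j" "(\<sigma> ^^ m) x = (\<sigma> ^^ k) x" by blast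
      then have e: "(\<sigma> ^^ Suc m) x = (\<sigma> ^^ Suc k) x" by simp
      show ?case
      proof (cases "Suc k = j")
        case True
        then show ?thesis using e ij(1,3) by (intro exI[of _ i]) simp
      next
        case False
        then show ?thesis using e k(1) by (intro exI[of _ "Suc k"]) simp
      qed
    qed
    have orb: "(\<sigma> ^^ m) x \<in> const_pts Y" for m using every[of m] all ij(2) by (metis order_less_imp_le order_trans)
    have "fold apply_rat gs ((\<sigma> ^^ m) x) \<in> const_pts Y" if "set gs \<subseteq> Y" for gs m
      using that
    proof (induction gs arbitrary: m)
      case (Cons g gs)
      have "apply_rat g ((\<sigma> ^^ m) x) = (\<sigma> ^^ Suc m) x" using const_step[OF orb, of g m] Cons.prems by simp
      then show ?case using Cons.IH[of "Suc m"] Cons.prems by simp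
    qed (use orb in simp)
    from this[of _ 0] have "x \<in> core Y" unfolding core_def by simp
    then show False using assms by blast
  qed
  then obtain i where i: "i \<le> card (const_pts Y)" "(\<sigma> ^^ i) x \<notin> const_pts Y" by blast
  define k where "k = (LEAST i. (\<sigma> ^^ i) x \<notin> const_pts Y)"
  have "(\<sigma> ^^ k) x \<notin> const_pts Y" unfolding k_def by (rule LeastI[of _ i]) (rule i(2))
  moreover have "k \<le> i" unfolding k_def by (rule Least_le) (rule i(2))
  moreover have "(\<sigma> ^^ j) x \<in> const_pts Y" if "j < k" for j using not_less_Least[OF that[unfolded k_def]] by blast
  ultimately show ?thesis using i(1) by (intro exI[of _ k]) auto
qed

text \<open>At the first point of non-constant value the next letter has its image in the interior
  of the values at that level, all of which lie in X; afterwards openness of rational maps preserves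
  the interior. Up to then the choice of letters does not matter.\<close>

lemma word_into_interior:
  assumes t: "0 < t" "t \<le> 1" and X: "\<And>g y. g \<in> R t \<Longrightarrow> y \<in> X \<Longrightarrow> apply_rat g y \<in> X"
    and gs: "set gs \<subseteq> R t" "i < length gs" "(\<sigma> ^^ i) x \<notin> const_pts Y" "\<forall>k<i. (\<sigma> ^^ k) x \<in> const_pts Y" and x: "x \<in> X"
  shows "fold apply_rat gs x \<in> interior X"
  using gs x
proof (induction gs arbitrary: x i)
  case (Cons g gs)
  have gR: "g \<in> R t" "set gs \<subseteq> R t" using Cons.prems by auto
  show ?case
  proof (cases "x \<in> const_pts Y")
    case False
    have "apply_rat g x \<in> interior ((\<lambda>g. apply_rat g x) ` R t)" by (rule rich_value_interior[OF rich[OF t] gR(1) False])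
    moreover have "(\<lambda>g. apply_rat g x) ` R t \<subseteq> X" using X Cons.prems(5) by blast
    ultimately have "apply_rat g x \<in> interior X" using interior_mono by blast
    then have "fold apply_rat gs (apply_rat g x) \<in> interior X"
      using word_interior[of "R t" X gs "apply_rat g x"] X gR(2) by blast
    then show ?thesis by simp
  next
    case True
    then have "i \<noteq> 0" using Cons.prems(3) by (cases i) auto
    then obtain j where j: "i = Suc j" using not0_implies_Suc by blast
    have gx: "apply_rat g x = \<sigma> x" using const_step[OF True] gR(1) R_subset[OF t] by blast
    have "fold apply_rat gs (\<sigma> x) \<in> interior X"
    proof (rule Cons.IH[of j "\<sigma> x"])
      show "(\<sigma> ^^ j) (\<sigma> x) \<notin> const_pts Y" using Cons.prems(3) j by (simp add: funpow_swap1)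
      show "\<forall>k<j. (\<sigma> ^^ k) (\<sigma> x) \<in> const_pts Y" using Cons.prems(4) j by (auto simp: funpow_swap1 dest: spec[of _ "Suc _"])
      show "\<sigma> x \<in> X" using X[OF gR(1) Cons.prems(5)] gx by simp
    qed (use gR Cons.prems j in auto)
    then show ?thesis using gx by simp
  qed
qed simp

end


lemma orbit_closure_invariant:
  assumes "g \<in> S" "z \<in> closure {h y | h. h \<in> semigroup_generated S}"
  shows "apply_rat g z \<in> closure {h y | h. h \<in> semigroup_generated S}"
proof -
  let ?O = "{h y | h. h \<in> semigroup_generated S}"
  have "apply_rat g ` closure ?O \<subseteq> closure ?O"
  proof (rule image_closure_subset)
    show "apply_rat g ` ?O \<subseteq> closure ?O"
    proof
      fix z assume "z \<in> apply_rat g ` ?O"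
      then obtain h where h: "h \<in> semigroup_generated S" "z = (apply_rat g \<circ> h) y" by auto
      have "apply_rat g \<circ> h \<in> semigroup_generated S"
        by (rule semigroup_generated.comp[OF semigroup_generated.gen[OF assms(1)] h(1)])
      then have "z \<in> ?O" using h(2) by blast
      then show "z \<in> closure ?O" by (rule subsetD[OF closure_subset])
    qed
  qed (auto intro: continuous_on_apply_rat)
  then show ?thesis using assms(2) by blast
qed

section \<open>Orbit closures of interior points avoid the core\<close>

context level_family
begin

text \<open>The common dynamics carries x to a periodic core point that is still interior to the
  exceptional set, hence outside A and repelling. This contradicts
  \<open>no_interior_repelling_point\<close>, with A as the omitted open set.\<close>

lemma core_not_interior:
  assumes t: "0 < t" "t \<le> 1" and A: "open A" "A \<noteq> {}" "A \<inter> never_enters (R t) A = {}"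
    and rep: "\<And>x. x \<in> Per \<Longrightarrow> x \<notin> A \<Longrightarrow> repelling_in (R t) x" and x: "x \<in> core Y"
  shows "x \<notin> interior (never_enters (R t) A)"
proof
  let ?H = "never_enters (R t) A"
  assume xi: "x \<in> interior ?H"
  obtain k where k: "(\<sigma> ^^ k) x \<in> Per" using core_reaches_Per[OF x] by blast
  obtain g where g: "g \<in> R t" using ne[OF t] by blast
  let ?p = "(\<sigma> ^^ k) x"
  have gs: "set (replicate k g) \<subseteq> R t" using g by auto
  have "fold apply_rat (replicate k g) x = ?p"
    using core_word[OF x, of "replicate k g"] gs R_subset[OF t] by simp
  then have pi: "?p \<in> interior ?H"
    using word_interior[of "R t" ?H "replicate k g" x] never_enters_step gs xi by metis
  then have pH: "?p \<in> ?H" using interior_subset by blast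
  then have "?p \<notin> A" using A(3) by blast
  then obtain h where h: "h \<in> semigroup_generated (R t)" "repelling_fixed_point h ?p"
    using rep[OF k] unfolding repelling_in_def by blast
  show False
    by (rule no_interior_repelling_point[OF hmap_semigroup[OF h(1)] h(2) _ open_interior pi interior_subset A])
      (rule never_enters_invariant[OF _ h(1)])
qed

text \<open>The finite set T of core points in the closure is permuted by \<sigma>, since core
  points of the closure have preimages in T. Its points are repelling but not contracting, so blocks
  of p letters from Q do not decrease the distance to T nearby. An orbit starting away from T
  therefore keeps a positive distance, and T is empty.\<close>

lemma orbit_closure_avoids_core:
  assumes t: "0 < t" "t < t'" "t' \<le> 1"
    and A: "open A" "A \<noteq> {}" "A \<inter> never_enters (R t) A = {}"
    and rep: "\<And>x. x \<in> Per \<Longrightarrow> x \<notin> A \<Longrightarrow> repelling_in (R t) x"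
    and con: "\<And>x. x \<in> Per \<Longrightarrow> contracting_in (R t') x \<Longrightarrow> contracting_in (R t) x"
    and y: "y \<in> interior (never_enters (R t') A)"
  shows "closure {g y | g. g \<in> semigroup_generated (R t)} \<inter> core Y = {}"
proof (rule ccontr)
  let ?H = "never_enters (R t) A" and ?H' = "never_enters (R t') A"
  define Orb where "Orb = {g y | g. g \<in> semigroup_generated (R t)}"
  define X where "X = closure Orb"
  define T where "T = X \<inter> core Y"
  assume "closure {g y | g. g \<in> semigroup_generated (R t)} \<inter> core Y \<noteq> {}"
  then obtain x0 where x0: "x0 \<in> T" by (auto simp: T_def X_def Orb_def)
  have t1: "t \<le> 1" and t'0: "0 < t'" using t by auto
  have Rt: "R t \<subseteq> R t'" using R_mono[of t t'] t by simp
  have HH: "?H' \<subseteq> ?H" by (rule never_enters_antimono[OF Rt])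
  have A': "A \<inter> ?H' = {}" using A(3) HH by blast
  have rep': "repelling_in (R t') x" if "x \<in> Per" "x \<notin> A" for x using repelling_in_mono[OF Rt rep[OF that]] .
  have core_int: "x \<notin> interior ?H" "x \<notin> interior ?H'" if "x \<in> core Y" for x
    using core_not_interior[OF t(1) t1 A rep that] core_not_interior[OF t'0 t(3) A(1,2) A' rep' that] by blast+
  obtain Q where Q: "compact Q" "R t \<subseteq> Q" "Q \<subseteq> R t'" using cpt[OF t] by blast
  have Qne: "Q \<noteq> {}" using Q(2) ne[OF t(1) t1] by blast
  have QY: "Q \<subseteq> Y" using Q(3) R_subset[OF t'0 t(3)] by blast
  have wordO: "fold apply_rat gs y \<in> insert y Orb" if "set gs \<subseteq> R t" for gs
  proof (cases "gs = []")
    case False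
    then have "fold apply_rat gs \<in> semigroup_generated (R t)" unfolding semigroup_generated_eq using that by blast
    then show ?thesis by (auto simp: Orb_def)
  qed simp
  have Oword: "\<exists>gs. gs \<noteq> [] \<and> set gs \<subseteq> R t \<and> z = fold apply_rat gs y" if "z \<in> Orb" for z
    using that unfolding Orb_def semigroup_generated_eq by blast
  have Oint: "z \<in> interior ?H'" if zO: "z \<in> Orb" for z
  proof -
    obtain gs where gs: "set gs \<subseteq> R t" "z = fold apply_rat gs y" using Oword[OF zO] by blast
    have "set gs \<subseteq> R t'" using gs(1) Rt by blast
    then show ?thesis using word_interior[of "R t'" ?H' gs y] never_enters_step y gs(2) by metis
  qed
  have XH': "X \<subseteq> ?H'" unfolding X_def
  proof (rule closure_minimal)
    show "Orb \<subseteq> ?H'" using Oint interior_subset by blast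
    show "closed ?H'" by (rule closed_never_enters[OF A(1)])
  qed
  have yH': "y \<in> ?H'" using y interior_subset by blast
  \<comment> \<open>A core value can only come from a core point: at a point of non-constant value
    the level t' would spread it to an interior point of the exceptional set, which a core point
    never is.\<close>
  have stp: "u \<in> core Y" if u: "u \<in> ?H'" "g \<in> Q" "apply_rat g u \<in> core Y" for u g
  proof (cases "u \<in> const_pts Y")
    case True
    have "apply_rat g u = \<sigma> u" using const_step[OF True] u(2) QY by blast
    then show ?thesis using core_if_sigma[OF True] u(3) by simp
  next
    case False
    have gR: "g \<in> R t'" using u(2) Q(3) by blast
    have "apply_rat g u \<in> interior ((\<lambda>g. apply_rat g u) ` R t')"
      by (rule rich_value_interior[OF rich[OF t'0 t(3)] gR False])
    moreover have "(\<lambda>g. apply_rat g u) ` R t' \<subseteq> ?H'" using never_enters_step[OF u(1)] by blast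
    ultimately have "apply_rat g u \<in> interior ?H'" using interior_mono by blast
    then show ?thesis using core_int(2)[OF u(3)] by blast
  qed
  have core_back: "u \<in> core Y" if "u \<in> ?H'" "set gs \<subseteq> Q" "fold apply_rat gs u \<in> core Y" for u gs
    using that
  proof (induction gs arbitrary: u)
    case (Cons g gs)
    have g: "g \<in> Q" "g \<in> R t'" using Cons.prems(2) Q(3) by auto
    have "apply_rat g u \<in> core Y"
      by (rule Cons.IH[OF never_enters_step[OF Cons.prems(1) g(2)]]) (use Cons.prems in auto)
    then show ?case using stp[OF Cons.prems(1) g(1)] by blast
  qed simp
  define Z where "Z = insert y X"
  have Z: "compact Z" "Z \<subseteq> ?H'" using XH' yH' by (auto simp: Z_def X_def intro!: compact_insert closed_imp_compact_sphere)
  have ycore: "y \<notin> core Y" using core_int(2) y by blast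
  have ZT: "u \<in> T" if "u \<in> Z" "u \<in> core Y" for u using that ycore by (auto simp: Z_def T_def)
  let ?ev = "\<lambda>(g, x). apply_rat g x"
  \<comment> \<open>The image of the compact set Q x Z is closed, so limit points of the orbit also
    have preimages in Z. This is what the compact set between the levels is for.\<close>
  have Xev: "X \<subseteq> ?ev ` (Q \<times> Z)" unfolding X_def
  proof (rule closure_minimal)
    have "compact (?ev ` (Q \<times> Z))"
      by (intro compact_continuous_image continuous_on_apply_rat_pair compact_Times Q(1) Z(1))
    then show "closed (?ev ` (Q \<times> Z))" by (rule compact_imp_closed)
    show "Orb \<subseteq> ?ev ` (Q \<times> Z)"
    proof
      fix z assume "z \<in> Orb"
      then obtain gs where gs: "gs \<noteq> []" "set gs \<subseteq> R t" "z = fold apply_rat gs y" using Oword by blast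
      have bl: "gs = butlast gs @ [last gs]" using gs(1) by simp
      have sets: "set (butlast gs) \<subseteq> R t" "last gs \<in> R t" using gs(1,2) by (auto dest: in_set_butlastD)
      have "z = apply_rat (last gs) (fold apply_rat (butlast gs) y)"
        unfolding gs(3) by (subst bl) simp
      moreover have "fold apply_rat (butlast gs) y \<in> Z"
        using wordO[OF sets(1)] closure_subset by (auto simp: Z_def X_def)
      ultimately show "z \<in> ?ev ` (Q \<times> Z)" using sets(2) Q(2) by (intro image_eqI[of _ _ "(last gs, fold apply_rat (butlast gs) y)"]) auto
    qed
  qed
  have finT: "finite T" using finite_core by (auto simp: T_def intro: finite_subset)
  have "T \<subseteq> \<sigma> ` T"
  proof
    fix z assume z: "z \<in> T"
    then have "z \<in> ?ev ` (Q \<times> Z)" using Xev by (auto simp: T_def)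
    then obtain g u where gu: "g \<in> Q" "u \<in> Z" "z = apply_rat g u" by auto
    have uc: "u \<in> core Y" using stp[OF _ gu(1)] gu Z(2) z by (auto simp: T_def)
    have "apply_rat g u = \<sigma> u" using core_step[OF uc] gu(1) QY by blast
    then show "z \<in> \<sigma> ` T" using ZT[OF gu(2) uc] gu(3) by simp
  qed
  then obtain p where p: "p \<ge> 1" "\<And>x. x \<in> T \<Longrightarrow> (\<sigma> ^^ p) x = x" using finite_surj_periodic[OF finT] by metis
  have TPer: "x \<in> Per" if "x \<in> T" for x using that p by (auto simp: Per_def T_def)
  have TA: "x \<notin> A" if "x \<in> T" for x using that XH' A' by (auto simp: T_def)
  have TO: "x \<notin> Orb" if "x \<in> T" for x using that Oint core_int(2) by (auto simp: T_def)
  have nocon: "\<not> contracting_in (R t') x" if xT: "x \<in> T" for x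
  proof
    assume c: "contracting_in (R t') x"
    have "x \<in> interior ?H"
    proof (rule mixed_point_interior[OF TPer[OF xT] rep[OF TPer[OF xT] TA[OF xT]] con[OF TPer[OF xT] c] t(1) t1])
      show "apply_rat g z \<in> ?H" if "g \<in> R t" "z \<in> ?H" for g z by (rule never_enters_step[OF that(2,1)])
      show "x \<in> ?H" using xT XH' HH by (auto simp: T_def)
      fix r :: real assume r: "r > 0"
      have "open (ic x ` ball 0 r)" by (intro open_ic_image) simp
      moreover have "x \<in> ic x ` ball 0 r" using r by (intro image_eqI[of _ _ 0]) auto
      ultimately have "ic x ` ball 0 r \<inter> Orb \<noteq> {}"
        using xT open_Int_closure_eq_empty[of "ic x ` ball 0 r" Orb] by (auto simp: T_def X_def)
      then obtain w where w: "cmod w < r" "ic x w \<in> Orb" by auto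
      have "w \<noteq> 0" using w(2) TO[OF xT] by (intro notI) simp
      moreover have "ic x w \<in> ?H" using Oint[OF w(2)] interior_subset HH by blast
      ultimately show "\<exists>w. w \<noteq> 0 \<and> cmod w < r \<and> ic x w \<in> ?H" using w(1) by blast
    qed
    then show False using core_int(1) xT by (auto simp: T_def)
  qed
  obtain s where s: "s > 0" "\<And>x z. x \<in> T \<Longrightarrow> z \<in> T \<Longrightarrow> dist x z < s \<Longrightarrow> x = z"
    using finite_separation[OF finT] by blast
  \<comment> \<open>Half the separation makes these balls disjoint: a block that starts near x and
    ends in \<open>W x\<close> can come close to no other point of T.\<close>
  define W where "W = (\<lambda>x::riemann_sphere. ball x (s / 2))"
  have W: "open (W x)" "x \<in> W x" for x using s(1) by (auto simp: W_def)
  have Wdisj: "x = z" if "x \<in> T" "z \<in> T" "v \<in> W x" "v \<in> W z" for x z v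
  proof (rule s(2)[OF that(1,2)])
    show "dist x z < s" using dist_triangle2[of x z v] that(3,4) by (simp add: W_def)
  qed
  have fixw: "fold apply_rat gs x = x" if "x \<in> T" "length gs = p" "set gs \<subseteq> Q" for x gs
    using core_word[of x gs] that p(2)[OF that(1)] QY by (auto simp: T_def)
  define expands where "expands = (\<lambda>x \<eta>. \<eta> > 0 \<and> (\<forall>gs w. length gs = p \<longrightarrow> set gs \<subseteq> Q \<longrightarrow> cmod w < \<eta> \<longrightarrow>
      fold apply_rat gs (ic x w) \<in> W x \<and> (\<exists>w'. fold apply_rat gs (ic x w) = ic x w' \<and> cmod w \<le> cmod w')) \<and>
      y \<notin> ic x ` ball 0 \<eta>)"
  have "\<exists>\<eta>. expands x \<eta>" if xT: "x \<in> T" for x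
  proof -
    obtain \<theta> where \<theta>: "\<theta> > 1" "\<And>gs. length gs = p \<Longrightarrow> set gs \<subseteq> Q \<Longrightarrow> \<theta> \<le> cmod (sphere_deriv (fold apply_rat gs) x)"
      using expanding_multipliers[OF TPer[OF xT] rep'[OF TPer[OF xT] TA[OF xT]] nocon[OF xT] t'0 t(3) Q(1) Qne Q(3) p(1) p(2)[OF xT]] by blast
    obtain \<eta>1 where \<eta>1: "\<eta>1 > 0" "\<And>gs w. length gs = p \<Longrightarrow> set gs \<subseteq> Q \<Longrightarrow> cmod w < \<eta>1 \<Longrightarrow>
     \<exists>w'. fold apply_rat gs (ic x w) = ic x w' \<and> cmod w \<le> cmod w'"
      using expanding_words[OF Q(1) fixw[OF xT] \<theta>] by blast
    have mem: "fold apply_rat gs x \<in> W x" if "length gs = p" "set gs \<subseteq> Q" for gs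
      using fixw[OF xT that] W(2) by simp
    obtain \<eta>2 where \<eta>2: "\<eta>2 > 0" "\<And>gs w. length gs = p \<Longrightarrow> set gs \<subseteq> Q \<Longrightarrow> w \<in> ball 0 \<eta>2 \<Longrightarrow> fold apply_rat gs (ic x w) \<in> W x"
      using words_chart_uniform[OF Q(1) W(1) mem] by blast
    have "x \<in> - {y}" using xT ycore by (auto simp: T_def)
    then obtain \<eta>3 where \<eta>3: "\<eta>3 > 0" "ic x ` ball 0 \<eta>3 \<subseteq> - {y}"
      using obtain_ic_ball[of "- {y}" x] by (auto simp: open_Compl)
    show ?thesis unfolding expands_def
    proof (intro exI[of _ "min \<eta>1 (min \<eta>2 \<eta>3)"] conjI allI impI)
      show "min \<eta>1 (min \<eta>2 \<eta>3) > 0" using \<eta>1(1) \<eta>2(1) \<eta>3(1) by simp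
      show "y \<notin> ic x ` ball 0 (min \<eta>1 (min \<eta>2 \<eta>3))" using \<eta>3(2) by auto
    qed (use \<eta>1(2) \<eta>2(2) in auto)
  qed
  then obtain \<eta> where \<eta>0: "\<And>x. x \<in> T \<Longrightarrow> expands x (\<eta> x)" by metis
  have \<eta>: "\<And>x. x \<in> T \<Longrightarrow> \<eta> x > 0"
    "\<And>x gs w. x \<in> T \<Longrightarrow> length gs = p \<Longrightarrow> set gs \<subseteq> Q \<Longrightarrow> cmod w < \<eta> x \<Longrightarrow> fold apply_rat gs (ic x w) \<in> W x"
    "\<And>x gs w. x \<in> T \<Longrightarrow> length gs = p \<Longrightarrow> set gs \<subseteq> Q \<Longrightarrow> cmod w < \<eta> x \<Longrightarrow> \<exists>w'. fold apply_rat gs (ic x w) = ic x w' \<and> cmod w \<le> cmod w'"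
    "\<And>x. x \<in> T \<Longrightarrow> y \<notin> ic x ` ball 0 (\<eta> x)"
    using \<eta>0 unfolding expands_def by blast+
  define V where "V = (\<Union>x\<in>T. ic x ` ball 0 (\<eta> x))"
  have openV: "open V" unfolding V_def by (intro open_UN ballI open_ic_image) simp
  have TV: "T \<subseteq> V"
  proof
    fix x assume x: "x \<in> T"
    have "x \<in> ic x ` ball 0 (\<eta> x)" using \<eta>(1)[OF x] by (intro image_eqI[of _ _ 0]) auto
    then show "x \<in> V" using x by (auto simp: V_def)
  qed
  have K0: "compact (Z - V)" by (rule compact_diff[OF Z(1) openV])
  \<comment> \<open>All values after at most p letters from outside V. The set is compact and misses
    T, as a core value forces a core starting point; so smaller discs around T avoid it.\<close>
  define Z1 where "Z1 = (\<Union>r\<in>{..p}. {fold apply_rat gs u | gs u. length gs = r \<and> set gs \<subseteq> Q \<and> u \<in> Z - V})"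
  have "compact Z1" unfolding Z1_def by (intro compact_UN finite_atMost compact_words_image Q(1) K0)
  then have Z1c: "open (- Z1)" using compact_imp_closed by blast
  have Z1T: "x \<notin> Z1" if "x \<in> T" for x
  proof
    assume "x \<in> Z1"
    then obtain gs u where gu: "x = fold apply_rat gs u" "set gs \<subseteq> Q" "u \<in> Z" "u \<notin> V" by (auto simp: Z1_def)
    have "u \<in> core Y" using core_back[of u gs] gu Z(2) that by (auto simp: T_def)
    then show False using ZT[OF gu(3)] TV gu(4) by blast
  qed
  have "\<exists>\<epsilon>>0. ic x ` ball 0 \<epsilon> \<subseteq> - Z1 \<inter> W x" if "x \<in> T" for x
    using obtain_ic_ball[of "- Z1 \<inter> W x" x] Z1c W Z1T[OF that] by (metis ComplI IntI open_Int)
  then obtain \<epsilon> where \<epsilon>: "\<And>x. x \<in> T \<Longrightarrow> \<epsilon> x > 0" "\<And>x. x \<in> T \<Longrightarrow> ic x ` ball 0 (\<epsilon> x) \<subseteq> - Z1 \<inter> W x" by metis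
  define V\<epsilon> where "V\<epsilon> = (\<Union>x\<in>T. ic x ` ball 0 (\<epsilon> x))"
  have V\<epsilon>Z1: "V\<epsilon> \<inter> Z1 = {}" using \<epsilon>(2) by (auto simp: V\<epsilon>_def)
  have yV: "y \<notin> V" using \<eta>(4) by (auto simp: V_def)
  \<comment> \<open>Strong induction on the length, removing the last p letters. If the shorter
    orbit point is outside V, the new one lies in Z1; if it is inside, it is already outside the
    smaller discs and the block does not bring it closer.\<close>
  have claim: "fold apply_rat gs y \<notin> V\<epsilon>" if "set gs \<subseteq> R t" for gs
    using that
  proof (induction "length gs" arbitrary: gs rule: less_induct)
    case less
    have gQ: "set gs \<subseteq> Q" using less.prems Q(2) by blast
    show ?case
    proof (cases "length gs \<le> p")
      case True
      have "fold apply_rat gs y \<in> Z1" unfolding Z1_def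
        by (rule UN_I[of "length gs"]) (use True gQ yV in \<open>auto simp: Z_def\<close>)
      then show ?thesis using V\<epsilon>Z1 by blast
    next
      case False
      define hs where "hs = take (length gs - p) gs"
      define ks where "ks = drop (length gs - p) gs"
      have hk: "gs = hs @ ks" "length ks = p" "length hs < length gs" using False p(1) by (auto simp: hs_def ks_def)
      have sets: "set hs \<subseteq> R t" "set ks \<subseteq> Q" using less.prems gQ hk(1) by auto
      let ?u = "fold apply_rat hs y"
      have uZ: "?u \<in> Z" using wordO[OF sets(1)] closure_subset by (auto simp: Z_def X_def)
      have eq: "fold apply_rat gs y = fold apply_rat ks ?u" by (simp add: hk(1))
      have IH: "?u \<notin> V\<epsilon>" by (rule less.hyps[OF hk(3) sets(1)])
      show ?thesis
      proof (cases "?u \<in> V")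
        case False
        have "fold apply_rat ks ?u \<in> Z1" unfolding Z1_def
          by (rule UN_I[of p]) (use hk(2) sets(2) uZ False in auto)
        then show ?thesis using V\<epsilon>Z1 eq by auto
      next
        case True
        then obtain x w where x: "x \<in> T" "?u = ic x w" "cmod w < \<eta> x" by (auto simp: V_def)
        obtain w' where w': "fold apply_rat ks (ic x w) = ic x w'" "cmod w \<le> cmod w'"
          using \<eta>(3)[OF x(1) hk(2) sets(2) x(3)] by blast
        have inW: "fold apply_rat ks (ic x w) \<in> W x" by (rule \<eta>(2)[OF x(1) hk(2) sets(2) x(3)])
        show ?thesis
        proof
          assume "fold apply_rat gs y \<in> V\<epsilon>"
          then obtain z where z: "z \<in> T" "fold apply_rat gs y \<in> ic z ` ball 0 (\<epsilon> z)" by (auto simp: V\<epsilon>_def)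
          have "fold apply_rat gs y \<in> W z" using \<epsilon>(2)[OF z(1)] z(2) by blast
          then have "z = x" using Wdisj[OF z(1) x(1)] inW eq x(2) by simp
          then have "ic x w' \<in> ic x ` ball 0 (\<epsilon> x)" using z(2) eq x(2) w'(1) by simp
          then have "cmod w' < \<epsilon> x" by auto
          then have "?u \<in> ic x ` ball 0 (\<epsilon> x)" using w'(2) x(2) by (intro image_eqI[of _ _ w]) auto
          then show False using IH x(1) by (auto simp: V\<epsilon>_def)
        qed
      qed
    qed
  qed
  have "open V\<epsilon>" unfolding V\<epsilon>_def by (intro open_UN ballI open_ic_image) simp
  moreover have "x0 \<in> V\<epsilon>"
  proof -
    have "x0 \<in> ic x0 ` ball 0 (\<epsilon> x0)" using \<epsilon>(1)[OF x0] by (intro image_eqI[of _ _ 0]) auto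
    then show ?thesis using x0 by (auto simp: V\<epsilon>_def)
  qed
  ultimately have "V\<epsilon> \<inter> Orb \<noteq> {}"
    using x0 open_Int_closure_eq_empty[of V\<epsilon> Orb] by (auto simp: T_def X_def)
  then obtain z where "z \<in> V\<epsilon>" "z \<in> Orb" by blast
  then show False using Oword[of z] claim by blast
qed

text \<open>The orbit closure is mapped into its own interior by all words of this length: at most
  \<open>card (const_pts Y)\<close> letters until a point of non-constant value, and one more to
  move it. Finiteness of \<Gamma> makes the set of values compact.\<close>

lemma interior_traps:
  assumes t: "0 < t" "t \<le> 1" and X: "compact X" "X \<inter> core Y = {}" "\<And>g y. g \<in> R t \<Longrightarrow> y \<in> X \<Longrightarrow> apply_rat g y \<in> X"
    and \<Gamma>: "finite \<Gamma>" "\<Gamma> \<subseteq> R t"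
  shows "traps \<Gamma> (Suc (card (const_pts Y))) (interior X)"
  unfolding traps_def
proof (intro conjI exI allI impI)
  let ?n = "Suc (card (const_pts Y))"
  let ?K = "{fold apply_rat gs x | gs x. length gs = ?n \<and> set gs \<subseteq> \<Gamma> \<and> x \<in> X}"
  show "compact ?K" by (rule compact_words_image[OF finite_imp_compact[OF \<Gamma>(1)] X(1)])
  show "?K \<subseteq> interior X"
  proof
    fix z assume "z \<in> ?K"
    then obtain gs x where z: "z = fold apply_rat gs x" "length gs = ?n" "set gs \<subseteq> \<Gamma>" "x \<in> X" by blast
    have "x \<notin> core Y" using z(4) X(2) by blast
    then obtain i where i: "i \<le> card (const_pts Y)" "(\<sigma> ^^ i) x \<notin> const_pts Y" "\<forall>k<i. (\<sigma> ^^ k) x \<in> const_pts Y"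
      using escape_const_pts by blast
    show "z \<in> interior X" unfolding z(1)
    proof (rule word_into_interior[OF t X(3) _ _ i(2,3) z(4)])
      show "set gs \<subseteq> R t" using z(3) \<Gamma>(2) by blast
      show "i < length gs" using z(2) i(1) by simp
    qed
  qed
  show "fold apply_rat gs x \<in> ?K" if "length gs = ?n" "set gs \<subseteq> \<Gamma>" "x \<in> interior X" for gs x
    using that interior_subset by blast
qed auto

end


section \<open>Choice of the levels and of the finite set of generators\<close>

context level_family
begin

text \<open>Both properties can only be lost as the level decreases, and \<open>Per\<close> is
  finite, so below some level no further loss occurs.\<close>

lemma exists_stable_level:
  obtains t where "0 < t" "t \<le> 1"
    "\<And>x s. x \<in> Per \<Longrightarrow> repelling_in (R t) x \<Longrightarrow> 0 < s \<Longrightarrow> s \<le> 1 \<Longrightarrow> repelling_in (R s) x"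
    "\<And>x s. x \<in> Per \<Longrightarrow> contracting_in (R t) x \<Longrightarrow> 0 < s \<Longrightarrow> s \<le> 1 \<Longrightarrow> contracting_in (R s) x"
proof -
  obtain a where a: "0 < a" "a \<le> 1" "\<And>x. x \<in> Per \<Longrightarrow>
      (\<forall>s. 0 < s \<longrightarrow> s \<le> 1 \<longrightarrow> repelling_in (R s) x) \<or> (\<exists>s. a \<le> s \<and> s \<le> 1 \<and> \<not> repelling_in (R s) x)"
    using eventually_constant_predicates[OF finite_Per, of "\<lambda>s. repelling_in (R s)"] by metis
  obtain b where b: "0 < b" "b \<le> 1" "\<And>x. x \<in> Per \<Longrightarrow>
      (\<forall>s. 0 < s \<longrightarrow> s \<le> 1 \<longrightarrow> contracting_in (R s) x) \<or> (\<exists>s. b \<le> s \<and> s \<le> 1 \<and> \<not> contracting_in (R s) x)"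
    using eventually_constant_predicates[OF finite_Per, of "\<lambda>s. contracting_in (R s)"] by metis
  define t where "t = min a b"
  have t: "0 < t" "t \<le> 1" using a b by (auto simp: t_def)
  show ?thesis
  proof (rule that[OF t])
    fix x and s :: real assume x: "x \<in> Per" and s: "0 < s" "s \<le> 1"
    show "repelling_in (R s) x" if r: "repelling_in (R t) x"
    proof (rule ccontr)
      assume "\<not> repelling_in (R s) x"
      then obtain s' where s': "a \<le> s'" "s' \<le> 1" "\<not> repelling_in (R s') x" using a(3)[OF x] s by blast
      have "R t \<subseteq> R s'" using s'(1,2) t(1) by (intro R_mono) (auto simp: t_def)
      then show False using repelling_in_mono r s'(3) by blast
    qed
    show "contracting_in (R s) x" if r: "contracting_in (R t) x"
    proof (rule ccontr)
      assume "\<not> contracting_in (R s) x"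
      then obtain s' where s': "b \<le> s'" "s' \<le> 1" "\<not> contracting_in (R s') x" using b(3)[OF x] s by blast
      have "R t \<subseteq> R s'" using s'(1,2) t(1) by (intro R_mono) (auto simp: t_def)
      then show False using contracting_in_mono r s'(3) by blast
    qed
  qed
qed

text \<open>Discs around the non-repelling periodic core points are added to A0. All of them are
  chosen to avoid one point q outside A0 and \<open>Per\<close>, which keeps the union different
  from the sphere; this is where the infinite complement of A0 is used.\<close>

lemma exists_attracting_region:
  assumes A0: "traps (R 1) n0 A0" "A0 \<noteq> {}" "infinite (- A0)" and t: "0 < s" "s < t" "t \<le> 1"
  obtains n A where "traps (R s) n A" "A0 \<subseteq> A" "A \<noteq> UNIV" "\<And>x. x \<in> Per \<Longrightarrow> x \<notin> A \<Longrightarrow> repelling_in (R t) x"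
proof -
  have "infinite (- A0 - Per)" using A0(3) finite_Per by (rule Diff_infinite_finite[rotated])
  then have "- A0 - Per \<noteq> {}" by (metis finite.emptyI)
  then obtain q where q: "q \<notin> A0" "q \<notin> Per" by blast
  define N where "N = {x \<in> Per. \<not> repelling_in (R t) x}"
  have N: "finite N" using finite_Per by (simp add: N_def)
  have "\<exists>U n. x \<in> U \<and> U \<subseteq> - {q} \<and> traps (R s) n U" if x: "x \<in> N" for x
  proof -
    have "x \<in> Per" "\<not> repelling_in (R t) x" "x \<in> - {q}" using x q(2) by (auto simp: N_def)
    moreover have "open (- {q})" by (simp add: open_Compl)
    ultimately show ?thesis using attracting_trap[OF _ _ t] by metis
  qed
  then obtain U n where U: "\<And>x. x \<in> N \<Longrightarrow> x \<in> U x" "\<And>x. x \<in> N \<Longrightarrow> U x \<subseteq> - {q}" "\<And>x. x \<in> N \<Longrightarrow> traps (R s) (n x) (U x)"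
    by metis
  have "R s \<subseteq> R 1" using t by (intro R_mono) auto
  then have "traps (R s) n0 A0" using A0(1) traps_subset by blast
  then have "\<exists>n. traps (R s) n (A0 \<union> (\<Union>x\<in>N. U x))" using U(3) by (intro traps_Un_finite[OF N]) blast+
  then obtain m where m: "traps (R s) m (A0 \<union> (\<Union>x\<in>N. U x))" by blast
  show ?thesis
  proof (rule that[OF m])
    have "q \<notin> A0 \<union> (\<Union>x\<in>N. U x)" using q(1) U(2) by blast
    then show "A0 \<union> (\<Union>x\<in>N. U x) \<noteq> UNIV" by blast
    show "repelling_in (R t) x" if "x \<in> Per" "x \<notin> A0 \<union> (\<Union>x\<in>N. U x)" for x
      using that U(1) unfolding N_def by blast
  qed blast
qed

text \<open>A point outside the core escapes twice: first to an interior point y of the exceptional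
  set of A, then, since the orbit closure of y misses the core, into the interior of that
  closure.\<close>

lemma never_enters_subset_core:
  assumes t: "0 < t" "t \<le> 1" and A: "open A"
    and X: "\<And>y. y \<in> interior (never_enters (R t) A) \<Longrightarrow> closure {g y | g. g \<in> semigroup_generated (R t)} \<inter> core Y = {}"
    and x: "x \<in> never_enters (R t) (A \<union> (\<Union>y\<in>interior (never_enters (R t) A). interior (closure {g y | g. g \<in> semigroup_generated (R t)})))"
  shows "x \<in> core Y"
proof (rule ccontr)
  let ?H = "never_enters (R t) A" and ?X = "\<lambda>y. closure {g y | g. g \<in> semigroup_generated (R t)}"
  assume xc: "x \<notin> core Y"
  obtain g where g: "g \<in> R t" using ne[OF t] by blast
  have xH: "x \<in> ?H" using x unfolding never_enters_def by blast
  obtain i where i: "(\<sigma> ^^ i) x \<notin> const_pts Y" "\<forall>k<i. (\<sigma> ^^ k) x \<in> const_pts Y" using escape_const_pts[OF xc] by blast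
  define y where "y = fold apply_rat (replicate (Suc i) g) x"
  have y: "y \<in> interior ?H" unfolding y_def
  proof (rule word_into_interior[OF t _ _ _ i xH])
    show "apply_rat h z \<in> ?H" if "h \<in> R t" "z \<in> ?H" for h z by (rule never_enters_step[OF that(2,1)])
  qed (use g in auto)
  \<comment> \<open>One more letter, because y itself need not lie in the closure of its orbit under
    the semigroup.\<close>
  define z where "z = apply_rat g y"
  have "apply_rat g \<in> semigroup_generated (R t)" by (rule semigroup_generated.gen[OF g])
  then have "z \<in> {g y | g. g \<in> semigroup_generated (R t)}" unfolding z_def by blast
  then have zX: "z \<in> ?X y" by (rule subsetD[OF closure_subset])
  then have "z \<notin> core Y" using X[OF y] by blast
  then obtain j where j: "(\<sigma> ^^ j) z \<notin> const_pts Y" "\<forall>k<j. (\<sigma> ^^ k) z \<in> const_pts Y" using escape_const_pts by blast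
  have w: "fold apply_rat (replicate (Suc j) g) z \<in> interior (?X y)"
  proof (rule word_into_interior[OF t _ _ _ j zX])
    show "apply_rat h z \<in> ?X y" if "h \<in> R t" "z \<in> ?X y" for h z by (rule orbit_closure_invariant[OF that])
  qed (use g in auto)
  define gs where "gs = replicate (Suc i) g @ g # replicate (Suc j) g"
  have "fold apply_rat gs x = fold apply_rat (replicate (Suc j) g) z"
    unfolding gs_def z_def y_def by (simp only: fold_append comp_apply fold_simps)
  then have "fold apply_rat gs x \<in> interior (?X y)" using w by simp
  moreover have "fold apply_rat gs \<in> semigroup_generated (R t)" unfolding semigroup_generated_eq
    using g by (intro CollectI exI[of _ gs]) (auto simp: gs_def)
  ultimately show False using x y unfolding never_enters_def by blast
qed

theorem exists_wms_generators:
  assumes A0: "traps (R 1) n0 A0" "A0 \<noteq> {}" "infinite (- A0)"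
    and G0: "finite G0" "\<And>t. 0 < t \<Longrightarrow> t \<le> 1 \<Longrightarrow> G0 \<subseteq> R t"
  obtains \<Gamma> where "finite \<Gamma>" "G0 \<subseteq> \<Gamma>" "\<Gamma> \<subseteq> R 1" "wms \<Gamma>"
proof -
  obtain t1 where t1: "0 < t1" "t1 \<le> 1"
    "\<And>x s. x \<in> Per \<Longrightarrow> repelling_in (R t1) x \<Longrightarrow> 0 < s \<Longrightarrow> s \<le> 1 \<Longrightarrow> repelling_in (R s) x"
    "\<And>x s. x \<in> Per \<Longrightarrow> contracting_in (R t1) x \<Longrightarrow> 0 < s \<Longrightarrow> s \<le> 1 \<Longrightarrow> contracting_in (R s) x"
    using exists_stable_level by blast
  \<comment> \<open>Strictly below t1: the absence of repelling words at t1 yields trapped discs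
    only for smaller levels.\<close>
  define t2 where "t2 = t1 / 2"
  have t2: "0 < t2" "t2 < t1" using t1(1) by (auto simp: t2_def)
  obtain n A where A: "traps (R t2) n A" "A0 \<subseteq> A" "A \<noteq> UNIV" "\<And>x. x \<in> Per \<Longrightarrow> x \<notin> A \<Longrightarrow> repelling_in (R t1) x"
    using exists_attracting_region[OF A0 t2 t1(2)] by metis
  have Ao: "open A" using A(1) by (simp add: traps_def)
  have Ane: "A \<noteq> {}" using A(2) A0(2) by blast
  have anti: "never_enters (R t) A \<subseteq> never_enters (R s) A" if "0 < s" "s \<le> t" "t \<le> t2" for s t
    by (rule never_enters_antimono[OF R_mono]) (use that t2 t1(2) in auto)
  obtain t where t: "0 < t" "t < t2" "\<And>y. y \<in> interior (never_enters (R t) A) \<Longrightarrow>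
      \<exists>t'. t < t' \<and> t' < t2 \<and> y \<in> interior (never_enters (R t') A)"
    using good_level[OF t2(1), of "\<lambda>s. never_enters (R s) A"] anti by metis
  have tl: "t \<le> 1" using t t2 t1(2) by linarith
  let ?H = "never_enters (R t) A"
  define X where "X = (\<lambda>y. closure {g y | g. g \<in> semigroup_generated (R t)})"
  have Rt2: "R t \<subseteq> R t2" using t t2 t1(2) by (intro R_mono) auto
  have At: "traps (R t) n A" by (rule traps_subset[OF A(1) Rt2])
  have AH: "A \<inter> ?H = {}" using trap_disjoint_never_enters[OF At ne[OF t(1) tl]] by blast
  have rep: "repelling_in (R t) x" if "x \<in> Per" "x \<notin> A" for x
    by (rule t1(3)[OF that(1) A(4)[OF that] t(1) tl])
  have Xcore: "X y \<inter> core Y = {}" if y: "y \<in> interior ?H" for y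
  proof -
    obtain t' where t': "t < t'" "t' < t2" "y \<in> interior (never_enters (R t') A)" using t(3)[OF y] by blast
    have t'1: "t' \<le> 1" using t'(2) t2(2) t1(2) by linarith
    have con: "contracting_in (R t) x" if "x \<in> Per" "contracting_in (R t') x" for x
    proof -
      have "R t' \<subseteq> R t1" using t' t(1) t2 t1(2) by (intro R_mono) auto
      then have "contracting_in (R t1) x" using contracting_in_mono that(2) by blast
      then show ?thesis by (rule t1(4)[OF that(1) _ t(1) tl])
    qed
    show ?thesis unfolding X_def
      by (rule orbit_closure_avoids_core[OF t(1) t'(1) t'1 Ao Ane AH rep con t'(3)])
  qed
  have XH: "X y \<subseteq> ?H" if y: "y \<in> interior ?H" for y unfolding X_def
  proof (rule closure_minimal)
    have "y \<in> ?H" using y interior_subset by blast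
    then show "{g y | g. g \<in> semigroup_generated (R t)} \<subseteq> ?H" using never_enters_invariant by blast
  qed (rule closed_never_enters[OF Ao])
  define \<U> where "\<U> = insert A ((\<lambda>y. interior (X y)) ` interior ?H)"
  have UU: "\<Union>\<U> = A \<union> (\<Union>y\<in>interior ?H. interior (X y))" by (simp add: \<U>_def)
  have core: "x \<in> core Y" if "x \<in> never_enters (R t) (\<Union>\<U>)" for x
    by (rule never_enters_subset_core[OF t(1) tl Ao]) (use Xcore that in \<open>simp_all add: UU X_def\<close>)
  have op: "open U" if "U \<in> \<U>" for U using that Ao by (auto simp: \<U>_def)
  have finD: "finite (never_enters (R t) (\<Union>\<U>))" using finite_subset[OF _ finite_core] core by blast
  have ev: "ev_repelling (R t) d" if d: "d \<in> never_enters (R t) (\<Union>\<U>)" for d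
  proof -
    obtain k where k: "k \<ge> 1" "(\<sigma> ^^ k) d \<in> Per" using core_reaches_Per[OF core[OF d]] by blast
    obtain g where g: "g \<in> R t" using ne[OF t(1) tl] by blast
    have sY: "set (replicate k g) \<subseteq> Y" using g R_subset[OF t(1) tl] by auto
    have h: "fold apply_rat (replicate k g) \<in> semigroup_generated (R t)" unfolding semigroup_generated_eq
      using g k(1) by (intro CollectI exI[of _ "replicate k g"]) auto
    have eq: "fold apply_rat (replicate k g) d = (\<sigma> ^^ k) d" using core_word[OF core[OF d] sY] by simp
    have "fold apply_rat (replicate k g) d \<notin> \<Union>\<U>" using d h unfolding never_enters_def by blast
    then have "(\<sigma> ^^ k) d \<notin> A" unfolding eq UU by blast
    then have "repelling_in (R t) ((\<sigma> ^^ k) d)" by (rule rep[OF k(2)])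
    then show ?thesis unfolding ev_repelling_def repelling_in_def using h eq by metis
  qed
  obtain \<U>' where U': "finite \<U>'" "\<U>' \<subseteq> \<U>" "stably (R t) (\<lambda>S'. \<forall>V. \<Union>\<U>' \<subseteq> V \<longrightarrow>
      finite (never_enters S' V) \<and> (\<forall>d\<in>never_enters S' V. ev_repelling S' d))"
    by (rule stably_never_enters[OF op finD ev])
  obtain F d where F: "finite F" "F \<subseteq> R t" "d > 0" "\<And>S'. (\<forall>f\<in>F. \<exists>f'\<in>S'. dist f f' < d) \<Longrightarrow>
      (\<forall>V. \<Union>\<U>' \<subseteq> V \<longrightarrow> finite (never_enters S' V) \<and> (\<forall>d\<in>never_enters S' V. ev_repelling S' d))"
    using U'(3) unfolding stably_def by blast
  \<comment> \<open>F suffices to make the exceptional set finite and repelling; G0 is kept so that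
    the new support remains close to the given one.\<close>
  define \<Gamma> where "\<Gamma> = G0 \<union> F"
  have \<Gamma>: "finite \<Gamma>" "\<Gamma> \<subseteq> R t" using G0(1) G0(2)[OF t(1) tl] F(1,2) by (auto simp: \<Gamma>_def)
  have app: "\<forall>f\<in>F. \<exists>f'\<in>\<Gamma>. dist f f' < d"
  proof
    fix f assume "f \<in> F"
    then show "\<exists>f'\<in>\<Gamma>. dist f f' < d" using F(3) by (intro bexI[of _ f]) (auto simp: \<Gamma>_def)
  qed
  define V where "V = A \<union> (\<Union>U\<in>\<U>'. U)"
  have sub: "\<Union>\<U>' \<subseteq> V" by (auto simp: V_def)
  have stable: "finite (never_enters \<Gamma> V)" "\<forall>d\<in>never_enters \<Gamma> V. ev_repelling \<Gamma> d"
    using F(4)[OF app] sub by blast+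
  have trA: "traps \<Gamma> n A" by (rule traps_subset[OF At \<Gamma>(2)])
  have trU: "\<exists>m. traps \<Gamma> m U" if "U \<in> \<U>'" for U
  proof -
    have "U \<in> \<U>" using that U'(2) by blast
    then consider "U = A" | y where "y \<in> interior ?H" "U = interior (X y)" unfolding \<U>_def by blast
    then show ?thesis
    proof cases
      case 2
      have "traps \<Gamma> (Suc (card (const_pts Y))) (interior (X y))"
      proof (rule interior_traps[OF t(1) tl _ Xcore[OF 2(1)] _ \<Gamma>])
        show "compact (X y)" unfolding X_def by (rule closed_imp_compact_sphere) simp
        show "apply_rat g z \<in> X y" if "g \<in> R t" "z \<in> X y" for g z
          using that unfolding X_def by (rule orbit_closure_invariant)
      qed
      then show ?thesis using 2(2) by blast
    qed (use trA in blast)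
  qed
  obtain m where m: "traps \<Gamma> m V" unfolding V_def
    using traps_Un_finite[of \<U>' \<Gamma> "\<lambda>U. U" A] U'(1) trU trA by blast
  \<comment> \<open>The added traps lie in the exceptional set of A and are disjoint from A, so
    covering the sphere would disconnect it.\<close>
  have "V \<noteq> UNIV"
  proof
    assume VU: "V = UNIV"
    define W where "W = (\<Union>U\<in>\<U>' - {A}. U)"
    have "open W" unfolding W_def using op U'(2) by (intro open_UN) blast
    have WH: "W \<subseteq> ?H"
    proof
      fix z assume "z \<in> W"
      then obtain U where U: "U \<in> \<U>'" "U \<noteq> A" "z \<in> U" by (auto simp: W_def)
      then obtain y where "y \<in> interior ?H" "z \<in> interior (X y)" using U'(2) unfolding \<U>_def by blast
      then show "z \<in> ?H" using XH interior_subset by blast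
    qed
    have cov: "UNIV \<subseteq> A \<union> W" using VU unfolding V_def W_def by blast
    have dis: "A \<inter> W \<inter> UNIV = {}" using WH AH by blast
    have "A \<inter> UNIV = {} \<or> W \<inter> UNIV = {}"
      by (rule connectedD[OF connected_UNIV_sphere Ao \<open>open W\<close> dis cov])
    then show False using Ane cov A(3) by auto
  qed
  moreover have "V \<noteq> {}" using Ane by (simp add: V_def)
  ultimately have "wms \<Gamma>" unfolding wms_def using m stable by blast
  moreover have "\<Gamma> \<subseteq> R 1" using \<Gamma>(2) R_mono[of t 1] t(1) tl by auto
  ultimately show ?thesis using that[of \<Gamma>] \<Gamma>(1) by (auto simp: \<Gamma>_def)
qed

end

section \<open>Holomorphic families\<close>

lemma norm_scaleC_vec: "norm (c *\<^sub>C x) = cmod c * norm (x :: complex ^ 'n)"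
proof -
  have "norm (c *\<^sub>C x) = L2_set (\<lambda>i. cmod c * norm (x $ i)) UNIV"
    by (simp add: norm_vec_def scaleC_vec_def scaleC_complex_def norm_mult)
  also have "\<dots> = cmod c * norm x"
    by (simp add: L2_set_right_distrib norm_vec_def)
  finally show ?thesis .
qed

lemma bounded_linear_scaleC_left: "bounded_linear (\<lambda>\<zeta>. \<zeta> *\<^sub>C (u :: complex ^ 'n))"
proof (rule bounded_linear_intro[where K = "norm u"])
  show "(x + y) *\<^sub>C u = x *\<^sub>C u + y *\<^sub>C u" for x y by (rule scaleC_add_left)
  show "(r *\<^sub>R x) *\<^sub>C u = r *\<^sub>R x *\<^sub>C u" for r x
    by (simp add: scaleR_eq_scaleC scaleC_scaleC scaleC_complex_def)
  show "norm (x *\<^sub>C u) \<le> norm x * norm u" for x by (simp add: norm_scaleC_vec)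
qed

lemma scaleC_1: "1 *\<^sub>C (x :: complex ^ 'n) = x"
  by (simp add: scaleC_vec_def scaleC_complex_def vec_eq_iff)

lemma scaleC_0: "0 *\<^sub>C (x :: complex ^ 'n) = 0"
  by (simp add: scaleC_vec_def scaleC_complex_def vec_eq_iff)

lemma continuous_on_line: "continuous_on S (\<lambda>\<zeta>. (v :: complex ^ 'n) + \<zeta> *\<^sub>C u)"
  by (intro continuous_intros linear_continuous_on bounded_linear_scaleC_left)

lemma open_line_preimage: "open B \<Longrightarrow> open {\<zeta>. (v :: complex ^ 'n) + \<zeta> *\<^sub>C u \<in> B}"
  using open_vimage[OF _ continuous_on_line[of UNIV v u]] by (simp add: vimage_def)

lemma convex_line_preimage: "convex B \<Longrightarrow> convex {\<zeta>. (v :: complex ^ 'n) + \<zeta> *\<^sub>C u \<in> B}"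
proof (rule convexI)
  fix x y :: complex and a b :: real
  assume B: "convex B" and xy: "x \<in> {\<zeta>. v + \<zeta> *\<^sub>C u \<in> B}" "y \<in> {\<zeta>. v + \<zeta> *\<^sub>C u \<in> B}" and ab: "0 \<le> a" "0 \<le> b" "a + b = 1"
  interpret bounded_linear "\<lambda>\<zeta>. \<zeta> *\<^sub>C u" by (rule bounded_linear_scaleC_left)
  have "v + (a *\<^sub>R x + b *\<^sub>R y) *\<^sub>C u = (a + b) *\<^sub>R v + a *\<^sub>R (x *\<^sub>C u) + b *\<^sub>R (y *\<^sub>C u)"
    by (simp add: add scaleR ab)
  also have "\<dots> = a *\<^sub>R (v + x *\<^sub>C u) + b *\<^sub>R (v + y *\<^sub>C u)" by (simp add: algebra_simps)
  also have "\<dots> \<in> B" using B xy ab by (auto intro: convexD)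
  finally show "a *\<^sub>R x + b *\<^sub>R y \<in> {\<zeta>. v + \<zeta> *\<^sub>C u \<in> B}" by simp
qed

section \<open>Charts, and holomorphic dependence on the parameter\<close>

locale holo_family =
  fixes \<Lambda> :: "'l topology" and A :: "('l, complex ^ 'n) atlas" and f :: "'l \<Rightarrow> rational_map"
  assumes hf: "holomorphic_family \<Lambda> A f"
begin

lemma manifold: "complex_manifold \<Lambda> A" "connected_space \<Lambda>"
  using hf by (auto simp: holomorphic_family_def)

lemma chart:
  assumes "(U, \<phi>) \<in> A"
  shows "openin \<Lambda> U" "open (\<phi> ` U)" "inj_on \<phi> U"
    "continuous_map (top_of_set (\<phi> ` U)) \<Lambda> (inv_into U \<phi>)"
    "continuous_map (subtopology \<Lambda> U) (top_of_set (\<phi> ` U)) \<phi>"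
proof -
  have 1: "openin \<Lambda> U \<and> open (\<phi> ` U) \<and> homeomorphic_map (subtopology \<Lambda> U) (top_of_set (\<phi> ` U)) \<phi>"
    using manifold(1) assms unfolding complex_manifold_def by blast
  then show oU: "openin \<Lambda> U" and "open (\<phi> ` U)" by auto
  have tU: "topspace (subtopology \<Lambda> U) = U" using openin_subset[OF oU] by auto
  have hm: "homeomorphic_map (subtopology \<Lambda> U) (top_of_set (\<phi> ` U)) \<phi>" using 1 by blast
  then show inj: "inj_on \<phi> U" using homeomorphic_imp_injective_map tU by metis
  obtain g where g: "homeomorphic_maps (subtopology \<Lambda> U) (top_of_set (\<phi> ` U)) \<phi> g"
    using hm homeomorphic_map_maps by blast
  then show "continuous_map (subtopology \<Lambda> U) (top_of_set (\<phi> ` U)) \<phi>" by (simp add: homeomorphic_maps_def)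
  have gc: "continuous_map (top_of_set (\<phi> ` U)) \<Lambda> g"
    using g unfolding homeomorphic_maps_def by (auto simp: continuous_map_in_subtopology)
  show "continuous_map (top_of_set (\<phi> ` U)) \<Lambda> (inv_into U \<phi>)"
  proof (rule continuous_map_eq[OF gc])
    fix v assume "v \<in> topspace (top_of_set (\<phi> ` U))"
    then obtain x where x: "x \<in> U" "v = \<phi> x" by auto
    then have "g v = x" using g tU unfolding homeomorphic_maps_def by metis
    then show "g v = inv_into U \<phi> v" using x inj by simp
  qed
qed

lemma chart_at_point: "l \<in> topspace \<Lambda> \<Longrightarrow> \<exists>U \<phi>. (U, \<phi>) \<in> A \<and> l \<in> U"
proof -
  assume l: "l \<in> topspace \<Lambda>"
  have "(\<Union>(U, \<phi>)\<in>A. U) = topspace \<Lambda>" using manifold(1) by (simp add: complex_manifold_def)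
  then obtain c where c: "c \<in> A" "l \<in> (case c of (U, \<phi>) \<Rightarrow> U)" using l by blast
  then show ?thesis by (cases c) auto
qed

lemma openin_chart_preimage:
  assumes "(U, \<phi>) \<in> A" "open W" shows "openin \<Lambda> {l \<in> U. \<phi> l \<in> W}"
proof -
  have tU: "topspace (subtopology \<Lambda> U) = U" using openin_subset[OF chart(1)[OF assms(1)]] by auto
  have "openin (top_of_set (\<phi> ` U)) (\<phi> ` U \<inter> W)" using assms(2) by (simp add: openin_open_Int)
  then have "openin (subtopology \<Lambda> U) {l \<in> topspace (subtopology \<Lambda> U). \<phi> l \<in> \<phi> ` U \<inter> W}"
    by (rule openin_continuous_map_preimage[OF chart(5)[OF assms(1)]])
  moreover have "{l \<in> topspace (subtopology \<Lambda> U). \<phi> l \<in> \<phi> ` U \<inter> W} = {l \<in> U. \<phi> l \<in> W}" using tU by auto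
  ultimately show ?thesis using openin_trans_full chart(1)[OF assms(1)] by metis
qed

lemma open_param_preimage:
  assumes "(U, \<phi>) \<in> A" "openin \<Lambda> W" shows "open {v \<in> \<phi> ` U. inv_into U \<phi> v \<in> W}"
proof -
  have "openin (top_of_set (\<phi> ` U)) {v \<in> topspace (top_of_set (\<phi> ` U)). inv_into U \<phi> v \<in> W}"
    by (rule openin_continuous_map_preimage[OF chart(4)[OF assms(1)] assms(2)])
  then have "openin (top_of_set (\<phi> ` U)) {v \<in> \<phi> ` U. inv_into U \<phi> v \<in> W}" by simp
  then show ?thesis using chart(2)[OF assms(1)] openin_open_eq by blast
qed

lemma continuous_on_param_value:
  assumes "(U, \<phi>) \<in> A"
  shows "continuous_on (\<phi> ` U \<times> UNIV) (\<lambda>(v, z). apply_rat (f (inv_into U \<phi> v)) z)"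
proof -
  have F: "continuous_map (prod_topology euclidean \<Lambda>) euclidean (\<lambda>(z, l). apply_rat (f l) z)"
    using hf by (simp add: holomorphic_family_def holomorphic_map_def)
  let ?X = "top_of_set (\<phi> ` U \<times> (UNIV :: riemann_sphere set))"
  have "continuous_map ?X (top_of_set (\<phi> ` U)) fst"
    by (auto simp: continuous_map_in_subtopology intro: continuous_on_fst continuous_on_id)
  then have "continuous_map ?X \<Lambda> (inv_into U \<phi> \<circ> fst)" by (rule continuous_map_compose[OF _ chart(4)[OF assms]])
  moreover have "continuous_map ?X euclidean snd" by (auto intro: continuous_on_snd continuous_on_id)
  ultimately have "continuous_map ?X (prod_topology euclidean \<Lambda>) (\<lambda>x. (snd x, inv_into U \<phi> (fst x)))"
    by (simp add: continuous_map_pairwise o_def)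
  from continuous_map_compose[OF this F] show ?thesis by (simp add: o_def case_prod_unfold)
qed

text \<open>Joint continuity in parameter and point becomes uniform in the point because the sphere
  is compact; this is continuity for the metric of \<open>rational_map\<close>.\<close>

lemma continuous_on_param:
  assumes "(U, \<phi>) \<in> A"
  shows "continuous_on (\<phi> ` U) (\<lambda>v. f (inv_into U \<phi> v))"
proof (rule continuous_onI)
  fix v and e :: real assume v: "v \<in> \<phi> ` U" and e: "e > 0"
  have e2: "0 < e / 2" using e by simp
  obtain X0 where X0: "v \<in> X0" "open X0" and raw: "\<forall>x\<in>X0 \<inter> \<phi> ` U. \<forall>t\<in>UNIV.
      dist ((\<lambda>(v, z). apply_rat (f (inv_into U \<phi> v)) z) (x, t)) ((\<lambda>(v, z). apply_rat (f (inv_into U \<phi> v)) z) (v, t)) \<le> e / 2"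
    by (rule continuous_on_prod_compactE[OF continuous_on_param_value[OF assms] compact_UNIV_sphere v e2])
  have X0': "dist (apply_rat (f (inv_into U \<phi> v')) z) (apply_rat (f (inv_into U \<phi> v)) z) \<le> e / 2"
    if "v' \<in> X0 \<inter> \<phi> ` U" for v' z
    using bspec[OF bspec[OF raw that] UNIV_I[of z]] by simp
  obtain d where d: "d > 0" "ball v d \<subseteq> X0" using X0(1,2) open_contains_ball by blast
  show "\<exists>d>0. \<forall>v'\<in>\<phi> ` U. dist v' v < d \<longrightarrow> dist (f (inv_into U \<phi> v')) (f (inv_into U \<phi> v)) \<le> e"
  proof (intro exI[of _ d] conjI ballI impI d(1))
    fix v' assume v': "v' \<in> \<phi> ` U" "dist v' v < d"
    then have "v' \<in> X0 \<inter> \<phi> ` U" using d(2) by (auto simp: dist_commute)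
    then have "dist (f (inv_into U \<phi> v')) (f (inv_into U \<phi> v)) \<le> e / 2"
      unfolding dist_rational_map_def by (intro cSUP_least X0') auto
    then show "dist (f (inv_into U \<phi> v')) (f (inv_into U \<phi> v)) \<le> e" using e by simp
  qed
qed

lemma sphere_chart_mem:
  "q \<in> {Fin 0, Infty} \<Longrightarrow> (- {antip q}, cd q) \<in> sphere_atlas"
proof -
  assume "q \<in> {Fin 0, Infty}"
  moreover have "cd (Fin 0) = fin_coord" "cd Infty = inf_coord" by (auto simp: cd_def)
  ultimately show ?thesis by (auto simp: sphere_atlas_def fin_chart_def inf_chart_def antip_def)
qed

lemma sphere_chart_choice: obtains q where "q \<in> {Fin 0, Infty}" "z \<noteq> antip q"
proof (cases "z = Infty")
  case True
  then show ?thesis using that[of Infty] by (simp add: antip_def)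
next
  case False
  then show ?thesis using that[of "Fin 0"] by (simp add: antip_def)
qed

text \<open>On a complex line in a chart, complex Frechet differentiability reduces to one variable:
  complex linearity turns the derivative along u into multiplication by
  \<open>D (0, u)\<close>.\<close>

lemma line_holo_into:
  assumes U: "(U, \<phi>) \<in> A"
  shows "holo_into {\<zeta>. v + \<zeta> *\<^sub>C u \<in> \<phi> ` U} (\<lambda>\<zeta>. apply_rat (f (inv_into U \<phi> (v + \<zeta> *\<^sub>C u))) z)"
    (is "holo_into ?S ?h")
proof (rule holo_intoI)
  show S: "open ?S" by (rule open_line_preimage[OF chart(2)[OF U]])
  show "continuous_on ?S ?h"
  proof -
    have "continuous_on ?S (\<lambda>\<zeta>. (v + \<zeta> *\<^sub>C u, z))" by (intro continuous_on_Pair continuous_on_line continuous_on_const)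
    then have "continuous_on ?S (\<lambda>\<zeta>. (\<lambda>(v, z). apply_rat (f (inv_into U \<phi> v)) z) (v + \<zeta> *\<^sub>C u, z))"
      by (rule continuous_on_compose2[OF continuous_on_param_value[OF U]]) auto
    then show ?thesis by simp
  qed
  fix \<zeta>0 assume \<zeta>0: "\<zeta>0 \<in> ?S"
  obtain q where q: "q \<in> {Fin 0, Infty}" "z \<noteq> antip q" using sphere_chart_choice by blast
  obtain p where p: "p \<in> {Fin 0, Infty}" "?h \<zeta>0 \<noteq> antip p" using sphere_chart_choice by blast
  let ?F = "\<lambda>(z, l). apply_rat (f l) z"
  let ?V = "(- {antip q}) \<times> U" and ?\<psi> = "map_prod (cd q) \<phi>"
  have mem: "(?V, ?\<psi>) \<in> prod_atlas sphere_atlas A"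
    unfolding prod_atlas_def using sphere_chart_mem[OF q(1)] U by blast
  have hol: "cholomorphic_on (cd p \<circ> ?F \<circ> inv_into ?V ?\<psi>) (?\<psi> ` (?V \<inter> ?F -` (- {antip p})))"
    using hf mem sphere_chart_mem[OF p(1)] unfolding holomorphic_family_def holomorphic_map_def by blast
  have "inj_on (cd q) (- {antip q})" by (rule inj_on_inverseI[of _ "ic q"]) (simp add: ic_cd)
  then have inj: "inj_on ?\<psi> ?V" using chart(3)[OF U] by (intro map_prod_inj_on)
  have Pm: "inv_into U \<phi> x \<in> U" "\<phi> (inv_into U \<phi> x) = x" if "x \<in> \<phi> ` U" for x
    using that by (auto intro: inv_into_into f_inv_into_f)
  have inv: "inv_into ?V ?\<psi> (cd q z, x) = (z, inv_into U \<phi> x)" if "x \<in> \<phi> ` U" for x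
    by (rule inv_into_f_eq[OF inj]) (use Pm[OF that] q(2) in auto)
  let ?a = "\<lambda>\<zeta>. (cd q z, v + \<zeta> *\<^sub>C u)"
  have v1: "v + \<zeta>0 *\<^sub>C u \<in> \<phi> ` U" using \<zeta>0 by simp
  define l0 where "l0 = inv_into U \<phi> (v + \<zeta>0 *\<^sub>C u)"
  have l0: "l0 \<in> U" "\<phi> l0 = v + \<zeta>0 *\<^sub>C u" "apply_rat (f l0) z \<noteq> antip p"
    using Pm[OF v1] p(2) unfolding l0_def by blast+
  have "(z, l0) \<in> ?V \<inter> ?F -` (- {antip p})" using l0(1,3) q(2) by simp
  moreover have "?\<psi> (z, l0) = ?a \<zeta>0" using l0(2) by simp
  ultimately have "?a \<zeta>0 \<in> ?\<psi> ` (?V \<inter> ?F -` (- {antip p}))" by (metis imageI)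
  then have "\<exists>D. ((cd p \<circ> ?F \<circ> inv_into ?V ?\<psi>) has_derivative D) (at (?a \<zeta>0)) \<and> (\<forall>c w. D (c *\<^sub>C w) = c *\<^sub>C D w)"
    by (rule bspec[OF hol[unfolded cholomorphic_on_def]])
  then obtain D where D: "((cd p \<circ> ?F \<circ> inv_into ?V ?\<psi>) has_derivative D) (at (?a \<zeta>0))"
    "\<And>c w. D (c *\<^sub>C w) = c *\<^sub>C D w" by (elim exE conjE) metis
  have "(?a has_derivative (\<lambda>\<zeta>. (0, \<zeta> *\<^sub>C u))) (at \<zeta>0)"
    by (auto intro!: derivative_eq_intros bounded_linear.has_derivative[OF bounded_linear_scaleC_left])
  from diff_chain_at[OF this D(1)]
  have "((cd p \<circ> ?F \<circ> inv_into ?V ?\<psi>) \<circ> ?a has_derivative D \<circ> (\<lambda>\<zeta>. (0, \<zeta> *\<^sub>C u))) (at \<zeta>0)" .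
  moreover have "D \<circ> (\<lambda>\<zeta>. (0, \<zeta> *\<^sub>C u)) = (*) (D (0, u))"
  proof
    fix \<zeta>
    have "(0, \<zeta> *\<^sub>C u) = \<zeta> *\<^sub>C (0 :: complex, u)" by (simp add: scaleC_prod_def scaleC_complex_def)
    then show "(D \<circ> (\<lambda>\<zeta>. (0, \<zeta> *\<^sub>C u))) \<zeta> = D (0, u) * \<zeta>"
      using D(2) by (simp add: scaleC_complex_def mult.commute)
  qed
  ultimately have der: "((cd p \<circ> ?F \<circ> inv_into ?V ?\<psi>) \<circ> ?a has_field_derivative D (0, u)) (at \<zeta>0)"
    by (simp add: has_field_derivative_def)
  have "((\<lambda>\<zeta>. cd p (?h \<zeta>)) has_field_derivative D (0, u)) (at \<zeta>0)"
  proof (rule DERIV_local_eq[OF der])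
    have "\<forall>\<^sub>F \<zeta> in nhds \<zeta>0. \<zeta> \<in> ?S" using S \<zeta>0 by (rule eventually_nhds_in_open)
    then show "\<forall>\<^sub>F \<zeta> in nhds \<zeta>0. cd p (?h \<zeta>) = ((cd p \<circ> ?F \<circ> inv_into ?V ?\<psi>) \<circ> ?a) \<zeta>"
      by eventually_elim (simp add: inv)
  qed
  then show "\<exists>p. ?h \<zeta>0 \<noteq> antip p \<and> (\<lambda>\<zeta>. cd p (?h \<zeta>)) field_differentiable (at \<zeta>0)"
    using p(2) unfolding field_differentiable_def by blast
qed

lemma line_holo_disc:
  assumes U: "(U, \<phi>) \<in> A" and B: "\<And>\<zeta>. \<zeta> \<in> ball 0 1 \<Longrightarrow> v + \<zeta> *\<^sub>C u \<in> \<phi> ` U"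
  shows "holo_disc (\<lambda>\<zeta>. f (inv_into U \<phi> (v + \<zeta> *\<^sub>C u)))"
  unfolding holo_disc_def
proof (intro conjI allI)
  show "continuous_on (ball 0 1) (\<lambda>\<zeta>. f (inv_into U \<phi> (v + \<zeta> *\<^sub>C u)))"
    by (rule continuous_on_compose2[OF continuous_on_param[OF U] continuous_on_line]) (use B in auto)
  show "holo_into (ball 0 1) (\<lambda>\<zeta>. apply_rat (f (inv_into U \<phi> (v + \<zeta> *\<^sub>C u))) z)" for z
    by (rule holo_into_subset[OF line_holo_into[OF U]]) (use B in auto)
qed

text \<open>The identity principle along a complex line inside a chart ball, as a property of h:
  constancy for \<zeta> near 0 reaches \<zeta> = 1, that is b'. Values and derivatives have
  different target types, so the connectedness argument is run once for both.\<close>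

definition line_identity :: "('l \<Rightarrow> 'b) \<Rightarrow> bool" where
  "line_identity h \<longleftrightarrow> (\<forall>U \<phi> v e b b' d. (U, \<phi>) \<in> A \<longrightarrow> ball v e \<subseteq> \<phi> ` U \<longrightarrow> b \<in> ball v e \<longrightarrow> b' \<in> ball v e \<longrightarrow> d > 0 \<longrightarrow>
      (\<forall>\<zeta>\<in>ball 0 d. b + \<zeta> *\<^sub>C (b' - b) \<in> ball v e \<and> h (inv_into U \<phi> (b + \<zeta> *\<^sub>C (b' - b))) = h (inv_into U \<phi> b)) \<longrightarrow>
      h (inv_into U \<phi> b') = h (inv_into U \<phi> b))"

text \<open>Connectedness of \<open>\<Lambda>\<close> globalizes the identity principle along complex lines in charts.\<close>

lemma nonconstant_in_chart_ball:
  fixes h :: "'l \<Rightarrow> 'b"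
  assumes line: "line_identity h"
    and nc: "\<not> h constant_on topspace \<Lambda>"
    and U: "(U, \<phi>) \<in> A" "l \<in> U" "e > 0" "ball (\<phi> l) e \<subseteq> \<phi> ` U"
  shows "\<exists>b\<in>ball (\<phi> l) e. h (inv_into U \<phi> b) \<noteq> h l"
proof (rule ccontr)
  assume "\<not> ?thesis"
  then have const: "h (inv_into U \<phi> b) = h l" if "b \<in> ball (\<phi> l) e" for b using that by blast
  define Z where "Z = {x \<in> topspace \<Lambda>. \<exists>N. openin \<Lambda> N \<and> x \<in> N \<and> (\<forall>n\<in>N. h n = h l)}"
  have Zsub: "N \<subseteq> Z" if "openin \<Lambda> N" "\<forall>n\<in>N. h n = h l" for N
    using that openin_subset[OF that(1)] unfolding Z_def by blast
  have Zo: "openin \<Lambda> Z"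
  proof (subst openin_subopen, intro ballI)
    fix x assume "x \<in> Z"
    then obtain N where N: "openin \<Lambda> N" "x \<in> N" "\<forall>n\<in>N. h n = h l" unfolding Z_def by blast
    then show "\<exists>T. openin \<Lambda> T \<and> x \<in> T \<and> T \<subseteq> Z" using Zsub by blast
  qed
  have "openin \<Lambda> (topspace \<Lambda> - Z)"
  proof (subst openin_subopen, intro ballI)
    fix x assume x: "x \<in> topspace \<Lambda> - Z"
    obtain U' \<phi>' where U': "(U', \<phi>') \<in> A" "x \<in> U'" using chart_at_point x by blast
    obtain e' where e': "e' > 0" "ball (\<phi>' x) e' \<subseteq> \<phi>' ` U'"
      using chart(2)[OF U'(1)] U'(2) open_contains_ball by blast
    define N where "N = {n \<in> U'. \<phi>' n \<in> ball (\<phi>' x) e'}"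
    have N: "openin \<Lambda> N" unfolding N_def by (rule openin_chart_preimage[OF U'(1)]) simp
    have xN: "x \<in> N" using U'(2) e'(1) by (simp add: N_def)
    have "N \<inter> Z = {}"
    proof (rule ccontr)
      assume "N \<inter> Z \<noteq> {}"
      then obtain n where n: "n \<in> N" "n \<in> Z" by blast
      obtain M where M: "openin \<Lambda> M" "n \<in> M" "\<forall>m\<in>M. h m = h l" using n(2) unfolding Z_def by blast
      define b where "b = \<phi>' n"
      have nU: "n \<in> U'" and bb: "b \<in> ball (\<phi>' x) e'" using n(1) by (auto simp: N_def b_def)
      have Pb: "inv_into U' \<phi>' b = n" unfolding b_def by (rule inv_into_f_f[OF chart(3)[OF U'(1)] nU])
      have "open {v \<in> \<phi>' ` U'. inv_into U' \<phi>' v \<in> M}" by (rule open_param_preimage[OF U'(1) M(1)])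
      then have oW: "open ({v \<in> \<phi>' ` U'. inv_into U' \<phi>' v \<in> M} \<inter> ball (\<phi>' x) e')" by (intro open_Int) auto
      \<comment> \<open>Every b' in the ball lies on a complex line through b, and near b this line
        stays in M, where h is constant.\<close>
      have allc: "h (inv_into U' \<phi>' b') = h l" if b': "b' \<in> ball (\<phi>' x) e'" for b'
      proof -
        let ?S = "{\<zeta>. b + \<zeta> *\<^sub>C (b' - b) \<in> {v \<in> \<phi>' ` U'. inv_into U' \<phi>' v \<in> M} \<inter> ball (\<phi>' x) e'}"
        have "open ?S" by (rule open_line_preimage[OF oW])
        moreover have "0 \<in> ?S" using bb Pb M(2) nU by (auto simp: scaleC_0 b_def)
        ultimately obtain d where d: "d > 0" "ball 0 d \<subseteq> ?S" using open_contains_ball by blast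
        have "h (inv_into U' \<phi>' b') = h (inv_into U' \<phi>' b)"
        proof (rule line[unfolded line_identity_def, rule_format, OF U'(1) e'(2) bb b' d(1)])
          fix \<zeta> :: complex assume "\<zeta> \<in> ball 0 d"
          then have "\<zeta> \<in> ?S" using d(2) by blast
          then show "b + \<zeta> *\<^sub>C (b' - b) \<in> ball (\<phi>' x) e' \<and> h (inv_into U' \<phi>' (b + \<zeta> *\<^sub>C (b' - b))) = h (inv_into U' \<phi>' b)"
            using M(2,3) Pb by auto
        qed
        then show ?thesis using Pb M(2,3) by simp
      qed
      have "h m = h l" if "m \<in> N" for m
      proof -
        have m: "m \<in> U'" "\<phi>' m \<in> ball (\<phi>' x) e'" using that by (auto simp: N_def)
        have "inv_into U' \<phi>' (\<phi>' m) = m" by (rule inv_into_f_f[OF chart(3)[OF U'(1)] m(1)])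
        then show ?thesis using allc[OF m(2)] by simp
      qed
      then have "N \<subseteq> Z" using Zsub[OF N] by blast
      then show False using xN x by blast
    qed
    then show "\<exists>T. openin \<Lambda> T \<and> x \<in> T \<and> T \<subseteq> topspace \<Lambda> - Z"
      using N xN openin_subset[OF N] by (intro exI[of _ N]) blast
  qed
  then have "closedin \<Lambda> Z" using openin_subset[OF Zo] by (simp add: closedin_def)
  then have "Z = {} \<or> Z = topspace \<Lambda>" using Zo manifold(2) connected_space_clopen_in by blast
  moreover have "l \<in> Z"
  proof -
    have "{n \<in> U. \<phi> n \<in> ball (\<phi> l) e} \<subseteq> Z"
    proof (rule Zsub)
      show "openin \<Lambda> {n \<in> U. \<phi> n \<in> ball (\<phi> l) e}" by (rule openin_chart_preimage[OF U(1)]) simp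
      show "\<forall>n\<in>{n \<in> U. \<phi> n \<in> ball (\<phi> l) e}. h n = h l"
        using const inv_into_f_f[OF chart(3)[OF U(1)]] by fastforce
    qed
    then show ?thesis using U(2,3) by auto
  qed
  ultimately have "Z = topspace \<Lambda>" by blast
  then have "h n = h l" if "n \<in> topspace \<Lambda>" for n using that unfolding Z_def by blast
  then show False using nc unfolding constant_on_def by blast
qed

lemma exists_nonconstant_disc:
  fixes h :: "'l \<Rightarrow> 'b"
  assumes line: "line_identity h"
    and nc: "\<not> h constant_on topspace \<Lambda>" and W: "openin \<Lambda> W" "l \<in> W"
  obtains \<gamma> where "holo_disc (f \<circ> \<gamma>)" "\<gamma> ` ball 0 1 \<subseteq> W" "\<gamma> 0 = l" "\<not> (h \<circ> \<gamma>) constant_on ball 0 1"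
proof -
  have "l \<in> topspace \<Lambda>" using W openin_subset by blast
  then obtain U \<phi> where U: "(U, \<phi>) \<in> A" "l \<in> U" using chart_at_point by blast
  have Pl: "inv_into U \<phi> (\<phi> l) = l" by (rule inv_into_f_f[OF chart(3)[OF U(1)] U(2)])
  have "open {v \<in> \<phi> ` U. inv_into U \<phi> v \<in> W}" by (rule open_param_preimage[OF U(1) W(1)])
  moreover have "\<phi> l \<in> {v \<in> \<phi> ` U. inv_into U \<phi> v \<in> W}" using U(2) W(2) Pl by auto
  ultimately obtain e where e: "e > 0" "ball (\<phi> l) e \<subseteq> {v \<in> \<phi> ` U. inv_into U \<phi> v \<in> W}"
    using open_contains_ball by blast
  have eU: "ball (\<phi> l) e \<subseteq> \<phi> ` U" using e(2) by blast
  obtain b where b: "b \<in> ball (\<phi> l) e" "h (inv_into U \<phi> b) \<noteq> h l"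
    by (rule bexE[OF nonconstant_in_chart_ball[OF line nc U e(1) eU]])
  define t where "t = norm (b - \<phi> l)"
  have t0: "t > 0" using b(2) Pl by (auto simp: t_def)
  have te: "t < e" using b(1) by (simp add: t_def dist_norm norm_minus_commute)
  \<comment> \<open>Strictly between, so that the disc of radius s fits into the ball and contains b
    in its interior, at the parameter t/s < 1.\<close>
  obtain s where s: "t < s" "s < e" using dense[OF te] by blast
  define u where "u = complex_of_real (s / t) *\<^sub>C (b - \<phi> l)"
  have nu: "norm u = s" using t0 s(1) by (simp add: u_def norm_scaleC_vec norm_divide flip: t_def)
  define \<gamma> where "\<gamma> = (\<lambda>\<zeta>. inv_into U \<phi> (\<phi> l + \<zeta> *\<^sub>C u))"
  have inb: "\<phi> l + \<zeta> *\<^sub>C u \<in> ball (\<phi> l) e" if "\<zeta> \<in> ball 0 1" for \<zeta>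
  proof -
    have "cmod \<zeta> * s \<le> 1 * s" using that s(1) t0 by (intro mult_right_mono) auto
    then show ?thesis using s(2) by (simp add: dist_norm norm_scaleC_vec nu)
  qed
  show ?thesis
  proof (rule that[of \<gamma>])
    show "holo_disc (f \<circ> \<gamma>)" unfolding \<gamma>_def o_def
      by (rule line_holo_disc[OF U(1)]) (use inb eU in blast)
    show "\<gamma> ` ball 0 1 \<subseteq> W" using inb e(2) unfolding \<gamma>_def by blast
    show \<gamma>0: "\<gamma> 0 = l" by (simp add: \<gamma>_def scaleC_0 Pl)
    let ?\<zeta> = "complex_of_real (t / s)"
    have "?\<zeta> *\<^sub>C u = b - \<phi> l"
    proof -
      have "complex_of_real (t / s) * complex_of_real (s / t) = 1" using t0 s(1) by simp
      then show ?thesis unfolding u_def scaleC_scaleC by (simp only: scaleC_1)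
    qed
    then have "\<gamma> ?\<zeta> = inv_into U \<phi> b" by (simp add: \<gamma>_def)
    moreover have "?\<zeta> \<in> ball 0 1" using t0 s(1) by (simp add: norm_divide)
    ultimately show "\<not> (h \<circ> \<gamma>) constant_on ball 0 1"
      using b(2) \<gamma>0 unfolding constant_on_def by (metis centre_in_ball comp_apply zero_less_one)
  qed
qed

lemma line_segment_domain:
  assumes "b \<in> ball v e" "b' \<in> ball v (e::real)"
  shows "open {\<zeta>. b + \<zeta> *\<^sub>C (b' - b) \<in> ball v e}" "connected {\<zeta>. b + \<zeta> *\<^sub>C (b' - b) \<in> ball v e}"
    "0 \<in> {\<zeta>. b + \<zeta> *\<^sub>C (b' - b) \<in> ball v e}" "1 \<in> {\<zeta>. b + \<zeta> *\<^sub>C ((b' :: complex ^ 'n) - b) \<in> ball v e}"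
  using assms open_line_preimage[OF open_ball] convex_connected[OF convex_line_preimage[OF convex_ball]]
  by (simp_all only: mem_Collect_eq scaleC_0 scaleC_1) simp_all

lemma value_line_identity: "line_identity (\<lambda>l. apply_rat (f l) x)"
  unfolding line_identity_def
proof (intro allI impI)
  fix U \<phi> v e b b' and d :: real
  assume U: "(U, \<phi>) \<in> A" "ball v e \<subseteq> \<phi> ` U" "b \<in> ball v e" "b' \<in> ball v e" "d > 0"
    and c: "\<forall>\<zeta>\<in>ball 0 d. b + \<zeta> *\<^sub>C (b' - b) \<in> ball v e \<and>
       apply_rat (f (inv_into U \<phi> (b + \<zeta> *\<^sub>C (b' - b)))) x = apply_rat (f (inv_into U \<phi> b)) x"
  let ?S = "{\<zeta>. b + \<zeta> *\<^sub>C (b' - b) \<in> ball v e}"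
  let ?h = "\<lambda>\<zeta>. apply_rat (f (inv_into U \<phi> (b + \<zeta> *\<^sub>C (b' - b)))) x"
  note dom = line_segment_domain[OF U(3,4)]
  have h: "holo_into ?S ?h" by (rule holo_into_subset[OF line_holo_into[OF U(1)] dom(1)]) (use U(2) in blast)
  have "?h 1 = apply_rat (f (inv_into U \<phi> b)) x"
  proof (rule holo_into_identity[OF h dom(2) open_ball[of 0 d]])
    show "ball 0 d \<noteq> {}" using U(5) by simp
    show "ball 0 d \<subseteq> ?S" using c by (intro subsetI) simp
    show "?h \<zeta> = apply_rat (f (inv_into U \<phi> b)) x" if "\<zeta> \<in> ball 0 d" for \<zeta> using bspec[OF c that] by blast
  qed (rule dom(4))
  then show "apply_rat (f (inv_into U \<phi> b')) x = apply_rat (f (inv_into U \<phi> b)) x" by (simp add: scaleC_1)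
qed

lemma deriv_line_identity:
  assumes x: "\<And>l l'. l \<in> topspace \<Lambda> \<Longrightarrow> l' \<in> topspace \<Lambda> \<Longrightarrow> apply_rat (f l) x = apply_rat (f l') x"
  shows "line_identity (\<lambda>l. sphere_deriv (apply_rat (f l)) x)"
  unfolding line_identity_def
proof (intro allI impI)
  fix U \<phi> v e b b' and d :: real
  assume U: "(U, \<phi>) \<in> A" "ball v e \<subseteq> \<phi> ` U" "b \<in> ball v e" "b' \<in> ball v e" "d > 0"
    and c: "\<forall>\<zeta>\<in>ball 0 d. b + \<zeta> *\<^sub>C (b' - b) \<in> ball v e \<and>
       sphere_deriv (apply_rat (f (inv_into U \<phi> (b + \<zeta> *\<^sub>C (b' - b))))) x = sphere_deriv (apply_rat (f (inv_into U \<phi> b))) x"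
  let ?S = "{\<zeta>. b + \<zeta> *\<^sub>C (b' - b) \<in> ball v e}"
  let ?D = "\<lambda>\<zeta>. sphere_deriv (apply_rat (f (inv_into U \<phi> (b + \<zeta> *\<^sub>C (b' - b))))) x"
  note dom = line_segment_domain[OF U(3,4)]
  have Ptop: "inv_into U \<phi> w \<in> topspace \<Lambda>" if "w \<in> \<phi> ` U" for w
    by (rule subsetD[OF openin_subset[OF chart(1)[OF U(1)]] inv_into_into[OF that]])
  have "?D holomorphic_on ?S" unfolding holomorphic_on_def
  proof
    fix \<zeta>1 assume \<zeta>1: "\<zeta>1 \<in> ?S"
    obtain s where s: "s > 0" "ball \<zeta>1 s \<subseteq> ?S" by (rule openE[OF dom(1) \<zeta>1])
    \<comment> \<open>The disc around \<zeta>1 is rescaled to the unit disc, the domain of a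
      \<open>holo_disc\<close>.\<close>
    let ?c = "\<lambda>\<zeta>. f (inv_into U \<phi> ((b + \<zeta>1 *\<^sub>C (b' - b)) + \<zeta> *\<^sub>C (complex_of_real s *\<^sub>C (b' - b))))"
    have eq: "(b + \<zeta>1 *\<^sub>C (b' - b)) + \<zeta> *\<^sub>C (complex_of_real s *\<^sub>C (b' - b)) = b + (\<zeta>1 + \<zeta> * complex_of_real s) *\<^sub>C (b' - b)" for \<zeta>
      by (simp add: scaleC_scaleC scaleC_add_left)
    have inS: "b + (\<zeta>1 + \<zeta> * complex_of_real s) *\<^sub>C (b' - b) \<in> \<phi> ` U" if "\<zeta> \<in> ball 0 1" for \<zeta>
    proof -
      have "\<zeta>1 + \<zeta> * complex_of_real s \<in> ball \<zeta>1 s" using that s(1) by (simp add: dist_norm norm_mult)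
      then show ?thesis using s(2) U(2) by blast
    qed
    have disc: "holo_disc ?c" by (rule line_holo_disc[OF U(1)]) (use inS in \<open>simp add: eq\<close>)
    have "(\<lambda>\<zeta>. sphere_deriv (apply_rat (?c \<zeta>)) x) holomorphic_on ball 0 1"
    proof (rule disc_deriv_holomorphic[OF disc])
      show "apply_rat (?c \<zeta>) x = apply_rat (f (inv_into U \<phi> b)) x" if "\<zeta> \<in> ball 0 1" for \<zeta>
        unfolding eq using inS[OF that] U(2,3) by (intro x Ptop) auto
    qed
    then have hol: "(\<lambda>\<zeta>. ?D (\<zeta>1 + \<zeta> * complex_of_real s)) holomorphic_on ball 0 1" unfolding eq .
    have "(\<lambda>\<zeta>. ?D (\<zeta>1 + \<zeta> * complex_of_real s)) field_differentiable (at ((\<zeta>1 - \<zeta>1) / complex_of_real s))"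
      by (rule holomorphic_on_imp_differentiable_at[OF hol]) auto
    moreover have "(\<lambda>\<zeta>. (\<zeta> - \<zeta>1) / complex_of_real s) field_differentiable (at \<zeta>1)"
      using s(1) by (auto intro!: derivative_intros)
    ultimately have "((\<lambda>\<zeta>. ?D (\<zeta>1 + \<zeta> * complex_of_real s)) \<circ> (\<lambda>\<zeta>. (\<zeta> - \<zeta>1) / complex_of_real s)) field_differentiable (at \<zeta>1)"
      by (intro field_differentiable_compose)
    moreover have "(\<lambda>\<zeta>. ?D (\<zeta>1 + \<zeta> * complex_of_real s)) \<circ> (\<lambda>\<zeta>. (\<zeta> - \<zeta>1) / complex_of_real s) = ?D"
      using s(1) by (auto simp: o_def)
    ultimately show "?D field_differentiable at \<zeta>1 within ?S" using field_differentiable_at_within by metis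
  qed
  then have "?D 1 = sphere_deriv (apply_rat (f (inv_into U \<phi> b))) x"
  proof (rule analytic_continuation_open[of "ball 0 d" ?S ?D "\<lambda>_. sphere_deriv (apply_rat (f (inv_into U \<phi> b))) x" 1, rotated -4])
    show "?D z = sphere_deriv (apply_rat (f (inv_into U \<phi> b))) x" if "z \<in> ball 0 d" for z using bspec[OF c that] by blast
    show "ball 0 d \<subseteq> ?S" using c by (intro subsetI) simp
  qed (use dom U(5) in auto)
  then show "sphere_deriv (apply_rat (f (inv_into U \<phi> b'))) x = sphere_deriv (apply_rat (f (inv_into U \<phi> b))) x" by (simp add: scaleC_1)
qed

theorem rich_image:
  assumes W: "openin \<Lambda> W"
  shows "rich (f ` topspace \<Lambda>) (f ` W)"
  unfolding rich_def
proof (intro conjI ballI allI impI)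
  let ?Y = "f ` topspace \<Lambda>"
  show "f ` W \<subseteq> ?Y" using openin_subset[OF W] by blast
  fix g x assume g: "g \<in> f ` W"
  then obtain l where l: "l \<in> W" "g = f l" by blast
  show "\<exists>c. holo_disc c \<and> c ` ball 0 1 \<subseteq> f ` W \<and> c 0 = g \<and> \<not> (\<lambda>\<zeta>. apply_rat (c \<zeta>) x) constant_on ball 0 1"
    if x: "x \<notin> const_pts ?Y"
  proof -
    have nc: "\<not> (\<lambda>l. apply_rat (f l) x) constant_on topspace \<Lambda>"
    proof
      assume "(\<lambda>l. apply_rat (f l) x) constant_on topspace \<Lambda>"
      then obtain y where "\<forall>l\<in>topspace \<Lambda>. apply_rat (f l) x = y" unfolding constant_on_def by blast
      then have "x \<in> const_pts ?Y" unfolding const_pts_def by simp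
      then show False using x by blast
    qed
    obtain \<gamma> where \<gamma>: "holo_disc (f \<circ> \<gamma>)" "\<gamma> ` ball 0 1 \<subseteq> W" "\<gamma> 0 = l" "\<not> ((\<lambda>l. apply_rat (f l) x) \<circ> \<gamma>) constant_on ball 0 1"
      by (rule exists_nonconstant_disc[OF value_line_identity nc W l(1)])
    then show ?thesis using l(2) by (intro exI[of _ "f \<circ> \<gamma>"]) (auto simp: o_def)
  qed
  show "\<exists>c. holo_disc c \<and> c ` ball 0 1 \<subseteq> f ` W \<and> c 0 = g \<and> \<not> (\<lambda>\<zeta>. sphere_deriv (apply_rat (c \<zeta>)) x) constant_on ball 0 1"
    if x: "x \<in> const_pts ?Y" and D: "\<not> (\<lambda>g. sphere_deriv (apply_rat g) x) constant_on ?Y"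
  proof -
    have nc: "\<not> (\<lambda>l. sphere_deriv (apply_rat (f l)) x) constant_on topspace \<Lambda>"
    proof
      assume "(\<lambda>l. sphere_deriv (apply_rat (f l)) x) constant_on topspace \<Lambda>"
      then obtain y where "\<forall>l\<in>topspace \<Lambda>. sphere_deriv (apply_rat (f l)) x = y" unfolding constant_on_def by blast
      then have "(\<lambda>g. sphere_deriv (apply_rat g) x) constant_on ?Y" unfolding constant_on_def by blast
      then show False using D by blast
    qed    have xc: "apply_rat (f l) x = apply_rat (f l') x" if "l \<in> topspace \<Lambda>" "l' \<in> topspace \<Lambda>" for l l'
      using x that unfolding const_pts_def by blast
    obtain \<gamma> where \<gamma>: "holo_disc (f \<circ> \<gamma>)" "\<gamma> ` ball 0 1 \<subseteq> W" "\<gamma> 0 = l" "\<not> ((\<lambda>l. sphere_deriv (apply_rat (f l)) x) \<circ> \<gamma>) constant_on ball 0 1"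
      by (rule exists_nonconstant_disc[OF deriv_line_identity[OF xc] nc W l(1)])
    then show ?thesis using l(2) by (intro exI[of _ "f \<circ> \<gamma>"]) (auto simp: o_def)
  qed
qed

end


section \<open>Points of constant value and the set S(W)\<close>

lemma finite_const_pts:
  assumes "\<not> f constant_on T" shows "finite (const_pts (f ` T))"
proof -
  obtain l l' where l: "l \<in> T" "l' \<in> T" "f l \<noteq> f l'" using assms unfolding constant_on_def by metis
  have "const_pts (f ` T) \<subseteq> {x. apply_rat (f l) x = apply_rat (f l') x}"
    using l(1,2) unfolding const_pts_def by blast
  then show ?thesis by (rule finite_subset[OF _ finite_apply_rat_coincidence[OF l(3)]])
qed

lemma core_words_agree:
  assumes "x \<in> core Y" "length gs = length hs" "set gs \<subseteq> Y" "set hs \<subseteq> Y"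
  shows "fold apply_rat gs x = fold apply_rat hs x"
  using assms(2-4)
proof (induction gs arbitrary: hs rule: rev_induct)
  case (snoc g gs)
  obtain hs' h where hs: "hs = hs' @ [h]" "length hs' = length gs"
    using snoc.prems(1) by (cases hs rule: rev_exhaust) auto
  have gh: "g \<in> Y" "h \<in> Y" "set gs \<subseteq> Y" "set hs' \<subseteq> Y" using snoc.prems(2,3) hs(1) by auto
  have eq: "fold apply_rat gs x = fold apply_rat hs' x" using snoc.IH[of hs'] hs(2) gh by simp
  have "fold apply_rat gs x \<in> const_pts Y" using assms(1) gh(3) unfolding core_def by blast
  then have "apply_rat g (fold apply_rat gs x) = apply_rat h (fold apply_rat gs x)"
    using gh(1,2) unfolding const_pts_def by blast
  then show ?case using eq hs(1) by simp
qed simp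

lemma foldr_eq_fold_word: "foldr (\<lambda>l. apply_rat (f l)) ls z = fold apply_rat (map f (rev ls)) z"
  by (simp add: foldr_conv_fold fold_map o_def)

text \<open>This makes niceness, which speaks of S(W), available at core points. The two
  formulations compose the letters in opposite orders, which constancy does not notice.\<close>

lemma core_subset_S_set: "core (f ` topspace \<Lambda>) \<subseteq> S_set \<Lambda> f"
proof
  fix z assume z: "z \<in> core (f ` topspace \<Lambda>)"
  have "(\<lambda>ls. foldr (\<lambda>l. apply_rat (f l)) ls z) constant_on {ls. length ls = n \<and> set ls \<subseteq> topspace \<Lambda>}" for n
  proof (cases "{ls. length ls = n \<and> set ls \<subseteq> topspace \<Lambda>} = {}")
    case True
    show ?thesis unfolding True constant_on_def by blast
  next
    case False
    then obtain ls0 where ls0: "length ls0 = n" "set ls0 \<subseteq> topspace \<Lambda>" by blast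
    have "foldr (\<lambda>l. apply_rat (f l)) ls z = foldr (\<lambda>l. apply_rat (f l)) ls0 z"
      if ls: "length ls = n" "set ls \<subseteq> topspace \<Lambda>" for ls
      unfolding foldr_eq_fold_word using ls ls0 by (intro core_words_agree[OF z]) auto
    then show ?thesis unfolding constant_on_def by blast
  qed
  then show "z \<in> S_set \<Lambda> f" unfolding S_set_def S_n_def by blast
qed

section \<open>From parameter balls to levels of generators\<close>

context holo_family
begin

lemma openin_family_preimage:
  assumes "open U" shows "openin \<Lambda> {l \<in> topspace \<Lambda>. f l \<in> U}"
proof (subst openin_subopen, intro ballI)
  fix l assume l: "l \<in> {l \<in> topspace \<Lambda>. f l \<in> U}"
  then obtain V \<phi> where V: "(V, \<phi>) \<in> A" "l \<in> V" using chart_at_point by blast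
  let ?S = "(\<lambda>v. f (inv_into V \<phi> v)) -` U \<inter> \<phi> ` V"
  have S: "open ?S" by (rule continuous_on_open_vimage[OF chart(2)[OF V(1)], THEN iffD1, rule_format, OF continuous_on_param[OF V(1)] assms])
  have P: "inv_into V \<phi> (\<phi> n) = n" if "n \<in> V" for n by (rule inv_into_f_f[OF chart(3)[OF V(1)] that])
  let ?N = "{n \<in> V. \<phi> n \<in> ?S}"
  have "openin \<Lambda> ?N" by (rule openin_chart_preimage[OF V(1) S])
  moreover have "l \<in> ?N" using l V(2) P by simp
  moreover have "?N \<subseteq> {l \<in> topspace \<Lambda>. f l \<in> U}"
  proof
    fix n assume "n \<in> ?N"
    then have n: "n \<in> V" "f (inv_into V \<phi> (\<phi> n)) \<in> U" by simp_all
    then have "f n \<in> U" using P[OF n(1)] by simp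
    then show "n \<in> {l \<in> topspace \<Lambda>. f l \<in> U}" using n(1) openin_subset[OF chart(1)[OF V(1)]] by blast
  qed
  ultimately show "\<exists>T. openin \<Lambda> T \<and> l \<in> T \<and> T \<subseteq> {l \<in> topspace \<Lambda>. f l \<in> U}" by blast
qed

lemma local_parametrization:
  assumes "g \<in> f ` topspace \<Lambda>" "e > 0"
  shows "\<exists>(P :: complex ^ 'n \<Rightarrow> rational_map) a r. r > 0 \<and> continuous_on (cball a r) P \<and> P a = g \<and>
    (\<forall>v\<in>ball a r. dist g (P v) < e) \<and> (\<forall>s. 0 < s \<longrightarrow> s \<le> r \<longrightarrow> (\<exists>W. openin \<Lambda> W \<and> P ` ball a s = f ` W))"
proof -
  obtain l where l: "l \<in> topspace \<Lambda>" "g = f l" using assms(1) by blast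
  obtain U \<phi> where U: "(U, \<phi>) \<in> A" "l \<in> U" using chart_at_point l(1) by blast
  define P where "P = (\<lambda>v. f (inv_into U \<phi> v))"
  have inv: "inv_into U \<phi> (\<phi> n) = n" if "n \<in> U" for n by (rule inv_into_f_f[OF chart(3)[OF U(1)] that])
  have Pl: "P (\<phi> l) = g" using inv[OF U(2)] l(2) by (simp add: P_def)
  have cP: "continuous_on (\<phi> ` U) P" unfolding P_def by (rule continuous_on_param[OF U(1)])
  have "open (P -` ball g e \<inter> \<phi> ` U)"
    by (rule continuous_on_open_vimage[OF chart(2)[OF U(1)], THEN iffD1, rule_format, OF cP open_ball])
  moreover have "\<phi> l \<in> P -` ball g e \<inter> \<phi> ` U" using Pl U(2) assms(2) by simp
  ultimately obtain r where r: "r > 0" "cball (\<phi> l) r \<subseteq> P -` ball g e \<inter> \<phi> ` U"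
    using open_contains_cball by meson
  show ?thesis
  proof (intro exI[of _ P] exI[of _ "\<phi> l"] exI[of _ r] conjI allI impI ballI r(1) Pl)
    show "continuous_on (cball (\<phi> l) r) P" by (rule continuous_on_subset[OF cP]) (use r(2) in blast)
    show "dist g (P v) < e" if v: "v \<in> ball (\<phi> l) r" for v
    proof -
      have "v \<in> P -` ball g e \<inter> \<phi> ` U" using r(2) v ball_subset_cball by blast
      then show ?thesis by simp
    qed
    fix s :: real assume s: "0 < s" "s \<le> r"
    have sub: "ball (\<phi> l) s \<subseteq> \<phi> ` U" using r(2) s(2) by auto
    show "\<exists>W. openin \<Lambda> W \<and> P ` ball (\<phi> l) s = f ` W"
    proof (intro exI[of _ "{n \<in> U. \<phi> n \<in> ball (\<phi> l) s}"] conjI)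
      show "openin \<Lambda> {n \<in> U. \<phi> n \<in> ball (\<phi> l) s}" by (rule openin_chart_preimage[OF U(1) open_ball])
      show "P ` ball (\<phi> l) s = f ` {n \<in> U. \<phi> n \<in> ball (\<phi> l) s}"
      proof (intro equalityI subsetI)
        fix h assume "h \<in> P ` ball (\<phi> l) s"
        then obtain v where v: "v \<in> ball (\<phi> l) s" "h = P v" by blast
        then obtain n where n: "n \<in> U" "v = \<phi> n" using sub by blast
        then show "h \<in> f ` {n \<in> U. \<phi> n \<in> ball (\<phi> l) s}" using v inv[OF n(1)] by (auto simp: P_def)
      next
        fix h assume "h \<in> f ` {n \<in> U. \<phi> n \<in> ball (\<phi> l) s}"
        then obtain n where n: "n \<in> U" "\<phi> n \<in> ball (\<phi> l) s" "h = f n" by blast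
        then have "h = P (\<phi> n)" using inv[OF n(1)] by (simp add: P_def)
        then show "h \<in> P ` ball (\<phi> l) s" using n(2) by blast
      qed
    qed
  qed
qed

text \<open>Every map of G0 is the centre of a parameter ball. Scaling all radii by t gives the
  nested levels, and images of closed balls are the compact sets between them.\<close>

theorem rich_levels:
  assumes G0: "finite G0" "G0 \<subseteq> f ` topspace \<Lambda>" and e: "e > 0"
  obtains R :: "real \<Rightarrow> rational_map set" where "\<And>t. 0 < t \<Longrightarrow> t \<le> 1 \<Longrightarrow> rich (f ` topspace \<Lambda>) (R t)"
    "\<And>t. 0 < t \<Longrightarrow> t \<le> 1 \<Longrightarrow> G0 \<subseteq> R t"
    "\<And>s t. 0 < s \<Longrightarrow> s < t \<Longrightarrow> t \<le> 1 \<Longrightarrow> \<exists>Q. compact Q \<and> R s \<subseteq> Q \<and> Q \<subseteq> R t"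
    "R 1 \<subseteq> thicken e G0"
proof -
  define good where "good g P a r \<longleftrightarrow> r > 0 \<and> continuous_on (cball a r) P \<and> P a = g \<and>
    (\<forall>v\<in>ball a r. dist g (P v) < e) \<and> (\<forall>s. 0 < s \<longrightarrow> s \<le> r \<longrightarrow> (\<exists>W. openin \<Lambda> W \<and> P ` ball a s = f ` W))"
    for g :: rational_map and P :: "complex ^ 'n \<Rightarrow> rational_map" and a r
  have "\<forall>g\<in>G0. \<exists>P a r. good g P a r"
  proof
    fix g assume "g \<in> G0"
    then have "g \<in> f ` topspace \<Lambda>" using G0(2) by blast
    from local_parametrization[OF this e] show "\<exists>P a r. good g P a r" unfolding good_def .
  qed
  then obtain P a r where good: "\<And>g. g \<in> G0 \<Longrightarrow> good g (P g) (a g) (r g)" by metis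
  have r: "r g > 0" "continuous_on (cball (a g) (r g)) (P g)" "P g (a g) = g"
    and near: "\<And>v. v \<in> ball (a g) (r g) \<Longrightarrow> dist g (P g v) < e"
    and image: "\<And>s. 0 < s \<Longrightarrow> s \<le> r g \<Longrightarrow> \<exists>W. openin \<Lambda> W \<and> P g ` ball (a g) s = f ` W" if "g \<in> G0" for g
    using good[OF that, unfolded good_def] by simp_all
  define R where "R t = (\<Union>g\<in>G0. P g ` ball (a g) (t * r g))" for t
  show ?thesis
  proof (rule that[of R])
    fix t :: real assume t: "0 < t" "t \<le> 1"
    have "\<forall>g\<in>G0. \<exists>W. openin \<Lambda> W \<and> P g ` ball (a g) (t * r g) = f ` W"
    proof
      fix g assume g: "g \<in> G0"
      have "0 < t * r g" "t * r g \<le> r g" using t r(1)[OF g] by (auto simp: mult_left_le_one_le)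
      then show "\<exists>W. openin \<Lambda> W \<and> P g ` ball (a g) (t * r g) = f ` W" by (rule image[OF g])
    qed
    then obtain W where W: "\<And>g. g \<in> G0 \<Longrightarrow> openin \<Lambda> (W g) \<and> P g ` ball (a g) (t * r g) = f ` W g" by metis
    have "R t = f ` (\<Union>g\<in>G0. W g)" unfolding R_def using W by (simp add: image_UN)
    moreover have "openin \<Lambda> (\<Union>g\<in>G0. W g)" using W by blast
    ultimately show "rich (f ` topspace \<Lambda>) (R t)" using rich_image by metis
    show "G0 \<subseteq> R t"
    proof
      fix g assume g: "g \<in> G0"
      then have "a g \<in> ball (a g) (t * r g)" using t r(1) by simp
      then have "P g (a g) \<in> R t" unfolding R_def using g by blast
      then show "g \<in> R t" using r(3)[OF g] by simp
    qed
  next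
    fix s t :: real assume st: "0 < s" "s < t" "t \<le> 1"
    let ?Q = "\<Union>g\<in>G0. P g ` cball (a g) (s * r g)"
    have "compact ?Q"
    proof (rule compact_UN[OF G0(1)])
      fix g assume g: "g \<in> G0"
      have "s * r g \<le> r g" using st r(1)[OF g] by simp
      then have "continuous_on (cball (a g) (s * r g)) (P g)"
        by (intro continuous_on_subset[OF r(2)[OF g]]) auto
      then show "compact (P g ` cball (a g) (s * r g))" by (rule compact_continuous_image) simp
    qed
    moreover have "R s \<subseteq> ?Q" unfolding R_def by (intro UN_mono image_mono) auto
    moreover have "?Q \<subseteq> R t" unfolding R_def
    proof (intro UN_mono image_mono subset_refl)
      fix g assume g: "g \<in> G0"
      have "s * r g < t * r g" using st r(1)[OF g] by simp
      then show "cball (a g) (s * r g) \<subseteq> ball (a g) (t * r g)" by auto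
    qed
    ultimately show "\<exists>Q. compact Q \<and> R s \<subseteq> Q \<and> Q \<subseteq> R t" by blast
  next
    show "R 1 \<subseteq> thicken e G0"
    proof
      fix h assume "h \<in> R 1"
      then obtain g v where g: "g \<in> G0" "v \<in> ball (a g) (r g)" "h = P g v" unfolding R_def by auto
      then have "dist g h < e" using near by blast
      then show "h \<in> thicken e G0" using g(1) unfolding thicken_def by blast
    qed
  qed
qed

end


section \<open>Finitely supported measures\<close>

text \<open>The point measure is pushed forward to the Borel sets of Y, because measures in
  \<open>M1 Y\<close> have Y as their carrier.\<close>

definition atomic_measure :: "'a::metric_space set \<Rightarrow> 'a set \<Rightarrow> ('a \<Rightarrow> real) \<Rightarrow> 'a measure" where
  "atomic_measure Y \<Gamma> w = distr (point_measure \<Gamma> (\<lambda>x. ennreal (w x))) (restrict_space borel Y) (\<lambda>x. x)"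

lemma
  fixes Y :: "'a::metric_space set"
  assumes \<Gamma>: "finite \<Gamma>" "\<Gamma> \<subseteq> Y" and w: "\<And>x. x \<in> \<Gamma> \<Longrightarrow> w x > 0" "sum w \<Gamma> = 1"
  shows atomic_measure_M1: "atomic_measure Y \<Gamma> w \<in> M1 Y"
    and supp_atomic_measure: "supp (atomic_measure Y \<Gamma> w) = \<Gamma>"
    and integral_atomic_measure: "continuous_on Y \<phi> \<Longrightarrow>
      (\<integral>x. \<phi> x \<partial>atomic_measure Y \<Gamma> w) = (\<Sum>x\<in>\<Gamma>. w x *\<^sub>R (\<phi> x :: complex))"
proof -
  let ?P = "point_measure \<Gamma> (\<lambda>x. ennreal (w x))" and ?\<tau> = "atomic_measure Y \<Gamma> w"
  have m: "(\<lambda>x. x) \<in> measurable ?P (restrict_space borel Y)"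
    using \<Gamma>(2) by (auto simp: space_restrict_space)
  have "emeasure ?P (space ?P) = (\<Sum>x\<in>\<Gamma>. ennreal (w x))"
    by (simp add: space_point_measure emeasure_point_measure_finite \<Gamma>(1))
  also have "\<dots> = ennreal (sum w \<Gamma>)" by (rule sum_ennreal) (use w(1) less_imp_le in blast)
  finally have "prob_space ?P" using w(2) by (intro prob_spaceI) simp
  then have "prob_space ?\<tau>" unfolding atomic_measure_def by (rule prob_space.prob_space_distr[OF _ m])
  then show "?\<tau> \<in> M1 Y" by (simp add: M1_def atomic_measure_def)
  have sp: "space ?\<tau> = Y" by (simp add: atomic_measure_def space_restrict_space)
  have em: "emeasure ?\<tau> (U \<inter> Y) = (\<Sum>x\<in>U \<inter> \<Gamma>. ennreal (w x))" if "open U" for U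
  proof -
    have "U \<inter> Y \<in> sets (restrict_space borel Y)" using that by (auto simp: sets_restrict_space)
    then have "emeasure ?\<tau> (U \<inter> Y) = emeasure ?P ((\<lambda>x. x) -` (U \<inter> Y) \<inter> space ?P)"
      unfolding atomic_measure_def by (rule emeasure_distr[OF m])
    also have "(\<lambda>x. x) -` (U \<inter> Y) \<inter> space ?P = U \<inter> \<Gamma>" using \<Gamma>(2) by (auto simp: space_point_measure)
    finally show ?thesis by (simp add: emeasure_point_measure_finite \<Gamma>(1))
  qed
  show "supp ?\<tau> = \<Gamma>"
  proof (intro equalityI subsetI)
    fix x assume x: "x \<in> supp ?\<tau>"
    show "x \<in> \<Gamma>"
    proof (rule ccontr)
      assume "x \<notin> \<Gamma>"
      moreover have "open (- \<Gamma>)" using finite_imp_closed[OF \<Gamma>(1)] by (simp add: open_Compl)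
      ultimately have "emeasure ?\<tau> (- \<Gamma> \<inter> Y) > 0" using x sp unfolding supp_def by auto
      then show False using em[OF \<open>open (- \<Gamma>)\<close>] by simp
    qed
  next
    fix x assume x: "x \<in> \<Gamma>"
    have "emeasure ?\<tau> (U \<inter> Y) > 0" if U: "open U" "x \<in> U" for U
    proof -
      have "0 < ennreal (w x)" using w(1)[OF x] by simp
      also have "\<dots> \<le> (\<Sum>x\<in>U \<inter> \<Gamma>. ennreal (w x))"
        by (rule member_le_sum) (use x U(2) \<Gamma>(1) in auto)
      finally show ?thesis using em[OF U(1)] by simp
    qed
    then show "x \<in> supp ?\<tau>" using x \<Gamma>(2) sp unfolding supp_def by auto
  qed
  show "(\<integral>x. \<phi> x \<partial>?\<tau>) = (\<Sum>x\<in>\<Gamma>. w x *\<^sub>R \<phi> x)" if "continuous_on Y \<phi>"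
  proof -
    have "(\<integral>x. \<phi> x \<partial>?\<tau>) = (\<integral>x. \<phi> x \<partial>?P)"
      unfolding atomic_measure_def
      by (rule integral_distr[OF m borel_measurable_continuous_on_restrict[OF that]])
    also have "\<dots> = (\<Sum>x\<in>\<Gamma>. w x *\<^sub>R \<phi> x)"
      by (rule lebesgue_integral_point_measure_finite[OF \<Gamma>(1)]) (use w(1) less_imp_le in blast)
    finally show ?thesis .
  qed
qed

lemma atomic_measure_M1c:
  assumes "finite \<Gamma>" "\<Gamma> \<subseteq> Y" "\<And>x. x \<in> \<Gamma> \<Longrightarrow> w x > 0" "sum w \<Gamma> = 1"
  shows "atomic_measure Y \<Gamma> w \<in> M1c Y"
  using atomic_measure_M1[of \<Gamma> Y w] supp_atomic_measure[of \<Gamma> Y w] assms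
  by (simp add: M1c_def finite_imp_compact)

text \<open>The weights are the integrals of a partition of unity subordinate to the \<open>e\<close>-balls around \<open>G\<close>,
  mixed with a small uniform weight on \<open>\<Gamma>\<close>.\<close>

lemma atomic_approximation:
  fixes Y :: "'a::metric_space set"
  assumes \<tau>: "\<tau> \<in> M1 Y" and AE_S: "AE x in \<tau>. x \<in> S"
    and G: "finite G" "G \<subseteq> S" "S \<subseteq> thicken e G" and \<Gamma>: "finite \<Gamma>" "G \<subseteq> \<Gamma>" "\<Gamma> \<subseteq> Y" and e: "0 < e" "e < 1"
  obtains w where "\<And>x. x \<in> \<Gamma> \<Longrightarrow> w x > 0" "sum w \<Gamma> = 1"
    "\<And>(\<phi> :: 'a \<Rightarrow> complex) M c. continuous_on Y \<phi> \<Longrightarrow> (\<And>y. y \<in> Y \<Longrightarrow> norm (\<phi> y) \<le> M) \<Longrightarrow>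
      (\<And>x y. x \<in> S \<Longrightarrow> y \<in> S \<Longrightarrow> dist x y < e \<Longrightarrow> norm (\<phi> x - \<phi> y) \<le> c) \<Longrightarrow>
      norm ((\<integral>x. \<phi> x \<partial>\<tau>) - (\<Sum>x\<in>\<Gamma>. w x *\<^sub>R \<phi> x)) \<le> c + 2 * e * M"
proof -
  have sets: "sets \<tau> = sets (restrict_space borel Y)" and "prob_space \<tau>" using \<tau> by (auto simp: M1_def)
  then interpret prob_space \<tau> by blast
  have sp: "space \<tau> = Y" using sets_eq_imp_space_eq[OF sets] by (simp add: space_restrict_space)
  define b where "b g y = max 0 (e - dist g y)" for g y :: 'a
  define B where "B y = (\<Sum>g\<in>G. b g y)" for y
  define u where "u g y = b g y / B y" for g y
  have b0: "b g y \<ge> 0" for g y by (simp add: b_def)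
  have bB: "b g y \<le> B y" if "g \<in> G" for g y
    unfolding B_def by (rule member_le_sum[OF that]) (use b0 G(1) in auto)
  have u0: "0 \<le> u g y" if "g \<in> G" for g y using b0[of g y] bB[OF that, of y] by (simp add: u_def)
  have u1: "u g y \<le> 1" if "g \<in> G" for g y using b0[of g y] bB[OF that, of y] unfolding u_def divide_le_eq_1 by linarith
  have sum_u: "(\<Sum>g\<in>G. u g y) = 1" if y: "y \<in> S" for y
  proof -
    obtain g where g: "g \<in> G" "dist g y < e" using G(3) y unfolding thicken_def by blast
    then have "b g y > 0" by (simp add: b_def)
    then have "B y > 0" using bB[OF g(1), of y] by simp
    then show ?thesis unfolding u_def by (simp add: B_def flip: sum_divide_distrib)
  qed
  have bm: "b g \<in> borel_measurable borel" for g
    unfolding b_def by (intro borel_measurable_continuous_onI continuous_intros)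
  have "u g \<in> borel_measurable borel" for g
    unfolding u_def B_def by (intro borel_measurable_divide borel_measurable_sum bm)
  then have "u g \<in> borel_measurable (restrict_space borel Y)" for g by (rule measurable_restrict_space1)
  then have um: "u g \<in> borel_measurable \<tau>" for g unfolding measurable_cong_sets[OF sets refl] .
  have ui: "integrable \<tau> (u g)" if "g \<in> G" for g
    by (rule integrable_const_bound[of _ 1, OF _ um]) (use u0[OF that] u1[OF that] in auto)
  define m where "m g = (\<integral>y. u g y \<partial>\<tau>)" for g
  have m0: "m g \<ge> 0" if "g \<in> G" for g unfolding m_def using u0[OF that] by simp
  have "(\<Sum>g\<in>G. m g) = (\<integral>y. (\<Sum>g\<in>G. u g y) \<partial>\<tau>)" unfolding m_def by (simp add: ui)
  also have "\<dots> = (\<integral>y. 1 \<partial>\<tau>)"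
  proof (rule integral_cong_AE)
    show "AE y in \<tau>. (\<Sum>g\<in>G. u g y) = 1" using AE_S by eventually_elim (rule sum_u)
  qed (use um in auto)
  finally have msum: "(\<Sum>g\<in>G. m g) = 1" by (simp add: prob_space)
  then have "G \<noteq> {}" by auto
  then have N: "card \<Gamma> > 0" using \<Gamma> by (auto simp: card_gt_0_iff)
  define w where "w x = (1 - e) * (if x \<in> G then m x else 0) + e / card \<Gamma>" for x
  have Gsum: "(\<Sum>x\<in>\<Gamma>. if x \<in> G then h x else 0) = sum h G" for h :: "'a \<Rightarrow> 'b::comm_monoid_add"
    using \<Gamma>(2) by (simp add: Int_absorb1 flip: sum.inter_restrict[OF \<Gamma>(1)])
  show ?thesis
  proof (rule that[of w])
    show "w x > 0" if "x \<in> \<Gamma>" for x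
    proof -
      have "0 \<le> (1 - e) * (if x \<in> G then m x else 0)" using m0 e by simp
      moreover have "e / card \<Gamma> > 0" using e N by simp
      ultimately show ?thesis by (simp add: w_def)
    qed
    have "sum w \<Gamma> = (1 - e) * (\<Sum>x\<in>\<Gamma>. if x \<in> G then m x else 0) + (\<Sum>x\<in>\<Gamma>. e / card \<Gamma>)"
      unfolding w_def sum.distrib sum_distrib_left ..
    also have "\<dots> = 1" using N by (simp add: Gsum msum)
    finally show "sum w \<Gamma> = 1" .
    fix \<phi> :: "'a \<Rightarrow> complex" and M c
    assume \<phi>: "continuous_on Y \<phi>" and M: "\<And>y. y \<in> Y \<Longrightarrow> norm (\<phi> y) \<le> M"
      and c: "\<And>x y. x \<in> S \<Longrightarrow> y \<in> S \<Longrightarrow> dist x y < e \<Longrightarrow> norm (\<phi> x - \<phi> y) \<le> c"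
    have \<phi>m: "\<phi> \<in> borel_measurable \<tau>"
      unfolding measurable_cong_sets[OF sets refl] by (rule borel_measurable_continuous_on_restrict[OF \<phi>])
    have \<phi>i: "integrable \<tau> \<phi>"
      by (rule integrable_const_bound[of _ M, OF _ \<phi>m]) (use M sp in \<open>auto intro: AE_I2\<close>)
    define E where "E = (\<integral>x. \<phi> x \<partial>\<tau>)"
    \<comment> \<open>The new integral is (1 - e) S1 + e S3, so the error is (E - S1) + e (S1 - S3).
      The first part is bounded by the oscillation c, the second by 2 e M.\<close>
    define S1 where "S1 = (\<Sum>g\<in>G. m g *\<^sub>R \<phi> g)"
    define S3 where "S3 = (1 / card \<Gamma>) *\<^sub>R (\<Sum>x\<in>\<Gamma>. \<phi> x)"
    let ?h = "\<lambda>y. \<phi> y - (\<Sum>g\<in>G. u g y *\<^sub>R \<phi> g)"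
    have hi: "integrable \<tau> ?h" by (intro Bochner_Integration.integrable_diff Bochner_Integration.integrable_sum integrable_scaleR_left \<phi>i ui)
    have "E - S1 = (\<integral>y. ?h y \<partial>\<tau>)"
      unfolding E_def S1_def m_def by (simp add: \<phi>i ui)
    then have "norm (E - S1) \<le> (\<integral>y. norm (?h y) \<partial>\<tau>)" using integral_norm_bound[of \<tau> ?h] by simp
    also have "\<dots> \<le> c"
    proof (rule integral_le_const)
      show "integrable \<tau> (\<lambda>y. norm (?h y))" using hi by (rule integrable_norm)
      show "AE y in \<tau>. norm (?h y) \<le> c"
        using AE_S
      proof eventually_elim
        case (elim y)
        have "?h y = (\<Sum>g\<in>G. u g y) *\<^sub>R \<phi> y - (\<Sum>g\<in>G. u g y *\<^sub>R \<phi> g)" using sum_u[OF elim] by simp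
        also have "\<dots> = (\<Sum>g\<in>G. u g y *\<^sub>R (\<phi> y - \<phi> g))"
          by (simp only: scaleR_left.sum scaleR_diff_right sum_subtractf)
        finally have "norm (?h y) = norm (\<Sum>g\<in>G. u g y *\<^sub>R (\<phi> y - \<phi> g))" by simp
        also have "\<dots> \<le> (\<Sum>g\<in>G. u g y * c)"
        proof (rule sum_norm_le)
          fix g assume g: "g \<in> G"
          show "norm (u g y *\<^sub>R (\<phi> y - \<phi> g)) \<le> u g y * c"
          proof (cases "dist g y < e")
            case True
            then have "norm (\<phi> y - \<phi> g) \<le> c" using c[of y g] elim g G(2) by (auto simp: dist_commute)
            then show ?thesis using u0[OF g, of y] by (simp add: mult_left_mono)
          next
            case False
            then have "u g y = 0" by (simp add: u_def b_def)
            then show ?thesis by simp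
          qed
        qed
        also have "\<dots> = c" using sum_u[OF elim] by (simp flip: sum_distrib_right)
        finally show ?case .
      qed
    qed
    finally have ES: "norm (E - S1) \<le> c" .
    have "norm S1 \<le> (\<Sum>g\<in>G. m g * M)"
      unfolding S1_def
    proof (rule sum_norm_le)
      fix g assume g: "g \<in> G"
      then have "norm (\<phi> g) \<le> M" using M \<Gamma> by blast
      then show "norm (m g *\<^sub>R \<phi> g) \<le> m g * M" using m0[OF g] by (simp add: mult_left_mono)
    qed
    also have "\<dots> = M" using msum by (simp flip: sum_distrib_right)
    finally have S1: "norm S1 \<le> M" .
    have "norm (\<Sum>x\<in>\<Gamma>. \<phi> x) \<le> card \<Gamma> * M" using \<Gamma>(3) M by (intro sum_norm_bound) blast
    then have S3: "norm S3 \<le> M" unfolding S3_def using N by (simp add: field_simps)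
    have "(\<Sum>x\<in>\<Gamma>. w x *\<^sub>R \<phi> x) = (\<Sum>x\<in>\<Gamma>. (1 - e) *\<^sub>R (if x \<in> G then m x *\<^sub>R \<phi> x else 0) + (e / card \<Gamma>) *\<^sub>R \<phi> x)"
      by (intro sum.cong refl) (simp add: w_def scaleR_add_left)
    also have "\<dots> = (1 - e) *\<^sub>R S1 + e *\<^sub>R S3"
      by (simp add: sum.distrib S1_def S3_def Gsum flip: scaleR_sum_right)
    finally have "E - (\<Sum>x\<in>\<Gamma>. w x *\<^sub>R \<phi> x) = (E - S1) + e *\<^sub>R (S1 - S3)" by (simp add: algebra_simps)
    also have "norm \<dots> \<le> c + e * (M + M)"
    proof (rule norm_triangle_le[OF add_mono[OF ES]])
      have "norm (S1 - S3) \<le> M + M" using S1 S3 norm_triangle_ineq4[of S1 S3] by linarith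
      then show "norm (e *\<^sub>R (S1 - S3)) \<le> e * (M + M)" using e by (simp add: mult_left_mono)
    qed
    finally show "norm ((\<integral>x. \<phi> x \<partial>\<tau>) - (\<Sum>x\<in>\<Gamma>. w x *\<^sub>R \<phi> x)) \<le> c + 2 * e * M" by (simp add: E_def algebra_simps)
  qed
qed


section \<open>Supports, Hausdorff distance and the topology on measures\<close>

lemma infdist_less_imp_thicken:
  assumes "L \<noteq> {}" "infdist x L < d" shows "x \<in> thicken d L"
proof -
  have "\<not> (\<forall>a\<in>L. d \<le> dist x a)"
  proof
    assume "\<forall>a\<in>L. d \<le> dist x a"
    then have "d \<le> infdist x L" unfolding infdist_notempty[OF assms(1)] by (intro cINF_greatest assms(1)) blast
    then show False using assms(2) by simp
  qed
  then show ?thesis unfolding thicken_def by (auto simp: dist_commute not_le)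
qed

lemma hausdorff_dist_less_imp_thicken:
  assumes "K \<in> Cpt UNIV" "L \<in> Cpt UNIV" "hausdorff_dist K L < d"
  shows "K \<subseteq> thicken d L" "L \<subseteq> thicken d K"
proof -
  have *: "K \<subseteq> thicken d L"
    if K: "compact K" "L \<noteq> {}" and less: "(SUP x\<in>K. infdist x L) < d" for K L :: "'a set"
  proof
    fix x assume x: "x \<in> K"
    have "compact ((\<lambda>x. infdist x L) ` K)"
      by (intro compact_continuous_image K(1) continuous_on_infdist continuous_on_id)
    then have "bdd_above ((\<lambda>x. infdist x L) ` K)" by (intro bounded_imp_bdd_above compact_imp_bounded)
    then have "infdist x L \<le> (SUP x\<in>K. infdist x L)" by (rule cSUP_upper[OF x])
    then show "x \<in> thicken d L" using less by (intro infdist_less_imp_thicken K(2)) simp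
  qed
  have KL: "compact K" "K \<noteq> {}" "compact L" "L \<noteq> {}" using assms(1,2) by (auto simp: Cpt_def)
  have "(SUP x\<in>K. infdist x L) < d" "(SUP y\<in>L. infdist y K) < d"
    using assms by (simp_all add: hausdorff_dist_def)
  then show "K \<subseteq> thicken d L" "L \<subseteq> thicken d K" using *[OF KL(1,4)] *[OF KL(3,2)] by blast+
qed

lemma hausdorff_dist_le_if_thicken:
  assumes "K \<in> Cpt UNIV" "L \<in> Cpt UNIV" "K \<subseteq> thicken d L" "L \<subseteq> thicken d K"
  shows "hausdorff_dist K L \<le> d"
proof -
  have *: "(SUP x\<in>K. infdist x L) \<le> d" if K: "K \<noteq> {}" and sub: "K \<subseteq> thicken d L" for K L :: "'a set"
  proof (rule cSUP_least[OF K])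
    fix x assume "x \<in> K"
    then obtain y where y: "y \<in> L" "dist y x < d" using sub unfolding thicken_def by blast
    then show "infdist x L \<le> d" using infdist_le[OF y(1), of x] by (simp add: dist_commute)
  qed
  show ?thesis using assms by (auto intro!: * simp: hausdorff_dist_def Cpt_def)
qed

lemma topspace_weak_topology: "topspace (weak_topology Y) = M1 Y"
proof
  show "topspace (weak_topology Y) \<subseteq> M1 Y" unfolding weak_topology_def topology_generated_by_topspace by blast
  have "{\<tau> \<in> M1 Y. (\<integral>x. (\<lambda>_. 0 :: complex) x \<partial>\<tau>) \<in> UNIV} \<in> {{\<tau> \<in> M1 Y. (\<integral>x. \<phi> x \<partial>\<tau>) \<in> U} | (\<phi> :: 'a \<Rightarrow> complex) U.
        continuous_on Y \<phi> \<and> bounded (\<phi> ` Y) \<and> open U}"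
    by (intro CollectI exI[of _ "\<lambda>_. 0 :: complex"] exI[of _ "UNIV :: complex set"])
      (auto intro: boundedI[of _ 0])
  then show "M1 Y \<subseteq> topspace (weak_topology Y)" unfolding weak_topology_def topology_generated_by_topspace by auto
qed

text \<open>It reduces convergence in the weak topology to the generating sets, that is to one test
  function at a time.\<close>

lemma eventually_in_generated_topology:
  assumes "openin (topology_generated_by \<B>) U" "x \<in> U"
    and basis: "\<And>B. B \<in> \<B> \<Longrightarrow> x \<in> B \<Longrightarrow> \<forall>\<^sub>F n in F. s n \<in> B"
  shows "\<forall>\<^sub>F n in F. s n \<in> U"
proof -
  have "generate_topology_on \<B> U" using assms(1) by (simp add: openin_topology_generated_by_iff)
  then show ?thesis using assms(2)
  proof (induction rule: generate_topology_on.induct)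
    case (Int a b)
    then have "\<forall>\<^sub>F n in F. s n \<in> a" "\<forall>\<^sub>F n in F. s n \<in> b" by simp_all
    then show ?case by eventually_elim simp
  next
    case (UN K)
    then obtain k where k: "k \<in> K" "x \<in> k" by blast
    then have "\<forall>\<^sub>F n in F. s n \<in> k" using UN.IH by blast
    then show ?case by eventually_elim (use k(1) in blast)
  qed (auto intro: basis)
qed

text \<open>Second countability of the parameter space makes the image a Lindelof space, which is what forces
  a measure on it to live on its support.\<close>

lemma (in holo_family) AE_in_supp:
  assumes \<tau>: "\<tau> \<in> M1 (f ` topspace \<Lambda>)" shows "AE x in \<tau>. x \<in> supp \<tau>"
proof -
  let ?Y = "f ` topspace \<Lambda>"
  have sets: "sets \<tau> = sets (restrict_space borel ?Y)" using \<tau> by (simp add: M1_def)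
  have sp: "space \<tau> = ?Y" using sets_eq_imp_space_eq[OF sets] by (simp add: space_restrict_space)
  have "second_countable \<Lambda>" using manifold(1) by (simp add: complex_manifold_def)
  then obtain \<B> where cB: "countable \<B>" and basis: "\<forall>U x. openin \<Lambda> U \<and> x \<in> U \<longrightarrow> (\<exists>V\<in>\<B>. x \<in> V \<and> V \<subseteq> U)"
    unfolding second_countable_def by (elim exE conjE)
  define null where "null b U \<longleftrightarrow> open U \<and> emeasure \<tau> (U \<inter> ?Y) = 0 \<and> f ` b \<subseteq> U" for b U
  define \<N> where "\<N> = {b \<in> \<B>. \<exists>U. null b U}"
  have "\<forall>b\<in>\<N>. \<exists>U. null b U" by (simp add: \<N>_def)
  then obtain U where U: "\<And>b. b \<in> \<N> \<Longrightarrow> null b (U b)" by metis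
  have "countable \<N>" using cB unfolding \<N>_def by simp
  moreover have "U b \<inter> ?Y \<in> null_sets \<tau>" if "b \<in> \<N>" for b
    using U[OF that] unfolding null_def by (auto simp: null_sets_def sets sets_restrict_space)
  ultimately have "(\<Union>b\<in>\<N>. U b \<inter> ?Y) \<in> null_sets \<tau>" by (rule null_sets_UN')
  moreover have "{x \<in> space \<tau>. \<not> x \<in> supp \<tau>} \<subseteq> (\<Union>b\<in>\<N>. U b \<inter> ?Y)"
  proof
    fix x assume "x \<in> {x \<in> space \<tau>. \<not> x \<in> supp \<tau>}"
    then obtain W where x: "x \<in> ?Y" and W: "open W" "x \<in> W" "emeasure \<tau> (W \<inter> ?Y) = 0"
      unfolding supp_def sp by (auto simp: not_gr_zero)
    obtain l where l: "l \<in> topspace \<Lambda>" "x = f l" using x by blast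
    have "l \<in> {l \<in> topspace \<Lambda>. f l \<in> W}" using l W(2) by simp
    with openin_family_preimage[OF W(1)] have "\<exists>V\<in>\<B>. l \<in> V \<and> V \<subseteq> {l \<in> topspace \<Lambda>. f l \<in> W}"
      by (intro basis[rule_format] conjI)
    then obtain b where b: "b \<in> \<B>" "l \<in> b" "b \<subseteq> {l \<in> topspace \<Lambda>. f l \<in> W}" by blast
    then have "null b W" using W unfolding null_def by blast
    then have bN: "b \<in> \<N>" using b(1) unfolding \<N>_def by blast
    then have "x \<in> U b" using U[OF bN] b(2) l(2) unfolding null_def by blast
    then show "x \<in> (\<Union>b\<in>\<N>. U b \<inter> ?Y)" using bN x by blast
  qed
  ultimately show ?thesis by (rule AE_I')
qed

lemma (in holo_family) supp_in_Cpt: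
  assumes "\<tau> \<in> M1c (f ` topspace \<Lambda>)" shows "supp \<tau> \<in> Cpt (f ` topspace \<Lambda>)"
proof -
  let ?Y = "f ` topspace \<Lambda>"
  have \<tau>: "\<tau> \<in> M1 ?Y" "compact (supp \<tau>)" using assms by (auto simp: M1c_def)
  have sets: "sets \<tau> = sets (restrict_space borel ?Y)" and "prob_space \<tau>" using \<tau> by (auto simp: M1_def)
  then interpret prob_space \<tau> by blast
  have sp: "space \<tau> = ?Y" using sets_eq_imp_space_eq[OF sets] by (simp add: space_restrict_space)
  have "supp \<tau> \<noteq> {}"
  proof
    assume "supp \<tau> = {}"
    then have "AE x in \<tau>. False" using AE_in_supp[OF \<tau>(1)] by simp
    then show False by simp
  qed
  then show ?thesis using \<tau>(2) sp unfolding Cpt_def supp_def by blast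
qed

lemma (in holo_family) topspace_topology_O:
  "topspace (topology_O (f ` topspace \<Lambda>)) = M1c (f ` topspace \<Lambda>)"
proof -
  interpret H: Metric_space "Cpt (f ` topspace \<Lambda>)" hausdorff_dist by (rule Metric_space_Cpt)
  show ?thesis
    unfolding topology_O_def topspace_pullback_topology
    using supp_in_Cpt by (auto simp: topspace_weak_topology M1c_def)
qed

section \<open>Approximation of finite sets of generators\<close>

lemma finite_const_pts_if_nice:
  assumes "nice Y \<Lambda> f" shows "finite (const_pts (f ` topspace \<Lambda>))"
  by (rule finite_const_pts) (insert assms[unfolded nice_def weakly_nice_def], elim conjE, assumption)

text \<open>Niceness speaks of minimal sets of measures, so it is applied to the Dirac mass at one
  map g0: the orbit of x under g0 is finite and contains a minimal set, which contains x because x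
  is periodic.\<close>

lemma (in holo_family) nice_at_core:
  assumes nice: "nice (f ` topspace \<Lambda>) \<Lambda> f" and x: "x \<in> core (f ` topspace \<Lambda>)" and p: "p \<ge> 1"
    and fixed: "\<And>gs. length gs = p \<Longrightarrow> set gs \<subseteq> f ` topspace \<Lambda> \<Longrightarrow> fold apply_rat gs x = x"
  shows "\<not> (\<lambda>g. sphere_deriv (apply_rat g) x) constant_on f ` topspace \<Lambda> \<or>
    (\<forall>g\<in>f ` topspace \<Lambda>. sphere_deriv (apply_rat g) x = 0)"
proof (cases "topspace \<Lambda> = {}")
  case False
  let ?Y = "f ` topspace \<Lambda>"
  obtain g0 where g0: "g0 \<in> ?Y" using False by blast
  define \<tau> where "\<tau> = atomic_measure ?Y {g0} (\<lambda>_. 1)"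
  have \<tau>: "\<tau> \<in> M1c ?Y" unfolding \<tau>_def by (rule atomic_measure_M1c) (use g0 in auto)
  have supp: "supp \<tau> = {g0}" unfolding \<tau>_def by (rule supp_atomic_measure) (use g0 in auto)
  have G: "G_of \<tau> = {fold apply_rat gs | gs. gs \<noteq> [] \<and> set gs \<subseteq> {g0}}"
    unfolding supp by (rule semigroup_generated_eq)
  have word: "fold apply_rat (replicate m g0) \<in> G_of \<tau>" if "m \<ge> 1" for m
    unfolding G using that by (intro CollectI exI[of _ "replicate m g0"]) auto
  have "finite (const_pts ?Y)" by (rule finite_const_pts_if_nice[OF nice])
  moreover have "core ?Y \<subseteq> const_pts ?Y" unfolding core_def by (auto dest: spec[of _ "[]"])
  ultimately have fin: "finite (core ?Y)" by (rule finite_subset[rotated])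
  have step: "g z \<in> core ?Y" if g: "g \<in> G_of \<tau>" and z: "z \<in> core ?Y" for g z
  proof -
    obtain gs where gs: "g = fold apply_rat gs" "set gs \<subseteq> {g0}" using g unfolding G by blast
    have "fold apply_rat hs (g z) \<in> const_pts ?Y" if "set hs \<subseteq> ?Y" for hs
    proof -
      have "set (gs @ hs) \<subseteq> ?Y" using gs(2) g0 that by auto
      then have "fold apply_rat (gs @ hs) z \<in> const_pts ?Y" using z unfolding core_def by blast
      then show ?thesis using gs(1) by simp
    qed
    then show ?thesis unfolding core_def by blast
  qed
  have ne: "G_of \<tau> \<noteq> {}" using word[of 1] by auto
  obtain L where L: "L \<in> Min_sets (G_of \<tau>)" "L \<subseteq> core ?Y" "L \<subseteq> {g x | g. g \<in> G_of \<tau>}"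
    by (rule finite_orbit_minimal[where G = "G_of \<tau>" and D = "core ?Y" and d = x, OF ne _ fin _ x])
      (erule (1) semigroup_generated.comp, erule (1) step)
  obtain y where y: "y \<in> L" using L(1) unfolding Min_sets_def by blast
  then obtain gs where gs: "y = fold apply_rat gs x" "set gs \<subseteq> {g0}" using L(3) unfolding G by blast
  let ?m = "length gs"
  have gs_eq: "gs = replicate ?m g0" using gs(2) by (metis replicate_length_same singletonD subsetD)
  have pow: "fold apply_rat (replicate m g0) = apply_rat g0 ^^ m" for m by (simp add: fold_replicate)
  have px: "(apply_rat g0 ^^ p) x = x"
    unfolding pow[symmetric] by (rule fixed) (use p g0 in simp_all)
  have "((apply_rat g0 ^^ p) ^^ k) x = x" for k by (induction k) (simp_all add: px)
  then have "(apply_rat g0 ^^ (p * ?m)) x = x" unfolding funpow_mult mult.commute[of p] .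
  moreover have "p * ?m = (p - 1) * ?m + ?m" using p by (simp add: algebra_simps)
  moreover have "y = (apply_rat g0 ^^ ?m) x" using gs(1) gs_eq pow by metis
  \<comment> \<open>Since y is reached from x in m steps and p m steps fix x, another (p - 1) m
    steps lead from y back to x. This number may be 0, which is no word of the semigroup; then y =
    x.\<close>
  ultimately have ret: "(apply_rat g0 ^^ ((p - 1) * ?m)) y = x" by (simp add: funpow_add)
  have xL: "x \<in> L"
  proof (cases "(p - 1) * ?m = 0")
    case True
    then have "y = x" using ret unfolding True by simp
    then show ?thesis using y by simp
  next
    case False
    then have "(p - 1) * ?m \<ge> 1" by linarith
    then have "fold apply_rat (replicate ((p - 1) * ?m) g0) y \<in> L" by (intro min_set_mem[OF L(1) y] word)
    then show ?thesis using ret pow by simp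
  qed
  have "L \<subseteq> S_set \<Lambda> f" using L(2) core_subset_S_set by blast
  then have "\<not> (\<lambda>l. sphere_deriv (apply_rat (f l)) x) constant_on topspace \<Lambda> \<or>
      (\<forall>l\<in>topspace \<Lambda>. sphere_deriv (apply_rat (f l)) x = 0)"
    by (rule nice[unfolded nice_def, THEN conjunct2, rule_format, OF \<tau> L(1) _ xL])
  then show ?thesis unfolding constant_on_def by simp
qed simp

text \<open>Mildness is applied to the uniform measure on G. The attracting set A is then shrunk to
  a neighbourhood of the closure of B, whose complement contains a non-empty open set and is
  therefore infinite.\<close>

lemma mild_finite_trap:
  assumes "mild Y" "finite G" "G \<noteq> {}" "G \<subseteq> Y"
  obtains n A where "traps G n A" "A \<noteq> {}" "infinite (- A)"
proof -
  define \<tau> where "\<tau> = atomic_measure Y G (\<lambda>_. 1 / card G)"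
  have card: "0 < card G" using assms(2,3) by (simp add: card_gt_0_iff)
  have \<tau>: "\<tau> \<in> M1c Y" unfolding \<tau>_def by (rule atomic_measure_M1c[OF assms(2,4)]) (use card in auto)
  have supp: "supp \<tau> = G" unfolding \<tau>_def by (rule supp_atomic_measure[OF assms(2,4)]) (use card in auto)
  obtain L where "attracting_for \<tau> L" using assms(1) \<tau> unfolding mild_def by blast
  then obtain A B n where n: "n \<ge> 1" and AB: "open A" "at_least_three (- A)" "L \<subseteq> B" "closure B \<subseteq> A"
    and LM: "L \<in> Min_sets (G_of \<tau>)" and
    words: "\<And>gs. length gs = n \<Longrightarrow> set gs \<subseteq> supp \<tau> \<Longrightarrow> fold apply_rat gs ` A \<subseteq> B"
    unfolding attracting_for_def by blast
  have "- A \<noteq> {}"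
  proof
    assume "- A = {}"
    then show False using AB(2) unfolding at_least_three_def by simp
  qed
  then obtain q where q: "q \<notin> A" by blast
  have cB: "compact (closure B)" by (rule closed_imp_compact_sphere) simp
  obtain d where d: "d > 0" "thicken d (closure B) \<subseteq> A" using compact_thicken_subset[OF cB AB(1,4)] .
  let ?A = "thicken (d / 2) (closure B)"
  have Bsub: "closure B \<subseteq> ?A" using d(1) by (intro subset_thicken) simp
  have clA: "closure ?A \<subseteq> A" using closure_thicken_subset[of "d / 2" "closure B"] d by simp
  then have Asub: "?A \<subseteq> A" using closure_subset by blast
  show ?thesis
  proof (rule that[of n ?A])
    show "traps G n ?A"
      unfolding traps_def
    proof (intro conjI n open_thicken exI[of _ "closure B"] cB Bsub allI impI)
      fix gs x assume gs: "length gs = n" "set gs \<subseteq> G" "x \<in> ?A"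
      then have "fold apply_rat gs x \<in> B" using words[of gs] supp Asub by blast
      then show "fold apply_rat gs x \<in> closure B" using closure_subset by blast
    qed
    show "?A \<noteq> {}" using LM AB(3) Bsub closure_subset unfolding Min_sets_def by blast
    have "infinite (- closure ?A)" by (rule infinite_open_sphere) (use q clA in auto)
    then show "infinite (- ?A)" by (rule infinite_super[rotated]) (use closure_subset in blast)
  qed
qed

lemma (in holo_family) exists_wms_near:
  assumes mild: "mild (f ` topspace \<Lambda>)" and nice: "nice (f ` topspace \<Lambda>) \<Lambda> f"
    and G: "finite G" "G \<noteq> {}" "G \<subseteq> f ` topspace \<Lambda>" and e: "e > 0"
  obtains \<Gamma> where "finite \<Gamma>" "G \<subseteq> \<Gamma>" "\<Gamma> \<subseteq> f ` topspace \<Lambda>" "\<Gamma> \<subseteq> thicken e G" "wms \<Gamma>"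
proof -
  let ?Y = "f ` topspace \<Lambda>"
  obtain n A' where A: "traps G n A'" "A' \<noteq> {}" "infinite (- A')" using mild_finite_trap[OF mild G] .
  \<comment> \<open>The trap is made to survive a perturbation of G, so that it also works for the
    whole level \<open>R 1\<close>.\<close>
  obtain d where d: "d > 0" "traps (thicken d G) n A'"
    using traps_thicken[OF finite_imp_compact[OF G(1)] A(1)] .
  have de: "0 < min d e" using d(1) e by simp
  show ?thesis
  proof (rule rich_levels[OF G(1,3) de])
    fix R :: "real \<Rightarrow> rational_map set"
    assume R: "\<And>t. 0 < t \<Longrightarrow> t \<le> 1 \<Longrightarrow> rich ?Y (R t)"
      "\<And>t. 0 < t \<Longrightarrow> t \<le> 1 \<Longrightarrow> G \<subseteq> R t"
      "\<And>s t. 0 < s \<Longrightarrow> s < t \<Longrightarrow> t \<le> 1 \<Longrightarrow> \<exists>Q. compact Q \<and> R s \<subseteq> Q \<and> Q \<subseteq> R t"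
      "R 1 \<subseteq> thicken (min d e) G"
    interpret level_family ?Y R
    proof
      show "finite (const_pts ?Y)" by (rule finite_const_pts_if_nice[OF nice])
      show "R t \<noteq> {}" if "0 < t" "t \<le> 1" for t using R(2)[OF that] G(2) by blast
      show "\<not> (\<lambda>g. sphere_deriv (apply_rat g) x) constant_on ?Y \<or> (\<forall>g\<in>?Y. sphere_deriv (apply_rat g) x = 0)"
        if "x \<in> core ?Y" "p \<ge> 1" "\<And>gs. length gs = p \<Longrightarrow> set gs \<subseteq> ?Y \<Longrightarrow> fold apply_rat gs x = x" for x p
        using nice that by (rule nice_at_core)
    qed (use R in auto)
    have "R 1 \<subseteq> thicken d G" using R(4) thicken_mono[of "min d e" d G] by simp
    then have tr: "traps (R 1) n A'" by (rule traps_subset[OF d(2)])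
    obtain \<Gamma> where \<Gamma>: "finite \<Gamma>" "G \<subseteq> \<Gamma>" "\<Gamma> \<subseteq> R 1" "wms \<Gamma>"
      using exists_wms_generators[OF tr A(2,3) G(1) R(2)] .
    show ?thesis
    proof (rule that[OF \<Gamma>(1,2)])
      have "rich ?Y (R 1)" using R(1) by simp
      then have "R 1 \<subseteq> ?Y" unfolding rich_def by (rule conjunct1)
      then show "\<Gamma> \<subseteq> ?Y" using \<Gamma>(3) by blast
      show "\<Gamma> \<subseteq> thicken e G" using \<Gamma>(3) R(4) thicken_mono[of "min d e" e G] by simp
    qed (rule \<Gamma>(4))
  qed
qed


section \<open>Openness and density\<close>

context holo_family
begin

text \<open>The property depends on the support alone, so a ball in the Hausdorff metric around the
  support is enough and the weak topology contributes its whole space.\<close>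

lemma openin_weakly_mean_stable:
  "openin (topology_O (f ` topspace \<Lambda>)) {\<tau> \<in> M1c (f ` topspace \<Lambda>). weakly_mean_stable \<tau>}"
proof (subst openin_subopen, intro ballI)
  let ?Y = "f ` topspace \<Lambda>"
  interpret H: Metric_space "Cpt ?Y" hausdorff_dist by (rule Metric_space_Cpt)
  fix \<tau> assume \<tau>: "\<tau> \<in> {\<tau> \<in> M1c ?Y. weakly_mean_stable \<tau>}"
  then have sC: "supp \<tau> \<in> Cpt ?Y" using supp_in_Cpt by blast
  have cs: "compact (supp \<tau>)" using sC by (simp add: Cpt_def)
  have ws: "wms (supp \<tau>)" using \<tau> wms_if_weakly_mean_stable by blast
  show "\<exists>T. openin (topology_O ?Y) T \<and> \<tau> \<in> T \<and> T \<subseteq> {\<tau> \<in> M1c ?Y. weakly_mean_stable \<tau>}"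
  proof (rule wms_thicken[OF cs ws])
    fix d :: real
    assume d: "d > 0" and stable: "\<And>S'. S' \<subseteq> thicken d (supp \<tau>) \<Longrightarrow> supp \<tau> \<subseteq> thicken d S' \<Longrightarrow> wms S'"
    let ?U = "M1 ?Y \<times> H.mball (supp \<tau>) d"
    have "openin (prod_topology (weak_topology ?Y) H.mtopology) ?U"
      using openin_topspace[of "weak_topology ?Y"] by (simp add: openin_prod_Times_iff topspace_weak_topology)
    then have "openin (topology_O ?Y) ((\<lambda>\<tau>. (\<tau>, supp \<tau>)) -` ?U \<inter> M1c ?Y)"
      unfolding topology_O_def openin_pullback_topology by blast
    moreover have "\<tau> \<in> (\<lambda>\<tau>. (\<tau>, supp \<tau>)) -` ?U \<inter> M1c ?Y" using \<tau> sC d by (auto simp: M1c_def)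
    moreover have "(\<lambda>\<tau>. (\<tau>, supp \<tau>)) -` ?U \<inter> M1c ?Y \<subseteq> {\<tau> \<in> M1c ?Y. weakly_mean_stable \<tau>}"
    proof
      fix \<sigma> assume \<sigma>: "\<sigma> \<in> (\<lambda>\<tau>. (\<tau>, supp \<tau>)) -` ?U \<inter> M1c ?Y"
      then have less: "supp \<sigma> \<in> Cpt ?Y" "hausdorff_dist (supp \<tau>) (supp \<sigma>) < d" by auto
      have "supp \<tau> \<in> Cpt UNIV" "supp \<sigma> \<in> Cpt UNIV" using sC less(1) by (auto simp: Cpt_def)
      from hausdorff_dist_less_imp_thicken[OF this less(2)] have "wms (supp \<sigma>)" by (intro stable)
      then show "\<sigma> \<in> {\<tau> \<in> M1c ?Y. weakly_mean_stable \<tau>}" using \<sigma> weakly_mean_stable_if_wms by blast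
    qed
    ultimately show ?thesis by blast
  qed
qed

text \<open>The test function is quantified after the measure: one \<sigma> has to serve all \<phi>
  at once. Here M bounds \<phi>, and c is its oscillation on the support of \<tau> at scale
  e.\<close>

lemma weakly_mean_stable_approximation:
  assumes mild: "mild (f ` topspace \<Lambda>)" and nice: "nice (f ` topspace \<Lambda>) \<Lambda> f"
    and \<tau>: "\<tau> \<in> M1c (f ` topspace \<Lambda>)" and e: "0 < e" "e < 1"
  shows "\<exists>\<sigma>\<in>M1c (f ` topspace \<Lambda>). weakly_mean_stable \<sigma> \<and> hausdorff_dist (supp \<tau>) (supp \<sigma>) \<le> e \<and>
    (\<forall>(\<phi> :: rational_map \<Rightarrow> complex) M c. continuous_on (f ` topspace \<Lambda>) \<phi> \<longrightarrow>
      (\<forall>y\<in>f ` topspace \<Lambda>. norm (\<phi> y) \<le> M) \<longrightarrow>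
      (\<forall>x\<in>supp \<tau>. \<forall>y\<in>supp \<tau>. dist x y < e \<longrightarrow> norm (\<phi> x - \<phi> y) \<le> c) \<longrightarrow>
      norm ((\<integral>x. \<phi> x \<partial>\<tau>) - (\<integral>x. \<phi> x \<partial>\<sigma>)) \<le> c + 2 * e * M)"
proof -
  let ?Y = "f ` topspace \<Lambda>" and ?S = "supp \<tau>"
  have \<tau>1: "\<tau> \<in> M1 ?Y" using \<tau> by (simp add: M1c_def)
  have sC: "?S \<subseteq> ?Y" "compact ?S" "?S \<noteq> {}" using supp_in_Cpt[OF \<tau>] by (auto simp: Cpt_def)
  have "\<exists>k. finite k \<and> k \<subseteq> ?S \<and> ?S \<subseteq> (\<Union>x\<in>k. ball x e)"
    using seq_compact_imp_totally_bounded[of ?S] sC(2) e(1) compact_imp_seq_compact by blast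
  then obtain G where G: "finite G" "G \<subseteq> ?S" "?S \<subseteq> thicken e G" unfolding thicken_eq by blast
  have Gne: "G \<noteq> {}" using G(3) sC(3) by (auto simp: thicken_def)
  have GY: "G \<subseteq> ?Y" using G(2) sC(1) by blast
  obtain \<Gamma> where \<Gamma>: "finite \<Gamma>" "G \<subseteq> \<Gamma>" "\<Gamma> \<subseteq> ?Y" "\<Gamma> \<subseteq> thicken e G" "wms \<Gamma>"
    using exists_wms_near[OF mild nice G(1) Gne GY e(1)] .
  show ?thesis
  proof (rule atomic_approximation[OF \<tau>1 AE_in_supp[OF \<tau>1] G \<Gamma>(1-3) e])
    fix w assume w: "\<And>x. x \<in> \<Gamma> \<Longrightarrow> w x > 0" "sum w \<Gamma> = 1"
      and int: "\<And>(\<phi> :: rational_map \<Rightarrow> complex) M c. continuous_on ?Y \<phi> \<Longrightarrow> (\<And>y. y \<in> ?Y \<Longrightarrow> norm (\<phi> y) \<le> M) \<Longrightarrow>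
      (\<And>x y. x \<in> ?S \<Longrightarrow> y \<in> ?S \<Longrightarrow> dist x y < e \<Longrightarrow> norm (\<phi> x - \<phi> y) \<le> c) \<Longrightarrow>
      norm ((\<integral>x. \<phi> x \<partial>\<tau>) - (\<Sum>x\<in>\<Gamma>. w x *\<^sub>R \<phi> x)) \<le> c + 2 * e * M"
    let ?\<sigma> = "atomic_measure ?Y \<Gamma> w"
    have supp: "supp ?\<sigma> = \<Gamma>" by (rule supp_atomic_measure[OF \<Gamma>(1,3) w])
    show ?thesis
    proof (intro bexI[of _ ?\<sigma>] conjI allI impI)
      show "?\<sigma> \<in> M1c ?Y" by (rule atomic_measure_M1c[OF \<Gamma>(1,3) w])
      show "weakly_mean_stable ?\<sigma>" by (rule weakly_mean_stable_if_wms) (simp add: supp \<Gamma>(5))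
      show "hausdorff_dist ?S (supp ?\<sigma>) \<le> e"
        unfolding supp
      proof (rule hausdorff_dist_le_if_thicken)
        show "?S \<in> Cpt UNIV" "\<Gamma> \<in> Cpt UNIV" using sC Gne \<Gamma>(1,2) by (auto simp: Cpt_def finite_imp_compact)
        show "?S \<subseteq> thicken e \<Gamma>" using G(3) \<Gamma>(2) unfolding thicken_def by blast
        show "\<Gamma> \<subseteq> thicken e ?S" using \<Gamma>(4) G(2) unfolding thicken_def by blast
      qed
      fix \<phi> :: "rational_map \<Rightarrow> complex" and M c
      assume \<phi>: "continuous_on ?Y \<phi>" and M: "\<forall>y\<in>?Y. norm (\<phi> y) \<le> M"
        and c: "\<forall>x\<in>?S. \<forall>y\<in>?S. dist x y < e \<longrightarrow> norm (\<phi> x - \<phi> y) \<le> c"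
      have "norm ((\<integral>x. \<phi> x \<partial>\<tau>) - (\<Sum>x\<in>\<Gamma>. w x *\<^sub>R \<phi> x)) \<le> c + 2 * e * M"
        by (rule int[OF \<phi>]) (use M c in auto)
      then show "norm ((\<integral>x. \<phi> x \<partial>\<tau>) - (\<integral>x. \<phi> x \<partial>?\<sigma>)) \<le> c + 2 * e * M"
        by (simp only: integral_atomic_measure[OF \<Gamma>(1,3) w \<phi>])
    qed
  qed
qed

lemma closure_of_weakly_mean_stable:
  assumes mild: "mild (f ` topspace \<Lambda>)" and nice: "nice (f ` topspace \<Lambda>) \<Lambda> f"
  shows "topology_O (f ` topspace \<Lambda>) closure_of {\<tau> \<in> M1c (f ` topspace \<Lambda>). weakly_mean_stable \<tau>} = M1c (f ` topspace \<Lambda>)"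
proof
  let ?Y = "f ` topspace \<Lambda>"
  interpret H: Metric_space "Cpt ?Y" hausdorff_dist by (rule Metric_space_Cpt)
  show "topology_O ?Y closure_of {\<tau> \<in> M1c ?Y. weakly_mean_stable \<tau>} \<subseteq> M1c ?Y"
    using closure_of_subset_topspace topspace_topology_O by metis
  show "M1c ?Y \<subseteq> topology_O ?Y closure_of {\<tau> \<in> M1c ?Y. weakly_mean_stable \<tau>}"
  proof
    fix \<tau> assume \<tau>: "\<tau> \<in> M1c ?Y"
    let ?S = "supp \<tau>"
    have sC: "?S \<in> Cpt ?Y" by (rule supp_in_Cpt[OF \<tau>])
    \<comment> \<open>Shifted by 2 so that every term is strictly below 1, as needed for a mixing
      weight.\<close>
    define e where "e n = 1 / real (n + 2)" for n
    have e: "0 < e n" "e n < 1" for n by (auto simp: e_def)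
    have e0: "e \<longlonglongrightarrow> 0" unfolding e_def using LIMSEQ_ignore_initial_segment[OF lim_1_over_n, of 2] by simp
    obtain \<sigma> where \<sigma>: "\<And>n. \<sigma> n \<in> M1c ?Y" "\<And>n. weakly_mean_stable (\<sigma> n)"
      "\<And>n. hausdorff_dist ?S (supp (\<sigma> n)) \<le> e n"
      and int: "\<And>n (\<phi> :: rational_map \<Rightarrow> complex) M c. continuous_on ?Y \<phi> \<Longrightarrow> \<forall>y\<in>?Y. norm (\<phi> y) \<le> M \<Longrightarrow>
      \<forall>x\<in>?S. \<forall>y\<in>?S. dist x y < e n \<longrightarrow> norm (\<phi> x - \<phi> y) \<le> c \<Longrightarrow>
      norm ((\<integral>x. \<phi> x \<partial>\<tau>) - (\<integral>x. \<phi> x \<partial>\<sigma> n)) \<le> c + 2 * e n * M"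
    proof -
      define good where "good n \<sigma> \<longleftrightarrow> \<sigma> \<in> M1c ?Y \<and> weakly_mean_stable \<sigma> \<and> hausdorff_dist ?S (supp \<sigma>) \<le> e n \<and>
        (\<forall>(\<phi> :: rational_map \<Rightarrow> complex) M c. continuous_on ?Y \<phi> \<longrightarrow> (\<forall>y\<in>?Y. norm (\<phi> y) \<le> M) \<longrightarrow>
          (\<forall>x\<in>?S. \<forall>y\<in>?S. dist x y < e n \<longrightarrow> norm (\<phi> x - \<phi> y) \<le> c) \<longrightarrow>
          norm ((\<integral>x. \<phi> x \<partial>\<tau>) - (\<integral>x. \<phi> x \<partial>\<sigma>)) \<le> c + 2 * e n * M)" for n \<sigma>
      have "\<forall>n. \<exists>\<sigma>. good n \<sigma>"
      proof
        fix n
        from weakly_mean_stable_approximation[OF mild nice \<tau> e(1)[of n] e(2)[of n]]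
        show "\<exists>\<sigma>. good n \<sigma>" unfolding good_def Bex_def .
      qed
      then obtain \<sigma> where good: "\<And>n. good n (\<sigma> n)" by metis
      show thesis
      proof (rule that[of \<sigma>])
        show "\<sigma> n \<in> M1c ?Y" "weakly_mean_stable (\<sigma> n)" "hausdorff_dist ?S (supp (\<sigma> n)) \<le> e n" for n
          using good[of n] by (simp_all only: good_def)
        show "norm ((\<integral>x. \<phi> x \<partial>\<tau>) - (\<integral>x. \<phi> x \<partial>\<sigma> n)) \<le> c + 2 * e n * M"
          if "continuous_on ?Y \<phi>" "\<forall>y\<in>?Y. norm (\<phi> y) \<le> M"
            "\<forall>x\<in>?S. \<forall>y\<in>?S. dist x y < e n \<longrightarrow> norm (\<phi> x - \<phi> y) \<le> c" for n M c and \<phi> :: "rational_map \<Rightarrow> complex"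
          using good[of n, unfolded good_def, THEN conjunct2, THEN conjunct2, THEN conjunct2, rule_format, of \<phi> M c] that
          by simp
      qed
    qed
    have conv: "(\<lambda>n. \<integral>x. \<phi> x \<partial>\<sigma> n) \<longlonglongrightarrow> (\<integral>x. \<phi> x \<partial>\<tau>)"
      if \<phi>: "continuous_on ?Y \<phi>" "bounded (\<phi> ` ?Y)" for \<phi> :: "rational_map \<Rightarrow> complex"
    proof (rule tendstoI)
      fix \<eta> :: real assume \<eta>: "\<eta> > 0"
      obtain M where M: "\<forall>y\<in>?Y. norm (\<phi> y) \<le> M" using \<phi>(2) by (auto simp: bounded_iff)
      have "uniformly_continuous_on ?S \<phi>"
        by (rule compact_uniformly_continuous[OF continuous_on_subset[OF \<phi>(1)]]) (use sC in \<open>auto simp: Cpt_def\<close>)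
      moreover have "\<eta> / 2 > 0" using \<eta> by simp
      ultimately obtain d where d: "d > 0" "\<And>x y. x \<in> ?S \<Longrightarrow> y \<in> ?S \<Longrightarrow> dist y x < d \<Longrightarrow> dist (\<phi> y) (\<phi> x) < \<eta> / 2"
        unfolding uniformly_continuous_on_def by metis
      have "(\<lambda>n. 2 * e n * M) \<longlonglongrightarrow> 2 * 0 * M" by (intro tendsto_intros e0)
      then have "\<forall>\<^sub>F n in sequentially. 2 * e n * M < \<eta> / 2" by (rule order_tendstoD(2)) (use \<eta> in simp)
      moreover have "\<forall>\<^sub>F n in sequentially. e n < d" by (rule order_tendstoD(2)[OF e0 d(1)])
      ultimately show "\<forall>\<^sub>F n in sequentially. dist (\<integral>x. \<phi> x \<partial>\<sigma> n) (\<integral>x. \<phi> x \<partial>\<tau>) < \<eta>"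
      proof eventually_elim
        case (elim n)
        have "\<forall>x\<in>?S. \<forall>y\<in>?S. dist x y < e n \<longrightarrow> norm (\<phi> x - \<phi> y) \<le> \<eta> / 2"
        proof (intro ballI impI)
          fix x y assume xy: "x \<in> ?S" "y \<in> ?S" "dist x y < e n"
          then show "norm (\<phi> x - \<phi> y) \<le> \<eta> / 2" using d(2)[OF xy(2,1)] elim(2) by (simp add: dist_norm)
        qed
        from int[OF \<phi>(1) M this] have "norm ((\<integral>x. \<phi> x \<partial>\<tau>) - (\<integral>x. \<phi> x \<partial>\<sigma> n)) < \<eta>" using elim(1) by simp
        then show ?case by (simp add: dist_norm norm_minus_commute)
      qed
    qed
    show "\<tau> \<in> topology_O ?Y closure_of {\<tau> \<in> M1c ?Y. weakly_mean_stable \<tau>}"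
      unfolding in_closure_of
    proof (intro conjI allI impI)
      show "\<tau> \<in> topspace (topology_O ?Y)" using \<tau> topspace_topology_O by simp
      fix T assume T: "\<tau> \<in> T \<and> openin (topology_O ?Y) T"
      then obtain U where U: "openin (prod_topology (weak_topology ?Y) H.mtopology) U"
        "T = (\<lambda>\<tau>. (\<tau>, supp \<tau>)) -` U \<inter> M1c ?Y" unfolding topology_O_def openin_pullback_topology by blast
      have mem: "(\<tau>, ?S) \<in> U" using T U(2) by blast
      obtain U1 V1 where UV: "openin (weak_topology ?Y) U1" "openin H.mtopology V1" "\<tau> \<in> U1" "?S \<in> V1" "U1 \<times> V1 \<subseteq> U"
        using U(1)[unfolded openin_prod_topology_alt, rule_format, OF mem] by blast
      have "\<forall>\<^sub>F n in sequentially. \<sigma> n \<in> U1"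
      proof (rule eventually_in_generated_topology[OF UV(1)[unfolded weak_topology_def] UV(3)])
        fix B assume B: "B \<in> {{\<tau> \<in> M1 ?Y. (\<integral>x. \<phi> x \<partial>\<tau>) \<in> U} | (\<phi> :: rational_map \<Rightarrow> complex) U.
          continuous_on ?Y \<phi> \<and> bounded (\<phi> ` ?Y) \<and> open U}" "\<tau> \<in> B"
        then obtain \<phi> :: "rational_map \<Rightarrow> complex" and W where W: "B = {\<tau> \<in> M1 ?Y. (\<integral>x. \<phi> x \<partial>\<tau>) \<in> W}"
          "continuous_on ?Y \<phi>" "bounded (\<phi> ` ?Y)" "open W" by blast
        have "(\<integral>x. \<phi> x \<partial>\<tau>) \<in> W" using B(2) W(1) by simp
        from topological_tendstoD[OF conv[OF W(2,3)] W(4) this]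
        show "\<forall>\<^sub>F n in sequentially. \<sigma> n \<in> B"
          by eventually_elim (use \<sigma>(1) W(1) in \<open>simp add: M1c_def\<close>)
      qed
      moreover obtain r where r: "r > 0" "H.mball ?S r \<subseteq> V1"
        using UV(2,4) unfolding H.openin_mtopology by blast
      have "\<forall>\<^sub>F n in sequentially. e n < r" by (rule order_tendstoD(2)[OF e0 r(1)])
      ultimately have "\<forall>\<^sub>F n in sequentially. \<sigma> n \<in> U1 \<and> e n < r" by eventually_elim simp
      then obtain n where n: "\<sigma> n \<in> U1" "e n < r" using eventually_happens'[OF sequentially_bot] by blast
      have "supp (\<sigma> n) \<in> H.mball ?S r"
        using sC supp_in_Cpt[OF \<sigma>(1)] \<sigma>(3)[of n] n(2) by simp
      then have "\<sigma> n \<in> T" using n(1) r(2) UV(5) U(2) \<sigma>(1) by blast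
      then show "\<exists>y. y \<in> {\<tau> \<in> M1c ?Y. weakly_mean_stable \<tau>} \<and> y \<in> T" using \<sigma>(1,2) by blast
    qed
  qed
qed

end

theorem corollary1p8:
  fixes Y :: "rational_map set"
    and \<Lambda> :: "'l topology"
    and A :: "('l, complex ^ 'n) atlas"
    and f :: "'l \<Rightarrow> rational_map"
  assumes "Y \<subseteq> Rat_plus"
    and "mild Y"
    and "holomorphic_family \<Lambda> A f"
    and "nice Y \<Lambda> f"
  shows "openin (topology_O Y) {\<tau> \<in> M1c Y. weakly_mean_stable \<tau>} \<and>
    topology_O Y closure_of {\<tau> \<in> M1c Y. weakly_mean_stable \<tau>} = M1c Y"
proof -
  interpret holo_family \<Lambda> A f by standard (rule assms(3))
  have Y: "Y = f ` topspace \<Lambda>" using assms(4) by (simp add: nice_def weakly_nice_def)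
  show ?thesis
    using openin_weakly_mean_stable closure_of_weakly_mean_stable assms(2,4) unfolding Y by blast
qed

end
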